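(* Let $f$ be a stationary Gaussian process as in the context such that $r+\frac{r''}{\sigma^2}\notin\mathcal L^2(\mathbb R)$ and $\lim_{|t|\to\infty}\varphi(t)=0$, where $\varphi(t) = \max \{ |r(t)| + |r'(t)|/\sigma, \, |r'(t)|/\sigma + |r''(t)|/\sigma^2 \}$. Then \[ \lim_{T\to\infty}\frac{\operatorname{Var}[N(T)]}{\frac{\sigma^2}{\pi^2} T\int_{0}^T \left(1-\frac{t}{T}\right) \left(r(t)+\frac{r''(t)}{\sigma^2}\right)^2 dt}=1 . \]
   Context: Let $f:\mathbb R\to\mathbb R$ be a real-valued centred stationary Gaussian process with continuous covariance $r(t)=\mathbb E[f(0)f(t)]$, $r(0)=1$, and spectral measure $\rho$ (symmetric probability measure with $r(t)=\int e^{-i\lambda t}d\rho(\lambda)$). Assume the Geman condition $\int\log(1+|\lambda|)\lambda^2\,d\rho(\lambda)<\infty$; $\sigma^2=-r''(0)=\int\lambda^2 d\rho$, $\sigma>0$. $N(T)=\#\{t\in[0,T]:f(t)=0\}$. *)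

theory Defs
  imports "HOL-Probability.Probability"
begin

text \<open>A centred Gaussian process on the probability space M with covariance r:
  every finite real linear combination of its values is a centred normal random variable
  whose variance is given by r (a degenerate normal, i.e. a.s. zero, if that variance is 0).
  Since the covariance depends only on time differences, the process is stationary.\<close>
definition centred_stationary_gaussian ::
  "'a measure \<Rightarrow> (real \<Rightarrow> 'a \<Rightarrow> real) \<Rightarrow> (real \<Rightarrow> real) \<Rightarrow> bool" where
  "centred_stationary_gaussian M f r \<longleftrightarrow>
     prob_space M \<and> (\<forall>t. f t \<in> borel_measurable M) \<and>
     (\<forall>(ts::real list) (as::real list). length as = length ts \<longrightarrow>
        (let n = length ts;
             X = (\<lambda>\<omega>. \<Sum>i<n. as!i * f (ts!i) \<omega>);
             v = (\<Sum>i<n. \<Sum>j<n. as!i * as!j * r (ts!i - ts!j))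
         in (v > 0 \<longrightarrow> distributed M lborel X (normal_density 0 (sqrt v))) \<and>
            (v = 0 \<longrightarrow> (AE \<omega> in M. X \<omega> = 0))))"

definition spectral_measure :: "real measure \<Rightarrow> (real \<Rightarrow> real) \<Rightarrow> bool" where
  "spectral_measure \<rho> r \<longleftrightarrow>
     sets \<rho> = sets borel \<and> prob_space \<rho> \<and> distr \<rho> borel uminus = \<rho> \<and>
     (\<forall>t. complex_of_real (r t) = (LINT l|\<rho>. exp (- \<i> * complex_of_real (l * t))))"

definition zero_count :: "(real \<Rightarrow> 'a \<Rightarrow> real) \<Rightarrow> real \<Rightarrow> 'a \<Rightarrow> nat" where
  "zero_count f T \<omega> = card {t \<in> {0..T}. f t \<omega> = 0}"

end

theory Submission
  imports Defs "HOL-Real_Asymp.Real_Asymp"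
begin

text \<open>The zeros in \<open>[0, T]\<close> are counted by the sign changes along dyadic grids: almost surely the two numbers
  agree from some level on, since a tangential zero would create additional sign changes at small
  levels \<open>\<plusminus>\<epsilon>\<close>, whereas the expected count does not exceed that at level zero. The variance of the
  number of sign changes is a sum over lags. Lags below a constant contribute \<open>O(T)\<close>, by a Rice-type formula for pairs of
  segments and the Geman condition. At larger lags the sum converges to an integral of the two-point
  intensity of Kac and Rice. With \<open>w = r + r''/\<sigma>\<^sup>2\<close>, this intensity
  minus its limit is \<open>\<sigma>\<^sup>2 w\<^sup>2 / (2 \<pi>\<^sup>2)\<close>, up to a factor close to one, plus the exact derivative of a bounded
  function. The latter contributes \<open>O(T)\<close>, which is negligible because \<open>w\<close> is not square integrable.\<close>

section \<open>The Cramer-Wold device\<close>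

text \<open>The paths are only continuous, so no derivative of \<open>f\<close> is ever formed. The
  Rice formula is applied to the polygonal interpolation with mesh \<open>\<delta>\<close>; its
  slopes are increments, and the derivative survives only as the spectral function
  \<open>i l cis (l t)\<close> that difference quotients approach. Obstacle at short lags: the Gram
  determinant of the two values degenerates like the square of the lag t. It is compensated because
  two close values almost determine both slopes: the chord predicts them with squared error of order
  \<open>theta (2 t)\<close>, which leaves \<open>theta (2 t) / t\<close>. Integrating this over
  short t costs one logarithm of the frequency, which is what the Geman condition pays for. Why
  \<open>w\<close> appears: given zeros at 0 and t, the intensity depends on the correlation of the
  two slopes through \<open>hfun\<close>. Expanding \<open>hfun\<close> at \<open>r t\<close> rather
  than at 0 is decisive, since the correlation minus \<open>r t\<close> is a multiple of
  \<open>w t\<close>; the Taylor remainder is then quadratic in \<open>w\<close>, and the first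
  order part is a constant plus an exact derivative. All error constants are fixed before T is
  chosen, so they give bounds linear in T.\<close>

lemma (in prob_space) bounded_integrable:
  fixes g :: "'a \<Rightarrow> real"
  assumes "g \<in> borel_measurable M" and "\<And>x. \<bar>g x\<bar> \<le> B"
  shows "integrable M g"
  using assms by (intro integrable_const_bound[of _ B]) auto

lemma integral_density_distr:
  fixes g h :: "'a \<Rightarrow> real" and k :: "real \<Rightarrow> real"
  assumes [measurable]: "g \<in> borel_measurable M" "h \<in> borel_measurable M" "k \<in> borel_measurable borel"
    and "\<And>x. g x \<ge> 0"
  shows "(LINT y|distr (density M (\<lambda>x. ennreal (g x))) borel h. k y) = (LINT x|M. g x * k (h x))"
  using assms(4) by (subst integral_distr) (auto simp: integral_density)

lemma char_eq_cos_sin: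
  assumes "real_distribution D"
  shows "char D t = Complex (LINT x|D. cos (t * x)) (LINT x|D. sin (t * x))"
proof -
  interpret real_distribution D by fact
  have c: "integrable D (\<lambda>x. cos (t * x))" "integrable D (\<lambda>x. sin (t * x))"
    by (auto intro!: bounded_integrable[where B=1])
  have "(CLINT x|D. iexp (t * x)) = (CLINT x|D. complex_of_real (cos (t*x)) + \<i> * complex_of_real (sin (t * x)))"
    by (rule Bochner_Integration.integral_cong)
       (auto simp: exp_Euler cos_of_real sin_of_real simp flip: of_real_mult)
  also have "\<dots> = complex_of_real (LINT x|D. cos (t*x)) + \<i> * complex_of_real (LINT x|D. sin (t * x))"
    using c by (subst Bochner_Integration.integral_add) auto
  finally show ?thesis by (simp add: char_def complex_eq_iff)
qed

text \<open>After division by their common mass the weights are probability densities. The cosine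
  and sine integrals then form the characteristic functions of \<open>h\<close> and
  \<open>h'\<close> under these densities, and Levy's uniqueness theorem passes to indicators.
  Keeping a weight in the statement allows one coordinate to be treated while the others are carried
  along.\<close>

lemma integral_indicator_eqI:
  fixes g h :: "'a \<Rightarrow> real" and g' h' :: "'b \<Rightarrow> real"
  assumes "prob_space M" "prob_space N"
    and [measurable]: "g \<in> borel_measurable M" "h \<in> borel_measurable M"
      "g' \<in> borel_measurable N" "h' \<in> borel_measurable N"
    and g: "\<And>x. 0 \<le> g x" "\<And>x. g x \<le> C" and g': "\<And>x. 0 \<le> g' x" "\<And>x. g' x \<le> C"
    and eqc: "\<And>t. (LINT x|M. g x * cos (t * h x)) = (LINT x|N. g' x * cos (t * h' x))"
    and eqs: "\<And>t. (LINT x|M. g x * sin (t * h x)) = (LINT x|N. g' x * sin (t * h' x))"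
    and B[measurable]: "B \<in> sets borel"
  shows "(LINT x|M. g x * indicat_real B (h x)) = (LINT x|N. g' x * indicat_real B (h' x))"
proof -
  interpret M: prob_space M by fact
  interpret N: prob_space N by fact
  have i: "integrable M g" "integrable N g'"
    using g g' by (auto intro!: M.bounded_integrable[where B=C] N.bounded_integrable[where B=C])
  define m where "m = (LINT x|M. g x)"
  have m': "m = (LINT x|N. g' x)" using eqc[of 0] by (simp add: m_def)
  show ?thesis
  \<comment> \<open>A vanishing mass cannot be normalised, but then both weights are zero almost
    everywhere.\<close>
  proof (cases "m = 0")
    case True
    have "AE x in M. g x = 0" "AE x in N. g' x = 0"
      using True m_def m' i g g' integral_nonneg_eq_0_iff_AE by (metis (mono_tags, lifting) AE_I2)+
    then show ?thesis
      by (subst (1 2) integral_eq_zero_AE) (auto elim!: eventually_mono)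
  next
    case False
    have "m \<ge> 0" unfolding m_def using g by (intro integral_nonneg_AE) auto
    with False have m: "m > 0" by simp
    define D where "D = distr (density M (\<lambda>x. ennreal (g x / m))) borel h"
    define D' where "D' = distr (density N (\<lambda>x. ennreal (g' x / m))) borel h'"
    have "emeasure (density M (\<lambda>x. ennreal (g x / m))) (space M) = 1"
      using m g i by (subst emeasure_density) (auto simp: nn_integral_eq_integral m_def)
    then have pD: "prob_space D" unfolding D_def
      by (intro prob_space.prob_space_distr prob_spaceI) auto
    have "emeasure (density N (\<lambda>x. ennreal (g' x / m))) (space N) = 1"
      using m g' i by (subst emeasure_density) (auto simp: nn_integral_eq_integral m')
    then have pD': "prob_space D'" unfolding D'_def
      by (intro prob_space.prob_space_distr prob_spaceI) auto
    have rD: "real_distribution D" "real_distribution D'"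
      using pD pD' by (auto simp: real_distribution_def real_distribution_axioms_def D_def D'_def)
    have "char D = char D'"
    proof
      fix t
      have "(LINT x|D. cos (t * x)) = (LINT x|M. g x * cos (t * h x)) / m"
        "(LINT x|D. sin (t * x)) = (LINT x|M. g x * sin (t * h x)) / m"
        unfolding D_def using m g by (subst integral_density_distr; simp)+
      moreover have "(LINT x|D'. cos (t * x)) = (LINT x|N. g' x * cos (t * h' x)) / m"
        "(LINT x|D'. sin (t * x)) = (LINT x|N. g' x * sin (t * h' x)) / m"
        unfolding D'_def using m g' by (subst integral_density_distr; simp)+
      ultimately show "char D t = char D' t"
        using rD eqc eqs by (simp add: char_eq_cos_sin)
    qed
    then have "D = D'" using rD Levy_uniqueness by blast
    then have "(LINT y|D. indicat_real B y) = (LINT y|D'. indicat_real B y)" by (rule arg_cong)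
    moreover have "(LINT y|D. indicat_real B y) = (LINT x|M. g x / m * indicat_real B (h x))"
      unfolding D_def using m g by (intro integral_density_distr) auto
    moreover have "(LINT y|D'. indicat_real B y) = (LINT x|N. g' x / m * indicat_real B (h' x))"
      unfolding D'_def using m g' by (intro integral_density_distr) auto
    ultimately show ?thesis
      using m by simp
  qed
qed

text \<open>Reduction to dimension one: indicators of coordinate conditions are inserted one basis
  vector at a time, the remaining trigonometric factor being absorbed into the weight of
  \<open>integral_indicator_eqI\<close>. Once all coordinates are used, the two measures agree on
  open boxes.\<close>

lemma Cramer_Wold:
  fixes \<mu> \<nu> :: "'e::euclidean_space measure"
  assumes "prob_space \<mu>" "prob_space \<nu>" and [measurable_cong]: "sets \<mu> = sets borel" "sets \<nu> = sets borel"
    and c: "\<And>u. (LINT x|\<mu>. cos (u \<bullet> x)) = (LINT x|\<nu>. cos (u \<bullet> x))"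
    and s: "\<And>u. (LINT x|\<mu>. sin (u \<bullet> x)) = (LINT x|\<nu>. sin (u \<bullet> x))"
  shows "\<mu> = \<nu>"
proof -
  interpret M: prob_space \<mu> by fact
  interpret N: prob_space \<nu> by fact
  define W where "W S B x = (\<Prod>b\<in>S. indicat_real (B b) (x \<bullet> b))" for S and B :: "'e \<Rightarrow> real set" and x :: 'e
  have W[measurable]: "(\<lambda>x. W S B x) \<in> borel_measurable borel" if "\<And>b. B b \<in> sets borel" for S B
    unfolding W_def using that by measurable
  have W01: "0 \<le> W S B x" "W S B x \<le> 1" for S B x
    unfolding W_def by (auto intro!: prod_nonneg prod_le_1)
  have Wi: "integrable \<mu> (\<lambda>x. W S B x * cos (u \<bullet> x + a))" "integrable \<nu> (\<lambda>x. W S B x * cos (u \<bullet> x + a))"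
    if "\<And>b. B b \<in> sets borel" for S B u a
    using W[OF that] W01
    by (auto intro!: M.bounded_integrable[where B=1] N.bounded_integrable[where B=1] simp: abs_mult mult_le_one)
  \<comment> \<open>The free phase \<open>a\<close> covers sine as well as cosine and is produced by
    the product formula in the induction step.\<close>
  have main: "(LINT x|\<mu>. W S B x * cos (u \<bullet> x + a)) = (LINT x|\<nu>. W S B x * cos (u \<bullet> x + a))"
    if "finite S" "\<And>b. B b \<in> sets borel" for S B u a
    using that
  proof (induction S arbitrary: u a rule: finite_induct)
    case empty
    have "(LINT x|\<mu>. cos (u \<bullet> x + a)) = (LINT x|\<mu>. cos (u \<bullet> x)) * cos a - (LINT x|\<mu>. sin (u \<bullet> x)) * sin a"
      unfolding cos_add by (subst Bochner_Integration.integral_diff) (auto intro!: M.bounded_integrable[where B=1] simp: abs_mult mult_le_one)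
    moreover have "(LINT x|\<nu>. cos (u \<bullet> x + a)) = (LINT x|\<nu>. cos (u \<bullet> x)) * cos a - (LINT x|\<nu>. sin (u \<bullet> x)) * sin a"
      unfolding cos_add by (subst Bochner_Integration.integral_diff) (auto intro!: N.bounded_integrable[where B=1] simp: abs_mult mult_le_one)
    ultimately show ?case using c s by (simp add: W_def)
  next
    case (insert b S)
    note [measurable] = W[OF insert.prems, of S] insert.prems
    have IH: "(LINT x|\<mu>. W S B x * cos (u \<bullet> x + a)) = (LINT x|\<nu>. W S B x * cos (u \<bullet> x + a))" for u a
      using insert by blast
    \<comment> \<open>A weight has to be nonnegative, so \<open>1 + cos\<close> takes the place of
      \<open>cos\<close>. The product-to-sum formula moves the frequency \<open>t\<close> along
      \<open>b\<close> into the linear form, where the induction hypothesis applies.\<close>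
    have eq: "(LINT x|\<mu>. W S B x * (1 + cos (u \<bullet> x + a)) * cos (t * (x \<bullet> b) + d))
        = (LINT x|\<nu>. W S B x * (1 + cos (u \<bullet> x + a)) * cos (t * (x \<bullet> b) + d))" for u a t d
    proof -
      have e: "W S B x * (1 + cos (u \<bullet> x + a)) * cos (t * (x \<bullet> b) + d) =
         W S B x * cos ((t *\<^sub>R b) \<bullet> x + d) + (1/2) * (W S B x * cos ((u + t *\<^sub>R b) \<bullet> x + (a + d)))
          + (1/2) * (W S B x * cos ((u - t *\<^sub>R b) \<bullet> x + (a - d)))" for x
        by (simp add: cos_times_cos algebra_simps inner_commute add_divide_distrib)
      have Wi': "integrable \<mu> (\<lambda>x. W S B x * cos (u \<bullet> x + a))" "integrable \<nu> (\<lambda>x. W S B x * cos (u \<bullet> x + a))" for u a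
        using Wi[of B S u a] insert.prems by auto
      show ?thesis unfolding e
        by (simp add: Wi' IH del: inner_scaleR_left)
    qed
    have ab: "0 \<le> 1 + cos y" "1 + cos y \<le> 2" for y :: real
        using cos_ge_minus_one[of y] cos_le_one[of y] by linarith+
    have pos: "0 \<le> W S B x * (1 + cos (u \<bullet> x + a))" for x u a using W01 ab by simp
    have ind: "(LINT x|\<mu>. (W S B x * (1 + cos (u \<bullet> x + a))) * indicat_real (B b) (x \<bullet> b))
       = (LINT x|\<nu>. (W S B x * (1 + cos (u \<bullet> x + a))) * indicat_real (B b) (x \<bullet> b))" for u a
    proof (rule integral_indicator_eqI[where C=2])
      show "W S B x * (1 + cos (u \<bullet> x + a)) \<le> 2" for x
        using mult_mono[OF W01(2)[of S B x] ab(2)[of "u \<bullet> x + a"]] ab W01 by simp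
      then show "W S B x * (1 + cos (u \<bullet> x + a)) \<le> 2" for x .
      show "(LINT x|\<mu>. W S B x * (1 + cos (u \<bullet> x + a)) * sin (t * (x \<bullet> b)))
         = (LINT x|\<nu>. W S B x * (1 + cos (u \<bullet> x + a)) * sin (t * (x \<bullet> b)))" for t
      proof -
        have "sin y = cos (y + - pi/2)" for y :: real
          using cos_minus[of "y - pi/2"] by (simp add: sin_cos_eq)
        then show ?thesis using eq[of u a t "-pi/2"] by simp
      qed
    qed (use assms eq[of u a _ 0] pos in auto)
    \<comment> \<open>For zero frequency and zero phase the weight \<open>1 + cos\<close> equals 2,
      so half of that instance removes the added 1.\<close>
    have split: "W (insert b S) B x * cos (u \<bullet> x + a) =
       (W S B x * (1 + cos (u \<bullet> x + a))) * indicat_real (B b) (x \<bullet> b) - (1/2) *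
        ((W S B x * (1 + cos (0 \<bullet> x + 0))) * indicat_real (B b) (x \<bullet> b))" for x
      using insert.hyps by (simp add: W_def algebra_simps)
    have int: "integrable \<mu> (\<lambda>x. (W S B x * (1 + cos (u \<bullet> x + a))) * indicat_real (B b) (x \<bullet> b))"
      "integrable \<nu> (\<lambda>x. (W S B x * (1 + cos (u \<bullet> x + a))) * indicat_real (B b) (x \<bullet> b))" for u a
    proof -
      have "\<bar>(W S B x * (1 + cos (u \<bullet> x + a))) * indicat_real (B b) (x \<bullet> b)\<bar> \<le> 1 * 2 * 1" for x
        unfolding abs_mult using W01[of S B x] ab[of "u \<bullet> x + a"]
        by (intro mult_mono) (auto simp: indicator_def)
      then show "integrable \<mu> (\<lambda>x. (W S B x * (1 + cos (u \<bullet> x + a))) * indicat_real (B b) (x \<bullet> b))"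
      "integrable \<nu> (\<lambda>x. (W S B x * (1 + cos (u \<bullet> x + a))) * indicat_real (B b) (x \<bullet> b))"
        by (auto intro!: M.bounded_integrable[where B="1*2*1"] N.bounded_integrable[where B="1*2*1"])
    qed
    define V where "V u a x = (W S B x * (1 + cos (u \<bullet> x + a))) * indicat_real (B b) (x \<bullet> b)" for u x :: 'e and a
    show ?case unfolding split using ind int unfolding V_def[symmetric]
      by simp
  qed
  show ?thesis
  proof (rule measure_eqI_generator_eq[where E="range (\<lambda>(a, b). box a b)" and \<Omega>=UNIV
        and A="\<lambda>n. box (- (real n *\<^sub>R One)) (real n *\<^sub>R One)"])
    show "Int_stable (range (\<lambda>(a, b). box a b :: 'e set))"
      by (auto simp: Int_stable_def box_Int_box)
    show "sets \<mu> = sigma_sets UNIV (range (\<lambda>(a, b). box a b))"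
      "sets \<nu> = sigma_sets UNIV (range (\<lambda>(a, b). box a b))"
      using assms by (simp_all add: borel_eq_box)
    show "range (\<lambda>n. box (- (real n *\<^sub>R One)) (real n *\<^sub>R One)) \<subseteq> range (\<lambda>(a, b). box a b :: 'e set)" by auto
    show "(\<Union>n. box (- (real n *\<^sub>R One)) (real n *\<^sub>R One)) = (UNIV :: 'e set)"
      using UN_box_eq_UNIV by simp
    show "emeasure \<mu> (box (- (real n *\<^sub>R One)) (real n *\<^sub>R One)) \<noteq> \<infinity>" for n by simp
    fix X :: "'e set" assume "X \<in> range (\<lambda>(a, b). box a b)"
    then obtain a b where X: "X = box a b" by auto
    have W: "W Basis (\<lambda>i. {a \<bullet> i <..< b \<bullet> i}) x = indicat_real X x" for x
      by (auto simp: X W_def box_def indicator_def)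
    have "measure \<mu> X = measure \<nu> X"
      using main[of Basis "\<lambda>i. {a \<bullet> i <..< b \<bullet> i}" 0 0] assms
      by (simp add: W X)
    then show "emeasure \<mu> X = emeasure \<nu> X"
      by (simp add: M.emeasure_eq_measure N.emeasure_eq_measure)
  qed auto
qed

section \<open>Gaussian linear functionals of the process\<close>

interpretation std_normal: real_distribution std_normal_distribution
  by (rule real_dist_normal_dist)

lemma std_normal_cos_sin:
  "(LINT x|std_normal_distribution. cos (s * x)) = exp (- s\<^sup>2 / 2)"
  "(LINT x|std_normal_distribution. sin (s * x)) = 0"
  using char_eq_cos_sin[OF real_dist_normal_dist, of s]
  by (simp_all add: char_std_normal_distribution complex_eq_iff)

lemma pair_cos_sin:
  fixes g :: "'a \<Rightarrow> real" and h :: "'b \<Rightarrow> real"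
  assumes "prob_space P" "prob_space Q"
    and [measurable]: "g \<in> borel_measurable P" "h \<in> borel_measurable Q"
  shows "(LINT z|(P \<Otimes>\<^sub>M Q). cos (g (fst z) + h (snd z))) =
      (LINT x|P. cos (g x)) * (LINT y|Q. cos (h y)) - (LINT x|P. sin (g x)) * (LINT y|Q. sin (h y))" (is ?c)
    and "(LINT z|(P \<Otimes>\<^sub>M Q). sin (g (fst z) + h (snd z))) =
      (LINT x|P. sin (g x)) * (LINT y|Q. cos (h y)) + (LINT x|P. cos (g x)) * (LINT y|Q. sin (h y))" (is ?s)
proof -
  interpret P: prob_space P by fact
  interpret Q: prob_space Q by fact
  interpret PQ: pair_prob_space P Q ..
  have i: "integrable Q (\<lambda>y. sin (h y))" "integrable Q (\<lambda>y. cos (h y))"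
      "integrable P (\<lambda>y. sin (g y))" "integrable P (\<lambda>y. cos (g y))"
    by (auto intro!: Q.bounded_integrable[where B=1] P.bounded_integrable[where B=1])
  have "(LINT z|(P \<Otimes>\<^sub>M Q). cos (g (fst z) + h (snd z))) = (LINT x|P. LINT y|Q. cos (g x + h y))"
    by (subst PQ.integral_fst'[symmetric]) (auto intro!: PQ.bounded_integrable[where B=1])
  also have "\<dots> = (LINT x|P. cos (g x) * (LINT y|Q. cos (h y)) - sin (g x) * (LINT y|Q. sin (h y)))"
    using i by (simp add: cos_add)
  finally show ?c using i by simp
  have "(LINT z|(P \<Otimes>\<^sub>M Q). sin (g (fst z) + h (snd z))) = (LINT x|P. LINT y|Q. sin (g x + h y))"
    by (subst PQ.integral_fst'[symmetric]) (auto intro!: PQ.bounded_integrable[where B=1])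
  also have "\<dots> = (LINT x|P. sin (g x) * (LINT y|Q. cos (h y)) + cos (g x) * (LINT y|Q. sin (h y)))"
    using i by (simp add: sin_add)
  finally show ?s using i by simp
qed

text \<open>The decay of \<open>r\<close> is recorded here because it forces
  \<open>\<bar>r t\<bar> < 1\<close> for every positive lag. The decay of the derivatives enters
  only with \<open>tame\<close> and in the final limit.\<close>

locale gaussian_zeros = prob_space M
  for M :: "'a measure" +
  fixes f :: "real \<Rightarrow> 'a \<Rightarrow> real" and r :: "real \<Rightarrow> real" and \<rho> :: "real measure" and \<sigma> :: real
  assumes gauss: "centred_stationary_gaussian M f r"
    and r0: "r 0 = 1"
    and paths: "\<And>\<omega>. \<omega> \<in> space M \<Longrightarrow> continuous_on UNIV (\<lambda>t. f t \<omega>)"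
    and spec: "spectral_measure \<rho> r"
    and geman: "integrable \<rho> (\<lambda>l. ln (1 + \<bar>l\<bar>) * l\<^sup>2)"
    and sigma_pos: "\<sigma> > 0"
    and sigma_def: "\<sigma>\<^sup>2 = (LINT l|\<rho>. l\<^sup>2)"
    and r_lim: "(r \<longlongrightarrow> 0) at_infinity"
begin

sublocale R: prob_space \<rho>
  using spec by (simp add: spectral_measure_def)

lemma sets_rho[measurable_cong, simp]: "sets \<rho> = sets borel"
  using spec by (simp add: spectral_measure_def)

lemma space_rho[simp]: "space \<rho> = UNIV"
  using sets_eq_imp_space_eq[OF sets_rho] by simp

lemma f_measurable[measurable]: "f t \<in> borel_measurable M"
  using gauss by (simp add: centred_stationary_gaussian_def)

lemma r_eq: "r t = (LINT l|\<rho>. cos (l * t))"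
proof -
  have i: "integrable \<rho> (\<lambda>l. exp (- \<i> * complex_of_real (l * t)))"
    by (rule R.integrable_const_bound[of _ 1]) auto
  have "complex_of_real (r t) = (LINT l|\<rho>. exp (- \<i> * complex_of_real (l * t)))"
    using spec by (auto simp: spectral_measure_def)
  then have "r t = Re (LINT l|\<rho>. exp (- \<i> * complex_of_real (l * t)))"
    by (metis Re_complex_of_real)
  also have "\<dots> = (LINT l|\<rho>. Re (exp (- \<i> * complex_of_real (l * t))))"
    using i by simp
  finally show ?thesis by (simp add: Re_exp)
qed

text \<open>A pair of a linear functional of the process and its symbol in the spectral domain: mapping
  \<^term>\<open>f t\<close> to \<^term>\<open>\<lambda>l. cis (l * t)\<close> extends to an isometry into the complex square
  integrable functions over \<^term>\<open>\<rho>\<close>.\<close>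

inductive lin :: "('a \<Rightarrow> real) \<Rightarrow> (real \<Rightarrow> complex) \<Rightarrow> bool" where
  lin_base: "lin (f t) (\<lambda>l. cis (l * t))"
| lin_comb: "lin X \<phi> \<Longrightarrow> lin Y \<psi> \<Longrightarrow>
    lin (\<lambda>\<omega>. a * X \<omega> + b * Y \<omega>) (\<lambda>l. of_real a * \<phi> l + of_real b * \<psi> l)"

text \<open>The covariance of the corresponding functionals, but defined on spectral functions. It
  can therefore also be evaluated at the unbounded function of the derivative, which belongs to no
  \<open>lin\<close> pair.\<close>

definition ip :: "(real \<Rightarrow> complex) \<Rightarrow> (real \<Rightarrow> complex) \<Rightarrow> real" where
  "ip \<phi> \<psi> = (LINT l|\<rho>. Re (\<phi> l * cnj (\<psi> l)))"

lemma lin_diff: "lin X \<phi> \<Longrightarrow> lin Y \<psi> \<Longrightarrow> lin (\<lambda>\<omega>. X \<omega> - Y \<omega>) (\<lambda>l. \<phi> l - \<psi> l)"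
  using lin_comb[of X \<phi> Y \<psi> 1 "-1"] by simp

lemma lin_measurable1: "lin X \<phi> \<Longrightarrow> X \<in> borel_measurable M"
  by (induction rule: lin.induct) auto

lemma cis_measurable[measurable]: "cis \<in> borel_measurable borel"
  by (intro borel_measurable_continuous_onI continuous_intros)

lemma lin_measurable2: "lin X \<phi> \<Longrightarrow> \<phi> \<in> borel_measurable borel"
  by (induction rule: lin.induct) auto

lemma lin_bounded: "lin X \<phi> \<Longrightarrow> \<exists>B. \<forall>l. cmod (\<phi> l) \<le> B"
proof (induction rule: lin.induct)
  case (lin_comb X \<phi> Y \<psi> a b)
  then obtain A B where *: "\<forall>l. cmod (\<phi> l) \<le> A" "\<forall>l. cmod (\<psi> l) \<le> B" by blast
  have "cmod (of_real a * \<phi> l + of_real b * \<psi> l) \<le> \<bar>a\<bar> * A + \<bar>b\<bar> * B" for l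
    using * by (intro norm_triangle_le) (auto simp: norm_mult intro!: add_mono mult_left_mono)
  then show ?case by blast
qed (auto intro!: exI[of _ 1])

lemma ip_integrable:
  assumes "lin X \<phi>" "lin Y \<psi>"
  shows "integrable \<rho> (\<lambda>l. Re (\<phi> l * cnj (\<psi> l)))"
proof -
  obtain A B where *: "\<And>l. cmod (\<phi> l) \<le> A" "\<And>l. cmod (\<psi> l) \<le> B"
    using assms lin_bounded by metis
  have [measurable]: "\<phi> \<in> borel_measurable borel" "\<psi> \<in> borel_measurable borel"
    using assms lin_measurable2 by auto
  have "\<bar>Re (\<phi> l * cnj (\<psi> l))\<bar> \<le> A * B" for l
  proof -
    have "\<bar>Re (\<phi> l * cnj (\<psi> l))\<bar> \<le> cmod (\<phi> l) * cmod (\<psi> l)"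
      by (metis abs_Re_le_cmod complex_mod_cnj norm_mult)
    also have "\<dots> \<le> A * B" using *[of l] norm_ge_zero[of "\<phi> l"] norm_ge_zero[of "\<psi> l"]
      by (intro mult_mono) linarith+
    finally show ?thesis .
  qed
  then show ?thesis by (intro R.bounded_integrable[where B="A*B"]) auto
qed

lemma ip_commute: "ip \<phi> \<psi> = ip \<psi> \<phi>"
  unfolding ip_def by (intro Bochner_Integration.integral_cong) (auto simp: algebra_simps)

lemma ip_nonneg: "ip \<phi> \<phi> \<ge> 0"
  unfolding ip_def by (intro integral_nonneg_AE AE_I2) simp

lemma ip_comb_left:
  assumes "lin X \<phi>" "lin Y \<psi>" "lin Z \<eta>"
  shows "ip (\<lambda>l. of_real a * \<phi> l + of_real b * \<psi> l) \<eta> = a * ip \<phi> \<eta> + b * ip \<psi> \<eta>"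
proof -
  have "Re ((of_real a * \<phi> l + of_real b * \<psi> l) * cnj (\<eta> l)) =
     a * Re (\<phi> l * cnj (\<eta> l)) + b * Re (\<psi> l * cnj (\<eta> l))" for l
    by (simp add: algebra_simps)
  then show ?thesis unfolding ip_def
    using ip_integrable[OF assms(1,3)] ip_integrable[OF assms(2,3)] by simp
qed

lemma ip_comb_right:
  assumes "lin X \<phi>" "lin Y \<psi>" "lin Z \<eta>"
  shows "ip \<eta> (\<lambda>l. of_real a * \<phi> l + of_real b * \<psi> l) = a * ip \<eta> \<phi> + b * ip \<eta> \<psi>"
  using ip_comb_left[OF assms] by (simp add: ip_commute)

lemma lin_list:
  assumes "lin X \<phi>"
  shows "\<exists>xs. X = (\<lambda>\<omega>. \<Sum>(a, t)\<leftarrow>xs. a * f t \<omega>) \<and> \<phi> = (\<lambda>l. \<Sum>(a, t)\<leftarrow>xs. complex_of_real a * cis (l * t))"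
  using assms
proof (induction rule: lin.induct)
  case (lin_base t)
  show ?case by (rule exI[of _ "[(1, t)]"]) simp
next
  case (lin_comb X \<phi> Y \<psi> a b)
  then obtain xs ys where
    "X = (\<lambda>\<omega>. \<Sum>(a, t)\<leftarrow>xs. a * f t \<omega>)" "\<phi> = (\<lambda>l. \<Sum>(a, t)\<leftarrow>xs. complex_of_real a * cis (l * t))"
    "Y = (\<lambda>\<omega>. \<Sum>(a, t)\<leftarrow>ys. a * f t \<omega>)" "\<psi> = (\<lambda>l. \<Sum>(a, t)\<leftarrow>ys. complex_of_real a * cis (l * t))"
    by blast
  then show ?case
    by (intro exI[of _ "map (\<lambda>(c, t). (a * c, t)) xs @ map (\<lambda>(c, t). (b * c, t)) ys"])
       (simp add: o_def case_prod_unfold sum_list_const_mult mult.assoc)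
qed

text \<open>Expanding the squared modulus of the trigonometric polynomial gives the cosines of
  \<open>l (ts!i - ts!j)\<close>, whose integrals are the values of \<open>r\<close> in the
  quadratic form of the Gaussian hypothesis. A \<open>lin\<close> pair is a finite list of
  coefficients and times, which is the form that hypothesis speaks of.\<close>

lemma lin_normal:
  assumes "lin X \<phi>"
  shows "(ip \<phi> \<phi> > 0 \<longrightarrow> distributed M lborel X (normal_density 0 (sqrt (ip \<phi> \<phi>)))) \<and>
         (ip \<phi> \<phi> = 0 \<longrightarrow> (AE \<omega> in M. X \<omega> = 0))"
proof -
  obtain xs where xs: "X = (\<lambda>\<omega>. \<Sum>(a, t)\<leftarrow>xs. a * f t \<omega>)"
    "\<phi> = (\<lambda>l. \<Sum>(a, t)\<leftarrow>xs. complex_of_real a * cis (l * t))"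
    using lin_list[OF assms] by blast
  define ts where "ts = map snd xs"
  define as where "as = map fst xs"
  define n where "n = length ts"
  have len: "length as = length ts" by (simp add: as_def ts_def)
  have X: "X = (\<lambda>\<omega>. \<Sum>i<n. as!i * f (ts!i) \<omega>)"
    by (simp add: xs sum_list_sum_nth as_def ts_def n_def case_prod_unfold atLeast0LessThan)
  have \<phi>: "\<phi> = (\<lambda>l. \<Sum>i<n. of_real (as!i) * cis (l * (ts!i)))"
    by (simp add: xs sum_list_sum_nth as_def ts_def n_def case_prod_unfold atLeast0LessThan)
  have "Re (\<phi> l * cnj (\<phi> l)) = (\<Sum>i<n. \<Sum>j<n. as!i * as!j * cos (l * (ts!i - ts!j)))" for l
    by (simp add: \<phi> sum_product cos_diff algebra_simps)
  then have "ip \<phi> \<phi> = (LINT l|\<rho>. (\<Sum>i<n. \<Sum>j<n. as!i * as!j * cos (l * (ts!i - ts!j))))"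
    by (simp add: ip_def)
  also have "\<dots> = (\<Sum>i<n. \<Sum>j<n. as!i * as!j * r (ts!i - ts!j))"
    by (subst Bochner_Integration.integral_sum | subst integral_mult_right_zero |
        simp add: r_eq R.integrable_const_bound[of _ 1])+
  finally have v: "ip \<phi> \<phi> = (\<Sum>i<n. \<Sum>j<n. as!i * as!j * r (ts!i - ts!j))" .
  show ?thesis
    using gauss len unfolding centred_stationary_gaussian_def v X n_def Let_def by blast
qed

text \<open>One formula for the characteristic function covers the degenerate and the nondegenerate
  case; the joint laws below are derived from it without a case distinction.\<close>

lemma lin_cos_sin:
  assumes "lin X \<phi>"
  shows "expectation (\<lambda>\<omega>. cos (X \<omega>)) = exp (- ip \<phi> \<phi> / 2)" "expectation (\<lambda>\<omega>. sin (X \<omega>)) = 0"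
proof -
  note [measurable] = lin_measurable1[OF assms]
  let ?v = "ip \<phi> \<phi>"
  have "expectation (\<lambda>\<omega>. cos (X \<omega>)) = exp (- ?v / 2) \<and> expectation (\<lambda>\<omega>. sin (X \<omega>)) = 0"
  proof (cases "?v = 0")
    case True
    then have 1: "AE \<omega> in M. X \<omega> = 0" using lin_normal[OF assms] by simp
    have "expectation (\<lambda>\<omega>. cos (X \<omega>)) = expectation (\<lambda>\<omega>. 1)"
      using 1 by (intro integral_cong_AE) (auto elim!: eventually_mono)
    moreover have "expectation (\<lambda>\<omega>. sin (X \<omega>)) = expectation (\<lambda>\<omega>. 0)"
      using 1 by (intro integral_cong_AE) (auto elim!: eventually_mono)
    ultimately show ?thesis using True by (simp add: prob_space)
  next
    case False
    then have v: "?v > 0" using ip_nonneg[of \<phi>] by simp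
    define s where "s = sqrt ?v"
    have s: "s > 0" using v by (simp add: s_def)
    have "distributed M lborel X (normal_density 0 s)" using lin_normal[OF assms] v by (simp add: s_def)
    then have D: "distributed M lborel (\<lambda>\<omega>. X \<omega> / s) std_normal_density"
      using normal_standard_normal_convert[OF s, of X 0] by simp
    have "distr M borel (\<lambda>\<omega>. X \<omega> / s) = density lborel (\<lambda>x. ennreal (std_normal_density x))"
      using D by (auto simp: distributed_def cong: distr_cong)
    then have d: "distr M borel (\<lambda>\<omega>. X \<omega> / s) = std_normal_distribution" by simp
    show ?thesis using std_normal_cos_sin[of s] unfolding d[symmetric] using s v by (simp add: integral_distr s_def)
  qed
  then show "expectation (\<lambda>\<omega>. cos (X \<omega>)) = exp (- ip \<phi> \<phi> / 2)" "expectation (\<lambda>\<omega>. sin (X \<omega>)) = 0"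
    by auto
qed

lemma ip_comb2:
  assumes "lin X \<phi>" "lin Y \<psi>"
  shows "ip (\<lambda>l. of_real a * \<phi> l + of_real b * \<psi> l) (\<lambda>l. of_real a * \<phi> l + of_real b * \<psi> l)
     = a\<^sup>2 * ip \<phi> \<phi> + 2 * a * b * ip \<phi> \<psi> + b\<^sup>2 * ip \<psi> \<psi>"
  using assms
  by (simp add: ip_comb_left[OF assms lin_comb] ip_comb_right[OF assms] ip_commute[of \<psi> \<phi>])
     (simp add: algebra_simps power2_eq_square)

text \<open>The numbers \<open>a\<close>, \<open>b\<close>, \<open>c\<close> are a Cholesky factor
  of the covariance matrix, with \<open>a = 0\<close> or \<open>c = 0\<close> allowed. At the
  frequency \<open>(u, v)\<close> both sides have the characteristic function with exponent
  \<open>- ((u a + v b)^2 + (v c)^2) / 2\<close>.\<close>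

lemma law_pair:
  assumes X: "lin X \<phi>" and Y: "lin Y \<psi>"
    and abc: "ip \<phi> \<phi> = a\<^sup>2" "ip \<phi> \<psi> = a * b" "ip \<psi> \<psi> = b\<^sup>2 + c\<^sup>2"
  shows "distr M borel (\<lambda>\<omega>. (X \<omega>, Y \<omega>)) =
    distr (std_normal_distribution \<Otimes>\<^sub>M std_normal_distribution) borel (\<lambda>z. (a * fst z, b * fst z + c * snd z))"
proof -
  let ?N = "std_normal_distribution \<Otimes>\<^sub>M std_normal_distribution"
  interpret NN: pair_prob_space std_normal_distribution std_normal_distribution ..
  note [measurable] = lin_measurable1[OF X] lin_measurable1[OF Y]
  have m: "(\<lambda>z. (a * fst z, b * fst z + c * snd z)) \<in> borel_measurable ?N"
    by (simp add: borel_prod[symmetric])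
  have m2: "(\<lambda>\<omega>. (X \<omega>, Y \<omega>)) \<in> borel_measurable M" by (simp add: borel_prod[symmetric])
  have q: "ip (\<lambda>l. of_real u * \<phi> l + of_real v * \<psi> l) (\<lambda>l. of_real u * \<phi> l + of_real v * \<psi> l)
       = (u * a + v * b)\<^sup>2 + (v * c)\<^sup>2" for u v
    by (simp add: ip_comb2[OF X Y] abc) (simp add: algebra_simps power2_eq_square)
  note cs = lin_cos_sin[OF lin_comb[OF X Y], unfolded q]
  have e2: "u * (a * x) + v * (b * x + c * y) = (u * a + v * b) * x + (v * c) * y" for u v x y
    by (simp add: algebra_simps)
  have p: "(LINT z|?N. cos ((u * a + v * b) * fst z + (v * c) * snd z)) = exp (- ((u * a + v * b)\<^sup>2 + (v * c)\<^sup>2) / 2)"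
    "(LINT z|?N. sin ((u * a + v * b) * fst z + (v * c) * snd z)) = 0" for u v
    by (subst pair_cos_sin[where g="\<lambda>x. (u * a + v * b) * x" and h="\<lambda>x. (v * c) * x"];
        auto simp: std_normal_cos_sin exp_add[symmetric] std_normal.prob_space_axioms add_divide_distrib)+
  show ?thesis
  proof (rule Cramer_Wold)
    show "prob_space (distr M borel (\<lambda>\<omega>. (X \<omega>, Y \<omega>)))" using m2 by (rule prob_space_distr)
    show "prob_space (distr ?N borel (\<lambda>z. (a * fst z, b * fst z + c * snd z)))"
      using m by (rule NN.prob_space_distr)
    fix w :: "real \<times> real"
    obtain u v where w: "w = (u, v)" by (cases w)
    show "(LINT x|distr M borel (\<lambda>\<omega>. (X \<omega>, Y \<omega>)). cos (w \<bullet> x)) =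
        (LINT x|distr ?N borel (\<lambda>z. (a * fst z, b * fst z + c * snd z)). cos (w \<bullet> x))"
      unfolding w using cs(1)[of u v] p[of u v]
      by (subst integral_distr[OF m2] integral_distr[OF m], simp)+ (simp add: e2)
    show "(LINT x|distr M borel (\<lambda>\<omega>. (X \<omega>, Y \<omega>)). sin (w \<bullet> x)) =
        (LINT x|distr ?N borel (\<lambda>z. (a * fst z, b * fst z + c * snd z)). sin (w \<bullet> x))"
      unfolding w using cs(2)[of u v] p[of u v]
      by (subst integral_distr[OF m2] integral_distr[OF m], simp)+ (simp add: e2)
  qed auto
qed

text \<open>Orthogonality removes the mixed terms from the variance of any linear combination, so
  the joint characteristic function is a product, and \<open>Cramer_Wold\<close> identifies the
  joint law with the product law.\<close>

lemma indep_pairs: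
  assumes X: "lin X1 \<phi>1" "lin X2 \<phi>2" and Y: "lin Y1 \<psi>1" "lin Y2 \<psi>2"
    and orth: "ip \<phi>1 \<psi>1 = 0" "ip \<phi>1 \<psi>2 = 0" "ip \<phi>2 \<psi>1 = 0" "ip \<phi>2 \<psi>2 = 0"
  shows "indep_var borel (\<lambda>\<omega>. (X1 \<omega>, X2 \<omega>)) borel (\<lambda>\<omega>. (Y1 \<omega>, Y2 \<omega>))"
proof -
  note [measurable] = X[THEN lin_measurable1] Y[THEN lin_measurable1]
  let ?X = "\<lambda>\<omega>. (X1 \<omega>, X2 \<omega>)" and ?Y = "\<lambda>\<omega>. (Y1 \<omega>, Y2 \<omega>)"
  have mX[measurable]: "?X \<in> borel_measurable M" by (simp add: borel_prod[symmetric])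
  have mY[measurable]: "?Y \<in> borel_measurable M" by (simp add: borel_prod[symmetric])
  let ?P = "distr M borel ?X" and ?Q = "distr M borel ?Y"
  have ps: "prob_space ?P" "prob_space ?Q" by (simp_all add: prob_space_distr)
  interpret P: prob_space ?P by fact
  interpret Q: prob_space ?Q by fact
  interpret PQ: pair_prob_space ?P ?Q ..
  let ?J = "distr M (borel \<Otimes>\<^sub>M borel) (\<lambda>\<omega>. (?X \<omega>, ?Y \<omega>))"
  have key: "ip (\<lambda>l. of_real 1 * (of_real a * \<phi>1 l + of_real b * \<phi>2 l) + of_real 1 * (of_real c * \<psi>1 l + of_real d * \<psi>2 l))
     (\<lambda>l. of_real 1 * (of_real a * \<phi>1 l + of_real b * \<phi>2 l) + of_real 1 * (of_real c * \<psi>1 l + of_real d * \<psi>2 l))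
     = ip (\<lambda>l. of_real a * \<phi>1 l + of_real b * \<phi>2 l) (\<lambda>l. of_real a * \<phi>1 l + of_real b * \<phi>2 l)
      + ip (\<lambda>l. of_real c * \<psi>1 l + of_real d * \<psi>2 l) (\<lambda>l. of_real c * \<psi>1 l + of_real d * \<psi>2 l)" for a b c d
    unfolding ip_comb2[OF lin_comb[OF X] lin_comb[OF Y]]
    by (simp add: ip_comb_left[OF X lin_comb[OF Y]] ip_comb_right[OF Y X(1)] ip_comb_right[OF Y X(2)] orth)
  have J: "(LINT x|?J. cos (((a,b),(c,d)) \<bullet> x)) = (LINT x|(?P \<Otimes>\<^sub>M ?Q). cos (((a,b),(c,d)) \<bullet> x))"
    "(LINT x|?J. sin (((a,b),(c,d)) \<bullet> x)) = (LINT x|(?P \<Otimes>\<^sub>M ?Q). sin (((a,b),(c,d)) \<bullet> x))" for a b c d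
  proof -
    let ?g = "\<lambda>x. (a,b) \<bullet> x" and ?h = "\<lambda>x. (c,d) \<bullet> x"
    have e: "((a,b),(c,d)) \<bullet> z = ?g (fst z) + ?h (snd z)" for z :: "(real \<times> real) \<times> (real \<times> real)"
      by (cases z) auto
    have 1: "(LINT x|(?P \<Otimes>\<^sub>M ?Q). cos (((a,b),(c,d)) \<bullet> x)) =
        exp (- ip (\<lambda>l. of_real a * \<phi>1 l + of_real b * \<phi>2 l) (\<lambda>l. of_real a * \<phi>1 l + of_real b * \<phi>2 l) / 2) *
        exp (- ip (\<lambda>l. of_real c * \<psi>1 l + of_real d * \<psi>2 l) (\<lambda>l. of_real c * \<psi>1 l + of_real d * \<psi>2 l) / 2)"
      "(LINT x|(?P \<Otimes>\<^sub>M ?Q). sin (((a,b),(c,d)) \<bullet> x)) = 0"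
      unfolding e
      using lin_cos_sin[OF lin_comb[OF X], of a b] lin_cos_sin[OF lin_comb[OF Y], of c d]
      by (subst pair_cos_sin[OF ps]; simp add: integral_distr)+
    have 2: "(LINT x|?J. cos (((a,b),(c,d)) \<bullet> x)) = expectation (\<lambda>\<omega>. cos (1 * (a * X1 \<omega> + b * X2 \<omega>) + 1 * (c * Y1 \<omega> + d * Y2 \<omega>)))"
      "(LINT x|?J. sin (((a,b),(c,d)) \<bullet> x)) = expectation (\<lambda>\<omega>. sin (1 * (a * X1 \<omega> + b * X2 \<omega>) + 1 * (c * Y1 \<omega> + d * Y2 \<omega>)))"
      by (subst integral_distr; simp add: borel_prod)+
    show "(LINT x|?J. cos (((a,b),(c,d)) \<bullet> x)) = (LINT x|(?P \<Otimes>\<^sub>M ?Q). cos (((a,b),(c,d)) \<bullet> x))"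
      "(LINT x|?J. sin (((a,b),(c,d)) \<bullet> x)) = (LINT x|(?P \<Otimes>\<^sub>M ?Q). sin (((a,b),(c,d)) \<bullet> x))"
      unfolding 1 2 using lin_cos_sin[OF lin_comb[OF lin_comb[OF X] lin_comb[OF Y], of 1 a b 1 c d], unfolded key]
      by (simp_all add: exp_add[symmetric] add_divide_distrib diff_divide_distrib)
  qed
  have "?P \<Otimes>\<^sub>M ?Q = ?J"
  proof (rule Cramer_Wold)
    show "prob_space (?P \<Otimes>\<^sub>M ?Q)" by (rule PQ.prob_space_axioms)
    show "prob_space ?J" by (rule prob_space_distr) simp
    show "sets (?P \<Otimes>\<^sub>M ?Q) = sets borel"
      by (subst borel_prod[symmetric]) (intro sets_pair_measure_cong sets_distr)
    show "sets ?J = sets borel" by (simp add: borel_prod)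
  qed (use J in auto)
  then show ?thesis by (simp add: indep_var_distribution_eq)
qed

end

section \<open>A Rice formula for pairs of segments\<close>

abbreviation unif :: "real measure" where "unif \<equiv> uniform_measure lborel {0..1}"

lemma prob_space_unif: "prob_space unif"
  by (rule prob_space_uniform_measure) auto

lemma AE_unif: "AE \<theta> in unif. \<theta> \<in> {0..1}"
  by (rule AE_uniform_measureI) auto

lemma measure_unif:
  assumes "A \<in> sets borel" shows "measure unif A = measure lborel ({0..1} \<inter> A)"
  using assms by (simp add: measure_uniform_measure)

text \<open>The mollified Kac count of zeros of the affine function \<open>x + \<theta> d\<close> on
  the unit interval: the slope times an approximate delta of width \<open>2 \<epsilon>\<close>,
  integrated over \<open>\<theta>\<close>.\<close>

definition seg :: "real \<Rightarrow> real \<Rightarrow> real \<Rightarrow> real" where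
  "seg \<epsilon> x d = \<bar>d\<bar> * measure unif {\<theta>. \<bar>x + \<theta> * d\<bar> < \<epsilon>} / (2 * \<epsilon>)"

lemma abs_lt_set_eq:
  assumes "d > (0::real)"
  shows "{\<theta>. \<bar>x + \<theta> * d\<bar> < \<epsilon>} = {(- \<epsilon> - x) / d <..< (\<epsilon> - x) / d}"
  using assms by (auto simp: abs_less_iff field_simps)

lemma seg_uminus: "seg \<epsilon> (- x) (- d) = seg \<epsilon> x d"
proof -
  have "\<bar>- x + \<theta> * - d\<bar> = \<bar>x + \<theta> * d\<bar>" for \<theta> by (metis abs_minus_cancel minus_add_distrib mult_minus_right)
  then show ?thesis by (simp add: seg_def)
qed

text \<open>At slope \<open>d\<close> an affine function spends time at most
  \<open>2 \<epsilon> / \<bar>d\<bar>\<close> in a strip of width \<open>2 \<epsilon>\<close>, so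
  the slope cancels. This bound without moments is what permits the limit in the mesh-free parameter
  \<open>\<epsilon>\<close>.\<close>

lemma seg_bounds:
  assumes "\<epsilon> > 0" shows "0 \<le> seg \<epsilon> x d" "seg \<epsilon> x d \<le> 1"
proof -
  show "0 \<le> seg \<epsilon> x d" using assms by (simp add: seg_def)
  have pos: "seg \<epsilon> x d \<le> 1" if d: "d > 0" for x d
  proof -
    have le: "(- \<epsilon> - x) / d \<le> (\<epsilon> - x) / d" using d assms by (intro divide_right_mono) auto
    have "measure unif {\<theta>. \<bar>x + \<theta> * d\<bar> < \<epsilon>} \<le> measure lborel {(- \<epsilon> - x) / d <..< (\<epsilon> - x) / d}"
      unfolding abs_lt_set_eq[OF d]
      by (subst measure_unif, simp, rule measure_mono_fmeasurable) (use le in \<open>auto intro!: fmeasurableI\<close>)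
    also have "\<dots> = 2 * \<epsilon> / d" using d assms by (simp add: field_simps)
    finally have "d * measure unif {\<theta>. \<bar>x + \<theta> * d\<bar> < \<epsilon>} \<le> 2 * \<epsilon>" using d by (simp add: field_simps)
    then show ?thesis using d assms by (simp add: seg_def)
  qed
  show "seg \<epsilon> x d \<le> 1"
  proof (cases d "0::real" rule: linorder_cases)
    case less
    then show ?thesis using pos[of "-d" "-x"] by (simp add: seg_uminus)
  qed (use pos in \<open>auto simp: seg_def\<close>)
qed

text \<open>If both endpoints lie outside the strip, the segment either crosses the whole strip or
  misses it.\<close>

lemma seg_eq:
  assumes e: "0 < \<epsilon>" "\<epsilon> < \<bar>x\<bar>" "\<epsilon> < \<bar>x + d\<bar>"
  shows "seg \<epsilon> x d = (if x * (x + d) < 0 then 1 else 0)"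
proof -
  have pos: "seg \<epsilon> x d = (if x * (x + d) < 0 then 1 else 0)"
    if d: "d > 0" and e: "\<epsilon> < \<bar>x\<bar>" "\<epsilon> < \<bar>x + d\<bar>" for x d
  proof (cases "x * (x + d) < 0")
    case True
    then have x: "x < 0" "x + d > 0" using d by (auto simp: mult_less_0_iff)
    have "0 \<le> (- \<epsilon> - x) / d" "(\<epsilon> - x) / d \<le> 1"
      using e x d by (auto simp: field_simps)
    then have "{0..1} \<inter> {(- \<epsilon> - x) / d <..< (\<epsilon> - x) / d} = {(- \<epsilon> - x) / d <..< (\<epsilon> - x) / d}"
      by auto
    then have "measure unif {\<theta>. \<bar>x + \<theta> * d\<bar> < \<epsilon>} = 2 * \<epsilon> / d"
      unfolding abs_lt_set_eq[OF d] using d assms(1) by (subst measure_unif) (auto simp: field_simps)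
    then show ?thesis using True d assms(1) by (simp add: seg_def)
  next
    case False
    then consider "x > 0" | "x + d < 0" using e assms(1) d by (auto simp: mult_less_0_iff not_less abs_if split: if_splits)
    then have "{0..1} \<inter> {(- \<epsilon> - x) / d <..< (\<epsilon> - x) / d} = {}"
    proof cases
      case 1
      then have "(\<epsilon> - x) / d < 0" using e d by (auto simp: field_simps)
      then show ?thesis by auto
    next
      case 2
      then have "(- \<epsilon> - x) / d > 1" using e d by (auto simp: field_simps)
      then show ?thesis by auto
    qed
    then have "measure unif {\<theta>. \<bar>x + \<theta> * d\<bar> < \<epsilon>} = 0"
      unfolding abs_lt_set_eq[OF d] by (subst measure_unif) auto
    then show ?thesis using False by (simp add: seg_def)
  qed
  show ?thesis
  proof (cases d "0::real" rule: linorder_cases)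
    case less
    have "(- x) * (- x + - d) = x * (x + d)" by (simp add: algebra_simps)
    then show ?thesis using pos[of "-d" "-x"] less e by (simp add: seg_uminus)
  next
    case equal
    then show ?thesis using zero_le_square[of x] by (simp add: seg_def not_less)
  qed (use pos e in auto)
qed

lemma seg_nn_integral:
  assumes "\<epsilon> > 0"
  shows "ennreal (seg \<epsilon> x d) = (\<integral>\<^sup>+\<theta>. ennreal (\<bar>d\<bar> * indicat_real {y. \<bar>y\<bar> < \<epsilon>} (x + \<theta> * d) / (2 * \<epsilon>)) \<partial>unif)"
proof -
  interpret U: prob_space unif by (rule prob_space_unif)
  have "(\<integral>\<^sup>+\<theta>. ennreal (\<bar>d\<bar> * indicat_real {y. \<bar>y\<bar> < \<epsilon>} (x + \<theta> * d) / (2 * \<epsilon>)) \<partial>unif)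
      = (\<integral>\<^sup>+\<theta>. ennreal (\<bar>d\<bar> / (2 * \<epsilon>)) * indicator {\<theta>. \<bar>x + \<theta> * d\<bar> < \<epsilon>} \<theta> \<partial>unif)"
    by (intro nn_integral_cong) (auto simp: indicator_def)
  also have "\<dots> = ennreal (\<bar>d\<bar> / (2 * \<epsilon>)) * emeasure unif {\<theta>. \<bar>x + \<theta> * d\<bar> < \<epsilon>}"
    by (subst nn_integral_cmult_indicator) auto
  also have "\<dots> = ennreal (seg \<epsilon> x d)"
    using assms by (simp add: U.emeasure_eq_measure seg_def ennreal_mult[symmetric])
  finally show ?thesis by simp
qed

lemma seg_measurable[measurable]:
  assumes [measurable]: "X \<in> borel_measurable M" "D \<in> borel_measurable M"
  shows "(\<lambda>\<omega>. seg \<epsilon> (X \<omega>) (D \<omega>)) \<in> borel_measurable M"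
proof (cases "\<epsilon> > 0")
  case True
  interpret U: prob_space unif by (rule prob_space_unif)
  have "(\<lambda>\<omega>. ennreal (seg \<epsilon> (X \<omega>) (D \<omega>))) \<in> borel_measurable M"
    unfolding seg_nn_integral[OF True] by measurable
  then have "(\<lambda>\<omega>. enn2real (ennreal (seg \<epsilon> (X \<omega>) (D \<omega>)))) \<in> borel_measurable M" by measurable
  then show ?thesis using seg_bounds(1)[OF True] by simp
next
  case False
  have "{\<theta>. \<bar>x + \<theta> * d\<bar> < \<epsilon>} = {}" for x d :: real using False by auto
  then show ?thesis by (simp add: seg_def)
qed

text \<open>The indicator of a sign change of the affine function between its values \<^term>\<open>X\<close> and \<^term>\<open>X + D\<close>
  is the limit of its mollified zero count; the limit passes through the expectation because
  the mollified count of a segment is at most one.\<close>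

lemma (in prob_space) sign_change_prob_tendsto:
  assumes [measurable]: "X \<in> borel_measurable M" "D \<in> borel_measurable M" "Y \<in> borel_measurable M" "V \<in> borel_measurable M"
    and nz: "AE \<omega> in M. X \<omega> \<noteq> 0 \<and> X \<omega> + D \<omega> \<noteq> 0 \<and> Y \<omega> \<noteq> 0 \<and> Y \<omega> + V \<omega> \<noteq> 0"
  shows "(\<lambda>n. expectation (\<lambda>\<omega>. seg (1 / real (Suc n)) (X \<omega>) (D \<omega>) * seg (1 / real (Suc n)) (Y \<omega>) (V \<omega>)))
     \<longlonglongrightarrow> prob {\<omega>\<in>space M. X \<omega> * (X \<omega> + D \<omega>) < 0 \<and> Y \<omega> * (Y \<omega> + V \<omega>) < 0}"
proof -
  let ?A = "{\<omega>\<in>space M. X \<omega> * (X \<omega> + D \<omega>) < 0 \<and> Y \<omega> * (Y \<omega> + V \<omega>) < 0}"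
  have "(\<lambda>n. expectation (\<lambda>\<omega>. seg (1 / real (Suc n)) (X \<omega>) (D \<omega>) * seg (1 / real (Suc n)) (Y \<omega>) (V \<omega>)))
     \<longlonglongrightarrow> expectation (indicat_real ?A)"
  proof (rule integral_dominated_convergence[where w="\<lambda>_. 1"])
    show "AE \<omega> in M. (\<lambda>n. seg (1 / real (Suc n)) (X \<omega>) (D \<omega>) * seg (1 / real (Suc n)) (Y \<omega>) (V \<omega>)) \<longlonglongrightarrow> indicat_real ?A \<omega>"
      using nz AE_space
    proof eventually_elim
      case 1: (elim \<omega>)
      define e where "e = Min {\<bar>X \<omega>\<bar>, \<bar>X \<omega> + D \<omega>\<bar>, \<bar>Y \<omega>\<bar>, \<bar>Y \<omega> + V \<omega>\<bar>}"
      have e: "e > 0" "e \<le> \<bar>X \<omega>\<bar>" "e \<le> \<bar>X \<omega> + D \<omega>\<bar>" "e \<le> \<bar>Y \<omega>\<bar>" "e \<le> \<bar>Y \<omega> + V \<omega>\<bar>"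
        using 1 by (auto simp: e_def)
      have "eventually (\<lambda>n. 1 / real (Suc n) < e) sequentially"
        using e(1) by (intro order_tendstoD(2)[OF LIMSEQ_Suc[OF lim_1_over_n]]) auto
      then have "eventually (\<lambda>n. seg (1 / real (Suc n)) (X \<omega>) (D \<omega>) * seg (1 / real (Suc n)) (Y \<omega>) (V \<omega>)
         = (if X \<omega> * (X \<omega> + D \<omega>) < 0 \<and> Y \<omega> * (Y \<omega> + V \<omega>) < 0 then 1 else 0)) sequentially"
        by eventually_elim (use e in \<open>auto simp: seg_eq\<close>)
      then show ?case
        by (rule tendsto_eventually[OF eventually_mono]) (use 1 in auto)
    qed
    show "AE \<omega> in M. norm (seg (1 / real (Suc n)) (X \<omega>) (D \<omega>) * seg (1 / real (Suc n)) (Y \<omega>) (V \<omega>)) \<le> 1" for n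
      using seg_bounds[of "1 / real (Suc n)"] by (auto simp: abs_mult intro!: mult_le_one)
  qed auto
  then show ?thesis by simp
qed

text \<open>Tonelli moves the two segment parameters outside the expectation. For fixed parameters
  what is left is a Gaussian expectation localised where the two interpolated values are
  small.\<close>

lemma (in prob_space) seg_product_nn_integral:
  assumes [measurable]: "X \<in> borel_measurable M" "D \<in> borel_measurable M" "Y \<in> borel_measurable M" "V \<in> borel_measurable M"
    and e: "\<epsilon> > 0"
  shows "ennreal (expectation (\<lambda>\<omega>. seg \<epsilon> (X \<omega>) (D \<omega>) * seg \<epsilon> (Y \<omega>) (V \<omega>))) =
    (\<integral>\<^sup>+\<theta>. \<integral>\<^sup>+\<theta>'. \<integral>\<^sup>+\<omega>. ennreal (\<bar>D \<omega> * V \<omega>\<bar> * (indicat_real {y. \<bar>y\<bar> < \<epsilon>} (X \<omega> + \<theta> * D \<omega>) * indicat_real {y. \<bar>y\<bar> < \<epsilon>} (Y \<omega> + \<theta>' * V \<omega>)) / (4 * \<epsilon>\<^sup>2)) \<partial>M \<partial>unif \<partial>unif)"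
proof -
  interpret U: prob_space unif by (rule prob_space_unif)
  interpret UM: pair_sigma_finite unif M ..
  have "ennreal (expectation (\<lambda>\<omega>. seg \<epsilon> (X \<omega>) (D \<omega>) * seg \<epsilon> (Y \<omega>) (V \<omega>))) =
     (\<integral>\<^sup>+\<omega>. ennreal (seg \<epsilon> (X \<omega>) (D \<omega>) * seg \<epsilon> (Y \<omega>) (V \<omega>)) \<partial>M)"
    using seg_bounds[OF e]
    by (intro nn_integral_eq_integral[symmetric] bounded_integrable[where B=1]) (auto simp: abs_mult intro!: mult_le_one)
  also have "\<dots> = (\<integral>\<^sup>+\<omega>. \<integral>\<^sup>+\<theta>. \<integral>\<^sup>+\<theta>'. ennreal (\<bar>D \<omega>\<bar> * indicat_real {y. \<bar>y\<bar> < \<epsilon>} (X \<omega> + \<theta> * D \<omega>) / (2 * \<epsilon>)) *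
       ennreal (\<bar>V \<omega>\<bar> * indicat_real {y. \<bar>y\<bar> < \<epsilon>} (Y \<omega> + \<theta>' * V \<omega>) / (2 * \<epsilon>)) \<partial>unif \<partial>unif \<partial>M)"
    using seg_bounds[OF e]
    by (intro nn_integral_cong) (simp add: ennreal_mult seg_nn_integral[OF e] nn_integral_cmult nn_integral_multc)
  also have "\<dots> = (\<integral>\<^sup>+\<omega>. \<integral>\<^sup>+\<theta>. \<integral>\<^sup>+\<theta>'. ennreal (\<bar>D \<omega> * V \<omega>\<bar> * (indicat_real {y. \<bar>y\<bar> < \<epsilon>} (X \<omega> + \<theta> * D \<omega>) * indicat_real {y. \<bar>y\<bar> < \<epsilon>} (Y \<omega> + \<theta>' * V \<omega>)) / (4 * \<epsilon>\<^sup>2)) \<partial>unif \<partial>unif \<partial>M)"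
    using e by (intro nn_integral_cong) (simp add: ennreal_mult[symmetric] abs_mult power2_eq_square field_simps)
  also have "\<dots> = (\<integral>\<^sup>+\<theta>. \<integral>\<^sup>+\<omega>. \<integral>\<^sup>+\<theta>'. ennreal (\<bar>D \<omega> * V \<omega>\<bar> * (indicat_real {y. \<bar>y\<bar> < \<epsilon>} (X \<omega> + \<theta> * D \<omega>) * indicat_real {y. \<bar>y\<bar> < \<epsilon>} (Y \<omega> + \<theta>' * V \<omega>)) / (4 * \<epsilon>\<^sup>2)) \<partial>unif \<partial>M \<partial>unif)"
    by (subst UM.Fubini') (auto simp: split_beta')
  also have "\<dots> = (\<integral>\<^sup>+\<theta>. \<integral>\<^sup>+\<theta>'. \<integral>\<^sup>+\<omega>. ennreal (\<bar>D \<omega> * V \<omega>\<bar> * (indicat_real {y. \<bar>y\<bar> < \<epsilon>} (X \<omega> + \<theta> * D \<omega>) * indicat_real {y. \<bar>y\<bar> < \<epsilon>} (Y \<omega> + \<theta>' * V \<omega>)) / (4 * \<epsilon>\<^sup>2)) \<partial>M \<partial>unif \<partial>unif)"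
    by (intro nn_integral_cong, subst UM.Fubini') (auto simp: split_beta')
  finally show ?thesis .
qed

text \<open>\<open>K\<close> is the prospective Rice density. After division by
  \<open>4 \<epsilon>^2\<close> the assumed error is of order \<open>\<epsilon>\<close>, uniformly
  in the parameters, and disappears in the limit. The result is stated as two bounds rather than as
  an integral of \<open>K\<close>, so that measurability of \<open>K\<close> in the parameters never
  arises.\<close>

lemma (in prob_space) sign_change_prob_bounds:
  assumes [measurable]: "X \<in> borel_measurable M" "D \<in> borel_measurable M" "Y \<in> borel_measurable M" "V \<in> borel_measurable M"
    and nz: "AE \<omega> in M. X \<omega> \<noteq> 0 \<and> X \<omega> + D \<omega> \<noteq> 0 \<and> Y \<omega> \<noteq> 0 \<and> Y \<omega> + V \<omega> \<noteq> 0"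
    and int: "integrable M (\<lambda>\<omega>. D \<omega> * V \<omega>)"
    and K: "\<And>\<epsilon> \<theta> \<theta>'. 0 < \<epsilon> \<Longrightarrow> \<epsilon> \<le> 1 \<Longrightarrow> \<theta> \<in> {0..1} \<Longrightarrow> \<theta>' \<in> {0..1} \<Longrightarrow>
      \<bar>expectation (\<lambda>\<omega>. \<bar>D \<omega> * V \<omega>\<bar> * (indicat_real {y. \<bar>y\<bar> < \<epsilon>} (X \<omega> + \<theta> * D \<omega>) * indicat_real {y. \<bar>y\<bar> < \<epsilon>} (Y \<omega> + \<theta>' * V \<omega>)))
        - 4 * \<epsilon>\<^sup>2 * K \<theta> \<theta>'\<bar> \<le> C * \<epsilon>^3"
  defines "p \<equiv> prob {\<omega>\<in>space M. X \<omega> * (X \<omega> + D \<omega>) < 0 \<and> Y \<omega> * (Y \<omega> + V \<omega>) < 0}"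
  shows "(\<And>\<theta> \<theta>'. \<theta> \<in> {0..1} \<Longrightarrow> \<theta>' \<in> {0..1} \<Longrightarrow> K \<theta> \<theta>' \<le> k) \<Longrightarrow> p \<le> k"
    and "(\<And>\<theta> \<theta>'. \<theta> \<in> {0..1} \<Longrightarrow> \<theta>' \<in> {0..1} \<Longrightarrow> k \<le> K \<theta> \<theta>') \<Longrightarrow> k \<le> p"
proof -
  interpret U: prob_space unif by (rule prob_space_unif)
  define s where "s \<epsilon> = expectation (\<lambda>\<omega>. seg \<epsilon> (X \<omega>) (D \<omega>) * seg \<epsilon> (Y \<omega>) (V \<omega>))" for \<epsilon>
  define g where "g \<epsilon> \<theta> \<theta>' \<omega> = \<bar>D \<omega> * V \<omega>\<bar> * (indicat_real {y. \<bar>y\<bar> < \<epsilon>} (X \<omega> + \<theta> * D \<omega>) * indicat_real {y. \<bar>y\<bar> < \<epsilon>} (Y \<omega> + \<theta>' * V \<omega>))" for \<epsilon> \<theta> \<theta>' \<omega>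
  have gm[measurable]: "g \<epsilon> \<theta> \<theta>' \<in> borel_measurable M" for \<epsilon> \<theta> \<theta>' unfolding g_def by measurable
  have gi: "integrable M (g \<epsilon> \<theta> \<theta>')" for \<epsilon> \<theta> \<theta>'
    by (rule Bochner_Integration.integrable_bound[OF int]) (auto simp: g_def indicator_def abs_mult)
  have g0: "0 \<le> g \<epsilon> \<theta> \<theta>' \<omega>" for \<epsilon> \<theta> \<theta>' \<omega> by (simp add: g_def)
  have nn: "(\<integral>\<^sup>+\<omega>. ennreal (g \<epsilon> \<theta> \<theta>' \<omega> / (4 * \<epsilon>\<^sup>2)) \<partial>M) = ennreal (expectation (g \<epsilon> \<theta> \<theta>') / (4 * \<epsilon>\<^sup>2))" for \<epsilon> \<theta> \<theta>'
  proof -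
    have "integrable M (\<lambda>\<omega>. g \<epsilon> \<theta> \<theta>' \<omega> / (4 * \<epsilon>\<^sup>2))" using gi by simp
    then show ?thesis
      by (subst nn_integral_eq_integral) (auto simp: g0)
  qed
  have s: "ennreal (s \<epsilon>) = (\<integral>\<^sup>+\<theta>. \<integral>\<^sup>+\<theta>'. ennreal (expectation (g \<epsilon> \<theta> \<theta>') / (4 * \<epsilon>\<^sup>2)) \<partial>unif \<partial>unif)" if "\<epsilon> > 0" for \<epsilon>
    using seg_product_nn_integral[OF assms(1-4) that] nn
    unfolding s_def g_def by simp
  have s0: "0 \<le> s \<epsilon>" if "\<epsilon> > 0" for \<epsilon>
    unfolding s_def using seg_bounds[OF that] by (intro integral_nonneg_AE) auto
  have lim: "(\<lambda>n. s (1 / real (Suc n))) \<longlonglongrightarrow> p"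
    unfolding s_def p_def by (rule sign_change_prob_tendsto) fact+
  have e_lim: "(\<lambda>n. C / 4 * (1 / real (Suc n))) \<longlonglongrightarrow> C / 4 * 0"
    by (intro tendsto_intros LIMSEQ_Suc[OF lim_1_over_n])
  have K': "\<bar>expectation (g \<epsilon> \<theta> \<theta>') / (4 * \<epsilon>\<^sup>2) - K \<theta> \<theta>'\<bar> \<le> C / 4 * \<epsilon>"
    if "0 < \<epsilon>" "\<epsilon> \<le> 1" "\<theta> \<in> {0..1}" "\<theta>' \<in> {0..1}" for \<epsilon> \<theta> \<theta>'
  proof -
    have "expectation (g \<epsilon> \<theta> \<theta>') / (4 * \<epsilon>\<^sup>2) - K \<theta> \<theta>' = (expectation (g \<epsilon> \<theta> \<theta>') - 4 * \<epsilon>\<^sup>2 * K \<theta> \<theta>') / (4 * \<epsilon>\<^sup>2)"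
      using that by (simp add: diff_divide_distrib)
    then have "\<bar>expectation (g \<epsilon> \<theta> \<theta>') / (4 * \<epsilon>\<^sup>2) - K \<theta> \<theta>'\<bar> = \<bar>expectation (g \<epsilon> \<theta> \<theta>') - 4 * \<epsilon>\<^sup>2 * K \<theta> \<theta>'\<bar> / (4 * \<epsilon>\<^sup>2)"
      by (simp add: abs_mult)
    also have "\<dots> \<le> C * \<epsilon>^3 / (4 * \<epsilon>\<^sup>2)"
      using K[OF that] that unfolding g_def[abs_def] by (intro divide_right_mono) auto
    finally show ?thesis using that by (simp add: power2_eq_square power3_eq_cube)
  qed
  {
    assume k: "\<And>\<theta> \<theta>'. \<theta> \<in> {0..1} \<Longrightarrow> \<theta>' \<in> {0..1} \<Longrightarrow> K \<theta> \<theta>' \<le> k"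
    have B: "s \<epsilon> \<le> max 0 (k + C / 4 * \<epsilon>)" if e: "0 < \<epsilon>" "\<epsilon> \<le> 1" for \<epsilon>
    proof -
      have "ennreal (s \<epsilon>) \<le> (\<integral>\<^sup>+\<theta>. \<integral>\<^sup>+\<theta>'. ennreal (max 0 (k + C / 4 * \<epsilon>)) \<partial>unif \<partial>unif)"
        unfolding s[OF e(1)]
      proof (intro nn_integral_mono_AE)
        show "AE \<theta> in unif. (\<integral>\<^sup>+\<theta>'. ennreal (expectation (g \<epsilon> \<theta> \<theta>') / (4 * \<epsilon>\<^sup>2)) \<partial>unif) \<le> (\<integral>\<^sup>+\<theta>'. ennreal (max 0 (k + C / 4 * \<epsilon>)) \<partial>unif)"
          using AE_unif
        proof eventually_elim
          case (elim \<theta>)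
          then show ?case
          proof -
            assume "\<theta> \<in> {0..1}"
            show ?thesis
          proof (intro nn_integral_mono_AE)
            show "AE \<theta>' in unif. ennreal (expectation (g \<epsilon> \<theta> \<theta>') / (4 * \<epsilon>\<^sup>2)) \<le> ennreal (max 0 (k + C / 4 * \<epsilon>))"
              using AE_unif
            proof eventually_elim
              case (elim \<theta>')
              show ?case
                using k[OF \<open>\<theta> \<in> {0..1}\<close> elim] K'[OF e \<open>\<theta> \<in> {0..1}\<close> elim]
                by (intro ennreal_leI) linarith
            qed
          qed
          qed
        qed
      qed
      also have "\<dots> = ennreal (max 0 (k + C / 4 * \<epsilon>))" using U.emeasure_space_1 by simp
      finally show ?thesis by (subst (asm) ennreal_le_iff) auto
    qed
    have "(\<lambda>n. max 0 (k + C / 4 * (1 / real (Suc n)))) \<longlonglongrightarrow> max 0 (k + C / 4 * 0)"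
      by (intro tendsto_max tendsto_add tendsto_const e_lim)
    then have "p \<le> max 0 (k + C / 4 * 0)"
      by (rule LIMSEQ_le[OF lim]) (intro exI[of _ 0] allI impI B; simp)
    \<comment> \<open>Truncation at 0 came from working with extended nonnegative integrals. It is
      undone because \<open>K 0 0\<close> is a limit of nonnegative quantities.\<close>
    moreover have "k \<ge> 0"
    proof -
      have "- (C / 4 * (1 / real (Suc n))) \<le> K 0 0" for n
      proof -
        have "0 \<le> expectation (g (1 / real (Suc n)) 0 0)" by (intro integral_nonneg_AE) (auto simp: g_def)
        then have "0 \<le> expectation (g (1 / real (Suc n)) 0 0) / (4 * (1 / real (Suc n))\<^sup>2)" by simp
        then show ?thesis using K'[of "1 / real (Suc n)" 0 0] by force
      qed
      then have "- (C / 4 * 0) \<le> K 0 0"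
        by (intro LIMSEQ_le[OF tendsto_minus[OF e_lim] tendsto_const]) auto
      then show ?thesis using k[of 0 0] by simp
    qed
    ultimately show "p \<le> k" by simp
  }
  {
    assume k: "\<And>\<theta> \<theta>'. \<theta> \<in> {0..1} \<Longrightarrow> \<theta>' \<in> {0..1} \<Longrightarrow> k \<le> K \<theta> \<theta>'"
    have B: "k - C / 4 * \<epsilon> \<le> s \<epsilon>" if e: "0 < \<epsilon>" "\<epsilon> \<le> 1" for \<epsilon>
    proof -
      have "ennreal (k - C / 4 * \<epsilon>) = (\<integral>\<^sup>+\<theta>. \<integral>\<^sup>+\<theta>'. ennreal (k - C / 4 * \<epsilon>) \<partial>unif \<partial>unif)"
        using U.emeasure_space_1 by simp
      also have "\<dots> \<le> ennreal (s \<epsilon>)"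
        unfolding s[OF e(1)]
      proof (intro nn_integral_mono_AE)
        show "AE \<theta> in unif. (\<integral>\<^sup>+\<theta>'. ennreal (k - C / 4 * \<epsilon>) \<partial>unif) \<le> (\<integral>\<^sup>+\<theta>'. ennreal (expectation (g \<epsilon> \<theta> \<theta>') / (4 * \<epsilon>\<^sup>2)) \<partial>unif)"
          using AE_unif
        proof eventually_elim
          case (elim \<theta>)
          then show ?case
          proof -
            assume "\<theta> \<in> {0..1}"
            show ?thesis
          proof (intro nn_integral_mono_AE)
            show "AE \<theta>' in unif. ennreal (k - C / 4 * \<epsilon>) \<le> ennreal (expectation (g \<epsilon> \<theta> \<theta>') / (4 * \<epsilon>\<^sup>2))"
              using AE_unif
            proof eventually_elim
              case (elim \<theta>')
              show ?case
                using k[OF \<open>\<theta> \<in> {0..1}\<close> elim] K'[OF e \<open>\<theta> \<in> {0..1}\<close> elim]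
                by (intro ennreal_leI) linarith
            qed
          qed
          qed
        qed
      qed
      finally show ?thesis using s0[OF e(1)] by (simp add: ennreal_le_iff)
    qed
    have "(\<lambda>n. k - C / 4 * (1 / real (Suc n))) \<longlonglongrightarrow> k - C / 4 * 0"
      by (intro tendsto_intros e_lim)
    then have "k - C / 4 * 0 \<le> p"
      by (rule LIMSEQ_le[OF _ lim]) (intro exI[of _ 0] allI impI B; simp)
    then show "k \<le> p" by simp
  }
qed

section \<open>Gaussian probabilities of short strips and small boxes\<close>

lemma std_normal_density_bounds:
  "std_normal_density x \<le> 1 / sqrt (2 * pi)"
  "(1 - x\<^sup>2 / 2) / sqrt (2 * pi) \<le> std_normal_density x"
proof -
  have "1 - x\<^sup>2 / 2 \<le> exp (- x\<^sup>2 / 2)" using exp_ge_add_one_self[of "- x\<^sup>2 / 2"] by simp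
  then show "(1 - x\<^sup>2 / 2) / sqrt (2 * pi) \<le> std_normal_density x"
    by (simp add: std_normal_density_def divide_right_mono)
  show "std_normal_density x \<le> 1 / sqrt (2 * pi)"
    by (simp add: std_normal_density_def divide_right_mono)
qed

text \<open>The set is an interval of length \<open>2 \<epsilon> / c\<close> all of whose points are
  within \<open>(\<epsilon> + \<bar>x\<bar>) / c\<close> of the origin. The density is compared
  there with its value at 0.\<close>

lemma std_normal_strip:
  assumes c: "c > 0" and e: "\<epsilon> > 0"
  shows "measure std_normal_distribution {z. \<bar>x + c * z\<bar> < \<epsilon>} \<le> 2 * \<epsilon> / c / sqrt (2 * pi)"
    and "2 * \<epsilon> / c / sqrt (2 * pi) * (1 - ((\<epsilon> + \<bar>x\<bar>) / c)\<^sup>2 / 2) \<le> measure std_normal_distribution {z. \<bar>x + c * z\<bar> < \<epsilon>}"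
proof -
  let ?A = "{z. \<bar>x + c * z\<bar> < \<epsilon>}"
  have A: "?A = {(- \<epsilon> - x) / c <..< (\<epsilon> - x) / c}"
    using c by (auto simp: abs_less_iff field_simps)
  have le: "(- \<epsilon> - x) / c \<le> (\<epsilon> - x) / c" using c e by (intro divide_right_mono) auto
  have [measurable]: "?A \<in> sets borel" by measurable
  have mA: "measure lborel ?A = 2 * \<epsilon> / c" unfolding A using le c by (simp add: field_simps)
  have iA: "integrable lborel (indicat_real ?A)" unfolding A using le by (simp add: integrable_indicator_iff)
  have iD: "integrable lborel (\<lambda>z. std_normal_density z * indicat_real ?A z)"
    by (rule Bochner_Integration.integrable_bound[of lborel std_normal_density]) (auto simp: indicator_def)
  have m: "measure std_normal_distribution ?A = (LINT z|lborel. std_normal_density z * indicat_real ?A z)"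
  proof -
    have "measure std_normal_distribution ?A = (LINT z|std_normal_distribution. indicat_real ?A z)" by simp
    also have "\<dots> = (LINT z|lborel. std_normal_density z * indicat_real ?A z)"
      by (subst integral_density) auto
    finally show ?thesis .
  qed
  have "(LINT z|lborel. std_normal_density z * indicat_real ?A z) \<le> (LINT z|lborel. 1 / sqrt (2 * pi) * indicat_real ?A z)"
    by (rule integral_mono[OF iD integrable_mult_right[OF iA]]) (use std_normal_density_bounds(1) in \<open>auto simp: indicator_def\<close>)
  then show "measure std_normal_distribution ?A \<le> 2 * \<epsilon> / c / sqrt (2 * pi)"
    unfolding m using mA by simp
  let ?M = "(\<epsilon> + \<bar>x\<bar>) / c"
  have "(LINT z|lborel. (1 - ?M\<^sup>2 / 2) / sqrt (2 * pi) * indicat_real ?A z) \<le> (LINT z|lborel. std_normal_density z * indicat_real ?A z)"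
  proof (rule integral_mono)
    show "(1 - ?M\<^sup>2 / 2) / sqrt (2 * pi) * indicat_real ?A z \<le> std_normal_density z * indicat_real ?A z" for z
    proof (cases "z \<in> ?A")
      case True
      then have "\<bar>c * z\<bar> \<le> \<epsilon> + \<bar>x\<bar>" by auto
      then have "\<bar>z\<bar> \<le> ?M" using c by (simp add: abs_mult field_simps)
      then have "z\<^sup>2 \<le> ?M\<^sup>2" using abs_le_square_iff[of z ?M] c e by simp
      then have "(1 - ?M\<^sup>2 / 2) / sqrt (2 * pi) \<le> (1 - z\<^sup>2 / 2) / sqrt (2 * pi)"
        by (intro divide_right_mono) auto
      then show ?thesis using std_normal_density_bounds(2)[of z] True by simp
    qed simp
  qed (use iA iD in auto)
  then show "2 * \<epsilon> / c / sqrt (2 * pi) * (1 - ?M\<^sup>2 / 2) \<le> measure std_normal_distribution ?A"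
    unfolding m using mA by (simp add: mult.commute)
qed

text \<open>Slicing along the first coordinate reduces the box to two strips. The main term is the
  area \<open>4 \<epsilon>^2\<close> times the density of the pair at the origin, since
  \<open>a c\<close> is the root of the covariance determinant.\<close>

lemma std_normal_box:
  fixes a b c \<epsilon> :: real
  assumes a: "a > 0" and c: "c > 0" and e: "\<epsilon> > 0"
  defines "p \<equiv> measure (std_normal_distribution \<Otimes>\<^sub>M std_normal_distribution) {z. \<bar>a * fst z\<bar> < \<epsilon> \<and> \<bar>b * fst z + c * snd z\<bar> < \<epsilon>}"
  shows "p \<le> 4 * \<epsilon>\<^sup>2 / (2 * pi * (a * c))"
    and "4 * \<epsilon>\<^sup>2 / (2 * pi * (a * c)) * (1 - (\<epsilon> / a)\<^sup>2 / 2 - ((\<epsilon> + \<bar>b\<bar> * \<epsilon> / a) / c)\<^sup>2 / 2) \<le> p"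
proof -
  interpret NN: pair_prob_space std_normal_distribution std_normal_distribution ..
  let ?N = std_normal_distribution
  define A where "A = {z. \<bar>0 + a * z\<bar> < \<epsilon>}"
  define S where "S x = {z. \<bar>b * x + c * z\<bar> < \<epsilon>}" for x
  let ?B = "{z. \<bar>a * fst z\<bar> < \<epsilon> \<and> \<bar>b * fst z + c * snd z\<bar> < \<epsilon>}"
  have [measurable]: "A \<in> sets borel" unfolding A_def by measurable
  have Bm: "?B \<in> sets (?N \<Otimes>\<^sub>M ?N)"
  proof -
    have "{z \<in> space (?N \<Otimes>\<^sub>M ?N). \<bar>a * fst z\<bar> < \<epsilon> \<and> \<bar>b * fst z + c * snd z\<bar> < \<epsilon>} \<in> sets (?N \<Otimes>\<^sub>M ?N)"
      by measurable
    then show ?thesis by (simp add: space_pair_measure)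
  qed
  have e0: "emeasure (?N \<Otimes>\<^sub>M ?N) ?B = (\<integral>\<^sup>+x. ennreal (measure ?N (S x)) * indicator A x \<partial>?N)"
    unfolding std_normal.emeasure_pair_measure_alt[OF Bm]
    by (intro nn_integral_cong)
       (auto simp: S_def A_def indicator_def vimage_def std_normal.emeasure_eq_measure)
  have p0: "ennreal p = emeasure (?N \<Otimes>\<^sub>M ?N) ?B" unfolding p_def by (rule NN.emeasure_eq_measure[symmetric])
  have Ac: "(\<integral>\<^sup>+x. ennreal k * indicator A x \<partial>?N) = ennreal (k * measure ?N A)" if "k \<ge> 0" for k
    using that by (subst nn_integral_cmult_indicator) (auto simp: std_normal.emeasure_eq_measure ennreal_mult)
  have sq: "sqrt (2 * pi) * sqrt (2 * pi) = 2 * pi" by simp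
  have pp: "p \<ge> 0" by (simp add: p_def)
  note A1 = std_normal_strip[OF a e, of 0, folded A_def] and S1 = std_normal_strip[OF c e, of "b * x" for x, folded S_def]
  let ?u = "2 * \<epsilon> / c / sqrt (2 * pi)" and ?v = "2 * \<epsilon> / a / sqrt (2 * pi)"
  have uv: "?u * ?v = 4 * \<epsilon>\<^sup>2 / (2 * pi * (a * c))" 
  proof -
    have "?u * ?v = 2 * \<epsilon> * (2 * \<epsilon>) / (c * a * (sqrt (2 * pi) * sqrt (2 * pi)))"
      by (simp only: divide_divide_eq_left times_divide_times_eq mult_ac)
    then show ?thesis unfolding sq by (simp add: power2_eq_square mult_ac)
  qed
  have u0: "?u > 0" "?v > 0" using a c e by auto
  have "ennreal p \<le> (\<integral>\<^sup>+x. ennreal ?u * indicator A x \<partial>?N)" (is "_ \<le> ?r")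
    unfolding p0 e0 using S1(1) by (intro nn_integral_mono mult_right_mono ennreal_leI) auto
  also have "?r = ennreal (?u * measure ?N A)" using u0 by (intro Ac) simp
  finally have "p \<le> ?u * measure ?N A"
    by (subst (asm) ennreal_le_iff) (use u0 in \<open>intro mult_nonneg_nonneg; simp\<close>)
  also have "\<dots> \<le> ?u * ?v" using A1(1) u0 by (intro mult_left_mono) auto
  finally show "p \<le> 4 * \<epsilon>\<^sup>2 / (2 * pi * (a * c))" unfolding uv .
  let ?M = "(\<epsilon> + \<bar>b\<bar> * \<epsilon> / a) / c" and ?L = "\<epsilon> / a"
  show "4 * \<epsilon>\<^sup>2 / (2 * pi * (a * c)) * (1 - ?L\<^sup>2 / 2 - ?M\<^sup>2 / 2) \<le> p"
  \<comment> \<open>In the first case the lower bound is not positive and says nothing; in the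
    second both correction factors are nonnegative and may be multiplied.\<close>
  proof (cases "1 - ?L\<^sup>2 / 2 - ?M\<^sup>2 / 2 \<le> 0")
    case True
    then have "4 * \<epsilon>\<^sup>2 / (2 * pi * (a * c)) * (1 - ?L\<^sup>2 / 2 - ?M\<^sup>2 / 2) \<le> 0"
      using a c by (intro mult_nonneg_nonpos) auto
    then show ?thesis using pp by linarith
  next
    case False
    have M1: "0 \<le> 1 - ?M\<^sup>2 / 2" "0 \<le> 1 - ?L\<^sup>2 / 2" using False by (auto intro: order_trans[rotated] simp: not_le)
        (smt (verit) zero_le_power2 divide_nonneg_nonneg)+
    have "?u * (1 - ?M\<^sup>2 / 2) \<le> measure ?N (S x)" if "x \<in> A" for x
    proof -
      have "\<bar>b * x\<bar> \<le> \<bar>b\<bar> * \<epsilon> / a"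
        using that a mult_left_mono[of "\<bar>x\<bar>" "\<epsilon> / a" "\<bar>b\<bar>"] by (simp add: A_def abs_mult field_simps)
      then have "((\<epsilon> + \<bar>b * x\<bar>) / c)\<^sup>2 \<le> ?M\<^sup>2"
        using c e by (intro power_mono divide_right_mono) auto
      then have "?u * (1 - ?M\<^sup>2 / 2) \<le> ?u * (1 - ((\<epsilon> + \<bar>b * x\<bar>) / c)\<^sup>2 / 2)"
        using u0 by (intro mult_left_mono) auto
      then show ?thesis using S1(2)[of x] by linarith
    qed
    then have "(\<integral>\<^sup>+x. ennreal (?u * (1 - ?M\<^sup>2 / 2)) * indicator A x \<partial>?N) \<le> ennreal p"
      unfolding p0 e0 by (intro nn_integral_mono) (auto simp: indicator_def intro!: ennreal_leI)
    also have "(\<integral>\<^sup>+x. ennreal (?u * (1 - ?M\<^sup>2 / 2)) * indicator A x \<partial>?N) = ennreal (?u * (1 - ?M\<^sup>2 / 2) * measure ?N A)"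
      using u0 M1 by (intro Ac mult_nonneg_nonneg) simp_all
    finally have "?u * (1 - ?M\<^sup>2 / 2) * measure ?N A \<le> p"
      by (subst (asm) ennreal_le_iff) (rule pp)
    note P1 = this
    have P2: "?u * (1 - ?M\<^sup>2 / 2) * (?v * (1 - ?L\<^sup>2 / 2)) \<le> ?u * (1 - ?M\<^sup>2 / 2) * measure ?N A"
      using A1(2) u0 M1 by (intro mult_left_mono mult_nonneg_nonneg) auto
    have P3: "?u * ?v * (1 - ?L\<^sup>2 / 2 - ?M\<^sup>2 / 2) \<le> ?u * ?v * ((1 - ?M\<^sup>2 / 2) * (1 - ?L\<^sup>2 / 2))"
    proof (rule mult_left_mono)
      show "1 - ?L\<^sup>2 / 2 - ?M\<^sup>2 / 2 \<le> (1 - ?M\<^sup>2 / 2) * (1 - ?L\<^sup>2 / 2)" by (simp add: algebra_simps)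
      show "0 \<le> ?u * ?v" using mult_pos_pos[OF u0] by linarith
    qed
    have P4: "u * v * (m * l) = u * m * (v * l)" for u v m l :: real by simp
    show ?thesis unfolding uv[symmetric]
      by (rule order_trans[OF P3], subst P4, rule order_trans[OF P2 P1])
  qed
qed

context gaussian_zeros
begin

text \<open>The instance of \<open>law_pair\<close> with both components equal and
  \<open>c = 0\<close>, which avoids separating off the degenerate case.\<close>

lemma law_single:
  assumes X: "lin X \<phi>"
  shows "distr M borel X = distr std_normal_distribution borel (\<lambda>z. sqrt (ip \<phi> \<phi>) * z)"
proof -
  note [measurable] = lin_measurable1[OF X]
  interpret NN: pair_prob_space std_normal_distribution std_normal_distribution ..
  let ?a = "sqrt (ip \<phi> \<phi>)"
  have mXX: "(\<lambda>\<omega>. (X \<omega>, X \<omega>)) \<in> borel_measurable M" by (simp add: borel_prod[symmetric])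
  have mf: "fst \<in> borel_measurable (borel :: (real \<times> real) measure)" by (simp add: borel_prod[symmetric])
  have mN: "(\<lambda>z. (?a * fst z, ?a * fst z + 0 * snd z)) \<in> borel_measurable (std_normal_distribution \<Otimes>\<^sub>M std_normal_distribution)"
    by (simp add: borel_prod[symmetric])
  have "distr M borel X = distr (distr M borel (\<lambda>\<omega>. (X \<omega>, X \<omega>))) borel fst"
    using mXX mf by (subst distr_distr) (auto simp: o_def)
  also have "distr M borel (\<lambda>\<omega>. (X \<omega>, X \<omega>)) = distr (std_normal_distribution \<Otimes>\<^sub>M std_normal_distribution) borel (\<lambda>z. (?a * fst z, ?a * fst z + 0 * snd z))"
    using ip_nonneg[of \<phi>] by (intro law_pair[OF X X]) auto
  also have "distr \<dots> borel fst = distr (std_normal_distribution \<Otimes>\<^sub>M std_normal_distribution) borel (\<lambda>z. ?a * fst z)"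
    using mN mf by (subst distr_distr) (auto simp: o_def)
  also have "\<dots> = distr (distr (std_normal_distribution \<Otimes>\<^sub>M std_normal_distribution) std_normal_distribution fst) borel (\<lambda>z. ?a * z)"
    by (subst distr_distr) (auto simp: o_def)
  also have "distr (std_normal_distribution \<Otimes>\<^sub>M std_normal_distribution) std_normal_distribution fst = std_normal_distribution"
    by (rule std_normal.distr_pair_fst)
  finally show ?thesis .
qed

lemma lin_square:
  assumes X: "lin X \<phi>"
  shows "integrable M (\<lambda>\<omega>. (X \<omega>)\<^sup>2)" "expectation (\<lambda>\<omega>. (X \<omega>)\<^sup>2) = ip \<phi> \<phi>"
proof -
  note [measurable] = lin_measurable1[OF X]
  let ?N = std_normal_distribution
  have h: "has_bochner_integral lborel (\<lambda>x. std_normal_density x * x ^ (2 * 1)) (fact (2 * 1) / (2^1 * fact 1))"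
    by (rule std_normal_moment_even)
  then have h: "has_bochner_integral ?N (\<lambda>x. x\<^sup>2) 1"
    by (subst has_bochner_integral_density) (auto simp: power2_eq_square)
  have "integrable (distr M borel X) (\<lambda>x. x\<^sup>2)"
    unfolding law_single[OF X] using h
    by (subst integrable_distr_eq) (auto simp: power_mult_distrib ip_nonneg has_bochner_integral_iff)
  then show "integrable M (\<lambda>\<omega>. (X \<omega>)\<^sup>2)" by (subst (asm) integrable_distr_eq) auto
  have "(LINT x|distr M borel X. x\<^sup>2) = ip \<phi> \<phi>"
    unfolding law_single[OF X] using h
    by (subst integral_distr) (auto simp: power_mult_distrib ip_nonneg has_bochner_integral_iff)
  then show "expectation (\<lambda>\<omega>. (X \<omega>)\<^sup>2) = ip \<phi> \<phi>" by (subst (asm) integral_distr) auto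
qed

lemma lin_prod_integrable:
  assumes X: "lin X \<phi>" and Y: "lin Y \<psi>"
  shows "integrable M (\<lambda>\<omega>. X \<omega> * Y \<omega>)"
proof (rule Bochner_Integration.integrable_bound)
  show "integrable M (\<lambda>\<omega>. (X \<omega>)\<^sup>2 + (Y \<omega>)\<^sup>2)" using lin_square(1)[OF X] lin_square(1)[OF Y] by simp
  show "(\<lambda>\<omega>. X \<omega> * Y \<omega>) \<in> borel_measurable M" using X Y lin_measurable1 by auto
  have "\<bar>x * y\<bar> \<le> x\<^sup>2 + y\<^sup>2" for x y :: real
  proof -
    have "0 \<le> \<bar>x\<bar> * \<bar>y\<bar>" by simp
    then show ?thesis using sum_squares_bound[of "\<bar>x\<bar>" "\<bar>y\<bar>"] unfolding abs_mult power2_abs by linarith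
  qed
  then show "AE \<omega> in M. norm (X \<omega> * Y \<omega>) \<le> norm ((X \<omega>)\<^sup>2 + (Y \<omega>)\<^sup>2)" by simp
qed

lemma lin_abs:
  assumes X: "lin X \<phi>"
  shows "integrable M (\<lambda>\<omega>. \<bar>X \<omega>\<bar>)" "expectation (\<lambda>\<omega>. \<bar>X \<omega>\<bar>) \<le> 1 + ip \<phi> \<phi>"
proof -
  note [measurable] = lin_measurable1[OF X]
  have le: "\<bar>x\<bar> \<le> 1 + x\<^sup>2" for x :: real
    using sum_squares_bound[of "\<bar>x\<bar>" 1] by simp
  have i: "integrable M (\<lambda>\<omega>. 1 + (X \<omega>)\<^sup>2)" using lin_square(1)[OF X] by simp
  show j: "integrable M (\<lambda>\<omega>. \<bar>X \<omega>\<bar>)"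
    by (rule Bochner_Integration.integrable_bound[OF i]) (use le in auto)
  have "expectation (\<lambda>\<omega>. \<bar>X \<omega>\<bar>) \<le> expectation (\<lambda>\<omega>. 1 + (X \<omega>)\<^sup>2)"
    using i j le by (intro integral_mono) auto
  also have "\<dots> = 1 + ip \<phi> \<phi>" using lin_square[OF X] by (simp add: prob_space)
  finally show "expectation (\<lambda>\<omega>. \<bar>X \<omega>\<bar>) \<le> 1 + ip \<phi> \<phi>" .
qed

lemma lin_ne_0:
  assumes X: "lin X \<phi>" and "ip \<phi> \<phi> > 0"
  shows "AE \<omega> in M. X \<omega> \<noteq> u"
proof -
  have D: "distributed M lborel X (normal_density 0 (sqrt (ip \<phi> \<phi>)))"
    using lin_normal[OF X] assms by simp
  have "AE x in lborel. x \<noteq> u" by (rule AE_lborel_singleton)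
  then show ?thesis by (subst distributed_AE2[OF D]) auto
qed

end

text \<open>The expectation of \<^term>\<open>\<bar>X * Y\<bar>\<close> for a centred Gaussian pair with covariances
  \<^term>\<open>v\<close>, \<^term>\<open>c\<close>, \<^term>\<open>w\<close>. For \<^term>\<open>v = 0\<close> the first factor vanishes, so that the junk value of
  \<^term>\<open>c / sqrt v\<close> does not matter.\<close>

definition absprod :: "real \<Rightarrow> real \<Rightarrow> real \<Rightarrow> real" where
  "absprod v c w = (LINT z|(std_normal_distribution \<Otimes>\<^sub>M std_normal_distribution).
     \<bar>(sqrt v * fst z) * (c / sqrt v * fst z + sqrt (w - c\<^sup>2 / v) * snd z)\<bar>)"

text \<open>The conditional expectation of \<^term>\<open>\<bar>D * V\<bar>\<close> given that \<^term>\<open>P = 0\<close> and \<^term>\<open>Q = 0\<close>, multiplied by the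
  density of \<^term>\<open>(P, Q)\<close> at the origin, in terms of the covariances of these Gaussian variables.\<close>

definition rice_density ::
  "real \<Rightarrow> real \<Rightarrow> real \<Rightarrow> real \<Rightarrow> real \<Rightarrow> real \<Rightarrow> real \<Rightarrow> real \<Rightarrow> real \<Rightarrow> real \<Rightarrow> real" where
  "rice_density s11 s12 s22 d1 d2 v1 v2 dd dv vv =
    (let \<Delta> = s11 * s22 - s12\<^sup>2;
         R = (\<lambda>a1 a2 b1 b2 ab. ab - (a1 * b1 * s22 - (a1 * b2 + a2 * b1) * s12 + a2 * b2 * s11) / \<Delta>)
     in absprod (R d1 d2 d1 d2 dd) (R d1 d2 v1 v2 dv) (R v1 v2 v1 v2 vv) / (2 * pi * sqrt \<Delta>))"

lemma quadratic_form_disc: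
  fixes v c w :: real
  assumes nn: "\<And>a b. 0 \<le> a\<^sup>2 * v + 2 * a * b * c + b\<^sup>2 * w"
  shows "c\<^sup>2 \<le> v * w"
proof (cases "w = 0")
  case True
  have "c = 0"
  proof (rule ccontr)
    assume "c \<noteq> 0"
    \<comment> \<open>With \<open>w = 0\<close> the form takes the value \<open>-1\<close> at this
      point.\<close>
    moreover have "0 \<le> 1\<^sup>2 * v + 2 * 1 * (- (v + 1) / (2 * c)) * c + (- (v + 1) / (2 * c))\<^sup>2 * w"
      by (rule nn)
    ultimately show False using True by (simp add: field_simps)
  qed
  then show ?thesis using True by simp
next
  case False
  have w: "w > 0" using nn[of 0 1] False by simp
  have "0 \<le> w\<^sup>2 * v + 2 * w * (- c) * c + (- c)\<^sup>2 * w" by (rule nn)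
  also have "\<dots> = w * (v * w - c\<^sup>2)" by (simp add: algebra_simps power2_eq_square)
  finally show ?thesis using w by (simp add: zero_le_mult_iff)
qed

lemma absprod_scale:
  assumes "k > 0"
  shows "absprod (k\<^sup>2 * v) (k\<^sup>2 * c) (k\<^sup>2 * w) = k\<^sup>2 * absprod v c w"
proof -
  have 1: "sqrt (k\<^sup>2 * v) = k * sqrt v" using assms by (simp add: real_sqrt_mult)
  have 2: "sqrt (k\<^sup>2 * w - (k\<^sup>2 * c)\<^sup>2 / (k\<^sup>2 * v)) = k * sqrt (w - c\<^sup>2 / v)"
  proof -
    have "k\<^sup>2 * w - (k\<^sup>2 * c)\<^sup>2 / (k\<^sup>2 * v) = k\<^sup>2 * (w - c\<^sup>2 / v)"
      using assms by (cases "v = 0") (simp_all add: power_mult_distrib field_simps power2_eq_square)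
    then show ?thesis using assms by (simp only: real_sqrt_mult real_sqrt_abs abs_of_pos)
  qed
  have 3: "k\<^sup>2 * c / (k * sqrt v) = k * (c / sqrt v)" using assms by (simp add: power2_eq_square)
  have "\<bar>k * sqrt v * x * (k * (c / sqrt v) * x + k * s * y)\<bar> = k\<^sup>2 * \<bar>sqrt v * x * (c / sqrt v * x + s * y)\<bar>" for x y s
  proof -
    have "k * sqrt v * x * (k * (c / sqrt v) * x + k * s * y) = k\<^sup>2 * (sqrt v * x * (c / sqrt v * x + s * y))"
      by (simp add: power2_eq_square algebra_simps)
    then show ?thesis by (simp only: abs_mult abs_power2)
  qed
  then show ?thesis unfolding absprod_def 1 2 3 by simp
qed

text \<open>Homogeneity of degree two in the slopes: increments can be exchanged for difference
  quotients at the price of a factor \<open>\<delta>^2\<close>.\<close>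

lemma rice_density_scale:
  assumes "k > 0"
  shows "rice_density s11 s12 s22 (k * d1) (k * d2) (k * v1) (k * v2) (k\<^sup>2 * dd) (k\<^sup>2 * dv) (k\<^sup>2 * vv)
    = k\<^sup>2 * rice_density s11 s12 s22 d1 d2 v1 v2 dd dv vv"
proof -
  have "k\<^sup>2 * ab - (k * a1 * (k * b1) * s22 - (k * a1 * (k * b2) + k * a2 * (k * b1)) * s12 + k * a2 * (k * b2) * s11) / \<Delta>
    = k\<^sup>2 * (ab - (a1 * b1 * s22 - (a1 * b2 + a2 * b1) * s12 + a2 * b2 * s11) / \<Delta>)" for a1 a2 b1 b2 ab \<Delta>
    by (cases "\<Delta> = 0") (simp_all add: field_simps power2_eq_square)
  then show ?thesis
    unfolding rice_density_def Let_def by (simp only: absprod_scale[OF assms] times_divide_eq_right)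
qed

section \<open>Regression on the two values and estimates for the Rice density\<close>

context gaussian_zeros
begin

lemma ip_Cauchy_Schwarz:
  assumes "lin X \<phi>" "lin Y \<psi>"
  shows "(ip \<phi> \<psi>)\<^sup>2 \<le> ip \<phi> \<phi> * ip \<psi> \<psi>"
proof (rule quadratic_form_disc)
  fix a b
  show "0 \<le> a\<^sup>2 * ip \<phi> \<phi> + 2 * a * b * ip \<phi> \<psi> + b\<^sup>2 * ip \<psi> \<psi>"
    unfolding ip_comb2[OF assms, symmetric] by (rule ip_nonneg)
qed

lemma ip_bound:
  assumes "lin X \<phi>" "lin Y \<psi>" "ip \<phi> \<phi> \<le> B" "ip \<psi> \<psi> \<le> B"
  shows "\<bar>ip \<phi> \<psi>\<bar> \<le> B"
proof -
  have "(ip \<phi> \<psi>)\<^sup>2 \<le> B * B"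
    using ip_Cauchy_Schwarz[OF assms(1,2)] mult_mono[OF assms(3,4)] ip_nonneg[of \<phi>] ip_nonneg[of \<psi>] assms(3) by linarith
  then show ?thesis using ip_nonneg[of \<phi>] assms(3) by (simp add: power2_eq_square[symmetric] abs_le_square_iff[symmetric])
qed

lemma lin_absprod:
  assumes X: "lin X \<phi>" and Y: "lin Y \<psi>"
  shows "expectation (\<lambda>\<omega>. \<bar>X \<omega> * Y \<omega>\<bar>) = absprod (ip \<phi> \<phi>) (ip \<phi> \<psi>) (ip \<psi> \<psi>)"
proof -
  note [measurable] = lin_measurable1[OF X] lin_measurable1[OF Y]
  let ?NN = "std_normal_distribution \<Otimes>\<^sub>M std_normal_distribution"
  let ?v = "ip \<phi> \<phi>" and ?c = "ip \<phi> \<psi>" and ?w = "ip \<psi> \<psi>"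
  let ?g = "\<lambda>z. (sqrt ?v * fst z, ?c / sqrt ?v * fst z + sqrt (?w - ?c\<^sup>2 / ?v) * snd z)"
  have m: "(\<lambda>\<omega>. (X \<omega>, Y \<omega>)) \<in> borel_measurable M" by (simp add: borel_prod[symmetric])
  have mg: "?g \<in> borel_measurable ?NN" by (simp add: borel_prod[symmetric])
  have mp: "(\<lambda>z. \<bar>fst z * snd z\<bar>) \<in> borel_measurable (borel :: (real \<times> real) measure)" by (simp add: borel_prod[symmetric])
  have v: "?v \<ge> 0" "?w \<ge> 0" by (rule ip_nonneg)+
  have cs: "?c\<^sup>2 \<le> ?v * ?w" using ip_Cauchy_Schwarz[OF X Y] .
  \<comment> \<open>By Cauchy-Schwarz a degenerate first variable has no covariance with the second,
    so the junk value of the division is multiplied by zero.\<close>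
  then have "?v = 0 \<Longrightarrow> ?c = 0" by simp
  then have "?c = sqrt ?v * (?c / sqrt ?v)" by (cases "?v = 0") auto
  moreover have "?w = (?c / sqrt ?v)\<^sup>2 + (sqrt (?w - ?c\<^sup>2 / ?v))\<^sup>2"
  proof -
    have "?c\<^sup>2 / ?v \<le> ?w" using v cs by (cases "?v = 0") (auto simp: field_simps)
    then show ?thesis using v by (simp add: power_divide)
  qed
  ultimately have "distr M borel (\<lambda>\<omega>. (X \<omega>, Y \<omega>)) = distr ?NN borel ?g"
    using v by (intro law_pair[OF X Y]) auto
  then have "(LINT z|distr M borel (\<lambda>\<omega>. (X \<omega>, Y \<omega>)). \<bar>fst z * snd z\<bar>) = (LINT z|distr ?NN borel ?g. \<bar>fst z * snd z\<bar>)"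
    by simp
  then show ?thesis
    unfolding absprod_def by (subst (asm) integral_distr[OF m mp], subst (asm) integral_distr[OF mg mp]) simp
qed

lemma lin_absprod_le:
  assumes X: "lin X \<phi>" and Y: "lin Y \<psi>"
  shows "absprod (ip \<phi> \<phi>) (ip \<phi> \<psi>) (ip \<psi> \<psi>) \<le> (ip \<phi> \<phi> + ip \<psi> \<psi>) / 2"
    and "0 \<le> absprod (ip \<phi> \<phi>) (ip \<phi> \<psi>) (ip \<psi> \<psi>)"
proof -
  have i: "integrable M (\<lambda>\<omega>. ((X \<omega>)\<^sup>2 + (Y \<omega>)\<^sup>2) / 2)" using lin_square(1)[OF X] lin_square(1)[OF Y] by simp
  have "\<bar>x * y\<bar> \<le> (x\<^sup>2 + y\<^sup>2) / 2" for x y :: real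
    using sum_squares_bound[of "\<bar>x\<bar>" "\<bar>y\<bar>"] by (simp add: abs_mult)
  then have "expectation (\<lambda>\<omega>. \<bar>X \<omega> * Y \<omega>\<bar>) \<le> expectation (\<lambda>\<omega>. ((X \<omega>)\<^sup>2 + (Y \<omega>)\<^sup>2) / 2)"
    using i lin_prod_integrable[OF X Y] by (intro integral_mono) auto
  also have "\<dots> = (ip \<phi> \<phi> + ip \<psi> \<psi>) / 2" using lin_square[OF X] lin_square[OF Y] by simp
  finally show "absprod (ip \<phi> \<phi>) (ip \<phi> \<psi>) (ip \<psi> \<psi>) \<le> (ip \<phi> \<phi> + ip \<psi> \<psi>) / 2" by (simp add: lin_absprod[OF X Y])
  show "0 \<le> absprod (ip \<phi> \<phi>) (ip \<phi> \<psi>) (ip \<psi> \<psi>)"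
    unfolding lin_absprod[OF X Y, symmetric] by (intro integral_nonneg_AE) auto
qed

text \<open>The coefficients \<open>\<alpha>\<close>, \<open>\<beta>\<close> solve the normal
  equations of the regression of \<open>D\<close> on \<open>P\<close> and \<open>Q\<close> by
  Cramer's rule, \<open>\<Delta>\<close> being the Gram determinant. The residual is uncorrelated
  with both values, hence independent of them.\<close>

lemma lin_residual:
  assumes P: "lin P p" and Q: "lin Q q" and D: "lin D d"
  defines "\<Delta> \<equiv> ip p p * ip q q - (ip p q)\<^sup>2"
  assumes \<Delta>: "\<Delta> > 0"
  defines "\<alpha> \<equiv> (ip d p * ip q q - ip d q * ip p q) / \<Delta>" and "\<beta> \<equiv> (ip d q * ip p p - ip d p * ip p q) / \<Delta>"
  obtains E e where "lin E e" "\<And>\<omega>. D \<omega> = E \<omega> + \<alpha> * P \<omega> + \<beta> * Q \<omega>" "ip e p = 0" "ip e q = 0"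
    "\<And>Y y. lin Y y \<Longrightarrow> ip e y = ip d y - \<alpha> * ip p y - \<beta> * ip q y" "ip e e \<le> ip d d"
proof -
  define S where "S \<omega> = \<alpha> * P \<omega> + \<beta> * Q \<omega>" for \<omega>
  define s where "s l = of_real \<alpha> * p l + of_real \<beta> * q l" for l
  have S: "lin S s" unfolding S_def[abs_def] s_def[abs_def] by (rule lin_comb[OF P Q])
  define E where "E \<omega> = 1 * D \<omega> + (-1) * S \<omega>" for \<omega>
  define e where "e l = of_real 1 * d l + of_real (-1) * s l" for l
  have E: "lin E e" unfolding E_def[abs_def] e_def[abs_def] by (rule lin_comb[OF D S])
  have s_ip: "ip s y = \<alpha> * ip p y + \<beta> * ip q y" if "lin Y y" for Y y
    unfolding s_def[abs_def] by (rule ip_comb_left[OF P Q that])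
  have e_ip: "ip e y = ip d y - \<alpha> * ip p y - \<beta> * ip q y" if "lin Y y" for Y y
    unfolding e_def[abs_def] ip_comb_left[OF D S that] s_ip[OF that] by simp
  have \<Delta>': "ip p p * ip q q - ip p q * ip p q = \<Delta>" by (simp add: \<Delta>_def power2_eq_square)
  have "\<alpha> * ip p p + \<beta> * ip p q = ip d p * (ip p p * ip q q - ip p q * ip p q) / \<Delta>"
    by (simp add: \<alpha>_def \<beta>_def add_divide_distrib[symmetric] algebra_simps)
  then have ep: "ip e p = 0" using \<Delta> unfolding e_ip[OF P] \<Delta>' by (simp add: ip_commute[of q p])
  have "\<alpha> * ip p q + \<beta> * ip q q = ip d q * (ip p p * ip q q - ip p q * ip p q) / \<Delta>"
    by (simp add: \<alpha>_def \<beta>_def add_divide_distrib[symmetric] algebra_simps)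
  then have eq: "ip e q = 0" using \<Delta> unfolding e_ip[OF Q] \<Delta>' by simp
  have se: "ip s e = 0" using s_ip[OF E] ep eq by (simp add: ip_commute[of p e] ip_commute[of q e])
  have eD: "ip e y = ip d y - ip s y" if "lin Y y" for Y y
    unfolding e_def[abs_def] ip_comb_left[OF D S that] by simp
  have es: "ip e s = 0" using se by (simp add: ip_commute[of e s])
  have "ip e e = ip d e" using eD[OF E] se by simp
  also have "\<dots> = ip d d - ip s d" using eD[OF D] by (simp add: ip_commute[of d e])
  also have "ip s d = ip e s + ip s s" using eD[OF S] by (simp add: ip_commute[of d s])
  finally have "ip e e \<le> ip d d" using es ip_nonneg[of s] by simp
  then show ?thesis
    using that[OF E _ ep eq e_ip] by (simp add: E_def S_def)
qed

text \<open>The expressions \<open>R\<close> inside \<open>rice_density\<close> are Schur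
  complements, that is, covariances of the two regression residuals. Orthogonality lets one residual
  in each inner product be replaced by the variable it came from.\<close>

lemma rice_density_residual:
  assumes P: "lin P p" and Q: "lin Q q" and D: "lin D d" and V: "lin V v"
    and \<Delta>0: "0 < ip p p * ip q q - (ip p q)\<^sup>2"
    and EF: "lin E e" "lin F g" and orth: "ip e p = 0" "ip e q = 0" "ip g p = 0" "ip g q = 0"
    and e_ip: "\<And>Y y. lin Y y \<Longrightarrow> ip e y = ip d y - \<alpha> * ip p y - \<beta> * ip q y"
    and g_ip: "\<And>Y y. lin Y y \<Longrightarrow> ip g y = ip v y - \<alpha>' * ip p y - \<beta>' * ip q y"
    and ab: "\<alpha> = (ip d p * ip q q - ip d q * ip p q) / (ip p p * ip q q - (ip p q)\<^sup>2)"
      "\<beta> = (ip d q * ip p p - ip d p * ip p q) / (ip p p * ip q q - (ip p q)\<^sup>2)"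
      "\<alpha>' = (ip v p * ip q q - ip v q * ip p q) / (ip p p * ip q q - (ip p q)\<^sup>2)"
      "\<beta>' = (ip v q * ip p p - ip v p * ip p q) / (ip p p * ip q q - (ip p q)\<^sup>2)"
  shows "rice_density (ip p p) (ip p q) (ip q q) (ip d p) (ip d q) (ip v p) (ip v q) (ip d d) (ip d v) (ip v v)
      = absprod (ip e e) (ip e g) (ip g g) / (2 * pi * sqrt (ip p p * ip q q - (ip p q)\<^sup>2))"
proof -
  define \<Delta> where "\<Delta> = ip p p * ip q q - (ip p q)\<^sup>2"
  note ab = ab[folded \<Delta>_def]
  have E0: "ip p e = 0" "ip q e = 0" and F0: "ip p g = 0" "ip q g = 0"
    using orth by (simp_all add: ip_commute)
  have ee: "ip e e = ip d d - (ip d p * ip d p * ip q q - (ip d p * ip d q + ip d q * ip d p) * ip p q + ip d q * ip d q * ip p p) / \<Delta>"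
  proof -
    have "ip e e = ip e d" unfolding e_ip[OF EF(1)] by (simp add: E0 ip_commute[of d e])
    also have "\<dots> = ip d d - \<alpha> * ip d p - \<beta> * ip d q" unfolding e_ip[OF D] by (simp add: ip_commute[of p d] ip_commute[of q d])
    also have "\<alpha> * ip d p + \<beta> * ip d q = (ip d p * ip d p * ip q q - (ip d p * ip d q + ip d q * ip d p) * ip p q + ip d q * ip d q * ip p p) / \<Delta>"
      by (simp add: ab(1,2) add_divide_distrib[symmetric] algebra_simps)
    ultimately show ?thesis by linarith
  qed
  have gg: "ip g g = ip v v - (ip v p * ip v p * ip q q - (ip v p * ip v q + ip v q * ip v p) * ip p q + ip v q * ip v q * ip p p) / \<Delta>"
  proof -
    have "ip g g = ip g v" unfolding g_ip[OF EF(2)] by (simp add: F0 ip_commute[of v g])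
    also have "\<dots> = ip v v - \<alpha>' * ip v p - \<beta>' * ip v q" unfolding g_ip[OF V] by (simp add: ip_commute[of p v] ip_commute[of q v])
    also have "\<alpha>' * ip v p + \<beta>' * ip v q = (ip v p * ip v p * ip q q - (ip v p * ip v q + ip v q * ip v p) * ip p q + ip v q * ip v q * ip p p) / \<Delta>"
      by (simp add: ab(3,4) add_divide_distrib[symmetric] algebra_simps)
    ultimately show ?thesis by linarith
  qed
  have eg: "ip e g = ip d v - (ip d p * ip v p * ip q q - (ip d p * ip v q + ip d q * ip v p) * ip p q + ip d q * ip v q * ip p p) / \<Delta>"
  proof -
    have "ip e g = ip e v" unfolding ip_commute[of e g] g_ip[OF EF(1)] by (simp add: E0 ip_commute[of v e])
    also have "\<dots> = ip d v - \<alpha> * ip v p - \<beta> * ip v q" unfolding e_ip[OF V] by (simp add: ip_commute[of p v] ip_commute[of q v])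
    also have "\<alpha> * ip v p + \<beta> * ip v q = (ip d p * ip v p * ip q q - (ip d p * ip v q + ip d q * ip v p) * ip p q + ip d q * ip v q * ip p p) / \<Delta>"
      by (simp add: ab(1,2) add_divide_distrib[symmetric] algebra_simps)
    ultimately show ?thesis by linarith
  qed
  show ?thesis
    unfolding rice_density_def Let_def \<Delta>_def[symmetric] ee[symmetric] gg[symmetric] eg[symmetric] ..
qed

text \<open>The residual is the best linear prediction error, so any other coefficients
  \<open>a\<close>, \<open>b\<close>, \<open>a'\<close>, \<open>b'\<close> give an upper bound. A
  convenient predictor can then stand in for the exact regression, whose coefficients are hard to
  control when the Gram determinant is small.\<close>

lemma rice_density_le:
  assumes P: "lin P p" and Q: "lin Q q" and D: "lin D d" and V: "lin V v"
    and \<Delta>: "0 < \<kappa>" "\<kappa> \<le> ip p p * ip q q - (ip p q)\<^sup>2"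
  shows "rice_density (ip p p) (ip p q) (ip q q) (ip d p) (ip d q) (ip v p) (ip v q) (ip d d) (ip d v) (ip v v)
      \<le> (ip (\<lambda>l. of_real 1 * d l + of_real (-1) * (of_real a * p l + of_real b * q l))
            (\<lambda>l. of_real 1 * d l + of_real (-1) * (of_real a * p l + of_real b * q l))
         + ip (\<lambda>l. of_real 1 * v l + of_real (-1) * (of_real a' * p l + of_real b' * q l))
            (\<lambda>l. of_real 1 * v l + of_real (-1) * (of_real a' * p l + of_real b' * q l))) / (4 * pi * sqrt \<kappa>)"
proof -
  have \<Delta>0: "0 < ip p p * ip q q - (ip p q)\<^sup>2" using \<Delta> by linarith
  obtain E e where E: "lin E e" "ip e p = 0" "ip e q = 0"
    "\<And>Y y. lin Y y \<Longrightarrow> ip e y = ip d y - (ip d p * ip q q - ip d q * ip p q) / (ip p p * ip q q - (ip p q)\<^sup>2) * ip p y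
       - (ip d q * ip p p - ip d p * ip p q) / (ip p p * ip q q - (ip p q)\<^sup>2) * ip q y"
    using lin_residual[OF P Q D \<Delta>0] by metis
  obtain F g where F: "lin F g" "ip g p = 0" "ip g q = 0"
    "\<And>Y y. lin Y y \<Longrightarrow> ip g y = ip v y - (ip v p * ip q q - ip v q * ip p q) / (ip p p * ip q q - (ip p q)\<^sup>2) * ip p y
       - (ip v q * ip p p - ip v p * ip p q) / (ip p p * ip q q - (ip p q)\<^sup>2) * ip q y"
    using lin_residual[OF P Q V \<Delta>0] by metis
  have eq: "rice_density (ip p p) (ip p q) (ip q q) (ip d p) (ip d q) (ip v p) (ip v q) (ip d d) (ip d v) (ip v v)
      = absprod (ip e e) (ip e g) (ip g g) / (2 * pi * sqrt (ip p p * ip q q - (ip p q)\<^sup>2))"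
    by (rule rice_density_residual[OF P Q D V \<Delta>0 E(1) F(1) E(2,3) F(2,3) E(4) F(4)]) simp_all
  \<comment> \<open>Every competing error differs from the residual by a combination of
    \<open>P\<close> and \<open>Q\<close>, hence has the same inner product with the residual.
    Cauchy-Schwarz does the rest.\<close>
  have opt: "ip e e \<le> ip (\<lambda>l. of_real 1 * d l + of_real (-1) * (of_real a * p l + of_real b * q l))
            (\<lambda>l. of_real 1 * d l + of_real (-1) * (of_real a * p l + of_real b * q l))" (is "_ \<le> ip ?y ?y")
    if D: "lin D d" and E: "lin E e" "ip e p = 0" "ip e q = 0"
      "\<And>Y y. lin Y y \<Longrightarrow> ip e y = ip d y - \<alpha> * ip p y - \<beta> * ip q y" for D d E e a b \<alpha> \<beta>
  proof -
    have y: "lin (\<lambda>\<omega>. 1 * D \<omega> + (-1) * (a * P \<omega> + b * Q \<omega>)) ?y"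
      by (intro lin_comb D P Q)
    have "ip e ?y = 1 * ip e d + (-1) * (a * ip e p + b * ip e q)"
      unfolding ip_comb_right[OF D lin_comb[OF P Q] E(1)] ip_comb_right[OF P Q E(1)] ..
    also have "\<dots> = ip e d" using E by simp
    also have "\<dots> = ip e e"
      using E(4)[OF E(1)] E(2,3) by (simp add: ip_commute[of p e] ip_commute[of q e] ip_commute[of d e])
    finally have "(ip e e)\<^sup>2 \<le> ip e e * ip ?y ?y" using ip_Cauchy_Schwarz[OF E(1) y] by simp
    then show ?thesis
      using ip_nonneg[of e] ip_nonneg[of ?y] by (cases "ip e e = 0") (auto simp: power2_eq_square)
  qed
  have "absprod (ip e e) (ip e g) (ip g g) \<le> (ip e e + ip g g) / 2" by (rule lin_absprod_le[OF E(1) F(1)])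
  also have "\<dots> \<le> (ip (\<lambda>l. of_real 1 * d l + of_real (-1) * (of_real a * p l + of_real b * q l))
            (\<lambda>l. of_real 1 * d l + of_real (-1) * (of_real a * p l + of_real b * q l))
         + ip (\<lambda>l. of_real 1 * v l + of_real (-1) * (of_real a' * p l + of_real b' * q l))
            (\<lambda>l. of_real 1 * v l + of_real (-1) * (of_real a' * p l + of_real b' * q l))) / 2" (is "_ \<le> ?R / 2")
    by (intro divide_right_mono add_mono opt[OF D E] opt[OF V F]) simp_all
  finally have "absprod (ip e e) (ip e g) (ip g g) / (2 * pi * sqrt (ip p p * ip q q - (ip p q)\<^sup>2)) \<le> ?R / 2 / (2 * pi * sqrt \<kappa>)"
    using \<Delta> lin_absprod_le(2)[OF E(1) F(1)]
    by (intro frac_le) (auto intro!: add_nonneg_nonneg ip_nonneg)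
  then show ?thesis unfolding eq by (simp add: field_simps)
qed

text \<open>On the event that both values are below \<open>\<epsilon>\<close>, the slopes differ
  from their residuals by at most \<open>m \<epsilon>\<close>, because \<open>m\<close> bounds the
  sum of the regression coefficients. The residuals are independent of the event, so the expectation
  factors into their absolute product moment and a box probability. Each replacement costs a
  relative error of order \<open>\<epsilon>\<close>. The constant depends only on \<open>B\<close>
  and \<open>\<kappa>\<close>, hence is uniform along the segments.\<close>

lemma rice_estimate:
  assumes P: "lin P p" and Q: "lin Q q" and D: "lin D d" and V: "lin V v"
    and B: "ip p p \<le> B" "ip q q \<le> B" "ip d d \<le> B" "ip v v \<le> B"
    and \<kappa>: "0 < \<kappa>" "\<kappa> \<le> ip p p * ip q q - (ip p q)\<^sup>2" and \<epsilon>: "0 < \<epsilon>" "\<epsilon> \<le> 1"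
  defines "m \<equiv> 4 * B\<^sup>2 / \<kappa>"
  shows "\<bar>expectation (\<lambda>\<omega>. \<bar>D \<omega> * V \<omega>\<bar> * (indicat_real {y. \<bar>y\<bar> < \<epsilon>} (P \<omega>) * indicat_real {y. \<bar>y\<bar> < \<epsilon>} (Q \<omega>)))
     - 4 * \<epsilon>\<^sup>2 * rice_density (ip p p) (ip p q) (ip q q) (ip d p) (ip d q) (ip v p) (ip v q) (ip d d) (ip d v) (ip v v)\<bar>
    \<le> ((m * (2 * (1 + B)) + m\<^sup>2) * (4 / (2 * pi * sqrt \<kappa>)) + B * (4 / (2 * pi * sqrt \<kappa>) * (B / \<kappa> * (1 + (1 + B\<^sup>2 / \<kappa>)\<^sup>2)))) * \<epsilon> ^ 3"
proof -
  note [measurable] = P[THEN lin_measurable1] Q[THEN lin_measurable1] D[THEN lin_measurable1] V[THEN lin_measurable1]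
  define \<Delta> where "\<Delta> = ip p p * ip q q - (ip p q)\<^sup>2"
  have \<Delta>: "\<Delta> > 0" "\<kappa> \<le> \<Delta>" using \<kappa> by (auto simp: \<Delta>_def)
  have \<Delta>0: "0 < ip p p * ip q q - (ip p q)\<^sup>2" using \<Delta> by (simp add: \<Delta>_def)
  have pq0: "ip p p \<ge> 0" "ip q q \<ge> 0" "ip d d \<ge> 0" by (rule ip_nonneg)+
  have B0: "B \<ge> 0" using pq0 B by linarith
  have m0: "m \<ge> 0" using \<kappa> by (simp add: m_def)
  define \<alpha> \<beta> where "\<alpha> = (ip d p * ip q q - ip d q * ip p q) / \<Delta>" and "\<beta> = (ip d q * ip p p - ip d p * ip p q) / \<Delta>"
  define \<alpha>' \<beta>' where "\<alpha>' = (ip v p * ip q q - ip v q * ip p q) / \<Delta>" and "\<beta>' = (ip v q * ip p p - ip v p * ip p q) / \<Delta>"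
  obtain E e where E: "lin E e" "\<And>\<omega>. D \<omega> = E \<omega> + \<alpha> * P \<omega> + \<beta> * Q \<omega>" "ip e p = 0" "ip e q = 0"
    "\<And>Y y. lin Y y \<Longrightarrow> ip e y = ip d y - \<alpha> * ip p y - \<beta> * ip q y" "ip e e \<le> ip d d"
    using lin_residual[OF P Q D \<Delta>0, folded \<Delta>_def, folded \<alpha>_def \<beta>_def] by metis
  obtain F g where F: "lin F g" "\<And>\<omega>. V \<omega> = F \<omega> + \<alpha>' * P \<omega> + \<beta>' * Q \<omega>" "ip g p = 0" "ip g q = 0"
    "\<And>Y y. lin Y y \<Longrightarrow> ip g y = ip v y - \<alpha>' * ip p y - \<beta>' * ip q y" "ip g g \<le> ip v v"
    using lin_residual[OF P Q V \<Delta>0, folded \<Delta>_def, folded \<alpha>'_def \<beta>'_def] by metis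
  have E0: "ip p e = 0" "ip q e = 0" and F0: "ip p g = 0" "ip q g = 0"
    using E(3,4) F(3,4) by (simp_all add: ip_commute)
  note [measurable] = E(1)[THEN lin_measurable1] F(1)[THEN lin_measurable1]
  have bnd: "\<bar>x * y - z * w\<bar> / \<Delta> \<le> 2 * B\<^sup>2 / \<kappa>" if "\<bar>x\<bar> \<le> B" "\<bar>y\<bar> \<le> B" "\<bar>z\<bar> \<le> B" "\<bar>w\<bar> \<le> B" for x y z w
  proof -
    have "\<bar>x * y - z * w\<bar> \<le> \<bar>x\<bar> * \<bar>y\<bar> + \<bar>z\<bar> * \<bar>w\<bar>" by (metis abs_mult abs_triangle_ineq4)
    also have "\<dots> \<le> B * B + B * B" using that by (intro add_mono mult_mono) auto
    finally have "\<bar>x * y - z * w\<bar> \<le> 2 * B\<^sup>2" by (simp add: power2_eq_square)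
    then show ?thesis using \<Delta> \<kappa> B0 by (intro frac_le) auto
  qed
  note ipB = ip_bound[OF P Q B(1,2)] ip_bound[OF D P B(3,1)] ip_bound[OF D Q B(3,2)]
    ip_bound[OF V P B(4,1)] ip_bound[OF V Q B(4,2)] ip_bound[OF P P B(1,1)] ip_bound[OF Q Q B(2,2)]
  have "\<bar>\<alpha>\<bar> \<le> 2 * B\<^sup>2 / \<kappa>" "\<bar>\<beta>\<bar> \<le> 2 * B\<^sup>2 / \<kappa>" "\<bar>\<alpha>'\<bar> \<le> 2 * B\<^sup>2 / \<kappa>" "\<bar>\<beta>'\<bar> \<le> 2 * B\<^sup>2 / \<kappa>"
    unfolding \<alpha>_def \<beta>_def \<alpha>'_def \<beta>'_def abs_divide using ipB \<Delta> bnd by (simp_all)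
  then have ab: "\<bar>\<alpha>\<bar> + \<bar>\<beta>\<bar> \<le> m" "\<bar>\<alpha>'\<bar> + \<bar>\<beta>'\<bar> \<le> m" by (auto simp: m_def)
  define h where "h = expectation (\<lambda>\<omega>. \<bar>E \<omega> * F \<omega>\<bar>)"
  have rice: "rice_density (ip p p) (ip p q) (ip q q) (ip d p) (ip d q) (ip v p) (ip v q) (ip d d) (ip d v) (ip v v)
      = h / (2 * pi * sqrt \<Delta>)"
    unfolding h_def lin_absprod[OF E(1) F(1)]
    unfolding \<Delta>_def
    by (rule rice_density_residual[OF P Q D V \<Delta>0 E(1) F(1) E(3,4) F(3,4) E(5) F(5)])
       (simp_all add: \<alpha>_def \<beta>_def \<alpha>'_def \<beta>'_def \<Delta>_def)
  have h: "0 \<le> h" "h \<le> B"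
    using lin_absprod_le[OF E(1) F(1)] E(6) F(6) B unfolding h_def lin_absprod[OF E(1) F(1)] by auto
  define J where "J \<omega> = indicat_real {y. \<bar>y\<bar> < \<epsilon>} (P \<omega>) * indicat_real {y. \<bar>y\<bar> < \<epsilon>} (Q \<omega>)" for \<omega>
  have [measurable]: "J \<in> borel_measurable M" unfolding J_def by measurable
  have J01: "0 \<le> J \<omega>" "J \<omega> \<le> 1" for \<omega> by (auto simp: J_def indicator_def)
  have Ji: "integrable M J" by (rule bounded_integrable[where B=1]) (use J01 in auto)
  define b where "b = expectation J"
  have ind: "indep_var borel (\<lambda>\<omega>. (E \<omega>, F \<omega>)) borel (\<lambda>\<omega>. (P \<omega>, Q \<omega>))"
    by (rule indep_pairs[OF E(1) F(1) P Q E(3,4) F(3,4)])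
  have indJ: "integrable M (\<lambda>\<omega>. k (E \<omega>, F \<omega>) * J \<omega>)" "expectation (\<lambda>\<omega>. k (E \<omega>, F \<omega>) * J \<omega>) = expectation (\<lambda>\<omega>. k (E \<omega>, F \<omega>)) * b"
    if k: "k \<in> borel_measurable borel" "integrable M (\<lambda>\<omega>. k (E \<omega>, F \<omega>))" for k :: "real \<times> real \<Rightarrow> real"
  proof -
    let ?j = "\<lambda>z. indicat_real {y. \<bar>y\<bar> < \<epsilon>} (fst z) * indicat_real {y. \<bar>y\<bar> < \<epsilon>} (snd z)"
    have j: "?j \<in> borel_measurable (borel :: (real \<times> real) measure)" by (simp add: borel_prod[symmetric])
    have J: "J = ?j \<circ> (\<lambda>\<omega>. (P \<omega>, Q \<omega>))" by (auto simp: J_def)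
    have "indep_var borel (k \<circ> (\<lambda>\<omega>. (E \<omega>, F \<omega>))) borel (?j \<circ> (\<lambda>\<omega>. (P \<omega>, Q \<omega>)))"
      by (rule indep_var_compose[OF ind k(1) j])
    then have I: "indep_var borel (\<lambda>\<omega>. k (E \<omega>, F \<omega>)) borel J" unfolding J by (simp add: o_def)
    show "integrable M (\<lambda>\<omega>. k (E \<omega>, F \<omega>) * J \<omega>)" by (rule indep_var_integrable[OF I k(2) Ji])
    show "expectation (\<lambda>\<omega>. k (E \<omega>, F \<omega>) * J \<omega>) = expectation (\<lambda>\<omega>. k (E \<omega>, F \<omega>)) * b"
      unfolding b_def by (rule indep_var_lebesgue_integral[OF I k(2) Ji])
  qed
  define w where "w = 4 * \<epsilon>\<^sup>2 / (2 * pi * sqrt \<Delta>)"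
  have w: "0 \<le> w" "w \<le> 4 / (2 * pi * sqrt \<kappa>) * \<epsilon>\<^sup>2"
  proof -
    show "0 \<le> w" using \<Delta> by (simp add: w_def)
    have "w \<le> 4 * \<epsilon>\<^sup>2 / (2 * pi * sqrt \<kappa>)"
      unfolding w_def using \<Delta> \<kappa> by (intro divide_left_mono mult_left_mono mult_pos_pos) auto
    then show "w \<le> 4 / (2 * pi * sqrt \<kappa>) * \<epsilon>\<^sup>2" by simp
  qed
  \<comment> \<open>\<open>L \<epsilon>^2\<close> bounds the sum of the two corrections in the lower
    bound of \<open>std_normal_box\<close>; one power of \<open>\<epsilon>\<close> is then given
    away.\<close>
  define L where "L = B / \<kappa> * (1 + (1 + B\<^sup>2 / \<kappa>)\<^sup>2)"
  \<comment> \<open>The Cholesky factor is chosen with \<open>a c = sqrt \<Delta>\<close>, so that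
    the box probability has exactly the main term \<open>w\<close>.\<close>
  have bw: "b \<le> w" "w - w * L * \<epsilon> \<le> b"
  proof -
    define a where "a = sqrt (ip p p)"
    define c where "c = sqrt \<Delta> / a"
    have "ip p p \<noteq> 0" using \<Delta> by (auto simp: \<Delta>_def)
    then have pp: "ip p p > 0" using pq0 by simp
    have a: "a > 0" "a\<^sup>2 = ip p p" using pp by (auto simp: a_def)
    have c: "c > 0" "a * c = sqrt \<Delta>" "c\<^sup>2 = \<Delta> / ip p p" using a \<Delta> by (auto simp: c_def power_divide)
    have law: "distr M borel (\<lambda>\<omega>. (P \<omega>, Q \<omega>)) =
      distr (std_normal_distribution \<Otimes>\<^sub>M std_normal_distribution) borel (\<lambda>z. (a * fst z, ip p q / a * fst z + c * snd z))"
    proof (rule law_pair[OF P Q])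
      show "ip p p = a\<^sup>2" "ip p q = a * (ip p q / a)" using a by auto
      show "ip q q = (ip p q / a)\<^sup>2 + c\<^sup>2" using pp unfolding c power_divide a(2) \<Delta>_def by (simp add: add_divide_distrib[symmetric])
    qed
    let ?NN = "std_normal_distribution \<Otimes>\<^sub>M std_normal_distribution"
    let ?box = "{z :: real \<times> real. \<bar>fst z\<bar> < \<epsilon> \<and> \<bar>snd z\<bar> < \<epsilon>}"
    have mbox: "?box \<in> sets borel"
      by (intro borel_open open_Collect_conj open_Collect_less continuous_intros)
    have m1: "(\<lambda>\<omega>. (P \<omega>, Q \<omega>)) \<in> borel_measurable M" by (simp add: borel_prod[symmetric])
    have m2: "(\<lambda>z. (a * fst z, ip p q / a * fst z + c * snd z)) \<in> borel_measurable ?NN" by (simp add: borel_prod[symmetric])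
    have mi: "indicat_real ?box \<in> borel_measurable borel" using mbox by simp
    have Jb: "J \<omega> = indicat_real ?box (P \<omega>, Q \<omega>)" for \<omega> by (simp add: J_def indicator_def)
    have "b = (LINT z|distr M borel (\<lambda>\<omega>. (P \<omega>, Q \<omega>)). indicat_real ?box z)"
      unfolding integral_distr[OF m1 mi] b_def Jb ..
    also have "\<dots> = (LINT z|?NN. indicat_real ?box (a * fst z, ip p q / a * fst z + c * snd z))"
      unfolding law integral_distr[OF m2 mi] ..
    also have "\<dots> = (LINT z|?NN. indicat_real {z. \<bar>a * fst z\<bar> < \<epsilon> \<and> \<bar>ip p q / a * fst z + c * snd z\<bar> < \<epsilon>} z)"
      by (intro Bochner_Integration.integral_cong refl) (simp add: indicator_def)
    also have "\<dots> = measure ?NN {z. \<bar>a * fst z\<bar> < \<epsilon> \<and> \<bar>ip p q / a * fst z + c * snd z\<bar> < \<epsilon>}"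
      by (simp add: space_pair_measure)
    finally have b: "b = measure ?NN {z. \<bar>a * fst z\<bar> < \<epsilon> \<and> \<bar>ip p q / a * fst z + c * snd z\<bar> < \<epsilon>}" .
    have wac: "4 * \<epsilon>\<^sup>2 / (2 * pi * (a * c)) = w" by (simp add: w_def c(2))
    note box = std_normal_box[OF a(1) c(1) \<epsilon>(1), of "ip p q / a", folded b, unfolded wac]
    show "b \<le> w" by (rule box)
    have "\<kappa> \<le> ip p p * B" using \<Delta>(2) pp B mult_left_mono[OF B(2), of "ip p p"] zero_le_power2[of "ip p q"] unfolding \<Delta>_def by linarith
    then have ipp: "1 / ip p p \<le> B / \<kappa>" using pp \<kappa> by (simp add: field_simps)
    have M1: "(\<epsilon> / a)\<^sup>2 \<le> B / \<kappa> * \<epsilon>\<^sup>2"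
      using mult_right_mono[OF ipp, of "\<epsilon>\<^sup>2"] by (simp add: power_divide a(2))
    have "\<bar>ip p q / a\<bar> * \<epsilon> / a = \<bar>ip p q\<bar> * (1 / ip p p) * \<epsilon>"
      using a by (simp add: abs_divide power2_eq_square[symmetric])
    also have "\<dots> \<le> B * (B / \<kappa>) * \<epsilon>"
      using ipB(1) ipp \<epsilon> pp B0 by (intro mult_right_mono mult_mono) auto
    finally have M2: "\<epsilon> + \<bar>ip p q / a\<bar> * \<epsilon> / a \<le> (1 + B\<^sup>2 / \<kappa>) * \<epsilon>" by (simp add: power2_eq_square algebra_simps)
    have "1 / c\<^sup>2 \<le> B / \<kappa>" unfolding c(3) using \<Delta> \<kappa> pp B by (simp add: frac_le)
    then have "1 / c\<^sup>2 * (\<epsilon> + \<bar>ip p q / a\<bar> * \<epsilon> / a)\<^sup>2 \<le> B / \<kappa> * ((1 + B\<^sup>2 / \<kappa>) * \<epsilon>)\<^sup>2"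
      using M2 \<epsilon> a \<kappa> B0 by (intro mult_mono power_mono add_nonneg_nonneg) auto
    then have M3: "((\<epsilon> + \<bar>ip p q / a\<bar> * \<epsilon> / a) / c)\<^sup>2 \<le> B / \<kappa> * (1 + B\<^sup>2 / \<kappa>)\<^sup>2 * \<epsilon>\<^sup>2"
      by (simp add: power_divide power_mult_distrib)
    have half: "x\<^sup>2 / 2 + y\<^sup>2 / 2 \<le> x\<^sup>2 + y\<^sup>2" for x y :: real
      using zero_le_power2[of x] zero_le_power2[of y] by linarith
    have Leq: "L * \<epsilon>\<^sup>2 = B / \<kappa> * \<epsilon>\<^sup>2 + B / \<kappa> * (1 + B\<^sup>2 / \<kappa>)\<^sup>2 * \<epsilon>\<^sup>2"
      unfolding L_def by (simp only: distrib_left distrib_right mult_1_right)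
    have L0: "L \<ge> 0" using B0 \<kappa> by (simp add: L_def)
    have eps2: "\<epsilon>\<^sup>2 \<le> \<epsilon>" using \<epsilon> by (simp add: power2_eq_square mult_left_le)
    have "(\<epsilon> / a)\<^sup>2 / 2 + ((\<epsilon> + \<bar>ip p q / a\<bar> * \<epsilon> / a) / c)\<^sup>2 / 2 \<le> (\<epsilon> / a)\<^sup>2 + ((\<epsilon> + \<bar>ip p q / a\<bar> * \<epsilon> / a) / c)\<^sup>2"
      by (rule half)
    also have "\<dots> \<le> L * \<epsilon>\<^sup>2" unfolding Leq by (rule add_mono[OF M1 M3])
    also have "\<dots> \<le> L * \<epsilon>" by (rule mult_left_mono[OF eps2 L0])
    finally have "1 - L * \<epsilon> \<le> 1 - (\<epsilon> / a)\<^sup>2 / 2 - ((\<epsilon> + \<bar>ip p q / a\<bar> * \<epsilon> / a) / c)\<^sup>2 / 2" by linarith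
    from mult_left_mono[OF this w(1)] have "w * (1 - L * \<epsilon>) \<le> b" using box(2) by (rule order_trans)
    then show "w - w * L * \<epsilon> \<le> b" by (simp only: right_diff_distrib mult_1_right mult.assoc)
  qed
  have b0: "b \<ge> 0" unfolding b_def using J01 by (intro integral_nonneg_AE) auto
  have L0: "L \<ge> 0" using B0 \<kappa> by (simp add: L_def)
  \<comment> \<open>A majorant for the change of the product when each residual is perturbed by at
    most \<open>m \<epsilon>\<close>. It depends on the residuals only, so independence applies to
    it too.\<close>
  define k where "k z = m * \<epsilon> * (\<bar>fst z\<bar> + \<bar>snd z\<bar>) + m\<^sup>2 * \<epsilon>\<^sup>2" for z :: "real \<times> real"
  have km: "k \<in> borel_measurable borel" unfolding k_def by (simp add: borel_prod[symmetric])
  have EF: "integrable M (\<lambda>\<omega>. \<bar>E \<omega>\<bar>)" "integrable M (\<lambda>\<omega>. \<bar>F \<omega>\<bar>)" "expectation (\<lambda>\<omega>. \<bar>E \<omega>\<bar>) \<le> 1 + B" "expectation (\<lambda>\<omega>. \<bar>F \<omega>\<bar>) \<le> 1 + B"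
    using lin_abs[OF E(1)] lin_abs[OF F(1)] E(6) F(6) B by auto
  have ki: "integrable M (\<lambda>\<omega>. k (E \<omega>, F \<omega>))" using EF by (simp add: k_def)
  have kE: "expectation (\<lambda>\<omega>. k (E \<omega>, F \<omega>)) \<le> (m * (2 * (1 + B)) + m\<^sup>2) * \<epsilon>"
  proof -
    have "expectation (\<lambda>\<omega>. k (E \<omega>, F \<omega>)) = m * \<epsilon> * (expectation (\<lambda>\<omega>. \<bar>E \<omega>\<bar>) + expectation (\<lambda>\<omega>. \<bar>F \<omega>\<bar>)) + m\<^sup>2 * \<epsilon>\<^sup>2"
      using EF by (simp add: k_def prob_space)
    also have "\<dots> \<le> m * \<epsilon> * (2 * (1 + B)) + m\<^sup>2 * \<epsilon>"
      using EF m0 \<epsilon> by (intro add_mono mult_left_mono) (auto simp: power2_eq_square mult_left_le)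
    finally show ?thesis by (simp add: algebra_simps)
  qed
  have k0: "0 \<le> expectation (\<lambda>\<omega>. k (E \<omega>, F \<omega>))" using m0 \<epsilon> by (intro integral_nonneg_AE) (auto simp: k_def)
  define G where "G \<omega> = \<bar>D \<omega> * V \<omega>\<bar> * J \<omega>" for \<omega>
  define H where "H \<omega> = \<bar>E \<omega> * F \<omega>\<bar> * J \<omega>" for \<omega>
  have Gi: "integrable M G"
    by (rule Bochner_Integration.integrable_bound[OF lin_prod_integrable[OF D V]])
       (use J01 in \<open>auto simp: G_def[abs_def] abs_mult intro!: mult_left_le\<close>)
  have em: "(\<lambda>z. \<bar>fst z * snd z\<bar>) \<in> borel_measurable (borel :: (real \<times> real) measure)" by (simp add: borel_prod[symmetric])
  have H: "integrable M H" "expectation H = h * b"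
    using indJ[OF em] lin_prod_integrable[OF E(1) F(1)] unfolding H_def[abs_def] h_def by auto
  have diff: "\<bar>G \<omega> - H \<omega>\<bar> \<le> k (E \<omega>, F \<omega>) * J \<omega>" for \<omega>
  proof (cases "\<bar>P \<omega>\<bar> < \<epsilon> \<and> \<bar>Q \<omega>\<bar> < \<epsilon>")
    case True
    then have J: "J \<omega> = 1" by (simp add: J_def)
    define x y where "x = \<alpha> * P \<omega> + \<beta> * Q \<omega>" and "y = \<alpha>' * P \<omega> + \<beta>' * Q \<omega>"
    have xy: "\<bar>x\<bar> \<le> m * \<epsilon>" "\<bar>y\<bar> \<le> m * \<epsilon>"
    proof -
      have *: "\<bar>a * P \<omega> + c * Q \<omega>\<bar> \<le> m * \<epsilon>" if "\<bar>a\<bar> + \<bar>c\<bar> \<le> m" for a c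
      proof -
        have "\<bar>a * P \<omega> + c * Q \<omega>\<bar> \<le> \<bar>a\<bar> * \<bar>P \<omega>\<bar> + \<bar>c\<bar> * \<bar>Q \<omega>\<bar>" by (metis abs_mult abs_triangle_ineq)
        also have "\<dots> \<le> \<bar>a\<bar> * \<epsilon> + \<bar>c\<bar> * \<epsilon>" using True by (intro add_mono mult_left_mono) auto
        also have "\<dots> \<le> m * \<epsilon>" using mult_right_mono[OF that, of \<epsilon>] \<epsilon> by (simp add: algebra_simps)
        finally show ?thesis .
      qed
      show "\<bar>x\<bar> \<le> m * \<epsilon>" "\<bar>y\<bar> \<le> m * \<epsilon>" unfolding x_def y_def using * ab by auto
    qed
    have "\<bar>G \<omega> - H \<omega>\<bar> = \<bar>\<bar>(E \<omega> + x) * (F \<omega> + y)\<bar> - \<bar>E \<omega> * F \<omega>\<bar>\<bar>"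
      by (simp add: G_def H_def J E(2) F(2) x_def y_def add.assoc)
    also have "\<dots> \<le> \<bar>(E \<omega> + x) * (F \<omega> + y) - E \<omega> * F \<omega>\<bar>" by (rule abs_triangle_ineq3)
    also have "\<dots> = \<bar>E \<omega> * y + F \<omega> * x + x * y\<bar>" by (simp add: algebra_simps)
    also have "\<dots> \<le> \<bar>E \<omega>\<bar> * \<bar>y\<bar> + \<bar>F \<omega>\<bar> * \<bar>x\<bar> + \<bar>x\<bar> * \<bar>y\<bar>"
      unfolding abs_mult[symmetric] by linarith
    also have "\<dots> \<le> \<bar>E \<omega>\<bar> * (m * \<epsilon>) + \<bar>F \<omega>\<bar> * (m * \<epsilon>) + (m * \<epsilon>) * (m * \<epsilon>)"
      using xy m0 \<epsilon> by (intro add_mono mult_mono) auto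
    also have "\<dots> = k (E \<omega>, F \<omega>) * J \<omega>" by (simp add: k_def J algebra_simps power2_eq_square)
    finally show ?thesis .
  next
    case False
    then have "J \<omega> = 0" by (auto simp: J_def)
    then show ?thesis by (simp add: G_def H_def)
  qed
  have "\<bar>expectation G - expectation H\<bar> \<le> expectation (\<lambda>\<omega>. k (E \<omega>, F \<omega>) * J \<omega>)"
  proof -
    have "\<bar>expectation G - expectation H\<bar> = \<bar>expectation (\<lambda>\<omega>. G \<omega> - H \<omega>)\<bar>" using Gi H by simp
    also have "\<dots> \<le> expectation (\<lambda>\<omega>. \<bar>G \<omega> - H \<omega>\<bar>)" by (rule integral_abs_bound)
    also have "\<dots> \<le> expectation (\<lambda>\<omega>. k (E \<omega>, F \<omega>) * J \<omega>)"
      using Gi H indJ(1)[OF km ki] diff by (intro integral_mono) auto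
    finally show ?thesis .
  qed
  also have "\<dots> = expectation (\<lambda>\<omega>. k (E \<omega>, F \<omega>)) * b" by (rule indJ(2)[OF km ki])
  also have "\<dots> \<le> (m * (2 * (1 + B)) + m\<^sup>2) * \<epsilon> * w"
    using kE bw(1) b0 k0 m0 B0 \<epsilon> by (intro mult_mono) auto
  also have "\<dots> \<le> (m * (2 * (1 + B)) + m\<^sup>2) * \<epsilon> * (4 / (2 * pi * sqrt \<kappa>) * \<epsilon>\<^sup>2)"
    using w m0 B0 \<epsilon> by (intro mult_left_mono) auto
  finally have 1: "\<bar>expectation G - h * b\<bar> \<le> (m * (2 * (1 + B)) + m\<^sup>2) * (4 / (2 * pi * sqrt \<kappa>)) * \<epsilon> ^ 3"
    unfolding H(2) by (simp only: power2_eq_square power3_eq_cube mult_ac)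
  have "h * b - h * w = h * (b - w)" by (rule right_diff_distrib[symmetric])
  then have "\<bar>h * b - h * w\<bar> = h * \<bar>b - w\<bar>" using h by (simp only: abs_mult abs_of_nonneg)
  also have "\<dots> \<le> B * (w * L * \<epsilon>)"
  proof (rule mult_mono[OF h(2) _ B0])
    show "\<bar>b - w\<bar> \<le> w * L * \<epsilon>" using bw w(1) L0 \<epsilon> by (simp only: abs_le_iff) linarith
  qed simp
  also have "\<dots> \<le> B * (4 / (2 * pi * sqrt \<kappa>) * \<epsilon>\<^sup>2 * L * \<epsilon>)"
    using \<epsilon> by (intro mult_left_mono mult_right_mono w(2) L0 B0) simp_all
  finally have 2: "\<bar>h * b - h * w\<bar> \<le> B * (4 / (2 * pi * sqrt \<kappa>) * L) * \<epsilon> ^ 3"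
    by (simp only: power2_eq_square power3_eq_cube mult_ac)
  have "\<bar>expectation G - h * w\<bar> \<le> (m * (2 * (1 + B)) + m\<^sup>2) * (4 / (2 * pi * sqrt \<kappa>)) * \<epsilon> ^ 3 + B * (4 / (2 * pi * sqrt \<kappa>) * L) * \<epsilon> ^ 3"
    using 1 2 by linarith
  also have "h * w = 4 * \<epsilon>\<^sup>2 * (h / (2 * pi * sqrt \<Delta>))" by (simp add: w_def)
  finally show ?thesis
    unfolding rice G_def[abs_def] J_def[abs_def] L_def by (simp only: distrib_right)
qed

lemma ip_segment_le:
  assumes X: "lin X x" and D: "lin D d" and \<theta>: "\<theta> \<in> {0..1}"
  shows "ip (\<lambda>l. of_real 1 * x l + of_real \<theta> * d l) (\<lambda>l. of_real 1 * x l + of_real \<theta> * d l)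
    \<le> ip x x + 2 * \<bar>ip x d\<bar> + ip d d"
proof -
  have "\<bar>\<theta> * ip x d\<bar> \<le> 1 * \<bar>ip x d\<bar>"
    unfolding abs_mult using \<theta> by (intro mult_right_mono) auto
  then have "\<theta> * ip x d \<le> \<bar>ip x d\<bar>" by linarith
  moreover have "\<theta>\<^sup>2 * ip d d \<le> 1 * ip d d"
    using \<theta> ip_nonneg by (intro mult_right_mono) (auto simp: power_le_one)
  ultimately show ?thesis unfolding ip_comb2[OF X D] by simp
qed

text \<open>The Rice formula for a pair of segments in the form of bounds. A determinant bound that
  is uniform over both segments makes the error of \<open>rice_estimate\<close> uniform in the
  parameters.\<close>

lemma sign_change_rice:
  assumes X: "lin X x" and D: "lin D d" and Y: "lin Y y" and V: "lin V v" and \<kappa>: "\<kappa> > 0"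
  defines "P \<equiv> \<lambda>\<theta> l. of_real 1 * x l + of_real \<theta> * d l" and "Q \<equiv> \<lambda>\<theta> l. of_real 1 * y l + of_real \<theta> * v l"
  assumes det: "\<And>\<theta> \<theta>'. \<theta> \<in> {0..1} \<Longrightarrow> \<theta>' \<in> {0..1} \<Longrightarrow> \<kappa> \<le> ip (P \<theta>) (P \<theta>) * ip (Q \<theta>') (Q \<theta>') - (ip (P \<theta>) (Q \<theta>'))\<^sup>2"
  defines "K \<equiv> \<lambda>\<theta> \<theta>'. rice_density (ip (P \<theta>) (P \<theta>)) (ip (P \<theta>) (Q \<theta>')) (ip (Q \<theta>') (Q \<theta>')) (ip d (P \<theta>)) (ip d (Q \<theta>'))
      (ip v (P \<theta>)) (ip v (Q \<theta>')) (ip d d) (ip d v) (ip v v)"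
    and "p \<equiv> prob {\<omega>\<in>space M. X \<omega> * (X \<omega> + D \<omega>) < 0 \<and> Y \<omega> * (Y \<omega> + V \<omega>) < 0}"
  shows "(\<And>\<theta> \<theta>'. \<theta> \<in> {0..1} \<Longrightarrow> \<theta>' \<in> {0..1} \<Longrightarrow> K \<theta> \<theta>' \<le> k) \<Longrightarrow> p \<le> k"
    and "(\<And>\<theta> \<theta>'. \<theta> \<in> {0..1} \<Longrightarrow> \<theta>' \<in> {0..1} \<Longrightarrow> k \<le> K \<theta> \<theta>') \<Longrightarrow> k \<le> p"
proof -
  note m = X[THEN lin_measurable1] D[THEN lin_measurable1] Y[THEN lin_measurable1] V[THEN lin_measurable1]
  have P: "lin (\<lambda>\<omega>. 1 * X \<omega> + \<theta> * D \<omega>) (P \<theta>)" for \<theta> unfolding P_def by (intro lin_comb X D)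
  have Q: "lin (\<lambda>\<omega>. 1 * Y \<omega> + \<theta> * V \<omega>) (Q \<theta>)" for \<theta> unfolding Q_def by (intro lin_comb Y V)
  have pos: "ip (P \<theta>) (P \<theta>) > 0 \<and> ip (Q \<theta>) (Q \<theta>) > 0" if "\<theta> \<in> {0..1}" for \<theta>
  proof -
    have "0 < ip (P \<theta>) (P \<theta>) * ip (Q \<theta>) (Q \<theta>)" using det[OF that that] \<kappa> zero_le_power2[of "ip (P \<theta>) (Q \<theta>)"] by linarith
    then show ?thesis using ip_nonneg[of "P \<theta>"] ip_nonneg[of "Q \<theta>"] by (auto simp: zero_less_mult_iff)
  qed
  \<comment> \<open>The parameters 0 and 1 are the endpoints of the segments; the positive
    determinant makes the variables there nondegenerate.\<close>
  have nz: "AE \<omega> in M. X \<omega> \<noteq> 0 \<and> X \<omega> + D \<omega> \<noteq> 0 \<and> Y \<omega> \<noteq> 0 \<and> Y \<omega> + V \<omega> \<noteq> 0"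
    using lin_ne_0[OF P[of 0], of 0] lin_ne_0[OF P[of 1], of 0] lin_ne_0[OF Q[of 0], of 0] lin_ne_0[OF Q[of 1], of 0] pos[of 0] pos[of 1]
    by simp
  define B where "B = (ip x x + 2 * \<bar>ip x d\<bar> + ip d d) + (ip y y + 2 * \<bar>ip y v\<bar> + ip v v)"
  have B: "ip (P \<theta>) (P \<theta>) \<le> B" "ip (Q \<theta>) (Q \<theta>) \<le> B" "ip d d \<le> B" "ip v v \<le> B" if "\<theta> \<in> {0..1}" for \<theta>
    using ip_segment_le[OF X D that] ip_segment_le[OF Y V that] ip_nonneg[of x] ip_nonneg[of y] ip_nonneg[of d] ip_nonneg[of v]
    unfolding P_def Q_def B_def by linarith+
  define C where "C = ((4 * B\<^sup>2 / \<kappa> * (2 * (1 + B)) + (4 * B\<^sup>2 / \<kappa>)\<^sup>2) * (4 / (2 * pi * sqrt \<kappa>)) + B * (4 / (2 * pi * sqrt \<kappa>) * (B / \<kappa> * (1 + (1 + B\<^sup>2 / \<kappa>)\<^sup>2))))"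
  have est: "\<bar>expectation (\<lambda>\<omega>. \<bar>D \<omega> * V \<omega>\<bar> * (indicat_real {y. \<bar>y\<bar> < \<epsilon>} (X \<omega> + \<theta> * D \<omega>) * indicat_real {y. \<bar>y\<bar> < \<epsilon>} (Y \<omega> + \<theta>' * V \<omega>)))
        - 4 * \<epsilon>\<^sup>2 * K \<theta> \<theta>'\<bar> \<le> C * \<epsilon>^3"
    if "0 < \<epsilon>" "\<epsilon> \<le> 1" "\<theta> \<in> {0..1}" "\<theta>' \<in> {0..1}" for \<epsilon> \<theta> \<theta>'
    using rice_estimate[OF P[of \<theta>] Q[of \<theta>'] D V B(1)[OF that(3)] B(2)[OF that(4)] B(3,4)[OF that(3)] \<kappa> det[OF that(3,4)] that(1,2)]
    unfolding K_def C_def by simp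
  show "(\<And>\<theta> \<theta>'. \<theta> \<in> {0..1} \<Longrightarrow> \<theta>' \<in> {0..1} \<Longrightarrow> K \<theta> \<theta>' \<le> k) \<Longrightarrow> p \<le> k"
    unfolding p_def by (rule sign_change_prob_bounds(1)[OF m nz lin_prod_integrable[OF D V] est])
  show "(\<And>\<theta> \<theta>'. \<theta> \<in> {0..1} \<Longrightarrow> \<theta>' \<in> {0..1} \<Longrightarrow> k \<le> K \<theta> \<theta>') \<Longrightarrow> k \<le> p"
    unfolding p_def by (rule sign_change_prob_bounds(2)[OF m nz lin_prod_integrable[OF D V] est])
qed

end

section \<open>Closed form of the absolute product moment of a Gaussian pair through
  \<open>hfun\<close>\<close>

definition hfun :: "real \<Rightarrow> real" where
  "hfun x = sqrt (1 - x\<^sup>2) + x * arcsin x"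

lemma hfun_minus: "\<bar>x\<bar> \<le> 1 \<Longrightarrow> hfun (- x) = hfun x"
  by (simp add: hfun_def arcsin_minus abs_le_iff)

text \<open>Scaling by \<open>sqrt (1 + s^2)\<close> merges the two exponentials into one standard
  normal density and leaves the third absolute moment.\<close>

lemma nn_integral_abs_cube_gauss:
  "(\<integral>\<^sup>+z. ennreal (\<bar>z\<bar>^3 * (std_normal_density z * std_normal_density (z * s))) \<partial>lborel) = ennreal (2 / pi / (1 + s\<^sup>2)\<^sup>2)"
proof -
  define k where "k = sqrt (1 + s\<^sup>2)"
  have k: "k > 0" "k\<^sup>2 = 1 + s\<^sup>2" by (auto simp: k_def add_pos_nonneg)
  have "(\<integral>\<^sup>+z. ennreal (\<bar>z\<bar>^3 * (std_normal_density z * std_normal_density (z * s))) \<partial>lborel)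
    = ennreal \<bar>1 / k\<bar> * (\<integral>\<^sup>+z. ennreal (\<bar>0 + 1 / k * z\<bar>^3 * (std_normal_density (0 + 1 / k * z) * std_normal_density ((0 + 1 / k * z) * s))) \<partial>lborel)"
    using k by (intro nn_integral_real_affine) auto
  also have "\<dots> = ennreal (1 / k) * (\<integral>\<^sup>+z. ennreal (1 / (k ^ 3 * sqrt (2 * pi))) * ennreal (std_normal_density z * \<bar>z\<bar> ^ (2 * 1 + 1)) \<partial>lborel)"
  proof -
    have "\<bar>0 + 1 / k * z\<bar>^3 * (std_normal_density (0 + 1 / k * z) * std_normal_density ((0 + 1 / k * z) * s))
      = 1 / (k ^ 3 * sqrt (2 * pi)) * (std_normal_density z * \<bar>z\<bar> ^ (2 * 1 + 1))" for z
    proof -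
      have "- (z / k)\<^sup>2 / 2 + - (z / k * s)\<^sup>2 / 2 = - ((z / k)\<^sup>2 * (1 + s\<^sup>2)) / 2"
        by (simp add: power_mult_distrib power_divide distrib_left add_divide_distrib)
      also have "\<dots> = - z\<^sup>2 / 2" using k by (simp add: power_divide flip: k(2))
      finally have "exp (- (z / k)\<^sup>2 / 2) * exp (- (z / k * s)\<^sup>2 / 2) = exp (- z\<^sup>2 / 2)"
        unfolding exp_add[symmetric] by simp
      moreover have "\<bar>z\<bar> ^ 3 = z * (z * \<bar>z\<bar>)" by (simp add: power3_eq_cube)
      ultimately show ?thesis using k by (simp add: std_normal_density_def abs_divide power_divide field_simps)
    qed
    then show ?thesis using k by (simp add: ennreal_mult[symmetric])
  qed
  also have "\<dots> = ennreal (1 / k) * (ennreal (1 / (k ^ 3 * sqrt (2 * pi))) * ennreal (2 * sqrt (2 / pi)))"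
  proof -
    have "(\<integral>\<^sup>+z. ennreal (std_normal_density z * \<bar>z\<bar> ^ (2 * 1 + 1)) \<partial>lborel) = ennreal (2 * sqrt (2 / pi))"
      using std_normal_moment_abs_odd[of 1]
      by (subst nn_integral_eq_integral) (auto simp: has_bochner_integral_iff mult.commute)
    then show ?thesis by (subst nn_integral_cmult) auto
  qed
  also have "\<dots> = ennreal (1 / k * (1 / (k ^ 3 * sqrt (2 * pi)) * (2 * sqrt (2 / pi))))"
    using k by (simp add: ennreal_mult[symmetric])
  also have "1 / k * (1 / (k ^ 3 * sqrt (2 * pi)) * (2 * sqrt (2 / pi))) = 2 / pi / (1 + s\<^sup>2)\<^sup>2"
  proof -
    have "sqrt (2 / pi) / sqrt (2 * pi) = 1 / pi"
      unfolding real_sqrt_divide[symmetric] by (simp add: real_sqrt_divide power2_eq_square[symmetric])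
    moreover have "k * k ^ 3 = (1 + s\<^sup>2)\<^sup>2" unfolding k(2)[symmetric] by (simp add: power_numeral_reduce)
    moreover have "1 / k * (1 / (k ^ 3 * sqrt (2 * pi)) * (2 * sqrt (2 / pi))) = 2 * (sqrt (2 / pi) / sqrt (2 * pi)) / (k * k ^ 3)"
      by simp
    ultimately show ?thesis by simp
  qed
  finally show ?thesis .
qed

text \<open>The range of integration is where the numerator is nonnegative. At its left end the
  primitive is evaluated with \<open>arctan (\<mu> / \<nu>) = arcsin \<mu>\<close>, which is the
  source of the arcsine in \<open>hfun\<close>.\<close>

lemma nn_integral_half:
  assumes \<mu>: "\<bar>\<mu>\<bar> < 1" and \<nu>: "\<nu> = sqrt (1 - \<mu>\<^sup>2)"
  shows "(\<integral>\<^sup>+s. ennreal ((\<mu> + \<nu> * s) / (1 + s\<^sup>2)\<^sup>2) * indicator {- \<mu> / \<nu> ..} s \<partial>lborel) = ennreal (\<mu> * pi / 4 + hfun \<mu> / 2)"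
    and "0 \<le> \<mu> * pi / 4 + hfun \<mu> / 2"
proof -
  have m2: "\<mu>\<^sup>2 < 1" using \<mu> by (simp add: abs_square_less_1)
  have n: "\<nu> > 0" "\<nu>\<^sup>2 = 1 - \<mu>\<^sup>2" using m2 \<nu> by auto
  define F where "F s = \<mu> / 2 * (s / (1 + s\<^sup>2) + arctan s) - \<nu> / (2 * (1 + s\<^sup>2))" for s
  have pos: "1 + s\<^sup>2 > 0" for s :: real by (simp add: add_pos_nonneg)
  have D: "DERIV F s :> (\<mu> + \<nu> * s) / (1 + s\<^sup>2)\<^sup>2" for s
  proof -
    have "1 + s\<^sup>2 \<noteq> 0" "1 + s * s \<noteq> 0" using pos[of s] by (auto simp: power2_eq_square)
    then show ?thesis unfolding F_def
      by (auto intro!: derivative_eq_intros) (simp_all add: divide_simps power2_eq_square, simp_all add: algebra_simps power2_eq_square)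
  qed
  have lim: "(F \<longlongrightarrow> \<mu> * pi / 4) at_top"
  proof -
    have a: "((\<lambda>s::real. s / (1 + s\<^sup>2)) \<longlongrightarrow> 0) at_top" by real_asymp
    have b: "((\<lambda>s::real. \<nu> / (2 * (1 + s\<^sup>2))) \<longlongrightarrow> 0) at_top" by real_asymp
    have "(F \<longlongrightarrow> \<mu> / 2 * (0 + pi / 2) - 0) at_top"
      unfolding F_def by (intro tendsto_intros a b tendsto_arctan_at_top)
    then show ?thesis by simp
  qed
  have F0: "F (- \<mu> / \<nu>) = - hfun \<mu> / 2"
  proof -
    have e: "1 + (- \<mu> / \<nu>)\<^sup>2 = 1 / \<nu>\<^sup>2" using n by (simp add: power_divide field_simps)
    have at: "arctan (\<mu> / \<nu>) = arcsin \<mu>" using \<mu> by (simp add: arcsin_arctan \<nu> abs_less_iff)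
    have "F (- \<mu> / \<nu>) = \<mu> / 2 * (- \<mu> / \<nu> * \<nu>\<^sup>2 - arcsin \<mu>) - \<nu> * \<nu>\<^sup>2 / 2"
      unfolding F_def e using n by (simp add: arctan_minus at)
    also have "\<dots> = - (\<nu> * (\<mu>\<^sup>2 + \<nu>\<^sup>2) + \<mu> * arcsin \<mu>) / 2" using n(1) by (simp add: power2_eq_square field_simps)
    also have "\<mu>\<^sup>2 + \<nu>\<^sup>2 = 1" using n(2) by simp
    finally show ?thesis by (simp add: hfun_def \<nu>)
  qed
  have nn: "0 \<le> (\<mu> + \<nu> * s) / (1 + s\<^sup>2)\<^sup>2" if "- \<mu> / \<nu> \<le> s" for s
    using that n by (simp add: field_simps)
  have int: "(\<integral>\<^sup>+s. ennreal ((\<mu> + \<nu> * s) / (1 + s\<^sup>2)\<^sup>2) * indicator {- \<mu> / \<nu> ..} s \<partial>lborel) = ennreal (\<mu> * pi / 4 - F (- \<mu> / \<nu>))"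
    by (rule nn_integral_FTC_atLeast[OF _ D nn lim]) auto
  then show "(\<integral>\<^sup>+s. ennreal ((\<mu> + \<nu> * s) / (1 + s\<^sup>2)\<^sup>2) * indicator {- \<mu> / \<nu> ..} s \<partial>lborel) = ennreal (\<mu> * pi / 4 + hfun \<mu> / 2)"
    unfolding F0 by simp
  have "F (- \<mu> / \<nu>) \<le> \<mu> * pi / 4"
  proof (rule tendsto_lowerbound[OF lim])
    show "\<forall>\<^sub>F s in at_top. F (- \<mu> / \<nu>) \<le> F s"
      using eventually_ge_at_top[of "- \<mu> / \<nu>"]
    proof eventually_elim
      case (elim s)
      show ?case by (rule DERIV_nonneg_imp_nondecreasing[OF elim]) (use D nn in blast)
    qed
  qed simp
  then show "0 \<le> \<mu> * pi / 4 + hfun \<mu> / 2" unfolding F0 by simp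
qed

text \<open>The absolute value is split at its zero and the negative half is reflected, which
  amounts to the sign change of \<open>\<mu>\<close>. The two contributions
  \<open>\<mu> pi / 4\<close> cancel.\<close>

lemma nn_integral_abs_affine_cauchy:
  assumes \<mu>: "\<bar>\<mu>\<bar> < 1" and \<nu>: "\<nu> = sqrt (1 - \<mu>\<^sup>2)"
  shows "(\<integral>\<^sup>+s. ennreal (\<bar>\<mu> + \<nu> * s\<bar> / (1 + s\<^sup>2)\<^sup>2) \<partial>lborel) = ennreal (hfun \<mu>)"
proof -
  have m2: "\<mu>\<^sup>2 < 1" using \<mu> by (simp add: abs_square_less_1)
  have n: "\<nu> > 0" using m2 \<nu> by auto
  let ?U = "\<lambda>\<mu> s. ennreal ((\<mu> + \<nu> * s) / (1 + s\<^sup>2)\<^sup>2) * indicator {- \<mu> / \<nu> ..} s"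
  have "(\<integral>\<^sup>+s. ennreal (\<bar>\<mu> + \<nu> * s\<bar> / (1 + s\<^sup>2)\<^sup>2) \<partial>lborel) = (\<integral>\<^sup>+s. ?U \<mu> s + ?U (- \<mu>) (0 + (-1) * s) \<partial>lborel)"
  proof (intro nn_integral_cong)
    fix s
    consider "s > - \<mu> / \<nu>" | "s = - \<mu> / \<nu>" | "s < - \<mu> / \<nu>" by linarith
    then show "ennreal (\<bar>\<mu> + \<nu> * s\<bar> / (1 + s\<^sup>2)\<^sup>2) = ?U \<mu> s + ?U (- \<mu>) (0 + (-1) * s)"
    proof cases
      case 1
      then have "\<mu> + \<nu> * s > 0" "\<not> \<mu> / \<nu> \<le> - s" using n by (auto simp: field_simps)
      then show ?thesis using 1 by (simp add: indicator_def)
    next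
      case 2
      then have "\<mu> + \<nu> * s = 0" using n by (simp add: field_simps)
      moreover have "- \<mu> + - (\<nu> * s) = - (\<mu> + \<nu> * s)" by simp
      ultimately show ?thesis by (simp add: indicator_def)
    next
      case 3
      then have "\<mu> + \<nu> * s < 0" "\<mu> / \<nu> \<le> - s" using n by (auto simp: field_simps)
      then show ?thesis using 3 by (simp add: indicator_def algebra_simps)
    qed
  qed
  also have "\<dots> = (\<integral>\<^sup>+s. ?U \<mu> s \<partial>lborel) + (\<integral>\<^sup>+s. ?U (- \<mu>) (0 + (-1) * s) \<partial>lborel)"
    by (rule nn_integral_add) auto
  also have "(\<integral>\<^sup>+s. ?U (- \<mu>) (0 + (-1) * s) \<partial>lborel) = (\<integral>\<^sup>+s. ?U (- \<mu>) s \<partial>lborel)"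
    using nn_integral_real_affine[of "?U (- \<mu>)" "-1" 0] by simp
  also have "(\<integral>\<^sup>+s. ?U \<mu> s \<partial>lborel) = ennreal (\<mu> * pi / 4 + hfun \<mu> / 2)" by (rule nn_integral_half(1)[OF \<mu> \<nu>])
  also have "(\<integral>\<^sup>+s. ?U (- \<mu>) s \<partial>lborel) = ennreal (- \<mu> * pi / 4 + hfun (- \<mu>) / 2)"
    by (rule nn_integral_half(1)) (use \<mu> \<nu> in auto)
  also have "ennreal (\<mu> * pi / 4 + hfun \<mu> / 2) + ennreal (- \<mu> * pi / 4 + hfun (- \<mu>) / 2) = ennreal (hfun \<mu>)"
    using nn_integral_half(2)[OF \<mu> \<nu>] nn_integral_half(2)[of "- \<mu>" \<nu>] \<mu> \<nu>
    by (subst ennreal_plus[symmetric]) (auto simp: hfun_minus)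
  finally show ?thesis .
qed

text \<open>In the inner integral the second coordinate is written as \<open>x s\<close>, so the
  product becomes \<open>x^2\<close> times a function of the ratio \<open>s\<close> alone. The
  substitution contributes a further factor \<open>\<bar>x\<bar>\<close>, whence the third moment;
  the remaining integral over \<open>s\<close> gives \<open>hfun\<close> of the correlation.\<close>

lemma absprod_eq:
  assumes v: "v > 0" and w: "w > 0" and c: "c\<^sup>2 < v * w"
  shows "absprod v c w = sqrt (v * w) * (2 / pi) * hfun (c / sqrt (v * w))"
proof -
  define \<mu> where "\<mu> = c / sqrt (v * w)"
  define \<nu> where "\<nu> = sqrt (1 - \<mu>\<^sup>2)"
  let ?N = std_normal_distribution
  let ?n = std_normal_density
  have m2: "\<mu>\<^sup>2 < 1" using assms by (simp add: \<mu>_def power_divide)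
  then have \<mu>: "\<bar>\<mu>\<bar> < 1" by (simp add: abs_square_less_1)
  have m2e: "\<mu>\<^sup>2 = c\<^sup>2 / (v * w)" using v w by (simp add: \<mu>_def power_divide)
  have rw: "\<bar>(sqrt v * x) * (c / sqrt v * x + sqrt (w - c\<^sup>2 / v) * y)\<bar> = sqrt (v * w) * \<bar>x * (\<mu> * x + \<nu> * y)\<bar>" for x y
  proof -
    have "w - c\<^sup>2 / v = w * (1 - \<mu>\<^sup>2)" using v w by (simp add: m2e field_simps)
    then have 1: "sqrt (w - c\<^sup>2 / v) = sqrt w * \<nu>" by (simp add: \<nu>_def real_sqrt_mult)
    have 2: "c / sqrt v = sqrt w * \<mu>" using v w by (simp add: \<mu>_def real_sqrt_mult)
    have "(sqrt v * x) * (c / sqrt v * x + sqrt (w - c\<^sup>2 / v) * y) = sqrt (v * w) * (x * (\<mu> * x + \<nu> * y))"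
      unfolding 1 2 by (simp add: real_sqrt_mult algebra_simps)
    moreover have "\<bar>sqrt (v * w)\<bar> = sqrt (v * w)" using v w by simp
    ultimately show ?thesis by (metis abs_mult)
  qed
  have "(\<integral>\<^sup>+z. ennreal \<bar>fst z * (\<mu> * fst z + \<nu> * snd z)\<bar> \<partial>(?N \<Otimes>\<^sub>M ?N)) =
     (\<integral>\<^sup>+x. \<integral>\<^sup>+y. ennreal \<bar>x * (\<mu> * x + \<nu> * y)\<bar> \<partial>?N \<partial>?N)"
    by (subst std_normal.nn_integral_fst[symmetric]) auto
  also have "\<dots> = (\<integral>\<^sup>+x. ennreal (?n x) * (\<integral>\<^sup>+y. ennreal (?n y) * ennreal \<bar>x * (\<mu> * x + \<nu> * y)\<bar> \<partial>lborel) \<partial>lborel)"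
    by (subst nn_integral_density) (auto simp: nn_integral_density)
  also have "\<dots> = (\<integral>\<^sup>+x. \<integral>\<^sup>+s. ennreal (\<bar>\<mu> + \<nu> * s\<bar>) * ennreal (\<bar>x\<bar> ^ 3 * (?n x * ?n (x * s))) \<partial>lborel \<partial>lborel)"
  proof (rule nn_integral_cong_AE)
    have "AE x in lborel. x \<noteq> (0::real)" by (rule AE_lborel_singleton)
    then show "AE x in lborel. ennreal (?n x) * (\<integral>\<^sup>+y. ennreal (?n y) * ennreal \<bar>x * (\<mu> * x + \<nu> * y)\<bar> \<partial>lborel)
       = (\<integral>\<^sup>+s. ennreal (\<bar>\<mu> + \<nu> * s\<bar>) * ennreal (\<bar>x\<bar> ^ 3 * (?n x * ?n (x * s))) \<partial>lborel)"
    proof eventually_elim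
      case (elim x)
      have "(\<integral>\<^sup>+y. ennreal (?n y) * ennreal \<bar>x * (\<mu> * x + \<nu> * y)\<bar> \<partial>lborel) =
        ennreal \<bar>x\<bar> * (\<integral>\<^sup>+s. ennreal (?n (0 + x * s)) * ennreal \<bar>x * (\<mu> * x + \<nu> * (0 + x * s))\<bar> \<partial>lborel)"
        by (rule nn_integral_real_affine) (use elim in auto)
      then have "ennreal (?n x) * (\<integral>\<^sup>+y. ennreal (?n y) * ennreal \<bar>x * (\<mu> * x + \<nu> * y)\<bar> \<partial>lborel) =
        (\<integral>\<^sup>+s. ennreal (?n x) * (ennreal \<bar>x\<bar> * (ennreal (?n (0 + x * s)) * ennreal \<bar>x * (\<mu> * x + \<nu> * (0 + x * s))\<bar>)) \<partial>lborel)"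
        by (simp add: nn_integral_cmult)
      also have "\<dots> = (\<integral>\<^sup>+s. ennreal (\<bar>\<mu> + \<nu> * s\<bar>) * ennreal (\<bar>x\<bar> ^ 3 * (?n x * ?n (x * s))) \<partial>lborel)"
      proof (intro nn_integral_cong)
        fix s
        have *: "ennreal a * (ennreal b * (ennreal c * ennreal (b * b * d))) = ennreal d * ennreal (b ^ 3 * (a * c))"
          if "a \<ge> 0" "b \<ge> 0" "c \<ge> 0" "d \<ge> 0" for a b c d
          using that by (simp add: ennreal_mult[symmetric] power3_eq_cube mult_ac)
        have "x * (\<mu> * x + \<nu> * (0 + x * s)) = x * x * (\<mu> + \<nu> * s)" by (simp add: algebra_simps)
        then have "\<bar>x * (\<mu> * x + \<nu> * (0 + x * s))\<bar> = \<bar>x\<bar> * \<bar>x\<bar> * \<bar>\<mu> + \<nu> * s\<bar>" by (simp only: abs_mult)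
        then show "ennreal (?n x) * (ennreal \<bar>x\<bar> * (ennreal (?n (0 + x * s)) * ennreal \<bar>x * (\<mu> * x + \<nu> * (0 + x * s))\<bar>))
           = ennreal (\<bar>\<mu> + \<nu> * s\<bar>) * ennreal (\<bar>x\<bar> ^ 3 * (?n x * ?n (x * s)))"
          using *[of "?n x" "\<bar>x\<bar>" "?n (x * s)" "\<bar>\<mu> + \<nu> * s\<bar>"] by simp
      qed
      finally show ?case .
    qed
  qed
  also have "\<dots> = (\<integral>\<^sup>+s. \<integral>\<^sup>+x. ennreal (\<bar>\<mu> + \<nu> * s\<bar>) * ennreal (\<bar>x\<bar> ^ 3 * (?n x * ?n (x * s))) \<partial>lborel \<partial>lborel)"
    by (rule lborel_pair.Fubini') (auto simp: split_beta')
  also have "\<dots> = (\<integral>\<^sup>+s. ennreal (2 / pi) * ennreal (\<bar>\<mu> + \<nu> * s\<bar> / (1 + s\<^sup>2)\<^sup>2) \<partial>lborel)"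
  proof (intro nn_integral_cong)
    fix s
    have "(\<integral>\<^sup>+x. ennreal (\<bar>\<mu> + \<nu> * s\<bar>) * ennreal (\<bar>x\<bar> ^ 3 * (?n x * ?n (x * s))) \<partial>lborel)
      = ennreal (\<bar>\<mu> + \<nu> * s\<bar>) * ennreal (2 / pi / (1 + s\<^sup>2)\<^sup>2)"
      by (subst nn_integral_cmult) (auto simp: nn_integral_abs_cube_gauss)
    then show "(\<integral>\<^sup>+x. ennreal (\<bar>\<mu> + \<nu> * s\<bar>) * ennreal (\<bar>x\<bar> ^ 3 * (?n x * ?n (x * s))) \<partial>lborel)
      = ennreal (2 / pi) * ennreal (\<bar>\<mu> + \<nu> * s\<bar> / (1 + s\<^sup>2)\<^sup>2)"
      by (simp add: ennreal_mult[symmetric])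
  qed
  also have "\<dots> = ennreal (2 / pi) * ennreal (hfun \<mu>)"
    by (subst nn_integral_cmult) (auto simp: nn_integral_abs_affine_cauchy[OF \<mu> \<nu>_def])
  finally have nn: "(\<integral>\<^sup>+z. ennreal \<bar>fst z * (\<mu> * fst z + \<nu> * snd z)\<bar> \<partial>(?N \<Otimes>\<^sub>M ?N)) = ennreal (2 / pi) * ennreal (hfun \<mu>)" .
  have h0: "hfun \<mu> \<ge> 0"
  proof -
    have "0 \<le> (- \<mu>) * pi / 4 + hfun (- \<mu>) / 2" using \<mu> \<nu>_def by (intro nn_integral_half(2)[of _ \<nu>]) auto
    moreover have "hfun (- \<mu>) = hfun \<mu>" using \<mu> by (simp add: hfun_minus)
    ultimately show ?thesis using nn_integral_half(2)[OF \<mu> \<nu>_def] by linarith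
  qed
  have "(LINT z|(?N \<Otimes>\<^sub>M ?N). \<bar>fst z * (\<mu> * fst z + \<nu> * snd z)\<bar>) = 2 / pi * hfun \<mu>"
    by (subst integral_eq_nn_integral) (use h0 in \<open>auto simp: nn ennreal_mult[symmetric]\<close>)
  then show ?thesis unfolding absprod_def rw by (simp add: \<mu>_def)
qed

section \<open>The covariance function\<close>

text \<open>The mean value inequality turns the bound on the derivative into a majorant for all
  difference quotients, so dominated convergence applies.\<close>

lemma has_real_derivative_integral:
  fixes g g' :: "'b \<Rightarrow> real \<Rightarrow> real"
  assumes [measurable]: "\<And>t. (\<lambda>l. g l t) \<in> borel_measurable N" "(\<lambda>l. g' l t) \<in> borel_measurable N"
    and int: "\<And>t. integrable N (\<lambda>l. g l t)" and w: "integrable N w"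
    and der: "\<And>l s. (g l has_real_derivative g' l s) (at s)"
    and bound: "\<And>l s. \<bar>g' l s\<bar> \<le> w l"
  shows "((\<lambda>t. LINT l|N. g l t) has_real_derivative (LINT l|N. g' l t)) (at t)"
  unfolding DERIV_def tendsto_at_iff_sequentially comp_def
proof (intro allI impI)
  fix X :: "nat \<Rightarrow> real" assume X: "\<forall>i. X i \<in> UNIV - {0}" "X \<longlonglongrightarrow> 0"
  have eq: "((LINT l|N. g l (t + X i)) - (LINT l|N. g l t)) / X i = (LINT l|N. (g l (t + X i) - g l t) / X i)" for i
    using int by simp
  show "(\<lambda>i. ((LINT l|N. g l (t + X i)) - (LINT l|N. g l t)) / X i) \<longlonglongrightarrow> (LINT l|N. g' l t)"
    unfolding eq
  proof (rule integral_dominated_convergence[where w=w])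
    show "AE l in N. (\<lambda>i. (g l (t + X i) - g l t) / X i) \<longlonglongrightarrow> g' l t"
      using der[of _ t] X unfolding DERIV_def tendsto_at_iff_sequentially comp_def by auto
    show "AE l in N. norm ((g l (t + X i) - g l t) / X i) \<le> w l" for i
    proof (intro AE_I2)
      fix l
      have X0: "X i \<noteq> 0" using X(1) by auto
      have "norm (g l (t + X i) - g l t) \<le> w l * norm (t + X i - t)"
        by (rule field_differentiable_bound[of UNIV "g l" "g' l"])
           (use der bound in \<open>auto intro: has_field_derivative_at_within\<close>)
      then show "norm ((g l (t + X i) - g l t) / X i) \<le> w l" using X0 by (simp add: field_simps)
    qed
  qed (use w in auto)
qed

context gaussian_zeros
begin

definition r1 :: "real \<Rightarrow> real" where "r1 t = - (LINT l|\<rho>. l * sin (l * t))"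
definition r2 :: "real \<Rightarrow> real" where "r2 t = - (LINT l|\<rho>. l\<^sup>2 * cos (l * t))"

lemma R_UNIV[simp]: "R.prob UNIV = 1"
  using R.prob_space by simp

lemma l2_integrable: "integrable \<rho> (\<lambda>l. l\<^sup>2)"
proof (rule Bochner_Integration.integrable_bound)
  show "integrable \<rho> (\<lambda>l. 4 + ln (1 + \<bar>l\<bar>) * l\<^sup>2)" using geman by simp
  \<comment> \<open>For \<open>\<bar>l\<bar> \<le> 2\<close> the 4 suffices; beyond that the
    logarithm is at least 1, because \<open>exp 1 \<le> 3\<close>.\<close>
  have "l\<^sup>2 \<le> 4 + ln (1 + \<bar>l\<bar>) * l\<^sup>2" for l :: real
  proof (cases "\<bar>l\<bar> \<le> 2")
    case True
    then have "l\<^sup>2 \<le> 2\<^sup>2" using abs_le_square_iff[of l 2] by simp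
    moreover have "0 \<le> ln (1 + \<bar>l\<bar>) * l\<^sup>2" by (intro mult_nonneg_nonneg) auto
    ultimately show ?thesis unfolding power2_eq_square by linarith
  next
    case False
    have "exp 1 \<le> 1 + \<bar>l\<bar>" using False exp_le by linarith
    then have "1 \<le> ln (1 + \<bar>l\<bar>)" using ln_ge_iff[of "1 + \<bar>l\<bar>" 1] by linarith
    then show ?thesis using mult_right_mono[of 1 "ln (1 + \<bar>l\<bar>)" "l\<^sup>2"] by simp
  qed
  then show "AE l in \<rho>. norm (l\<^sup>2) \<le> norm (4 + ln (1 + \<bar>l\<bar>) * l\<^sup>2)" by (intro AE_I2) (simp add: add_nonneg_nonneg)
qed simp

lemma l1_integrable: "integrable \<rho> (\<lambda>l. \<bar>l\<bar>)"
proof (rule Bochner_Integration.integrable_bound)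
  show "integrable \<rho> (\<lambda>l. 1 + l\<^sup>2)" using l2_integrable by simp
  have "\<bar>x\<bar> \<le> 1 + x\<^sup>2" for x :: real
    using sum_squares_bound[of "\<bar>x\<bar>" 1] by simp
  then show "AE l in \<rho>. norm \<bar>l\<bar> \<le> norm (1 + l\<^sup>2)" by simp
qed simp

lemma cos_integrable: "integrable \<rho> (\<lambda>l. cos (l * t))"
  by (rule R.bounded_integrable[where B=1]) auto

lemma l_sin_integrable: "integrable \<rho> (\<lambda>l. l * sin (l * t))"
proof (rule Bochner_Integration.integrable_bound[OF l1_integrable])
  show "AE l in \<rho>. norm (l * sin (l * t)) \<le> norm \<bar>l\<bar>"
    by (auto simp: abs_mult intro!: mult_left_le)
qed simp

lemma l2_cos_integrable: "integrable \<rho> (\<lambda>l. l\<^sup>2 * cos (l * t))"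
proof (rule Bochner_Integration.integrable_bound[OF l2_integrable])
  show "AE l in \<rho>. norm (l\<^sup>2 * cos (l * t)) \<le> norm (l\<^sup>2)"
    by (auto simp: abs_mult intro!: mult_left_le)
qed simp

lemma r_has_derivative: "(r has_real_derivative r1 t) (at t)"
proof -
  have "((\<lambda>t. LINT l|\<rho>. cos (l * t)) has_real_derivative (LINT l|\<rho>. - (l * sin (l * t)))) (at t)"
  proof (rule has_real_derivative_integral[OF _ _ cos_integrable l1_integrable])
    show "((\<lambda>t. cos (l * t)) has_real_derivative - (l * sin (l * s))) (at s)" for l s
      by (auto intro!: derivative_eq_intros)
    show "\<bar>- (l * sin (l * s))\<bar> \<le> \<bar>l\<bar>" for l s :: real
      by (auto simp: abs_mult intro!: mult_left_le)
  qed auto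
  then show ?thesis by (simp add: r_eq[abs_def] r1_def)
qed

lemma r1_has_derivative: "(r1 has_real_derivative r2 t) (at t)"
proof -
  have "((\<lambda>t. LINT l|\<rho>. l * sin (l * t)) has_real_derivative (LINT l|\<rho>. l\<^sup>2 * cos (l * t))) (at t)"
  proof (rule has_real_derivative_integral[OF _ _ l_sin_integrable l2_integrable])
    show "((\<lambda>t. l * sin (l * t)) has_real_derivative (l\<^sup>2 * cos (l * s))) (at s)" for l s
      by (auto intro!: derivative_eq_intros simp: power2_eq_square)
    show "\<bar>l\<^sup>2 * cos (l * s)\<bar> \<le> l\<^sup>2" for l s :: real
      by (auto simp: abs_mult intro!: mult_left_le)
  qed auto
  from DERIV_minus[OF this] show ?thesis by (simp add: r1_def[abs_def] r2_def)
qed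

lemma deriv_r: "deriv r = r1"
  using r_has_derivative by (intro ext DERIV_imp_deriv)

lemma deriv_deriv_r: "deriv (deriv r) = r2"
  unfolding deriv_r using r1_has_derivative by (intro ext DERIV_imp_deriv)

lemma isCont_r2: "isCont r2 t"
  unfolding continuous_at_sequentially comp_def
proof (intro allI impI)
  fix X assume X: "X \<longlonglongrightarrow> t"
  have "(\<lambda>i. LINT l|\<rho>. l\<^sup>2 * cos (l * X i)) \<longlonglongrightarrow> (LINT l|\<rho>. l\<^sup>2 * cos (l * t))"
  proof (rule integral_dominated_convergence[where w="\<lambda>l. l\<^sup>2"])
    show "AE l in \<rho>. (\<lambda>i. l\<^sup>2 * cos (l * X i)) \<longlonglongrightarrow> l\<^sup>2 * cos (l * t)"
      by (intro AE_I2 tendsto_intros X)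
    show "AE l in \<rho>. norm (l\<^sup>2 * cos (l * X i)) \<le> l\<^sup>2" for i
      by (auto simp: abs_mult intro!: mult_left_le)
  qed (use l2_integrable in auto)
  then show "(\<lambda>i. r2 (X i)) \<longlonglongrightarrow> r2 t" unfolding r2_def by (rule tendsto_minus)
qed

lemma r_minus: "r (- t) = r t" by (simp add: r_eq)
lemma r2_minus: "r2 (- t) = r2 t" by (simp add: r2_def)

lemma abs_r_le: "\<bar>r t\<bar> \<le> 1"
proof -
  have "\<bar>r t\<bar> \<le> (LINT l|\<rho>. \<bar>cos (l * t)\<bar>)" unfolding r_eq by (rule integral_abs_bound)
  also have "\<dots> \<le> (LINT l|\<rho>. 1)" by (intro integral_mono integrable_abs cos_integrable) auto
  finally show ?thesis by (simp add: R.prob_space)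
qed

lemma abs_r2_le: "\<bar>r2 t\<bar> \<le> \<sigma>\<^sup>2"
proof -
  have "\<bar>r2 t\<bar> \<le> (LINT l|\<rho>. \<bar>l\<^sup>2 * cos (l * t)\<bar>)" unfolding r2_def abs_minus by (rule integral_abs_bound)
  also have "\<dots> \<le> (LINT l|\<rho>. l\<^sup>2)"
    by (intro integral_mono integrable_abs l2_cos_integrable l2_integrable) (auto simp: abs_mult intro!: mult_left_le)
  finally show ?thesis by (simp add: sigma_def)
qed

text \<open>From \<open>1 - cos (2 x) = 2 (1 - cos x) (1 + cos x)\<close> either factor can be
  estimated by 2. Using both versions gives the absolute value, so the values 1 and -1 of
  \<open>r\<close> are handled together.\<close>

lemma one_minus_r_double: "1 - r (2 * t) \<le> 4 * (1 - \<bar>r t\<bar>)"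
proof -
  have *: "1 - cos (l * (2 * t)) \<le> 4 * (1 - cos (l * t))" "1 - cos (l * (2 * t)) \<le> 4 * (1 + cos (l * t))" for l
  proof -
    have e: "cos (l * (2 * t)) = 2 * (cos (l * t))\<^sup>2 - 1" using cos_double_cos[of "l * t"] by (simp add: mult_ac)
    have "0 \<le> 2 * (1 - cos (l * t))\<^sup>2" "0 \<le> 2 * (1 + cos (l * t))\<^sup>2" by auto
    then show "1 - cos (l * (2 * t)) \<le> 4 * (1 - cos (l * t))" "1 - cos (l * (2 * t)) \<le> 4 * (1 + cos (l * t))"
      unfolding e by (auto simp: power2_eq_square algebra_simps)
  qed
  have "(LINT l|\<rho>. 1 - cos (l * (2 * t))) \<le> (LINT l|\<rho>. 4 * (1 - cos (l * t)))"
    "(LINT l|\<rho>. 1 - cos (l * (2 * t))) \<le> (LINT l|\<rho>. 4 * (1 + cos (l * t)))"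
    using cos_integrable[of t] cos_integrable[of "2 * t"] * by (intro integral_mono; auto)+
  then show ?thesis
    using cos_integrable[of t] cos_integrable[of "2 * t"] by (simp add: r_eq R.prob_space abs_if)
qed

text \<open>A value of modulus one would reproduce itself along the times \<open>2^n t\<close>,
  contrary to the decay of \<open>r\<close>.\<close>

lemma abs_r_less_1:
  assumes "t > 0" shows "\<bar>r t\<bar> < 1"
proof (rule ccontr)
  assume "\<not> \<bar>r t\<bar> < 1"
  then have r1: "\<bar>r t\<bar> = 1" using abs_r_le[of t] by simp
  have pow: "\<bar>r (2 ^ n * t)\<bar> = 1" for n
  proof (induction n)
    case (Suc n)
    then have "1 \<le> r (2 * (2 ^ n * t))" using one_minus_r_double[of "2 ^ n * t"] by simp
    then show ?case using abs_r_le[of "2 * (2 ^ n * t)"] by (simp add: mult.assoc)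
  qed (use r1 in simp)
  have "filterlim (\<lambda>n. 2 ^ n * t) at_infinity sequentially"
    using assms by real_asymp
  from filterlim_compose[OF r_lim this] have "(\<lambda>n. \<bar>r (2 ^ n * t)\<bar>) \<longlonglongrightarrow> \<bar>0\<bar>" by (rule tendsto_rabs)
  then show False unfolding pow by (simp add: LIMSEQ_const_iff)
qed

text \<open>Decay settles large lags, and compactness with \<open>abs_r_less_1\<close> the
  rest.\<close>

lemma abs_r_bound_away:
  assumes "a > 0"
  obtains b where "b < 1" "b > 0" "\<And>t. t \<ge> a \<Longrightarrow> \<bar>r t\<bar> \<le> b"
proof -
  have "eventually (\<lambda>t. \<bar>r t\<bar> < 1/2) at_infinity"
    using order_tendstoD(2)[OF tendsto_rabs[OF r_lim], of "1/2"] by simp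
  then obtain T where T: "\<And>t. \<bar>t\<bar> \<ge> T \<Longrightarrow> \<bar>r t\<bar> < 1/2" by (auto simp: eventually_at_infinity)
  have "continuous_on {a..max a T} (\<lambda>t. \<bar>r t\<bar>)"
    using r_has_derivative by (intro continuous_intros DERIV_continuous_on) (auto intro: has_field_derivative_at_within)
  then obtain s where s: "s \<in> {a..max a T}" "\<And>t. t \<in> {a..max a T} \<Longrightarrow> \<bar>r t\<bar> \<le> \<bar>r s\<bar>"
    using continuous_attains_sup[of "{a..max a T}" "\<lambda>t. \<bar>r t\<bar>"] by auto
  have "s > 0" using s assms by auto
  show ?thesis
  proof (rule that[of "max (1/2) \<bar>r s\<bar>"])
    show "max (1/2) \<bar>r s\<bar> < 1" using abs_r_less_1[OF \<open>s > 0\<close>] by simp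
    show "\<bar>r t\<bar> \<le> max (1/2) \<bar>r s\<bar>" if "t \<ge> a" for t
    proof (cases "t \<le> max a T")
      case True
      then show ?thesis using s(2)[of t] that by auto
    next
      case False
      then have "\<bar>r t\<bar> < 1/2" using that assms by (intro T) auto
      then show ?thesis by linarith
    qed
  qed simp
qed

end

section \<open>Sign changes over short intervals\<close>

lemma std_normal_abs_moment:
  "integrable std_normal_distribution (\<lambda>z. \<bar>z\<bar> ^ (2 * k + 1))"
  "(LINT z|std_normal_distribution. \<bar>z\<bar> ^ (2 * k + 1)) = sqrt (2 / pi) * 2 ^ k * fact k"
  using std_normal_moment_abs_odd[of k]
  by (auto simp: has_bochner_integral_iff integrable_density integral_density)

text \<open>Mean and half difference of two values of equal variance are uncorrelated. In these
  coordinates a sign change is a strip condition on the mean, given the half difference.\<close>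

lemma sign_change_iff_abs:
  fixes a b u :: real
  assumes "a \<noteq> u" "b \<noteq> u"
  shows "((a < u) \<noteq> (b < u)) \<longleftrightarrow> \<bar>(a + b) / 2 - u\<bar> < \<bar>(b - a) / 2\<bar>"
  using assms by (auto simp: abs_if field_simps)

context gaussian_zeros
begin

definition chg :: "real \<Rightarrow> real \<Rightarrow> real \<Rightarrow> 'a set" where
  "chg u s \<delta> = {\<omega> \<in> space M. (f s \<omega> < u) \<noteq> (f (s + \<delta>) \<omega> < u)}"

lemma chg_sets[measurable]: "chg u s \<delta> \<in> events"
  unfolding chg_def by measurable

lemma ip_cis: "ip (\<lambda>l. cis (l * s)) (\<lambda>l. cis (l * t)) = r (s - t)"
  unfolding ip_def r_eq by (simp add: cos_diff algebra_simps)

lemma f_ne: "AE \<omega> in M. f t \<omega> \<noteq> u"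
  by (rule lin_ne_0[OF lin_base]) (simp add: ip_cis r0)

lemma ip_shift: "ip (\<lambda>l. cis (l * s) * \<phi> l) (\<lambda>l. cis (l * s) * \<psi> l) = ip \<phi> \<psi>"
proof -
  have "(cis x * a) * cnj (cis x * b) = a * cnj b" for x a b
  proof -
    have "cis x * cnj (cis x) = 1" by (simp add: cis_cnj cis_mult)
    then show ?thesis by (simp add: mult_ac)
  qed
  then show ?thesis unfolding ip_def by (simp only:)
qed

text \<open>A time shift multiplies all spectral functions by the same unimodular factor, which
  drops out of \<open>ip\<close>; hence all linear combinations keep their characteristic
  functions.\<close>

lemma law_shift:
  "distr M borel (\<lambda>\<omega>. ((f (s + t1) \<omega>, f (s + t2) \<omega>), (f (s + t3) \<omega>, f (s + t4) \<omega>)))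
   = distr M borel (\<lambda>\<omega>. ((f t1 \<omega>, f t2 \<omega>), (f t3 \<omega>, f t4 \<omega>)))"
proof -
  have m: "(\<lambda>\<omega>. ((f u1 \<omega>, f u2 \<omega>), (f u3 \<omega>, f u4 \<omega>))) \<in> borel_measurable M" for u1 u2 u3 u4
    by (simp add: borel_prod[symmetric])
  define S where "S a b c d u1 u2 u3 u4 \<omega> = 1 * (a * f u1 \<omega> + b * f u2 \<omega>) + 1 * (c * f u3 \<omega> + d * f u4 \<omega>)"
    for a b c d u1 u2 u3 u4 :: real and \<omega>
  define \<phi> where "\<phi> a b c d u1 u2 u3 u4 l = of_real 1 * (of_real a * cis (l * u1) + of_real b * cis (l * u2)) +
     of_real 1 * (of_real c * cis (l * u3) + of_real d * cis (l * u4))" for a b c d u1 u2 u3 u4 :: real and l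
  have L: "lin (S a b c d u1 u2 u3 u4) (\<phi> a b c d u1 u2 u3 u4)" for a b c d u1 u2 u3 u4
    unfolding S_def \<phi>_def by (intro lin_comb lin_base)
  have "\<phi> a b c d (s + t1) (s + t2) (s + t3) (s + t4) = (\<lambda>l. cis (l * s) * \<phi> a b c d t1 t2 t3 t4 l)" for a b c d
    by (rule ext) (simp add: \<phi>_def distrib_left cis_mult[symmetric] mult_ac)
  then have q: "ip (\<phi> a b c d (s + t1) (s + t2) (s + t3) (s + t4)) (\<phi> a b c d (s + t1) (s + t2) (s + t3) (s + t4))
     = ip (\<phi> a b c d t1 t2 t3 t4) (\<phi> a b c d t1 t2 t3 t4)" for a b c d
    by (simp only: ip_shift)
  have e: "((a, b), (c, d)) \<bullet> ((f u1 \<omega>, f u2 \<omega>), (f u3 \<omega>, f u4 \<omega>)) = S a b c d u1 u2 u3 u4 \<omega>" for a b c d u1 u2 u3 u4 \<omega>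
    by (simp add: S_def)
  have C: "(\<lambda>x. cos (w \<bullet> x)) \<in> borel_measurable borel" "(\<lambda>x. sin (w \<bullet> x)) \<in> borel_measurable borel" for w :: "(real \<times> real) \<times> (real \<times> real)"
    by measurable
  show ?thesis
  proof (rule Cramer_Wold)
    fix w :: "(real \<times> real) \<times> (real \<times> real)"
    obtain a b c d where w: "w = ((a, b), (c, d))" by (metis surj_pair)
    show "(LINT x|distr M borel (\<lambda>\<omega>. ((f (s + t1) \<omega>, f (s + t2) \<omega>), (f (s + t3) \<omega>, f (s + t4) \<omega>))). cos (w \<bullet> x))
      = (LINT x|distr M borel (\<lambda>\<omega>. ((f t1 \<omega>, f t2 \<omega>), (f t3 \<omega>, f t4 \<omega>))). cos (w \<bullet> x))"
      unfolding integral_distr[OF m C(1)] w e lin_cos_sin(1)[OF L] q ..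
    show "(LINT x|distr M borel (\<lambda>\<omega>. ((f (s + t1) \<omega>, f (s + t2) \<omega>), (f (s + t3) \<omega>, f (s + t4) \<omega>))). sin (w \<bullet> x))
      = (LINT x|distr M borel (\<lambda>\<omega>. ((f t1 \<omega>, f t2 \<omega>), (f t3 \<omega>, f t4 \<omega>))). sin (w \<bullet> x))"
      unfolding integral_distr[OF m C(2)] w e lin_cos_sin(2)[OF L] q ..
  qed (use m in \<open>auto intro!: prob_space_distr\<close>)
qed

lemma prob_chg_shift: "prob (chg u s \<delta> \<inter> chg u (s + t) \<delta>) = prob (chg u 0 \<delta> \<inter> chg u t \<delta>)"
proof -
  have m: "(\<lambda>\<omega>. ((f u1 \<omega>, f u2 \<omega>), (f u3 \<omega>, f u4 \<omega>))) \<in> borel_measurable M" for u1 u2 u3 u4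
    by (simp add: borel_prod[symmetric])
  let ?B = "{z :: (real \<times> real) \<times> (real \<times> real). (fst (fst z) < u) \<noteq> (snd (fst z) < u) \<and> (fst (snd z) < u) \<noteq> (snd (snd z) < u)}"
  have B: "?B \<in> sets borel"
  proof -
    have "{z \<in> space ((borel \<Otimes>\<^sub>M borel) \<Otimes>\<^sub>M (borel \<Otimes>\<^sub>M borel)). (fst (fst z) < u) \<noteq> (snd (fst z) < u) \<and> (fst (snd z) < u) \<noteq> (snd (snd z) < u)}
       \<in> sets ((borel \<Otimes>\<^sub>M borel) \<Otimes>\<^sub>M (borel \<Otimes>\<^sub>M borel) :: ((real \<times> real) \<times> (real \<times> real)) measure)"
      by measurable
    then show ?thesis unfolding borel_prod by simp
  qed
  have e: "prob (chg u v \<delta> \<inter> chg u w \<delta>) = measure (distr M borel (\<lambda>\<omega>. ((f v \<omega>, f (v + \<delta>) \<omega>), (f w \<omega>, f (w + \<delta>) \<omega>)))) ?B" for v w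
    unfolding measure_distr[OF m B] by (rule arg_cong[where f=prob]) (auto simp: chg_def)
  show ?thesis
    using law_shift[of s 0 \<delta> t "t + \<delta>"] unfolding e by (simp add: add.assoc)
qed

lemma prob_chg_shift1: "prob (chg u s \<delta>) = prob (chg u 0 \<delta>)"
  using prob_chg_shift[of u s \<delta> 0] by simp

text \<open>The standard deviation of the half difference of two values at distance
  \<open>\<delta>\<close>, divided by that of their mean.\<close>

definition ratio :: "real \<Rightarrow> real" where
  "ratio \<delta> = sqrt ((1 - r \<delta>) / 2) / sqrt ((1 + r \<delta>) / 2)"

text \<open>Conditionally on the half difference, the event is a strip for an independent Gaussian
  mean, so \<open>std_normal_strip\<close> applies; the bounds are then averaged with the first and
  third absolute moments. The upper bound does not see the level, because the normal density is
  largest at its centre. It is this uniformity in \<open>u\<close> that later excludes tangential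
  zeros.\<close>

lemma prob_chg_bounds:
  assumes "\<delta> > 0"
  shows "prob (chg u 0 \<delta>) \<le> 2 / pi * ratio \<delta>"
    and "2 / pi * (ratio \<delta> - ratio \<delta> ^ 3) \<le> prob (chg 0 0 \<delta>)"
proof -
  let ?N = std_normal_distribution
  define a c where "a = sqrt ((1 + r \<delta>) / 2)" and "c = sqrt ((1 - r \<delta>) / 2)"
  have a: "a > 0" and c: "c > 0" using abs_r_less_1[OF assms] by (auto simp: a_def c_def abs_less_iff)
  have k: "ratio \<delta> = c / a" by (simp add: ratio_def a_def c_def)
  have q2: "a\<^sup>2 = (1 + r \<delta>) / 2" "c\<^sup>2 = (1 - r \<delta>) / 2" using abs_r_less_1[OF assms] by (auto simp: a_def c_def abs_less_iff)
  define S where "S \<omega> = 1/2 * f 0 \<omega> + 1/2 * f \<delta> \<omega>" for \<omega>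
  define H where "H \<omega> = (- 1/2) * f 0 \<omega> + 1/2 * f \<delta> \<omega>" for \<omega>
  define \<phi>0 \<phi>1 :: "real \<Rightarrow> complex" where "\<phi>0 = (\<lambda>l. cis (l * 0))" and "\<phi>1 = (\<lambda>l. cis (l * \<delta>))"
  have b: "lin (f 0) \<phi>0" "lin (f \<delta>) \<phi>1" unfolding \<phi>0_def \<phi>1_def by (rule lin_base)+
  define s h where "s l = of_real (1/2) * \<phi>0 l + of_real (1/2) * \<phi>1 l" and "h l = of_real (-1/2) * \<phi>0 l + of_real (1/2) * \<phi>1 l" for l
  have L: "lin S s" "lin H h" unfolding S_def[abs_def] s_def[abs_def] H_def[abs_def] h_def[abs_def] by (intro lin_comb b)+
  have g: "ip \<phi>0 \<phi>0 = 1" "ip \<phi>1 \<phi>1 = 1" "ip \<phi>0 \<phi>1 = r \<delta>" "ip \<phi>1 \<phi>0 = r \<delta>"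
    unfolding \<phi>0_def \<phi>1_def ip_cis by (simp_all add: r0 r_minus)
  have hh: "ip h h = c\<^sup>2" unfolding h_def[abs_def] ip_comb2[OF b] g q2 by (simp add: power2_eq_square field_simps)
  have ss: "ip s s = 0\<^sup>2 + a\<^sup>2" unfolding s_def[abs_def] ip_comb2[OF b] g q2 by (simp add: power2_eq_square field_simps)
  have sh: "ip h s = c * 0"
    unfolding h_def[abs_def] ip_comb_left[OF b L(1)] unfolding s_def[abs_def] ip_comb_right[OF b b(1)] ip_comb_right[OF b b(2)] g by simp
  have law: "distr M borel (\<lambda>\<omega>. (H \<omega>, S \<omega>)) = distr (?N \<Otimes>\<^sub>M ?N) borel (\<lambda>z. (c * fst z, 0 * fst z + a * snd z))"
    by (rule law_pair[OF L(2,1) hh sh ss])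
  note [measurable] = L[THEN lin_measurable1]
  have m1: "(\<lambda>\<omega>. (H \<omega>, S \<omega>)) \<in> borel_measurable M" by (simp add: borel_prod[symmetric])
  have m2: "(\<lambda>z. (c * fst z, 0 * fst z + a * snd z)) \<in> borel_measurable (?N \<Otimes>\<^sub>M ?N)" by (simp add: borel_prod[symmetric])
  let ?B = "\<lambda>u. {z :: real \<times> real. \<bar>snd z - u\<bar> < \<bar>fst z\<bar>}"
  have B: "?B u \<in> sets borel" for u
    by (intro borel_open open_Collect_less continuous_intros)
  have G: "(\<integral>\<^sup>+x. emeasure ?N {y. \<bar>- u + a * y\<bar> < \<bar>c * x\<bar>} \<partial>?N) = ennreal (prob (chg u 0 \<delta>))" for u
  proof -
    have "prob (chg u 0 \<delta>) = prob ((\<lambda>\<omega>. (H \<omega>, S \<omega>)) -` ?B u \<inter> space M)"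
    proof (rule measure_eq_AE)
      show "AE \<omega> in M. \<omega> \<in> chg u 0 \<delta> \<longleftrightarrow> \<omega> \<in> (\<lambda>\<omega>. (H \<omega>, S \<omega>)) -` ?B u \<inter> space M"
        using f_ne[of 0 u] f_ne[of \<delta> u]
      proof eventually_elim
        case (elim \<omega>)
        then show ?case using sign_change_iff_abs[OF elim]
          by (auto simp: chg_def S_def H_def add_divide_distrib diff_divide_distrib)
      qed
    qed (use B m1 in \<open>auto intro: measurable_sets\<close>)
    also have "\<dots> = measure (distr M borel (\<lambda>\<omega>. (H \<omega>, S \<omega>))) (?B u)" by (rule measure_distr[OF m1 B, symmetric])
    also have "\<dots> = measure (?N \<Otimes>\<^sub>M ?N) ((\<lambda>z. (c * fst z, 0 * fst z + a * snd z)) -` ?B u \<inter> space (?N \<Otimes>\<^sub>M ?N))"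
      unfolding law by (rule measure_distr[OF m2 B])
    finally have p: "prob (chg u 0 \<delta>) = measure (?N \<Otimes>\<^sub>M ?N) ((\<lambda>z. (c * fst z, 0 * fst z + a * snd z)) -` ?B u \<inter> space (?N \<Otimes>\<^sub>M ?N))" .
    interpret NN: pair_prob_space ?N ?N ..
    have "(\<lambda>z. (c * fst z, 0 * fst z + a * snd z)) -` ?B u \<inter> space (?N \<Otimes>\<^sub>M ?N) \<in> sets (?N \<Otimes>\<^sub>M ?N)"
      by (rule measurable_sets[OF m2 B])
    from std_normal.emeasure_pair_measure_alt[OF this] show ?thesis
      unfolding p NN.emeasure_eq_measure[symmetric] by (simp add: vimage_def space_pair_measure)
  qed
  have strip1: "measure ?N {y. \<bar>- u + a * y\<bar> < \<bar>c * x\<bar>} \<le> 2 / a / sqrt (2 * pi) * c * \<bar>x\<bar>" for u x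
  proof (cases "x = 0")
    case False
    then show ?thesis using std_normal_strip(1)[OF a, of "\<bar>c * x\<bar>" "-u"] c by (simp add: abs_mult mult_ac)
  qed simp
  have strip2: "2 / a / sqrt (2 * pi) * c * (\<bar>x\<bar> - (c / a)\<^sup>2 / 2 * \<bar>x\<bar> ^ 3) \<le> measure ?N {y. \<bar>- 0 + a * y\<bar> < \<bar>c * x\<bar>}" for x
  proof (cases "x = 0")
    case False
    have eq: "2 / a / sqrt (2 * pi) * c * (\<bar>x\<bar> - (c / a)\<^sup>2 / 2 * \<bar>x\<bar> ^ 3) =
      2 * \<bar>c * x\<bar> / a / sqrt (2 * pi) * (1 - ((\<bar>c * x\<bar> + \<bar>- 0\<bar>) / a)\<^sup>2 / 2)"
      using c by (simp add: abs_mult power_mult_distrib power_divide right_diff_distrib diff_divide_distrib power3_eq_cube power2_eq_square mult_ac)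
    show ?thesis unfolding eq using c False by (intro std_normal_strip(2)[OF a]) auto
  qed simp
  note mom = std_normal_abs_moment[of 0] std_normal_abs_moment[of 1]
  have i1: "integrable ?N (\<lambda>z. \<bar>z\<bar>)" "(LINT z|?N. \<bar>z\<bar>) = sqrt (2 / pi)" using mom(1,2) by simp_all
  have i3: "integrable ?N (\<lambda>z. \<bar>z\<bar> ^ 3)" "(LINT z|?N. \<bar>z\<bar> ^ 3) = 2 * sqrt (2 / pi)" using mom(3,4) by (simp_all add: numeral_3_eq_3)
  have sp: "sqrt (2 / pi) / sqrt (2 * pi) = 1 / pi"
    unfolding real_sqrt_divide[symmetric] by (simp add: real_sqrt_divide power2_eq_square[symmetric])
  have cst: "2 / a / sqrt (2 * pi) * c * sqrt (2 / pi) = 2 / pi * (c / a)"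
  proof -
    have "2 / a / sqrt (2 * pi) * c * sqrt (2 / pi) = 2 * (c / a) * (sqrt (2 / pi) / sqrt (2 * pi))" by simp
    then show ?thesis unfolding sp by simp
  qed
  have ab: "integrable ?N (\<lambda>x. measure ?N {y. \<bar>- u + a * y\<bar> < \<bar>c * x\<bar>})"
    "(LINT x|?N. measure ?N {y. \<bar>- u + a * y\<bar> < \<bar>c * x\<bar>}) = prob (chg u 0 \<delta>)" for u
  proof -
    have mm: "(\<lambda>x. measure ?N {y. \<bar>- u + a * y\<bar> < \<bar>c * x\<bar>}) \<in> borel_measurable ?N"
    proof -
      have s: "{z \<in> space (?N \<Otimes>\<^sub>M ?N). \<bar>- u + a * snd z\<bar> < \<bar>c * fst z\<bar>} \<in> sets (?N \<Otimes>\<^sub>M ?N)" by measurable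
      from std_normal.measurable_emeasure_Pair[OF s]
      have "(\<lambda>x. emeasure ?N {y. \<bar>- u + a * y\<bar> < \<bar>c * x\<bar>}) \<in> borel_measurable ?N"
        by (simp add: vimage_def space_pair_measure)
      then show ?thesis unfolding measure_def by measurable
    qed
    show i: "integrable ?N (\<lambda>x. measure ?N {y. \<bar>- u + a * y\<bar> < \<bar>c * x\<bar>})"
      by (rule std_normal.bounded_integrable[where B=1]) (use mm in auto)
    have "ennreal (LINT x|?N. measure ?N {y. \<bar>- u + a * y\<bar> < \<bar>c * x\<bar>}) = ennreal (prob (chg u 0 \<delta>))"
      unfolding G[symmetric] using i by (subst nn_integral_eq_integral[symmetric]) (auto simp: std_normal.emeasure_eq_measure)
    then show "(LINT x|?N. measure ?N {y. \<bar>- u + a * y\<bar> < \<bar>c * x\<bar>}) = prob (chg u 0 \<delta>)"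
      by (subst (asm) ennreal_inj) (auto intro!: integral_nonneg_AE)
  qed
  have "prob (chg u 0 \<delta>) \<le> (LINT x|?N. 2 / a / sqrt (2 * pi) * c * \<bar>x\<bar>)"
    unfolding ab(2)[symmetric] by (intro integral_mono ab(1) integrable_mult_right i1 strip1)
  also have "\<dots> = 2 / pi * (c / a)" using cst by (simp add: i1)
  finally show "prob (chg u 0 \<delta>) \<le> 2 / pi * ratio \<delta>" by (simp only: k)
  have "2 / pi * (c / a - (c / a) ^ 3) = (2 / a / sqrt (2 * pi) * c * sqrt (2 / pi)) * (1 - (c / a)\<^sup>2)"
    unfolding cst by (simp add: power2_eq_square power3_eq_cube right_diff_distrib)
  also have "\<dots> = (LINT x|?N. 2 / a / sqrt (2 * pi) * c * (\<bar>x\<bar> - (c / a)\<^sup>2 / 2 * \<bar>x\<bar> ^ 3))"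
    using i1 i3 by (simp add: right_diff_distrib)
  also have "\<dots> \<le> prob (chg 0 0 \<delta>)"
    unfolding ab(2)[symmetric] by (intro integral_mono ab(1) integrable_mult_right Bochner_Integration.integrable_diff i1 i3 strip2)
  finally show "2 / pi * (ratio \<delta> - ratio \<delta> ^ 3) \<le> prob (chg 0 0 \<delta>)" by (simp only: k)
qed

lemma ratio_limit: "((\<lambda>\<delta>. ratio \<delta> / \<delta>) \<longlongrightarrow> \<sigma> / 2) (at_right 0)"
proof -
  have r10: "r1 0 = 0" and r20: "r2 0 = - \<sigma>\<^sup>2" by (simp_all add: r1_def r2_def sigma_def)
  have l1: "((\<lambda>x. - r1 x / (2 * x)) \<longlongrightarrow> \<sigma>\<^sup>2 / 2) (at_right 0)"
  proof -
    have "((\<lambda>h. (r1 (0 + h) - r1 0) / h) \<longlongrightarrow> r2 0) (at 0)" using r1_has_derivative[of 0] unfolding DERIV_def .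
    then have "((\<lambda>h. (-1/2) * ((r1 (0 + h) - r1 0) / h)) \<longlongrightarrow> (-1/2) * r2 0) (at 0)" by (intro tendsto_intros)
    then have "((\<lambda>x. - r1 x / (2 * x)) \<longlongrightarrow> \<sigma>\<^sup>2 / 2) (at 0)" by (simp add: r10 r20 mult.commute)
    then show ?thesis by (rule tendsto_mono[OF at_le, rotated]) simp
  qed
  have rc: "(r \<longlongrightarrow> 1) (at_right 0)"
    using DERIV_isCont[OF r_has_derivative[of 0]] unfolding isCont_def r0 by (rule tendsto_mono[OF at_le, rotated]) simp
  have l2: "((\<lambda>x. (1 - r x) / x\<^sup>2) \<longlongrightarrow> \<sigma>\<^sup>2 / 2) (at_right 0)"
  proof (rule lhopital_right_0[where f'="\<lambda>x. - r1 x" and g'="\<lambda>x. 2 * x"])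
    show "((\<lambda>x. 1 - r x) \<longlongrightarrow> 0) (at_right 0)" using tendsto_diff[OF tendsto_const[of 1] rc] by simp
    show "((\<lambda>x::real. x\<^sup>2) \<longlongrightarrow> 0) (at_right 0)" by real_asymp
    show "\<forall>\<^sub>F x::real in at_right 0. x\<^sup>2 \<noteq> 0" "\<forall>\<^sub>F x::real in at_right 0. 2 * x \<noteq> 0"
      by (auto simp: eventually_at_right_less intro: eventually_mono[OF eventually_at_right_less])
    show "\<forall>\<^sub>F x in at_right 0. ((\<lambda>x. 1 - r x) has_real_derivative - r1 x) (at x)"
      by (intro always_eventually allI) (auto intro!: derivative_eq_intros r_has_derivative)
    show "\<forall>\<^sub>F x in at_right 0. ((\<lambda>x::real. x\<^sup>2) has_real_derivative 2 * x) (at x)"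
      by (intro always_eventually allI) (auto intro!: derivative_eq_intros)
    show "filterlim (\<lambda>x. - r1 x / (2 * x)) (nhds (\<sigma>\<^sup>2 / 2)) (at_right 0)" by (rule l1)
  qed
  have A: "((\<lambda>\<delta>. sqrt ((1 - r \<delta>) / \<delta>\<^sup>2 / 2) / sqrt ((1 + r \<delta>) / 2)) \<longlongrightarrow> sqrt (\<sigma>\<^sup>2 / 2 / 2) / sqrt ((1 + 1) / 2)) (at_right 0)"
    by (intro tendsto_intros l2 rc) auto
  have B: "sqrt (\<sigma>\<^sup>2 / 2 / 2) / sqrt ((1 + 1) / 2) = \<sigma> / 2"
    using sigma_pos by (simp add: real_sqrt_divide)
  have C: "\<forall>\<^sub>F \<delta> in at_right 0. sqrt ((1 - r \<delta>) / \<delta>\<^sup>2 / 2) / sqrt ((1 + r \<delta>) / 2) = ratio \<delta> / \<delta>"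
    using eventually_at_right_less[of 0]
    by eventually_elim (simp add: ratio_def real_sqrt_divide real_sqrt_mult)
  show ?thesis using A unfolding B by (rule Lim_transform_eventually[OF _ C])
qed

text \<open>\<open>\<sigma> / pi\<close> is Rice's mean number of zeros per unit of time. The two
  bounds differ by the cube of \<open>ratio \<delta>\<close>, which is negligible against
  \<open>\<delta>\<close>.\<close>

lemma chg_limit: "((\<lambda>\<delta>. prob (chg 0 0 \<delta>) / \<delta>) \<longlongrightarrow> \<sigma> / pi) (at_right 0)"
proof (rule tendsto_sandwich[where f="\<lambda>\<delta>. 2 / pi * (ratio \<delta> / \<delta> - (ratio \<delta> / \<delta>) ^ 3 * \<delta>\<^sup>2)" and h="\<lambda>\<delta>. 2 / pi * (ratio \<delta> / \<delta>)"])
  have u: "((\<lambda>\<delta>. 2 / pi * (ratio \<delta> / \<delta>)) \<longlongrightarrow> 2 / pi * (\<sigma> / 2)) (at_right 0)"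
    by (intro tendsto_intros ratio_limit)
  then show "((\<lambda>\<delta>. 2 / pi * (ratio \<delta> / \<delta>)) \<longlongrightarrow> \<sigma> / pi) (at_right 0)" by simp
  have "((\<lambda>\<delta>. 2 / pi * (ratio \<delta> / \<delta> - (ratio \<delta> / \<delta>) ^ 3 * \<delta>\<^sup>2)) \<longlongrightarrow> 2 / pi * (\<sigma> / 2 - (\<sigma> / 2) ^ 3 * 0\<^sup>2)) (at_right 0)"
    by (intro tendsto_intros ratio_limit)
  then show "((\<lambda>\<delta>. 2 / pi * (ratio \<delta> / \<delta> - (ratio \<delta> / \<delta>) ^ 3 * \<delta>\<^sup>2)) \<longlongrightarrow> \<sigma> / pi) (at_right 0)" by simp
  show "\<forall>\<^sub>F \<delta> in at_right 0. prob (chg 0 0 \<delta>) / \<delta> \<le> 2 / pi * (ratio \<delta> / \<delta>)"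
    using eventually_at_right_less[of 0]
    by eventually_elim (use prob_chg_bounds(1) in \<open>auto simp: field_simps\<close>)
  show "\<forall>\<^sub>F \<delta> in at_right 0. 2 / pi * (ratio \<delta> / \<delta> - (ratio \<delta> / \<delta>) ^ 3 * \<delta>\<^sup>2) \<le> prob (chg 0 0 \<delta>) / \<delta>"
    using eventually_at_right_less[of 0]
  proof eventually_elim
    case (elim \<delta>)
    have "2 / pi * (ratio \<delta> / \<delta> - (ratio \<delta> / \<delta>) ^ 3 * \<delta>\<^sup>2) = 2 / pi * (ratio \<delta> - ratio \<delta> ^ 3) / \<delta>"
      using elim by (simp add: power_divide power2_eq_square power3_eq_cube right_diff_distrib diff_divide_distrib)
    then show ?case using divide_right_mono[OF prob_chg_bounds(2)[OF elim], of \<delta>] elim by simp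
  qed
qed

end

section \<open>Sign changes in two cells: spectral error bounds, distant lags and short lags\<close>

lemma cmod_cis_minus_one: "cmod (cis x - 1) \<le> \<bar>x\<bar>" "cmod (cis x - 1) \<le> 2"
proof -
  show "cmod (cis x - 1) \<le> \<bar>x\<bar>" using iexp_approx1[of x 0] by (simp add: cis_conv_exp)
  show "cmod (cis x - 1) \<le> 2" using norm_triangle_ineq4[of "cis x" 1] by simp
qed

text \<open>The error of the tangent at 0, with the factor \<open>h\<close> capped at 2. The cap
  keeps the error linear in large frequencies, so that its square is integrable with second moments
  only.\<close>

lemma cmod_cis_increment:
  assumes "\<bar>u\<bar> \<le> h" "\<bar>v - u\<bar> \<le> h"
  shows "cmod (cis v - cis u - \<i> * of_real (v - u)) \<le> 2 * \<bar>v - u\<bar> * min 2 h"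
proof -
  define x where "x = v - u"
  have "cmod (cis x - 1 - \<i> * of_real x) \<le> \<bar>x\<bar>\<^sup>2 / 2"
    using iexp_approx1[of x 1] by (simp add: cis_conv_exp algebra_simps numeral_2_eq_2)
  moreover have "\<bar>x\<bar>\<^sup>2 / 2 \<le> \<bar>x\<bar> * h"
  proof -
    have "\<bar>x\<bar> \<le> h" using assms by (simp add: x_def)
    then have "\<bar>x\<bar> * \<bar>x\<bar> \<le> \<bar>x\<bar> * h" "0 \<le> \<bar>x\<bar> * \<bar>x\<bar>" by (intro mult_left_mono mult_nonneg_nonneg; simp)+
    then show ?thesis unfolding power2_eq_square by linarith
  qed
  moreover have "cmod (cis x - 1 - \<i> * of_real x) \<le> 2 * \<bar>x\<bar>"
    using iexp_approx2[of x 1] by (simp add: cis_conv_exp algebra_simps)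
  ultimately have 1: "cmod (cis x - 1 - \<i> * of_real x) \<le> \<bar>x\<bar> * min 2 h" by (simp add: min_def)
  have "cmod (cis u - 1) \<le> min 2 h" using cmod_cis_minus_one[of u] assms by simp
  then have 2: "cmod ((cis u - 1) * (\<i> * of_real x)) \<le> \<bar>x\<bar> * min 2 h"
    using mult_right_mono[of "cmod (cis u - 1)" "min 2 h" "\<bar>x\<bar>"] by (simp add: norm_mult mult.commute)
  have "cis v = cis u * cis x" by (simp add: x_def cis_mult)
  then have "cis v - cis u - \<i> * of_real x = cis u * (cis x - 1 - \<i> * of_real x) + (cis u - 1) * (\<i> * of_real x)"
    by (simp add: algebra_simps)
  then have "cmod (cis v - cis u - \<i> * of_real x) \<le> cmod (cis u * (cis x - 1 - \<i> * of_real x)) + cmod ((cis u - 1) * (\<i> * of_real x))"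
    by (simp only: norm_triangle_ineq)
  also have "\<dots> \<le> \<bar>x\<bar> * min 2 h + \<bar>x\<bar> * min 2 h" using 1 2 by (intro add_mono) (simp_all add: norm_mult)
  finally show ?thesis by (simp add: x_def)
qed

text \<open>A smooth majorant of \<^term>\<open>(min 2 \<bar>s\<bar>)\<^sup>2\<close> which, divided by \<^term>\<open>s\<close>, has an elementary primitive.\<close>

definition mfun :: "real \<Rightarrow> real" where "mfun s = 8 * s\<^sup>2 / (4 + s\<^sup>2)"

lemma mfun_pos: "(0::real) < 4 + s\<^sup>2" by (simp add: add_pos_nonneg)

lemma mfun_nonneg: "0 \<le> mfun s" by (simp add: mfun_def)

lemma mfun_le_8: "mfun s \<le> 8"
  using mfun_pos[of s] by (simp add: mfun_def divide_le_eq)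

lemma mfun_minus: "mfun \<bar>s\<bar> = mfun s" by (simp add: mfun_def)

lemma mfun_mono: "0 \<le> s \<Longrightarrow> s \<le> t \<Longrightarrow> mfun s \<le> mfun t"
proof -
  assume st: "0 \<le> s" "s \<le> t"
  then have "s\<^sup>2 \<le> t\<^sup>2" by (intro power_mono) auto
  then show ?thesis using mfun_pos[of s] mfun_pos[of t]
    by (simp add: mfun_def divide_le_eq le_divide_eq algebra_simps)
qed

lemma mfun_ge: "(min 2 \<bar>s\<bar>)\<^sup>2 \<le> mfun s"
proof (cases "\<bar>s\<bar> \<le> 2")
  case True
  then have "s\<^sup>2 \<le> 2\<^sup>2" using abs_le_square_iff[of s 2] by simp
  then have "s\<^sup>2 * (4 + s\<^sup>2) \<le> s\<^sup>2 * 8" by (intro mult_left_mono) auto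
  then show ?thesis using True mfun_pos[of s] by (simp add: mfun_def le_divide_eq)
next
  case False
  then have "2\<^sup>2 \<le> s\<^sup>2" using abs_le_square_iff[of 2 s] by simp
  then show ?thesis using False mfun_pos[of s] by (simp add: mfun_def le_divide_eq)
qed

lemma mfun_measurable[measurable]: "mfun \<in> borel_measurable borel" unfolding mfun_def by measurable

context gaussian_zeros
begin

definition inc :: "real \<Rightarrow> real \<Rightarrow> real \<Rightarrow> complex" where
  "inc \<delta> t l = cis (l * (t + \<delta>)) - cis (l * t)"

text \<open>The spectral function of the polygonal interpolation at the fraction
  \<open>\<theta>\<close> of the segment that starts at \<open>t\<close>.\<close>

definition pt :: "real \<Rightarrow> real \<Rightarrow> real \<Rightarrow> real \<Rightarrow> complex" where
  "pt \<delta> t \<theta> l = of_real 1 * cis (l * t) + of_real \<theta> * inc \<delta> t l"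

definition rice :: "real \<Rightarrow> real \<Rightarrow> real \<Rightarrow> real \<Rightarrow> real" where
  "rice \<delta> t \<theta> \<theta>' = rice_density (ip (pt \<delta> 0 \<theta>) (pt \<delta> 0 \<theta>)) (ip (pt \<delta> 0 \<theta>) (pt \<delta> t \<theta>')) (ip (pt \<delta> t \<theta>') (pt \<delta> t \<theta>'))
     (ip (inc \<delta> 0) (pt \<delta> 0 \<theta>)) (ip (inc \<delta> 0) (pt \<delta> t \<theta>')) (ip (inc \<delta> t) (pt \<delta> 0 \<theta>)) (ip (inc \<delta> t) (pt \<delta> t \<theta>'))
     (ip (inc \<delta> 0) (inc \<delta> 0)) (ip (inc \<delta> 0) (inc \<delta> t)) (ip (inc \<delta> t) (inc \<delta> t))"

definition gram :: "real \<Rightarrow> real \<Rightarrow> real \<Rightarrow> real \<Rightarrow> real" where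
  "gram \<delta> t \<theta> \<theta>' = ip (pt \<delta> 0 \<theta>) (pt \<delta> 0 \<theta>) * ip (pt \<delta> t \<theta>') (pt \<delta> t \<theta>') - (ip (pt \<delta> 0 \<theta>) (pt \<delta> t \<theta>'))\<^sup>2"

definition q :: "real \<Rightarrow> real \<Rightarrow> real" where
  "q \<delta> t = prob (chg 0 0 \<delta> \<inter> chg 0 t \<delta>)"

lemma lin_inc: "lin (\<lambda>\<omega>. f (t + \<delta>) \<omega> - f t \<omega>) (inc \<delta> t)"
  unfolding inc_def[abs_def] by (intro lin_diff lin_base)

lemma lin_pt: "lin (\<lambda>\<omega>. 1 * f t \<omega> + \<theta> * (f (t + \<delta>) \<omega> - f t \<omega>)) (pt \<delta> t \<theta>)"
  unfolding pt_def[abs_def] by (intro lin_comb lin_base lin_inc)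

lemma q_eq:
  "q \<delta> t = prob {\<omega> \<in> space M. f 0 \<omega> * (f 0 \<omega> + (f (0 + \<delta>) \<omega> - f 0 \<omega>)) < 0 \<and> f t \<omega> * (f t \<omega> + (f (t + \<delta>) \<omega> - f t \<omega>)) < 0}"
  unfolding q_def
proof (rule measure_eq_AE)
  have sgn: "((a < 0) \<noteq> (b < 0)) \<longleftrightarrow> a * b < 0" if "a \<noteq> 0" "b \<noteq> 0" for a b :: real
    using that by (auto simp: mult_less_0_iff)
  show "AE \<omega> in M. \<omega> \<in> chg 0 0 \<delta> \<inter> chg 0 t \<delta> \<longleftrightarrow>
    \<omega> \<in> {\<omega> \<in> space M. f 0 \<omega> * (f 0 \<omega> + (f (0 + \<delta>) \<omega> - f 0 \<omega>)) < 0 \<and> f t \<omega> * (f t \<omega> + (f (t + \<delta>) \<omega> - f t \<omega>)) < 0}"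
    using f_ne[of 0 0] f_ne[of "0 + \<delta>" 0] f_ne[of t 0] f_ne[of "t + \<delta>" 0]
  proof eventually_elim
    case (elim \<omega>)
    then show ?case using sgn[OF elim(1,2)] sgn[OF elim(3,4)] by (auto simp: chg_def)
  qed
qed (measurable, measurable)

lemma q_bounds:
  assumes "\<kappa> > 0" "\<And>\<theta> \<theta>'. \<theta> \<in> {0..1} \<Longrightarrow> \<theta>' \<in> {0..1} \<Longrightarrow> \<kappa> \<le> gram \<delta> t \<theta> \<theta>'"
  shows "(\<And>\<theta> \<theta>'. \<theta> \<in> {0..1} \<Longrightarrow> \<theta>' \<in> {0..1} \<Longrightarrow> rice \<delta> t \<theta> \<theta>' \<le> k) \<Longrightarrow> q \<delta> t \<le> k"
    and "(\<And>\<theta> \<theta>'. \<theta> \<in> {0..1} \<Longrightarrow> \<theta>' \<in> {0..1} \<Longrightarrow> k \<le> rice \<delta> t \<theta> \<theta>') \<Longrightarrow> k \<le> q \<delta> t"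
proof -
  note S = sign_change_rice[OF lin_base[of 0] lin_inc[of 0 \<delta>] lin_base[of t] lin_inc[of t \<delta>] assms(1)
      assms(2)[unfolded gram_def pt_def[abs_def]]]
  show "(\<And>\<theta> \<theta>'. \<theta> \<in> {0..1} \<Longrightarrow> \<theta>' \<in> {0..1} \<Longrightarrow> rice \<delta> t \<theta> \<theta>' \<le> k) \<Longrightarrow> q \<delta> t \<le> k"
    unfolding q_eq rice_def pt_def[abs_def] by (rule S(1))
  show "(\<And>\<theta> \<theta>'. \<theta> \<in> {0..1} \<Longrightarrow> \<theta>' \<in> {0..1} \<Longrightarrow> k \<le> rice \<delta> t \<theta> \<theta>') \<Longrightarrow> k \<le> q \<delta> t"
    unfolding q_eq rice_def pt_def[abs_def] by (rule S(2))
qed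

text \<open>Controls the mean square error of replacing the process by its tangent over times up to
  \<open>t\<close>. The weight \<open>mfun\<close> makes it vanish at 0 under a second moment alone;
  the rate of vanishing is what the Geman condition governs.\<close>

definition theta :: "real \<Rightarrow> real" where "theta t = (LINT l|\<rho>. l\<^sup>2 * mfun (l * t))"

lemma theta_integrable: "integrable \<rho> (\<lambda>l. l\<^sup>2 * mfun (l * t))"
proof (rule Bochner_Integration.integrable_bound)
  show "integrable \<rho> (\<lambda>l. l\<^sup>2 * 8)" using l2_integrable by simp
  show "AE l in \<rho>. norm (l\<^sup>2 * mfun (l * t)) \<le> norm (l\<^sup>2 * 8)"
    by (intro AE_I2) (simp add: abs_mult mfun_nonneg mfun_le_8 mult_left_mono)
qed simp

lemma theta_nonneg: "0 \<le> theta t"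
  unfolding theta_def by (intro integral_nonneg_AE AE_I2 mult_nonneg_nonneg mfun_nonneg) simp

lemma theta_mono:
  assumes "0 \<le> s" "s \<le> t" shows "theta s \<le> theta t"
  unfolding theta_def
proof (intro integral_mono theta_integrable mult_left_mono)
  fix l :: real
  have "mfun \<bar>l * s\<bar> \<le> mfun \<bar>l * t\<bar>" using assms by (intro mfun_mono) (auto simp: abs_mult mult_left_mono)
  then show "mfun (l * s) \<le> mfun (l * t)" by (simp only: mfun_minus)
qed simp

lemma theta_tendsto_0: "(theta \<longlongrightarrow> 0) (at 0)"
  unfolding tendsto_at_iff_sequentially comp_def
proof (intro allI impI)
  fix X :: "nat \<Rightarrow> real" assume X: "X \<longlonglongrightarrow> 0"
  have "(\<lambda>i. LINT l|\<rho>. l\<^sup>2 * mfun (l * X i)) \<longlonglongrightarrow> (LINT l|\<rho>. l\<^sup>2 * 0)"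
  proof (rule integral_dominated_convergence[where w="\<lambda>l. l\<^sup>2 * 8"])
    show "AE l in \<rho>. (\<lambda>i. l\<^sup>2 * mfun (l * X i)) \<longlonglongrightarrow> l\<^sup>2 * 0"
    proof (intro AE_I2 tendsto_mult tendsto_const)
      fix l :: real
      have "(\<lambda>i. 8 * (l * X i)\<^sup>2 / (4 + (l * X i)\<^sup>2)) \<longlonglongrightarrow> 8 * (l * 0)\<^sup>2 / (4 + (l * 0)\<^sup>2)"
        by (intro tendsto_intros X) simp
      then show "(\<lambda>i. mfun (l * X i)) \<longlonglongrightarrow> 0" by (simp add: mfun_def)
    qed
    show "AE l in \<rho>. norm (l\<^sup>2 * mfun (l * X i)) \<le> l\<^sup>2 * 8" for i
      by (intro AE_I2) (simp add: abs_mult mfun_nonneg mfun_le_8 mult_left_mono)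
  qed (use l2_integrable in auto)
  then show "(\<lambda>i. theta (X i)) \<longlonglongrightarrow> 0" by (simp add: theta_def)
qed

lemma Re_mult_cnj_self: "Re (z * cnj z) = (cmod z)\<^sup>2"
  by (simp only: complex_norm_square[symmetric] Re_complex_of_real)

lemma ip_self: "ip \<phi> \<phi> = (LINT l|\<rho>. (cmod (\<phi> l))\<^sup>2)"
  unfolding ip_def Re_mult_cnj_self ..

lemma ip_self_le:
  assumes "lin X \<phi>" "integrable \<rho> w" "\<And>l. (cmod (\<phi> l))\<^sup>2 \<le> w l"
  shows "ip \<phi> \<phi> \<le> (LINT l|\<rho>. w l)"
  unfolding ip_self using assms ip_integrable[OF assms(1,1)]
  unfolding Re_mult_cnj_self by (intro integral_mono)

lemma ip_self_ge:
  assumes "lin X \<phi>" "integrable \<rho> w" "\<And>l. w l \<le> (cmod (\<phi> l))\<^sup>2"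
  shows "(LINT l|\<rho>. w l) \<le> ip \<phi> \<phi>"
  unfolding ip_self using assms ip_integrable[OF assms(1,1)]
  unfolding Re_mult_cnj_self by (intro integral_mono)

lemma ip_abs_le:
  assumes "lin X \<phi>" "lin Y \<psi>" "integrable \<rho> w" "\<And>l. \<bar>Re (\<phi> l * cnj (\<psi> l))\<bar> \<le> w l"
  shows "\<bar>ip \<phi> \<psi>\<bar> \<le> (LINT l|\<rho>. w l)"
proof -
  have "\<bar>ip \<phi> \<psi>\<bar> \<le> (LINT l|\<rho>. \<bar>Re (\<phi> l * cnj (\<psi> l))\<bar>)" unfolding ip_def by (rule integral_abs_bound)
  also have "\<dots> \<le> (LINT l|\<rho>. w l)" using assms ip_integrable[OF assms(1,2)] by (intro integral_mono) auto
  finally show ?thesis .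
qed

lemma cmod_inc_le: "\<delta> \<ge> 0 \<Longrightarrow> cmod (inc \<delta> t l) \<le> \<bar>l\<bar> * \<delta>"
proof -
  assume d: "\<delta> \<ge> 0"
  have "inc \<delta> t l = cis (l * t) * (cis (l * \<delta>) - 1)" by (simp add: inc_def distrib_left cis_mult[symmetric] right_diff_distrib)
  then have "cmod (inc \<delta> t l) = cmod (cis (l * \<delta>) - 1)" by (simp add: norm_mult)
  also have "\<dots> \<le> \<bar>l * \<delta>\<bar>" by (rule cmod_cis_minus_one)
  finally show ?thesis using d by (simp add: abs_mult)
qed

lemma ip_inc_le: "\<delta> \<ge> 0 \<Longrightarrow> ip (inc \<delta> t) (inc \<delta> t) \<le> \<sigma>\<^sup>2 * \<delta>\<^sup>2"
proof -
  assume d: "\<delta> \<ge> 0"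
  have "ip (inc \<delta> t) (inc \<delta> t) \<le> (LINT l|\<rho>. l\<^sup>2 * \<delta>\<^sup>2)"
  proof (rule ip_self_le[OF lin_inc])
    show "integrable \<rho> (\<lambda>l. l\<^sup>2 * \<delta>\<^sup>2)" using l2_integrable by simp
    show "(cmod (inc \<delta> t l))\<^sup>2 \<le> l\<^sup>2 * \<delta>\<^sup>2" for l
      using power_mono[OF cmod_inc_le[OF d, of t l], of 2] by (simp add: power_mult_distrib)
  qed
  then show ?thesis by (simp add: sigma_def)
qed

lemma ip_pt:
  "ip (pt \<delta> 0 \<theta>) (pt \<delta> t \<theta>') = (1 - \<theta>) * (1 - \<theta>') * r t + (1 - \<theta>) * \<theta>' * r (t + \<delta>) + \<theta> * (1 - \<theta>') * r (t - \<delta>) + \<theta> * \<theta>' * r t"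
proof -
  have e: "pt \<delta> t \<theta> = (\<lambda>l. of_real (1 - \<theta>) * cis (l * t) + of_real \<theta> * cis (l * (t + \<delta>)))" for t \<theta>
    by (rule ext) (simp add: pt_def inc_def algebra_simps)
  have m: "r (\<delta> - t) = r (t - \<delta>)" using r_minus[of "t - \<delta>"] by simp
  have m2: "r (- t - \<delta>) = r (t + \<delta>)" using r_minus[of "t + \<delta>"] by simp
  have m3: "r (- \<delta> - t) = r (t + \<delta>)" using r_minus[of "\<delta> + t"] by (simp add: add.commute)
  show ?thesis
    unfolding e ip_comb_left[OF lin_base lin_base lin_comb[OF lin_base lin_base]]
      ip_comb_right[OF lin_base lin_base lin_base] ip_cis
    by (simp add: m m2 m3 r_minus algebra_simps)
qed

lemma ip_pt_self: "ip (pt \<delta> t \<theta>) (pt \<delta> t \<theta>) = 1 - 2 * \<theta> * (1 - \<theta>) * (1 - r \<delta>)"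
proof -
  have "pt \<delta> t \<theta> = (\<lambda>l. cis (l * t) * pt \<delta> 0 \<theta> l)"
    by (rule ext) (simp add: pt_def inc_def distrib_left right_diff_distrib cis_mult[symmetric] mult_ac)
  then have "ip (pt \<delta> t \<theta>) (pt \<delta> t \<theta>) = ip (pt \<delta> 0 \<theta>) (pt \<delta> 0 \<theta>)" by (simp only: ip_shift)
  also have "\<dots> = 1 - 2 * \<theta> * (1 - \<theta>) * (1 - r \<delta>)"
    unfolding ip_pt by (simp add: r0 r_minus algebra_simps)
  finally show ?thesis .
qed

text \<open>The zero predictor in \<open>rice_density_le\<close>: the slopes are bounded by their
  unconditional variances, which is enough when the Gram determinant stays away from 0.\<close>

lemma rice_le_simple:
  assumes "0 < \<kappa>" "\<kappa> \<le> gram \<delta> t \<theta> \<theta>'" "\<delta> \<ge> 0"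
  shows "rice \<delta> t \<theta> \<theta>' \<le> \<sigma>\<^sup>2 / (2 * pi * sqrt \<kappa>) * \<delta>\<^sup>2"
proof -
  have "rice \<delta> t \<theta> \<theta>' \<le> (ip (inc \<delta> 0) (inc \<delta> 0) + ip (inc \<delta> t) (inc \<delta> t)) / (4 * pi * sqrt \<kappa>)"
    using rice_density_le[OF lin_pt[where t=0] lin_pt[where t=t] lin_inc[of 0 \<delta>] lin_inc[of t \<delta>] assms(1) assms(2)[unfolded gram_def], of 0 0 0 0]
    unfolding rice_def by simp
  also have "\<dots> \<le> (\<sigma>\<^sup>2 * \<delta>\<^sup>2 + \<sigma>\<^sup>2 * \<delta>\<^sup>2) / (4 * pi * sqrt \<kappa>)"
    using assms ip_inc_le by (intro divide_right_mono add_mono) auto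
  finally show ?thesis by (simp add: field_simps)
qed

text \<open>The covariance of two interpolated values is a convex combination of values of
  \<open>r\<close> at lags at least \<open>a / 2\<close>, hence at most \<open>b\<close>, whereas
  for a fine mesh their variances exceed \<open>(1 + b) / 2\<close>.\<close>

lemma gram_far:
  assumes "a > 0"
  obtains \<kappa> \<delta>0 where "\<kappa> > 0" "\<delta>0 > 0" "\<And>\<delta> t \<theta> \<theta>'. 0 < \<delta> \<Longrightarrow> \<delta> \<le> \<delta>0 \<Longrightarrow> a \<le> t \<Longrightarrow> \<theta> \<in> {0..1} \<Longrightarrow> \<theta>' \<in> {0..1} \<Longrightarrow> \<kappa> \<le> gram \<delta> t \<theta> \<theta>'"
proof -
  obtain b where b: "b < 1" "b > 0" "\<And>t. t \<ge> a / 2 \<Longrightarrow> \<bar>r t\<bar> \<le> b" using abs_r_bound_away[of "a / 2"] assms by auto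
  have "(r \<longlongrightarrow> 1) (at_right 0)"
    using DERIV_isCont[OF r_has_derivative[of 0]] unfolding isCont_def r0 by (rule tendsto_mono[OF at_le, rotated]) simp
  then have "eventually (\<lambda>\<delta>. (1 + b) / 2 < r \<delta>) (at_right 0)" using b by (intro order_tendstoD) auto
  then obtain d where d: "d > 0" "\<And>\<delta>. 0 < \<delta> \<Longrightarrow> \<delta> < d \<Longrightarrow> (1 + b) / 2 < r \<delta>" by (auto simp: eventually_at_right_field)
  show ?thesis
  proof (rule that)
    show "((1 + b) / 2)\<^sup>2 - b\<^sup>2 > 0" using b power_strict_mono[of b "(1 + b) / 2" 2] by simp
    show "min (d / 2) (a / 2) > 0" using d assms by simp
    fix \<delta> t \<theta> \<theta>' :: real assume as: "0 < \<delta>" "\<delta> \<le> min (d / 2) (a / 2)" "a \<le> t" "\<theta> \<in> {0..1}" "\<theta>' \<in> {0..1 :: real}"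
    have rd: "(1 + b) / 2 < r \<delta>" using d as by auto
    have "(1 + b) / 2 \<le> ip (pt \<delta> s x) (pt \<delta> s x)" if "x \<in> {0..1}" for s x
    proof -
      have "2 * x * (1 - x) \<le> 1" using zero_le_power2[of "2 * x - 1"] by (simp add: power2_eq_square algebra_simps)
      then have "2 * x * (1 - x) * (1 - r \<delta>) \<le> 1 * (1 - r \<delta>)"
        using abs_r_le[of \<delta>] by (intro mult_right_mono) auto
      then show ?thesis unfolding ip_pt_self using rd by simp
    qed
    then have 1: "((1 + b) / 2) * ((1 + b) / 2) \<le> ip (pt \<delta> 0 \<theta>) (pt \<delta> 0 \<theta>) * ip (pt \<delta> t \<theta>') (pt \<delta> t \<theta>')"
      using as b by (intro mult_mono) (auto simp: ip_nonneg)
    have 2: "\<bar>ip (pt \<delta> 0 \<theta>) (pt \<delta> t \<theta>')\<bar> \<le> b"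
    proof -
      have rr: "\<bar>r t\<bar> \<le> b" "\<bar>r (t + \<delta>)\<bar> \<le> b" "\<bar>r (t - \<delta>)\<bar> \<le> b" using b(3) as assms by auto
      have p: "\<bar>k * y\<bar> \<le> k * b" if "k \<ge> 0" "\<bar>y\<bar> \<le> b" for k y
        using that by (simp add: abs_mult mult_left_mono)
      have "\<bar>ip (pt \<delta> 0 \<theta>) (pt \<delta> t \<theta>')\<bar> \<le> (1 - \<theta>) * (1 - \<theta>') * b + (1 - \<theta>) * \<theta>' * b + \<theta> * (1 - \<theta>') * b + \<theta> * \<theta>' * b"
        unfolding ip_pt using as
        by (intro order_trans[OF abs_triangle_ineq] add_mono p rr mult_nonneg_nonneg) auto
      also have "\<dots> = b" by (simp add: algebra_simps)
      finally show ?thesis .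
    qed
    then have "(ip (pt \<delta> 0 \<theta>) (pt \<delta> t \<theta>'))\<^sup>2 \<le> b\<^sup>2" using b by (simp add: abs_le_square_iff[symmetric])
    then show "((1 + b) / 2)\<^sup>2 - b\<^sup>2 \<le> gram \<delta> t \<theta> \<theta>'" using 1 unfolding gram_def by (simp add: power2_eq_square)
  qed
qed

lemma q_far:
  assumes "a > 0"
  obtains C \<delta>0 where "C \<ge> 0" "\<delta>0 > 0" "\<And>\<delta> t. 0 < \<delta> \<Longrightarrow> \<delta> \<le> \<delta>0 \<Longrightarrow> a \<le> t \<Longrightarrow> q \<delta> t \<le> C * \<delta>\<^sup>2"
proof -
  obtain \<kappa> \<delta>0 where k: "\<kappa> > 0" "\<delta>0 > 0" "\<And>\<delta> t \<theta> \<theta>'. 0 < \<delta> \<Longrightarrow> \<delta> \<le> \<delta>0 \<Longrightarrow> a \<le> t \<Longrightarrow> \<theta> \<in> {0..1} \<Longrightarrow> \<theta>' \<in> {0..1} \<Longrightarrow> \<kappa> \<le> gram \<delta> t \<theta> \<theta>'"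
    using gram_far[OF assms] by metis
  show ?thesis
  proof (rule that[of "\<sigma>\<^sup>2 / (2 * pi * sqrt \<kappa>)" \<delta>0])
    fix \<delta> t assume as: "0 < \<delta>" "\<delta> \<le> \<delta>0" "a \<le> t"
    show "q \<delta> t \<le> \<sigma>\<^sup>2 / (2 * pi * sqrt \<kappa>) * \<delta>\<^sup>2"
      by (rule q_bounds(1)[OF k(1) k(3)[OF as]], assumption, assumption)
         (use as in \<open>intro rice_le_simple k, auto\<close>)
  qed (use k in auto)
qed

text \<open>Both increments are predicted by \<open>\<delta>\<close> times the slope of the chord
  between the two interpolated values. The squared error is of order
  \<open>\<delta>^2 theta (2 t)\<close>, while the root of the Gram determinant is only of order
  \<open>\<sigma> t\<close>; their quotient is the bound.\<close>

lemma rice_near: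
  assumes \<delta>: "0 < \<delta>" "2 * \<delta> \<le> t" and \<theta>: "\<theta> \<in> {0..1}" "\<theta>' \<in> {0..1}"
    and small: "0 \<le> r \<delta>" "theta (2 * t) \<le> \<sigma>\<^sup>2 / 16" "49 * \<sigma>\<^sup>2 * t\<^sup>2 \<le> 1 / 16"
  shows "t\<^sup>2 * \<sigma>\<^sup>2 / 64 \<le> gram \<delta> t \<theta> \<theta>'"
    and "rice \<delta> t \<theta> \<theta>' \<le> 64 / (pi * \<sigma>) * \<delta>\<^sup>2 * theta (2 * t) / t"
proof -
  define mn where "mn l = min 2 \<bar>l * (2 * t)\<bar>" for l
  \<comment> \<open>The distance between the two interpolation points, comparable to
    \<open>t\<close> because \<open>\<delta> \<le> t / 2\<close>.\<close>
  define \<Delta> where "\<Delta> = t + \<theta>' * \<delta> - \<theta> * \<delta>"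
  have t: "t > 0" "\<delta> \<le> t / 2" using \<delta> by auto
  have td: "\<theta> * \<delta> \<le> \<delta>" "0 \<le> \<theta>' * \<delta>" "0 \<le> \<theta> * \<delta>" "\<theta>' * \<delta> \<le> \<delta>" using \<theta> \<delta> by (auto simp: mult_left_le_one_le)
  have \<Delta>: "t / 2 \<le> \<Delta>" "\<Delta> > 0" using td t unfolding \<Delta>_def by linarith+
  have mn: "0 \<le> mn l" "mn l \<le> 2" "mn l \<le> \<bar>l\<bar> * (2 * t)" "(mn l)\<^sup>2 \<le> mfun (l * (2 * t))" for l
    using t mfun_ge[of "l * (2 * t)"] by (auto simp: mn_def abs_mult)
  have inc: "cmod (cis (l * v) - cis (l * u) - \<i> * of_real (l * (v - u))) \<le> 2 * \<bar>l\<bar> * mn l * (v - u)"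
    if "0 \<le> u" "u \<le> v" "v \<le> 2 * t" for l u v
  proof -
    have "cmod (cis (l * v) - cis (l * u) - \<i> * of_real (l * v - l * u)) \<le> 2 * \<bar>l * v - l * u\<bar> * min 2 \<bar>l * (2 * t)\<bar>"
      using that by (intro cmod_cis_increment) (auto simp: abs_mult right_diff_distrib[symmetric] intro!: mult_left_mono)
    moreover have e: "l * v - l * u = l * (v - u)" by (simp add: right_diff_distrib)
    moreover have "2 * \<bar>l * (v - u)\<bar> * min 2 \<bar>l * (2 * t)\<bar> = 2 * \<bar>l\<bar> * mn l * (v - u)"
      using that by (simp add: mn_def abs_mult)
    ultimately show ?thesis by (simp only:)
  qed
  define s where "s l = pt \<delta> t \<theta>' l - pt \<delta> 0 \<theta> l" for l
  note Pl = lin_pt[where t=0 and \<theta>=\<theta> and \<delta>=\<delta>] and Ql = lin_pt[where t=t and \<theta>=\<theta>' and \<delta>=\<delta>]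
  have Sl: "lin (\<lambda>\<omega>. (1 * f t \<omega> + \<theta>' * (f (t + \<delta>) \<omega> - f t \<omega>)) - (1 * f 0 \<omega> + \<theta> * (f (0 + \<delta>) \<omega> - f 0 \<omega>))) s"
    unfolding s_def by (rule lin_diff[OF Ql Pl])
  have s_err: "cmod (s l - \<i> * of_real (l * \<Delta>)) \<le> 2 * \<bar>l\<bar> * mn l * \<Delta>" for l
  proof -
    let ?e = "\<lambda>u v. cis (l * v) - cis (l * u) - \<i> * of_real (l * (v - u))"
    \<comment> \<open>The chord is a telescoping sum over the rest of the first cell, the gap and
      the used part of the second cell. Their lengths, with the weights \<open>1 - \<theta>\<close>,
      1 and \<open>\<theta>'\<close>, add up to \<open>\<Delta>\<close>.\<close>
    have eq: "s l - \<i> * of_real (l * \<Delta>) = of_real (1 - \<theta>) * ?e 0 \<delta> + ?e \<delta> t + of_real \<theta>' * ?e t (t + \<delta>)"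
      by (simp add: s_def pt_def inc_def \<Delta>_def algebra_simps)
    have 1: "cmod (of_real (1 - \<theta>) * ?e 0 \<delta>) \<le> (1 - \<theta>) * (2 * \<bar>l\<bar> * mn l * (\<delta> - 0))"
      unfolding norm_mult norm_of_real using \<theta> \<delta> t by (intro mult_mono inc) auto
    have 2: "cmod (?e \<delta> t) \<le> 2 * \<bar>l\<bar> * mn l * (t - \<delta>)" using \<delta> t by (intro inc) auto
    have 3: "cmod (of_real \<theta>' * ?e t (t + \<delta>)) \<le> \<theta>' * (2 * \<bar>l\<bar> * mn l * (t + \<delta> - t))"
      unfolding norm_mult norm_of_real using \<theta> \<delta> t by (intro mult_mono inc) auto
    have "cmod (s l - \<i> * of_real (l * \<Delta>)) \<le> (1 - \<theta>) * (2 * \<bar>l\<bar> * mn l * (\<delta> - 0)) + 2 * \<bar>l\<bar> * mn l * (t - \<delta>) + \<theta>' * (2 * \<bar>l\<bar> * mn l * (t + \<delta> - t))"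
      unfolding eq by (intro norm_triangle_le add_mono 1 2 3)
    also have "\<dots> = 2 * \<bar>l\<bar> * mn l * \<Delta>" by (simp add: \<Delta>_def algebra_simps)
    finally show ?thesis .
  qed
  have il: "cmod (\<i> * of_real (l * \<Delta>)) = \<bar>l\<bar> * \<Delta>" for l using \<Delta> by (simp add: norm_mult)
  \<comment> \<open>The lower bound comes from \<open>A \<le> B + e\<close>, which implies
    \<open>A^2 / 2 - e^2 \<le> B^2\<close>.\<close>
  have cs_ge: "\<Delta>\<^sup>2 * (l\<^sup>2 / 2 - 4 * (l\<^sup>2 * mfun (l * (2 * t)))) \<le> (cmod (s l))\<^sup>2" for l
  proof -
    let ?e = "cmod (s l - \<i> * of_real (l * \<Delta>))"
    have "\<bar>l\<bar> * \<Delta> \<le> cmod (s l) + ?e"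
      using norm_triangle_ineq4[of "s l" "s l - \<i> * of_real (l * \<Delta>)"] il[of l] by simp
    then have "(\<bar>l\<bar> * \<Delta>)\<^sup>2 \<le> (cmod (s l) + ?e)\<^sup>2" using \<Delta> by (intro power_mono) auto
    also have "\<dots> \<le> 2 * (cmod (s l))\<^sup>2 + 2 * ?e\<^sup>2"
      using sum_squares_bound[of "cmod (s l)" ?e] by (simp add: power2_sum)
    finally have 1: "\<Delta>\<^sup>2 * l\<^sup>2 / 2 - ?e\<^sup>2 \<le> (cmod (s l))\<^sup>2" by (simp add: power_mult_distrib mult.commute)
    have "?e\<^sup>2 \<le> (2 * \<bar>l\<bar> * mn l * \<Delta>)\<^sup>2" using s_err by (intro power_mono) auto
    also have "\<dots> = 4 * l\<^sup>2 * \<Delta>\<^sup>2 * (mn l)\<^sup>2" by (simp add: power_mult_distrib)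
    also have "\<dots> \<le> 4 * l\<^sup>2 * \<Delta>\<^sup>2 * mfun (l * (2 * t))" using mn by (intro mult_left_mono) auto
    finally show ?thesis using 1 by (simp add: algebra_simps)
  qed
  have cs_le: "cmod (s l) \<le> 5 * \<bar>l\<bar> * \<Delta>" for l
  proof -
    have "cmod (s l) \<le> cmod (\<i> * of_real (l * \<Delta>)) + cmod (s l - \<i> * of_real (l * \<Delta>))"
      by (rule norm_triangle_sub)
    also have "\<dots> \<le> \<bar>l\<bar> * \<Delta> + 2 * \<bar>l\<bar> * mn l * \<Delta>" unfolding il using s_err by simp
    also have "2 * \<bar>l\<bar> * mn l * \<Delta> \<le> 2 * \<bar>l\<bar> * 2 * \<Delta>" using mn \<Delta> by (intro mult_right_mono mult_left_mono) auto
    finally show ?thesis by (simp add: mult_ac)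
  qed
  have ss: "\<Delta>\<^sup>2 * (\<sigma>\<^sup>2 / 4) \<le> ip s s"
  proof -
    have i: "integrable \<rho> (\<lambda>l. \<Delta>\<^sup>2 * (l\<^sup>2 / 2 - 4 * (l\<^sup>2 * mfun (l * (2 * t)))))"
      using l2_integrable theta_integrable[of "2 * t"] by simp
    have "\<Delta>\<^sup>2 * (\<sigma>\<^sup>2 / 4) \<le> \<Delta>\<^sup>2 * (\<sigma>\<^sup>2 / 2 - 4 * theta (2 * t))" using small by (intro mult_left_mono) auto
    also have "\<dots> = (LINT l|\<rho>. \<Delta>\<^sup>2 * (l\<^sup>2 / 2 - 4 * (l\<^sup>2 * mfun (l * (2 * t)))))"
      using l2_integrable theta_integrable[of "2 * t"] by (simp add: theta_def sigma_def)
    also have "\<dots> \<le> ip s s" by (rule ip_self_ge[OF Sl i cs_ge])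
    finally show ?thesis .
  qed
  have pp: "1 / 2 \<le> ip (pt \<delta> 0 \<theta>) (pt \<delta> 0 \<theta>)"
  proof -
    have "2 * \<theta> * (1 - \<theta>) \<le> 1 / 2" using zero_le_power2[of "2 * \<theta> - 1"] by (simp add: power2_eq_square algebra_simps)
    then have "2 * \<theta> * (1 - \<theta>) * (1 - r \<delta>) \<le> 1 / 2 * 1"
      using abs_r_le[of \<delta>] small \<theta> by (intro mult_mono) auto
    then show ?thesis unfolding ip_pt_self by simp
  qed
  \<comment> \<open>The linear part of the chord is purely imaginary and so orthogonal to the
    constant 1 in \<open>pt\<close>: a value and the slope at the same time are uncorrelated. Only
    second order terms remain, 4 from the chord error and 3 from the increment in \<open>pt\<close>,
    where \<open>5 \<delta> \<le> 3 t\<close>.\<close>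
  have ps: "\<bar>ip (pt \<delta> 0 \<theta>) s\<bar> \<le> 7 * \<sigma>\<^sup>2 * t * \<Delta>"
  proof -
    have "\<bar>ip (pt \<delta> 0 \<theta>) s\<bar> \<le> (LINT l|\<rho>. 7 * t * \<Delta> * l\<^sup>2)"
    proof (rule ip_abs_le[OF Pl Sl])
      show "integrable \<rho> (\<lambda>l. 7 * t * \<Delta> * l\<^sup>2)" using l2_integrable by simp
      show "\<bar>Re (pt \<delta> 0 \<theta> l * cnj (s l))\<bar> \<le> 7 * t * \<Delta> * l\<^sup>2" for l
      proof -
        have "Re (pt \<delta> 0 \<theta> l * cnj (s l)) = Re (s l - \<i> * of_real (l * \<Delta>)) + Re (of_real \<theta> * inc \<delta> 0 l * cnj (s l))"
          by (simp add: pt_def algebra_simps)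
        moreover have "\<bar>Re (s l - \<i> * of_real (l * \<Delta>))\<bar> \<le> 4 * t * \<Delta> * l\<^sup>2"
        proof -
          have "\<bar>Re (s l - \<i> * of_real (l * \<Delta>))\<bar> \<le> 2 * \<bar>l\<bar> * mn l * \<Delta>"
            using abs_Re_le_cmod[of "s l - \<i> * of_real (l * \<Delta>)"] s_err[of l] by linarith
          also have "\<dots> \<le> 2 * \<bar>l\<bar> * (\<bar>l\<bar> * (2 * t)) * \<Delta>" using mn \<Delta> by (intro mult_right_mono mult_left_mono) auto
          also have "\<dots> = 4 * t * \<Delta> * (\<bar>l\<bar> * \<bar>l\<bar>)" by (simp only: mult_ac)
          finally show ?thesis by (simp add: power2_eq_square)
        qed
        moreover have "\<bar>Re (of_real \<theta> * inc \<delta> 0 l * cnj (s l))\<bar> \<le> 3 * t * \<Delta> * l\<^sup>2"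
        proof -
          have "\<bar>Re (of_real \<theta> * inc \<delta> 0 l * cnj (s l))\<bar> \<le> \<theta> * cmod (inc \<delta> 0 l) * cmod (s l)"
            using abs_Re_le_cmod[of "of_real \<theta> * inc \<delta> 0 l * cnj (s l)"] \<theta> by (simp add: norm_mult)
          also have "\<dots> \<le> 1 * (\<bar>l\<bar> * \<delta>) * (5 * \<bar>l\<bar> * \<Delta>)"
            using \<theta> \<delta> cmod_inc_le[of \<delta> 0 l] cs_le[of l] by (intro mult_mono) auto
          also have "\<dots> = 5 * \<delta> * (l\<^sup>2 * \<Delta>)" by (simp add: power2_eq_square mult_ac)
          also have "\<dots> \<le> 3 * t * (l\<^sup>2 * \<Delta>)" using \<delta> \<Delta> by (intro mult_right_mono mult_nonneg_nonneg) auto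
          finally show ?thesis by (simp add: mult_ac)
        qed
        ultimately show ?thesis by linarith
      qed
    qed
    then show ?thesis by (simp add: sigma_def mult_ac)
  qed
  show gram: "t\<^sup>2 * \<sigma>\<^sup>2 / 64 \<le> gram \<delta> t \<theta> \<theta>'"
  proof -
    \<comment> \<open>The Gram determinant is unchanged if the second value is replaced by its
      difference from the first.\<close>
    have qs: "pt \<delta> t \<theta>' = (\<lambda>l. of_real 1 * pt \<delta> 0 \<theta> l + of_real 1 * s l)" by (rule ext) (simp add: s_def)
    have "ip (pt \<delta> t \<theta>') (pt \<delta> t \<theta>') = ip (pt \<delta> 0 \<theta>) (pt \<delta> 0 \<theta>) + 2 * ip (pt \<delta> 0 \<theta>) s + ip s s"
      unfolding qs ip_comb2[OF Pl Sl] by simp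
    moreover have "ip (pt \<delta> 0 \<theta>) (pt \<delta> t \<theta>') = ip (pt \<delta> 0 \<theta>) (pt \<delta> 0 \<theta>) + ip (pt \<delta> 0 \<theta>) s"
      unfolding qs ip_comb_right[OF Pl Sl Pl] by simp
    ultimately have g: "gram \<delta> t \<theta> \<theta>' = ip (pt \<delta> 0 \<theta>) (pt \<delta> 0 \<theta>) * ip s s - (ip (pt \<delta> 0 \<theta>) s)\<^sup>2"
      unfolding gram_def by (simp add: power2_eq_square algebra_simps)
    have "1 / 2 * (\<Delta>\<^sup>2 * (\<sigma>\<^sup>2 / 4)) \<le> ip (pt \<delta> 0 \<theta>) (pt \<delta> 0 \<theta>) * ip s s"
      using pp ss by (intro mult_mono) (auto simp: ip_nonneg)
    moreover have "(ip (pt \<delta> 0 \<theta>) s)\<^sup>2 \<le> \<Delta>\<^sup>2 * \<sigma>\<^sup>2 * (1 / 16)"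
    proof -
      have "(ip (pt \<delta> 0 \<theta>) s)\<^sup>2 \<le> (7 * \<sigma>\<^sup>2 * t * \<Delta>)\<^sup>2" using power_mono[OF ps, of 2] by simp
      also have "\<dots> = \<Delta>\<^sup>2 * \<sigma>\<^sup>2 * (49 * \<sigma>\<^sup>2 * t\<^sup>2)" by (simp add: power_mult_distrib power2_eq_square mult_ac)
      also have "\<dots> \<le> \<Delta>\<^sup>2 * \<sigma>\<^sup>2 * (1 / 16)" using small by (intro mult_left_mono) auto
      finally show ?thesis .
    qed
    ultimately have "\<Delta>\<^sup>2 * \<sigma>\<^sup>2 / 16 \<le> gram \<delta> t \<theta> \<theta>'" unfolding g by simp
    moreover have "(t / 2)\<^sup>2 * \<sigma>\<^sup>2 / 16 \<le> \<Delta>\<^sup>2 * \<sigma>\<^sup>2 / 16"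
      using \<Delta> t by (intro divide_right_mono mult_right_mono power_mono) auto
    ultimately show ?thesis by (simp add: power_divide algebra_simps)
  qed
  have \<kappa>: "0 < t\<^sup>2 * \<sigma>\<^sup>2 / 64" using t sigma_pos by simp
  have sq: "sqrt (t\<^sup>2 * \<sigma>\<^sup>2 / 64) = t * \<sigma> / 8"
    using t sigma_pos by (simp add: real_sqrt_divide real_sqrt_mult)
  \<comment> \<open>The coefficients form \<open>\<delta> / \<Delta>\<close> times the chord, so
    that the linear terms in \<open>l\<close> cancel and two tangent errors remain.\<close>
  have res: "ip (\<lambda>l. of_real 1 * inc \<delta> x l + of_real (-1) * (of_real (- (\<delta> / \<Delta>)) * pt \<delta> 0 \<theta> l + of_real (\<delta> / \<Delta>) * pt \<delta> t \<theta>' l))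
      (\<lambda>l. of_real 1 * inc \<delta> x l + of_real (-1) * (of_real (- (\<delta> / \<Delta>)) * pt \<delta> 0 \<theta> l + of_real (\<delta> / \<Delta>) * pt \<delta> t \<theta>' l))
      \<le> 16 * \<delta>\<^sup>2 * theta (2 * t)" (is "ip ?y ?y \<le> _") if x: "x = 0 \<or> x = t" for x
  proof -
    have "ip ?y ?y \<le> (LINT l|\<rho>. 16 * \<delta>\<^sup>2 * (l\<^sup>2 * mfun (l * (2 * t))))"
    proof (rule ip_self_le[OF lin_comb[OF lin_inc lin_comb[OF Pl Ql]]])
      show "integrable \<rho> (\<lambda>l. 16 * \<delta>\<^sup>2 * (l\<^sup>2 * mfun (l * (2 * t))))" using theta_integrable[of "2 * t"] by simp
      fix l
      have "of_real (\<delta> / \<Delta>) * (\<i> * of_real (l * \<Delta>)) = \<i> * of_real (l * \<delta>)" using \<Delta> by simp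
      then have "?y l = (inc \<delta> x l - \<i> * of_real (l * \<delta>)) - of_real (\<delta> / \<Delta>) * (s l - \<i> * of_real (l * \<Delta>))"
        unfolding s_def right_diff_distrib by simp
      also have "cmod \<dots> \<le> cmod (inc \<delta> x l - \<i> * of_real (l * \<delta>)) + cmod (of_real (\<delta> / \<Delta>) * (s l - \<i> * of_real (l * \<Delta>)))"
        by (rule norm_triangle_ineq4)
      also have "\<dots> \<le> 2 * \<bar>l\<bar> * mn l * \<delta> + \<delta> / \<Delta> * (2 * \<bar>l\<bar> * mn l * \<Delta>)"
      proof (rule add_mono)
        show "cmod (inc \<delta> x l - \<i> * of_real (l * \<delta>)) \<le> 2 * \<bar>l\<bar> * mn l * \<delta>"
          using inc[of x "x + \<delta>" l] x \<delta> t by (auto simp: inc_def)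
        show "cmod (of_real (\<delta> / \<Delta>) * (s l - \<i> * of_real (l * \<Delta>))) \<le> \<delta> / \<Delta> * (2 * \<bar>l\<bar> * mn l * \<Delta>)"
          unfolding norm_mult norm_of_real using \<delta> \<Delta> s_err[of l] by (intro mult_mono) auto
      qed
      also have "\<dots> = 4 * \<bar>l\<bar> * \<delta> * mn l" using \<Delta> by simp
      finally have "cmod (?y l) \<le> 4 * \<bar>l\<bar> * \<delta> * mn l" .
      then have "(cmod (?y l))\<^sup>2 \<le> (4 * \<bar>l\<bar> * \<delta> * mn l)\<^sup>2" by (intro power_mono) auto
      also have "\<dots> = 16 * \<delta>\<^sup>2 * (l\<^sup>2 * (mn l)\<^sup>2)" by (simp add: power_mult_distrib)
      also have "\<dots> \<le> 16 * \<delta>\<^sup>2 * (l\<^sup>2 * mfun (l * (2 * t)))" using mn by (intro mult_left_mono) auto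
      finally show "(cmod (?y l))\<^sup>2 \<le> 16 * \<delta>\<^sup>2 * (l\<^sup>2 * mfun (l * (2 * t)))" .
    qed
    then show ?thesis by (simp add: theta_def)
  qed
  have "rice \<delta> t \<theta> \<theta>' \<le> (16 * \<delta>\<^sup>2 * theta (2 * t) + 16 * \<delta>\<^sup>2 * theta (2 * t)) / (4 * pi * sqrt (t\<^sup>2 * \<sigma>\<^sup>2 / 64))"
    unfolding rice_def
    by (rule order_trans[OF rice_density_le[OF Pl Ql lin_inc lin_inc \<kappa> gram[unfolded gram_def]]],
        rule divide_right_mono[OF add_mono[OF res res]]) (use t in auto)
  then show "rice \<delta> t \<theta> \<theta>' \<le> 64 / (pi * \<sigma>) * \<delta>\<^sup>2 * theta (2 * t) / t"
    unfolding sq using t sigma_pos by (simp add: field_simps)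
qed

lemma q_near:
  obtains a where "a > 0" "\<And>\<delta> t. 0 < \<delta> \<Longrightarrow> 2 * \<delta> \<le> t \<Longrightarrow> t \<le> a \<Longrightarrow> q \<delta> t \<le> 64 / (pi * \<sigma>) * \<delta>\<^sup>2 * theta (2 * t) / t"
proof -
  have "(r \<longlongrightarrow> 1) (at_right 0)"
    using DERIV_isCont[OF r_has_derivative[of 0]] unfolding isCont_def r0 by (rule tendsto_mono[OF at_le, rotated]) simp
  then have "eventually (\<lambda>\<delta>. 0 < r \<delta>) (at_right 0)" by (rule order_tendstoD) simp
  then obtain d where d: "d > 0" "\<And>\<delta>. 0 < \<delta> \<Longrightarrow> \<delta> < d \<Longrightarrow> 0 < r \<delta>" by (auto simp: eventually_at_right_field)
  have "(theta \<longlongrightarrow> 0) (at_right 0)" using theta_tendsto_0 by (rule tendsto_mono[OF at_le, rotated]) simp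
  then have "eventually (\<lambda>t. theta t < \<sigma>\<^sup>2 / 16) (at_right 0)" using sigma_pos by (intro order_tendstoD) auto
  then obtain e where e: "e > 0" "\<And>t. 0 < t \<Longrightarrow> t < e \<Longrightarrow> theta t < \<sigma>\<^sup>2 / 16" by (auto simp: eventually_at_right_field)
  \<comment> \<open>The three entries secure \<open>0 \<le> r \<delta>\<close>, the smallness of
    \<open>theta (2 t)\<close>, and \<open>49 \<sigma>^2 t^2 \<le> 1 / 16\<close>, since
    \<open>28^2 = 16 * 49\<close>.\<close>
  define a where "a = Min {d / 2, e / 4, 1 / (28 * \<sigma>)}"
  have a: "a > 0" "a \<le> d / 2" "a \<le> e / 4" "a \<le> 1 / (28 * \<sigma>)" using d e sigma_pos by (auto simp: a_def)
  show ?thesis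
  proof (rule that[OF a(1)])
    fix \<delta> t assume as: "0 < \<delta>" "2 * \<delta> \<le> t" "t \<le> a"
    have t: "t > 0" using as by simp
    have r0: "0 \<le> r \<delta>" using d as a by (auto intro!: less_imp_le)
    have th: "theta (2 * t) \<le> \<sigma>\<^sup>2 / 16" using e as a t by (auto intro!: less_imp_le)
    have "t \<le> 1 / (28 * \<sigma>)" using as a by simp
    then have "28 * \<sigma> * t \<le> 1" using sigma_pos by (simp add: field_simps)
    then have "(28 * \<sigma> * t)\<^sup>2 \<le> 1\<^sup>2" using sigma_pos t by (intro power_mono) auto
    then have s: "49 * \<sigma>\<^sup>2 * t\<^sup>2 \<le> 1 / 16" by (simp add: power_mult_distrib)
    have "0 < t\<^sup>2 * \<sigma>\<^sup>2 / 64" using t sigma_pos by simp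
    then show "q \<delta> t \<le> 64 / (pi * \<sigma>) * \<delta>\<^sup>2 * theta (2 * t) / t"
      by (rule q_bounds(1)) (use rice_near[OF as(1,2) _ _ r0 th s] in blast)+
  qed
qed

end

section \<open>The two-point intensity as a limit at a fixed lag, and the Geman integral\<close>

lemma isCont_cis: "isCont cis x"
  using continuous_on_eq_continuous_at[of UNIV cis] by (auto intro!: continuous_intros)

lemma hfun_isCont: "\<bar>x\<bar> < 1 \<Longrightarrow> isCont hfun x"
  unfolding hfun_def by (intro continuous_intros isCont_arcsin) (auto simp: abs_less_iff)

text \<open>Continuity is read off the closed form, which is valid near the limit because its strict
  conditions are open.\<close>

lemma absprod_tendsto:
  assumes lim: "(v \<longlongrightarrow> v0) F" "(c \<longlongrightarrow> c0) F" "(w \<longlongrightarrow> w0) F" and pos: "v0 > 0" "w0 > 0" "c0\<^sup>2 < v0 * w0"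
  shows "((\<lambda>x. absprod (v x) (c x) (w x)) \<longlongrightarrow> absprod v0 c0 w0) F"
proof -
  have m: "\<bar>c0 / sqrt (v0 * w0)\<bar> < 1"
  proof -
    have "(c0 / sqrt (v0 * w0))\<^sup>2 < 1" using pos by (simp add: power_divide)
    then show ?thesis by (simp add: abs_square_less_1)
  qed
  have "((\<lambda>x. sqrt (v x * w x) * (2 / pi) * hfun (c x / sqrt (v x * w x))) \<longlongrightarrow> sqrt (v0 * w0) * (2 / pi) * hfun (c0 / sqrt (v0 * w0))) F"
    by (intro tendsto_intros lim isCont_tendsto_compose[OF hfun_isCont[OF m]]) (use pos in auto)
  moreover have "\<forall>\<^sub>F x in F. sqrt (v x * w x) * (2 / pi) * hfun (c x / sqrt (v x * w x)) = absprod (v x) (c x) (w x)"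
  proof -
    have T: "((\<lambda>x. v x * w x - (c x)\<^sup>2) \<longlongrightarrow> v0 * w0 - c0\<^sup>2) F" by (intro tendsto_intros lim)
    have "\<forall>\<^sub>F x in F. 0 < v x * w x - (c x)\<^sup>2" by (rule order_tendstoD(1)[OF T]) (use pos in simp)
    moreover have "\<forall>\<^sub>F x in F. 0 < v x" "\<forall>\<^sub>F x in F. 0 < w x" using order_tendstoD(1)[OF lim(1) pos(1)] order_tendstoD(1)[OF lim(3) pos(2)] by auto
    ultimately show ?thesis by eventually_elim (simp add: absprod_eq)
  qed
  ultimately show ?thesis unfolding absprod_eq[OF pos] by (rule Lim_transform_eventually)
qed

lemma rice_density_tendsto:
  assumes lim: "(s11 \<longlongrightarrow> S11) F" "(s12 \<longlongrightarrow> S12) F" "(s22 \<longlongrightarrow> S22) F" "(d1 \<longlongrightarrow> D1) F" "(d2 \<longlongrightarrow> D2) F"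
     "(v1 \<longlongrightarrow> V1) F" "(v2 \<longlongrightarrow> V2) F" "(dd \<longlongrightarrow> DD) F" "(dv \<longlongrightarrow> DV) F" "(vv \<longlongrightarrow> VV) F"
  defines "\<Delta> \<equiv> S11 * S22 - S12\<^sup>2"
  defines "R \<equiv> \<lambda>a1 a2 b1 b2 ab. ab - (a1 * b1 * S22 - (a1 * b2 + a2 * b1) * S12 + a2 * b2 * S11) / \<Delta>"
  assumes pos: "\<Delta> > 0" "R D1 D2 D1 D2 DD > 0" "R V1 V2 V1 V2 VV > 0" "(R D1 D2 V1 V2 DV)\<^sup>2 < R D1 D2 D1 D2 DD * R V1 V2 V1 V2 VV"
  shows "((\<lambda>x. rice_density (s11 x) (s12 x) (s22 x) (d1 x) (d2 x) (v1 x) (v2 x) (dd x) (dv x) (vv x))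
    \<longlongrightarrow> rice_density S11 S12 S22 D1 D2 V1 V2 DD DV VV) F"
proof -
  have dl: "((\<lambda>x. s11 x * s22 x - (s12 x)\<^sup>2) \<longlongrightarrow> \<Delta>) F" unfolding \<Delta>_def by (intro tendsto_intros lim)
  have d0: "\<Delta> \<noteq> 0" using pos by simp
  show ?thesis
    unfolding rice_density_def Let_def \<Delta>_def[symmetric]
    by (intro tendsto_divide tendsto_mult tendsto_const tendsto_real_sqrt dl absprod_tendsto tendsto_diff tendsto_add lim d0)
       (use pos d0 in \<open>auto simp: R_def\<close>)
qed

context gaussian_zeros
begin

text \<open>Stated for arbitrary spectral functions because the limit function of the derivative is
  unbounded and not in \<open>lin\<close>. The growth \<open>1 + \<bar>l\<bar>\<close> leaves the
  majorant \<open>2 + 2 l^2\<close>.\<close>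

lemma ip_tendsto:
  fixes \<Phi> \<Psi> :: "nat \<Rightarrow> real \<Rightarrow> complex"
  assumes [measurable]: "\<And>n. \<Phi> n \<in> borel_measurable borel" "\<And>n. \<Psi> n \<in> borel_measurable borel"
      "\<phi> \<in> borel_measurable borel" "\<psi> \<in> borel_measurable borel"
    and lim: "\<And>l. (\<lambda>n. \<Phi> n l) \<longlonglongrightarrow> \<phi> l" "\<And>l. (\<lambda>n. \<Psi> n l) \<longlonglongrightarrow> \<psi> l"
    and bnd: "\<And>n l. cmod (\<Phi> n l) \<le> 1 + \<bar>l\<bar>" "\<And>n l. cmod (\<Psi> n l) \<le> 1 + \<bar>l\<bar>"
  shows "(\<lambda>n. ip (\<Phi> n) (\<Psi> n)) \<longlonglongrightarrow> ip \<phi> \<psi>"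
  unfolding ip_def
proof (rule integral_dominated_convergence[where w="\<lambda>l. 2 + 2 * l\<^sup>2"])
  show "AE l in \<rho>. (\<lambda>n. Re (\<Phi> n l * cnj (\<Psi> n l))) \<longlonglongrightarrow> Re (\<phi> l * cnj (\<psi> l))"
    by (intro AE_I2 tendsto_intros lim)
  show "AE l in \<rho>. norm (Re (\<Phi> n l * cnj (\<Psi> n l))) \<le> 2 + 2 * l\<^sup>2" for n
  proof (intro AE_I2)
    fix l
    have "norm (Re (\<Phi> n l * cnj (\<Psi> n l))) \<le> cmod (\<Phi> n l) * cmod (\<Psi> n l)"
      using abs_Re_le_cmod[of "\<Phi> n l * cnj (\<Psi> n l)"] by (simp add: norm_mult)
    also have "\<dots> \<le> (1 + \<bar>l\<bar>) * (1 + \<bar>l\<bar>)" by (intro mult_mono bnd) auto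
    also have "\<dots> \<le> 2 + 2 * l\<^sup>2" using zero_le_power2[of "1 - \<bar>l\<bar>"] by (simp add: power2_eq_square algebra_simps)
    finally show "norm (Re (\<Phi> n l * cnj (\<Psi> n l))) \<le> 2 + 2 * l\<^sup>2" .
  qed
qed (use l2_integrable in auto)

lemma ip_scale_left: "ip (\<lambda>l. of_real k * \<phi> l) \<psi> = k * ip \<phi> \<psi>"
proof -
  have "Re (of_real k * \<phi> l * cnj (\<psi> l)) = k * Re (\<phi> l * cnj (\<psi> l))" for l by (simp add: mult.assoc algebra_simps)
  then show ?thesis unfolding ip_def by simp
qed

lemma ip_scale_right: "ip \<psi> (\<lambda>l. of_real k * \<phi> l) = k * ip \<psi> \<phi>"
  using ip_scale_left by (simp add: ip_commute)

definition ninc :: "real \<Rightarrow> real \<Rightarrow> real \<Rightarrow> complex" where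
  "ninc \<delta> t l = of_real (1 / \<delta>) * inc \<delta> t l"

lemma rice_scaled:
  assumes "\<delta> > 0"
  shows "rice \<delta> t \<theta> \<theta>' = \<delta>\<^sup>2 * rice_density (ip (pt \<delta> 0 \<theta>) (pt \<delta> 0 \<theta>)) (ip (pt \<delta> 0 \<theta>) (pt \<delta> t \<theta>')) (ip (pt \<delta> t \<theta>') (pt \<delta> t \<theta>'))
     (ip (ninc \<delta> 0) (pt \<delta> 0 \<theta>)) (ip (ninc \<delta> 0) (pt \<delta> t \<theta>')) (ip (ninc \<delta> t) (pt \<delta> 0 \<theta>)) (ip (ninc \<delta> t) (pt \<delta> t \<theta>'))
     (ip (ninc \<delta> 0) (ninc \<delta> 0)) (ip (ninc \<delta> 0) (ninc \<delta> t)) (ip (ninc \<delta> t) (ninc \<delta> t))"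
proof -
  have e: "inc \<delta> t = (\<lambda>l. of_real \<delta> * ninc \<delta> t l)" for t using assms by (intro ext) (simp add: ninc_def)
  have 1: "ip (inc \<delta> t) \<psi> = \<delta> * ip (ninc \<delta> t) \<psi>" for t \<psi> unfolding e by (rule ip_scale_left)
  have 2: "ip (inc \<delta> t) (inc \<delta> s) = \<delta>\<^sup>2 * ip (ninc \<delta> t) (ninc \<delta> s)" for t s
    unfolding 1 unfolding e[of s] ip_scale_right by (simp add: power2_eq_square)
  show ?thesis unfolding rice_def 2 unfolding 1 by (rule rice_density_scale[OF assms])
qed

lemma inc_eq: "inc \<delta> t l = cis (l * t) * (cis (l * \<delta>) - 1)"
  by (simp add: inc_def distrib_left cis_mult[symmetric] right_diff_distrib)

text \<open>The limit is the spectral function of the mean square derivative. The starting times may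
  vary with the mesh, as the cell containing a given lag does.\<close>

lemma ninc_tendsto:
  assumes \<delta>: "\<delta> \<longlonglongrightarrow> 0" "\<And>n. \<delta> n > 0" and t: "t \<longlonglongrightarrow> \<tau>"
  shows "(\<lambda>n. ninc (\<delta> n) (t n) l) \<longlonglongrightarrow> \<i> * of_real l * cis (l * \<tau>)"
proof -
  have "(\<lambda>n. (cis (l * \<delta> n) - 1) / of_real (\<delta> n) - \<i> * of_real l) \<longlonglongrightarrow> 0"
  proof (rule Lim_null_comparison)
    show "(\<lambda>n. 2 * l\<^sup>2 * \<delta> n) \<longlonglongrightarrow> 0" using tendsto_mult[OF tendsto_const \<delta>(1), of "2 * l\<^sup>2"] by simp
    show "\<forall>\<^sub>F n in sequentially. cmod ((cis (l * \<delta> n) - 1) / of_real (\<delta> n) - \<i> * of_real l) \<le> 2 * l\<^sup>2 * \<delta> n"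
    proof (intro always_eventually allI)
      fix n
      have "cmod (cis (l * \<delta> n) - cis 0 - \<i> * of_real (l * \<delta> n - 0)) \<le> 2 * \<bar>l * \<delta> n - 0\<bar> * min 2 \<bar>l * \<delta> n\<bar>"
        by (rule cmod_cis_increment) auto
      also have "\<dots> \<le> 2 * \<bar>l * \<delta> n - 0\<bar> * \<bar>l * \<delta> n\<bar>" by (intro mult_left_mono) auto
      finally have "cmod (cis (l * \<delta> n) - 1 - \<i> * of_real (l * \<delta> n)) / \<delta> n \<le> 2 * l\<^sup>2 * \<delta> n"
        using \<delta>(2)[of n] by (simp add: field_simps power2_eq_square)
      moreover have "(cis (l * \<delta> n) - 1) / of_real (\<delta> n) - \<i> * of_real l = (cis (l * \<delta> n) - 1 - \<i> * of_real (l * \<delta> n)) / of_real (\<delta> n)"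
        using \<delta>(2)[of n] by (simp add: field_simps)
      ultimately show "cmod ((cis (l * \<delta> n) - 1) / of_real (\<delta> n) - \<i> * of_real l) \<le> 2 * l\<^sup>2 * \<delta> n"
        using \<delta>(2)[of n] by (simp add: norm_divide)
    qed
  qed
  from Lim_transform[OF tendsto_const this] have 1: "(\<lambda>n. (cis (l * \<delta> n) - 1) / of_real (\<delta> n)) \<longlonglongrightarrow> \<i> * of_real l"
    by (simp add: LIM_zero_iff Lim_null[symmetric])
  have 2: "(\<lambda>n. cis (l * t n)) \<longlonglongrightarrow> cis (l * \<tau>)" by (intro isCont_tendsto_compose[OF isCont_cis] tendsto_mult tendsto_const t)
  show ?thesis using tendsto_mult[OF 2 1] by (simp add: ninc_def inc_eq mult_ac)
qed

lemma pt_tendsto: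
  assumes \<delta>: "\<delta> \<longlonglongrightarrow> 0" "\<And>n. \<delta> n > 0" and t: "t \<longlonglongrightarrow> \<tau>" and \<theta>: "\<And>n. \<theta> n \<in> {0..1}"
  shows "(\<lambda>n. pt (\<delta> n) (t n) (\<theta> n) l) \<longlonglongrightarrow> cis (l * \<tau>)"
proof -
  have 2: "(\<lambda>n. cis (l * t n)) \<longlonglongrightarrow> cis (l * \<tau>)" by (intro isCont_tendsto_compose[OF isCont_cis] tendsto_mult tendsto_const t)
  have "(\<lambda>n. of_real (\<theta> n) * inc (\<delta> n) (t n) l) \<longlonglongrightarrow> 0"
  proof (rule Lim_null_comparison)
    show "(\<lambda>n. \<bar>l\<bar> * \<delta> n) \<longlonglongrightarrow> 0" using tendsto_mult[OF tendsto_const \<delta>(1), of "\<bar>l\<bar>"] by simp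
    show "\<forall>\<^sub>F n in sequentially. cmod (of_real (\<theta> n) * inc (\<delta> n) (t n) l) \<le> \<bar>l\<bar> * \<delta> n"
    proof (intro always_eventually allI)
      fix n
      have "\<theta> n * cmod (inc (\<delta> n) (t n) l) \<le> 1 * (\<bar>l\<bar> * \<delta> n)"
        using \<theta>[of n] cmod_inc_le[of "\<delta> n" "t n" l] \<delta>(2)[of n] by (intro mult_mono) auto
      then show "cmod (of_real (\<theta> n) * inc (\<delta> n) (t n) l) \<le> \<bar>l\<bar> * \<delta> n" using \<theta>[of n] by (simp add: norm_mult)
    qed
  qed
  from tendsto_add[OF 2 this] show ?thesis by (simp add: pt_def)
qed

lemma cmod_ninc_le: "\<delta> > 0 \<Longrightarrow> cmod (ninc \<delta> t l) \<le> 1 + \<bar>l\<bar>"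
  using cmod_inc_le[of \<delta> t l] by (simp add: ninc_def norm_mult norm_divide field_simps)

lemma cmod_pt_le:
  assumes "\<theta> \<in> {0..1}" shows "cmod (pt \<delta> t \<theta> l) \<le> 1 + \<bar>l\<bar>"
proof -
  have "pt \<delta> t \<theta> l = of_real (1 - \<theta>) * cis (l * t) + of_real \<theta> * cis (l * (t + \<delta>))"
    by (simp add: pt_def inc_def algebra_simps)
  also have "cmod \<dots> \<le> (1 - \<theta>) + \<theta>" using assms by (intro norm_triangle_le) (simp only: norm_mult norm_of_real norm_cis; simp)
  finally show ?thesis by simp
qed

lemma pt_measurable[measurable]: "pt \<delta> t \<theta> \<in> borel_measurable borel" by (rule lin_measurable2[OF lin_pt])
lemma ninc_measurable[measurable]: "ninc \<delta> t \<in> borel_measurable borel"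
  unfolding ninc_def[abs_def] using lin_measurable2[OF lin_inc] by measurable

lemma limit_ips:
  defines "C \<equiv> \<lambda>t l. cis (l * t)" and "E \<equiv> \<lambda>t l. \<i> * of_real l * cis (l * t)"
  shows "ip (C s) (C t) = r (s - t)" "ip (E s) (C t) = r1 (s - t)" "ip (E s) (E t) = - r2 (s - t)"
proof -
  show "ip (C s) (C t) = r (s - t)" unfolding C_def by (rule ip_cis)
  have "Re (E s l * cnj (C t l)) = - (l * sin (l * (s - t)))" for l
    unfolding E_def C_def by (simp add: sin_diff right_diff_distrib algebra_simps)
  then show "ip (E s) (C t) = r1 (s - t)" unfolding ip_def r1_def by simp
  have "Re (E s l * cnj (E t l)) = l\<^sup>2 * cos (l * (s - t))" for l
    unfolding E_def by (simp add: cos_diff right_diff_distrib power2_eq_square algebra_simps)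
  then show "ip (E s) (E t) = - r2 (s - t)" unfolding ip_def r2_def by simp
qed

text \<open>The Kac-Rice two-point intensity. The arguments are the covariances of the values and of
  the mean square derivatives at 0 and \<open>\<tau>\<close>; the zeros express that value and
  derivative at the same time are uncorrelated.\<close>

definition Kac :: "real \<Rightarrow> real" where
  "Kac \<tau> = rice_density 1 (r \<tau>) 1 0 (- r1 \<tau>) (r1 \<tau>) 0 (\<sigma>\<^sup>2) (- r2 \<tau>) (\<sigma>\<^sup>2)"

text \<open>The threshold 1/4 is a convenient choice: it keeps \<open>1 - x^2 - y^2\<close> above
  7/8 in the normalised covariances and the conditional correlation of the slopes strictly below
  1.\<close>

definition tame :: "real \<Rightarrow> bool" where
  "tame \<tau> \<longleftrightarrow> \<tau> > 0 \<and> \<bar>r \<tau>\<bar> \<le> 1/4 \<and> \<bar>r1 \<tau> / \<sigma>\<bar> \<le> 1/4 \<and> \<bar>r2 \<tau> / \<sigma>\<^sup>2\<bar> \<le> 1/4"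

lemma tame_facts:
  assumes "tame \<tau>"
  defines "x \<equiv> r \<tau>" and "y \<equiv> r1 \<tau> / \<sigma>" and "z \<equiv> r2 \<tau> / \<sigma>\<^sup>2"
  shows "x\<^sup>2 \<le> 1/16" "y\<^sup>2 \<le> 1/16" "7/8 \<le> 1 - x\<^sup>2 - y\<^sup>2" "\<bar>z * (1 - x\<^sup>2) + x * y\<^sup>2\<bar> < 1 - x\<^sup>2 - y\<^sup>2"
    "r1 \<tau> = \<sigma> * y" "r2 \<tau> = \<sigma>\<^sup>2 * z"
proof -
  have b: "\<bar>x\<bar> \<le> 1/4" "\<bar>y\<bar> \<le> 1/4" "\<bar>z\<bar> \<le> 1/4" using assms by (auto simp: tame_def)
  have "x\<^sup>2 \<le> (1/4)\<^sup>2" "y\<^sup>2 \<le> (1/4)\<^sup>2" using b abs_le_square_iff[of x "1/4"] abs_le_square_iff[of y "1/4"] by auto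
  then show xy: "x\<^sup>2 \<le> 1/16" "y\<^sup>2 \<le> 1/16" by (auto simp: power2_eq_square)
  then show g: "7/8 \<le> 1 - x\<^sup>2 - y\<^sup>2" by simp
  have "\<bar>z * (1 - x\<^sup>2)\<bar> \<le> 1/4 * 1" unfolding abs_mult using b xy by (intro mult_mono) auto
  moreover have "\<bar>x * y\<^sup>2\<bar> \<le> 1/4 * (1/16)" unfolding abs_mult using b xy by (intro mult_mono) auto
  ultimately show "\<bar>z * (1 - x\<^sup>2) + x * y\<^sup>2\<bar> < 1 - x\<^sup>2 - y\<^sup>2" using g by linarith
  show "r1 \<tau> = \<sigma> * y" "r2 \<tau> = \<sigma>\<^sup>2 * z" using sigma_pos by (auto simp: y_def z_def)
qed

lemma Kac_aux:
  assumes "tame \<tau>"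
  defines "x \<equiv> r \<tau>" and "y \<equiv> r1 \<tau> / \<sigma>" and "z \<equiv> r2 \<tau> / \<sigma>\<^sup>2"
  defines "\<Delta> \<equiv> 1 * 1 - (r \<tau>)\<^sup>2"
  defines "R \<equiv> \<lambda>a1 a2 b1 b2 ab. ab - (a1 * b1 * 1 - (a1 * b2 + a2 * b1) * r \<tau> + a2 * b2 * 1) / \<Delta>"
  shows "\<Delta> = 1 - x\<^sup>2" "\<Delta> > 0"
    "R 0 (- r1 \<tau>) 0 (- r1 \<tau>) (\<sigma>\<^sup>2) = \<sigma>\<^sup>2 * ((1 - x\<^sup>2 - y\<^sup>2) / (1 - x\<^sup>2))"
    "R (r1 \<tau>) 0 (r1 \<tau>) 0 (\<sigma>\<^sup>2) = \<sigma>\<^sup>2 * ((1 - x\<^sup>2 - y\<^sup>2) / (1 - x\<^sup>2))"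
    "R 0 (- r1 \<tau>) (r1 \<tau>) 0 (- r2 \<tau>) = - \<sigma>\<^sup>2 * ((z * (1 - x\<^sup>2) + x * y\<^sup>2) / (1 - x\<^sup>2))"
    "R 0 (- r1 \<tau>) 0 (- r1 \<tau>) (\<sigma>\<^sup>2) > 0"
    "(R 0 (- r1 \<tau>) (r1 \<tau>) 0 (- r2 \<tau>))\<^sup>2 < R 0 (- r1 \<tau>) 0 (- r1 \<tau>) (\<sigma>\<^sup>2) * R (r1 \<tau>) 0 (r1 \<tau>) 0 (\<sigma>\<^sup>2)"
proof -
  note T = tame_facts[OF assms(1), folded x_def y_def z_def]
  show D: "\<Delta> = 1 - x\<^sup>2" by (simp add: \<Delta>_def x_def)
  have p: "1 - x\<^sup>2 > 0" using T(1) by simp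
  then show "\<Delta> > 0" by (simp add: D)
  show 1: "R 0 (- r1 \<tau>) 0 (- r1 \<tau>) (\<sigma>\<^sup>2) = \<sigma>\<^sup>2 * ((1 - x\<^sup>2 - y\<^sup>2) / (1 - x\<^sup>2))"
    unfolding R_def T(5) D using p by (simp add: field_simps power2_eq_square)
  show 2: "R (r1 \<tau>) 0 (r1 \<tau>) 0 (\<sigma>\<^sup>2) = \<sigma>\<^sup>2 * ((1 - x\<^sup>2 - y\<^sup>2) / (1 - x\<^sup>2))"
    unfolding R_def T(5) D using p by (simp add: field_simps power2_eq_square)
  show 3: "R 0 (- r1 \<tau>) (r1 \<tau>) 0 (- r2 \<tau>) = - \<sigma>\<^sup>2 * ((z * (1 - x\<^sup>2) + x * y\<^sup>2) / (1 - x\<^sup>2))"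
    unfolding R_def T(5,6) D x_def[symmetric] using p by (simp add: field_simps power2_eq_square)
  show "R 0 (- r1 \<tau>) 0 (- r1 \<tau>) (\<sigma>\<^sup>2) > 0"
    unfolding 1 using p T(3) sigma_pos by (intro mult_pos_pos divide_pos_pos) auto
  have sq: "(- k * (A / B))\<^sup>2 = k * k * A\<^sup>2 / B\<^sup>2" "k * (A / B) * (k * (A / B)) = k * k * A\<^sup>2 / B\<^sup>2" for k A B :: real
    by (simp_all add: power_mult_distrib power_divide power2_eq_square)
  have "(z * (1 - x\<^sup>2) + x * y\<^sup>2)\<^sup>2 < (1 - x\<^sup>2 - y\<^sup>2)\<^sup>2"
    using T(3,4) power_strict_mono[OF T(4), of 2] by simp
  then have "\<sigma>\<^sup>2 * \<sigma>\<^sup>2 * (z * (1 - x\<^sup>2) + x * y\<^sup>2)\<^sup>2 / (1 - x\<^sup>2)\<^sup>2 < \<sigma>\<^sup>2 * \<sigma>\<^sup>2 * (1 - x\<^sup>2 - y\<^sup>2)\<^sup>2 / (1 - x\<^sup>2)\<^sup>2"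
    using p sigma_pos by (intro divide_strict_right_mono mult_strict_left_mono) auto
  then show "(R 0 (- r1 \<tau>) (r1 \<tau>) 0 (- r2 \<tau>))\<^sup>2 < R 0 (- r1 \<tau>) 0 (- r1 \<tau>) (\<sigma>\<^sup>2) * R (r1 \<tau>) 0 (r1 \<tau>) 0 (\<sigma>\<^sup>2)"
    unfolding 1 2 3 sq .
qed

text \<open>In the normalised coordinates the argument of \<open>hfun\<close> is the correlation of
  the two slopes given zeros at both times, and the prefactor is their conditional variance over the
  root of the Gram determinant.\<close>

lemma Kac_eq:
  assumes "tame \<tau>"
  defines "x \<equiv> r \<tau>" and "y \<equiv> r1 \<tau> / \<sigma>" and "z \<equiv> r2 \<tau> / \<sigma>\<^sup>2"
  shows "Kac \<tau> = \<sigma>\<^sup>2 / pi\<^sup>2 * ((1 - x\<^sup>2 - y\<^sup>2) / ((1 - x\<^sup>2) * sqrt (1 - x\<^sup>2)) * hfun (- (z * (1 - x\<^sup>2) + x * y\<^sup>2) / (1 - x\<^sup>2 - y\<^sup>2)))"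
proof -
  note T = tame_facts[OF assms(1), folded x_def y_def z_def]
  note A = Kac_aux[OF assms(1), folded x_def y_def z_def]
  have p: "1 - x\<^sup>2 > 0" "1 - x\<^sup>2 - y\<^sup>2 > 0" using T by auto
  let ?v = "\<sigma>\<^sup>2 * ((1 - x\<^sup>2 - y\<^sup>2) / (1 - x\<^sup>2))" and ?c = "- \<sigma>\<^sup>2 * ((z * (1 - x\<^sup>2) + x * y\<^sup>2) / (1 - x\<^sup>2))"
  have v: "?v > 0" using A(6) unfolding A(3) .
  have "Kac \<tau> = absprod ?v ?c ?v / (2 * pi * sqrt (1 - x\<^sup>2))"
    unfolding Kac_def rice_density_def Let_def x_def[symmetric] A(3,4,5) unfolding A(1) ..
  also have "absprod ?v ?c ?v = sqrt (?v * ?v) * (2 / pi) * hfun (?c / sqrt (?v * ?v))"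
    using A(7) unfolding A(3,4,5) by (rule absprod_eq[OF v v])
  also have "sqrt (?v * ?v) = ?v" using v by (simp only: real_sqrt_abs2 abs_of_pos)
  also have "?c / ?v = - (z * (1 - x\<^sup>2) + x * y\<^sup>2) / (1 - x\<^sup>2 - y\<^sup>2)"
  proof -
    have "(- k * (A / B)) / (k * (D / B)) = - A / D" if "k \<noteq> 0" "B \<noteq> 0" for k A B D :: real
      using that by simp
    then show ?thesis by this (use p sigma_pos in auto)
  qed
  finally have "Kac \<tau> = ?v * (2 / pi) * hfun (- (z * (1 - x\<^sup>2) + x * y\<^sup>2) / (1 - x\<^sup>2 - y\<^sup>2)) / (2 * pi * sqrt (1 - x\<^sup>2))" .
  moreover have "s * (g / k) * (2 / pi) * h / (2 * pi * m) = s / pi\<^sup>2 * (g / (k * m) * h)" for s g k h m :: real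
    by (simp add: power2_eq_square)
  ultimately show ?thesis by (simp only:)
qed

text \<open>\<open>q\<close> is only enclosed between bounds of \<open>rice\<close> over all
  parameters. For each \<open>n\<close> nearly extremal parameters are selected; along any selection
  \<open>rice / \<delta>^2\<close> has the same limit, since the interpolation points merge. Thus no
  separate uniformity argument is required.\<close>

lemma q_limit:
  assumes \<tau>: "tame \<tau>" and \<delta>: "\<delta> \<longlonglongrightarrow> 0" "\<And>n. \<delta> n > 0" and t: "t \<longlonglongrightarrow> \<tau>"
  shows "(\<lambda>n. q (\<delta> n) (t n) / (\<delta> n)\<^sup>2) \<longlonglongrightarrow> Kac \<tau>"
proof -
  have \<tau>0: "\<tau> > 0" using \<tau> by (simp add: tame_def)
  have lim: "(\<lambda>n. rice (\<delta> n) (t n) (\<theta> n) (\<theta>' n) / (\<delta> n)\<^sup>2) \<longlonglongrightarrow> Kac \<tau>"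
    if \<theta>: "\<And>n. \<theta> n \<in> {0..1}" "\<And>n. \<theta>' n \<in> {0..1}" for \<theta> \<theta>'
  proof -
    note A = Kac_aux[OF \<tau>]
    define C where "C t = (\<lambda>l. cis (l * t))" for t
    define E where "E t = (\<lambda>l. \<i> * of_real l * cis (l * t))" for t
    have [measurable]: "C s \<in> borel_measurable borel" "E s \<in> borel_measurable borel" for s by (simp_all add: C_def E_def)
    note L = limit_ips[folded C_def E_def]
    have c0: "(\<lambda>n. 0 :: real) \<longlonglongrightarrow> 0" by simp
    have 1: "(\<lambda>n. pt (\<delta> n) 0 (\<theta> n) l) \<longlonglongrightarrow> C 0 l" for l unfolding C_def by (rule pt_tendsto[OF \<delta> c0 \<theta>(1)])
    have 2: "(\<lambda>n. pt (\<delta> n) (t n) (\<theta>' n) l) \<longlonglongrightarrow> C \<tau> l" for l unfolding C_def by (rule pt_tendsto[OF \<delta> t \<theta>(2)])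
    have 3: "(\<lambda>n. ninc (\<delta> n) 0 l) \<longlonglongrightarrow> E 0 l" for l unfolding E_def by (rule ninc_tendsto[OF \<delta> c0])
    have 4: "(\<lambda>n. ninc (\<delta> n) (t n) l) \<longlonglongrightarrow> E \<tau> l" for l unfolding E_def by (rule ninc_tendsto[OF \<delta> t])
    have v: "ip (C 0) (C 0) = 1" "ip (C 0) (C \<tau>) = r \<tau>" "ip (C \<tau>) (C \<tau>) = 1" "ip (E 0) (C 0) = 0" "ip (E 0) (C \<tau>) = - r1 \<tau>"
      "ip (E \<tau>) (C 0) = r1 \<tau>" "ip (E \<tau>) (C \<tau>) = 0" "ip (E 0) (E 0) = \<sigma>\<^sup>2" "ip (E 0) (E \<tau>) = - r2 \<tau>" "ip (E \<tau>) (E \<tau>) = \<sigma>\<^sup>2"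
      unfolding L by (simp_all add: r0 r_minus r2_minus) (simp_all add: r1_def r2_def sigma_def)
    define P where "P n = pt (\<delta> n) 0 (\<theta> n)" for n
    define Q where "Q n = pt (\<delta> n) (t n) (\<theta>' n)" for n
    define D where "D n = ninc (\<delta> n) 0" for n
    define V where "V n = ninc (\<delta> n) (t n)" for n
    note PQDV = P_def Q_def D_def V_def
    note m = pt_measurable[of "\<delta> n" 0 "\<theta> n" for n, folded P_def] pt_measurable[of "\<delta> n" "t n" "\<theta>' n" for n, folded Q_def]
      ninc_measurable[of "\<delta> n" 0 for n, folded D_def] ninc_measurable[of "\<delta> n" "t n" for n, folded V_def]
    have mC: "C s \<in> borel_measurable borel" and mE: "E s \<in> borel_measurable borel" for s by (simp_all add: C_def E_def)
    note l = 1[folded P_def] 2[folded Q_def] 3[folded D_def] 4[folded V_def]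
    have b: "cmod (P n l) \<le> 1 + \<bar>l\<bar>" "cmod (Q n l) \<le> 1 + \<bar>l\<bar>" "cmod (D n l) \<le> 1 + \<bar>l\<bar>" "cmod (V n l) \<le> 1 + \<bar>l\<bar>" for n l
      unfolding PQDV using cmod_pt_le \<theta> cmod_ninc_le \<delta>(2) by auto
    have "(\<lambda>n. rice_density (ip (P n) (P n)) (ip (P n) (Q n)) (ip (Q n) (Q n)) (ip (D n) (P n)) (ip (D n) (Q n))
      (ip (V n) (P n)) (ip (V n) (Q n)) (ip (D n) (D n)) (ip (D n) (V n)) (ip (V n) (V n))) \<longlonglongrightarrow> Kac \<tau>"
      unfolding Kac_def
      by (rule rice_density_tendsto[OF
         ip_tendsto[OF m(1) m(1) mC mC l(1) l(1) b(1) b(1), unfolded v]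
         ip_tendsto[OF m(1) m(2) mC mC l(1) l(2) b(1) b(2), unfolded v]
         ip_tendsto[OF m(2) m(2) mC mC l(2) l(2) b(2) b(2), unfolded v]
         ip_tendsto[OF m(3) m(1) mE mC l(3) l(1) b(3) b(1), unfolded v]
         ip_tendsto[OF m(3) m(2) mE mC l(3) l(2) b(3) b(2), unfolded v]
         ip_tendsto[OF m(4) m(1) mE mC l(4) l(1) b(4) b(1), unfolded v]
         ip_tendsto[OF m(4) m(2) mE mC l(4) l(2) b(4) b(2), unfolded v]
         ip_tendsto[OF m(3) m(3) mE mE l(3) l(3) b(3) b(3), unfolded v]
         ip_tendsto[OF m(3) m(4) mE mE l(3) l(4) b(3) b(4), unfolded v]
         ip_tendsto[OF m(4) m(4) mE mE l(4) l(4) b(4) b(4), unfolded v] A(2) A(6) _ A(7)])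
       (unfold A(4), use A(6)[unfolded A(3)] in simp)
    note K = this[unfolded PQDV]
    have "rice (\<delta> n) (t n) (\<theta> n) (\<theta>' n) / (\<delta> n)\<^sup>2 = rice_density (ip (pt (\<delta> n) 0 (\<theta> n)) (pt (\<delta> n) 0 (\<theta> n))) (ip (pt (\<delta> n) 0 (\<theta> n)) (pt (\<delta> n) (t n) (\<theta>' n))) (ip (pt (\<delta> n) (t n) (\<theta>' n)) (pt (\<delta> n) (t n) (\<theta>' n)))
     (ip (ninc (\<delta> n) 0) (pt (\<delta> n) 0 (\<theta> n))) (ip (ninc (\<delta> n) 0) (pt (\<delta> n) (t n) (\<theta>' n))) (ip (ninc (\<delta> n) (t n)) (pt (\<delta> n) 0 (\<theta> n))) (ip (ninc (\<delta> n) (t n)) (pt (\<delta> n) (t n) (\<theta>' n)))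
     (ip (ninc (\<delta> n) 0) (ninc (\<delta> n) 0)) (ip (ninc (\<delta> n) 0) (ninc (\<delta> n) (t n))) (ip (ninc (\<delta> n) (t n)) (ninc (\<delta> n) (t n)))" for n
      unfolding rice_scaled[OF \<delta>(2)] using \<delta>(2)[of n] by simp
    then show ?thesis using K by simp
  qed
  obtain \<kappa> \<delta>0 where k: "\<kappa> > 0" "\<delta>0 > 0" "\<And>\<delta> t \<theta> \<theta>'. 0 < \<delta> \<Longrightarrow> \<delta> \<le> \<delta>0 \<Longrightarrow> \<tau> / 2 \<le> t \<Longrightarrow> \<theta> \<in> {0..1} \<Longrightarrow> \<theta>' \<in> {0..1} \<Longrightarrow> \<kappa> \<le> gram \<delta> t \<theta> \<theta>'"
    using gram_far[of "\<tau> / 2"] \<tau>0 by (metis half_gt_zero)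
  have ev: "\<forall>\<^sub>F n in sequentially. \<delta> n \<le> \<delta>0 \<and> \<tau> / 2 \<le> t n"
    using order_tendstoD(2)[OF \<delta>(1) k(2)] order_tendstoD(1)[OF t, of "\<tau> / 2"] \<tau>0
    by (auto elim: eventually_elim2 simp: less_imp_le)
  \<comment> \<open>The slack \<open>\<delta>^3\<close> turns the bound into an attained inequality
    and is lost after division by \<open>\<delta>^2\<close>.\<close>
  have up: "\<exists>\<theta> \<theta>'. \<theta> \<in> {0..1} \<and> \<theta>' \<in> {0..1} \<and> (\<delta> n \<le> \<delta>0 \<and> \<tau> / 2 \<le> t n \<longrightarrow> q (\<delta> n) (t n) - (\<delta> n)^3 \<le> rice (\<delta> n) (t n) \<theta> \<theta>')" for n
  proof (rule ccontr)
    assume c: "\<not> ?thesis"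
    have c': "\<delta> n \<le> \<delta>0 \<and> \<tau> / 2 \<le> t n \<and> rice (\<delta> n) (t n) \<theta> \<theta>' < q (\<delta> n) (t n) - (\<delta> n)^3" if "\<theta> \<in> {0..1}" "\<theta>' \<in> {0..1}" for \<theta> \<theta>'
    proof -
      have "\<not> (\<delta> n \<le> \<delta>0 \<and> \<tau> / 2 \<le> t n \<longrightarrow> \<not> (rice (\<delta> n) (t n) \<theta> \<theta>' < q (\<delta> n) (t n) - (\<delta> n)^3))" using c that unfolding not_less by blast
      then show ?thesis by blast
    qed
    have g: "\<delta> n \<le> \<delta>0" "\<tau> / 2 \<le> t n" using c'[of 0 0] by auto
    have "q (\<delta> n) (t n) \<le> q (\<delta> n) (t n) - (\<delta> n)^3"
      by (rule q_bounds(1)[OF k(1) k(3)[OF \<delta>(2) g]], assumption, assumption) (use c' in \<open>auto intro: less_imp_le\<close>)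
    then show False using zero_less_power[OF \<delta>(2)[of n], of 3] by linarith
  qed
  have lo: "\<exists>\<theta> \<theta>'. \<theta> \<in> {0..1} \<and> \<theta>' \<in> {0..1} \<and> (\<delta> n \<le> \<delta>0 \<and> \<tau> / 2 \<le> t n \<longrightarrow> rice (\<delta> n) (t n) \<theta> \<theta>' \<le> q (\<delta> n) (t n) + (\<delta> n)^3)" for n
  proof (rule ccontr)
    assume c: "\<not> ?thesis"
    have c': "\<delta> n \<le> \<delta>0 \<and> \<tau> / 2 \<le> t n \<and> q (\<delta> n) (t n) + (\<delta> n)^3 < rice (\<delta> n) (t n) \<theta> \<theta>'" if "\<theta> \<in> {0..1}" "\<theta>' \<in> {0..1}" for \<theta> \<theta>'
    proof -
      have "\<not> (\<delta> n \<le> \<delta>0 \<and> \<tau> / 2 \<le> t n \<longrightarrow> \<not> (q (\<delta> n) (t n) + (\<delta> n)^3 < rice (\<delta> n) (t n) \<theta> \<theta>'))" using c that unfolding not_less by blast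
      then show ?thesis by blast
    qed
    have g: "\<delta> n \<le> \<delta>0" "\<tau> / 2 \<le> t n" using c'[of 0 0] by auto
    have "q (\<delta> n) (t n) + (\<delta> n)^3 \<le> q (\<delta> n) (t n)"
      by (rule q_bounds(2)[OF k(1) k(3)[OF \<delta>(2) g]], assumption, assumption) (use c' in \<open>auto intro: less_imp_le\<close>)
    then show False using zero_less_power[OF \<delta>(2)[of n], of 3] by linarith
  qed
  obtain \<theta> \<theta>' where u: "\<And>n. \<theta> n \<in> {0..1}" "\<And>n. \<theta>' n \<in> {0..1}"
    "\<And>n. \<delta> n \<le> \<delta>0 \<and> \<tau> / 2 \<le> t n \<Longrightarrow> q (\<delta> n) (t n) - (\<delta> n)^3 \<le> rice (\<delta> n) (t n) (\<theta> n) (\<theta>' n)"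
    using up by metis
  obtain \<eta> \<eta>' where l: "\<And>n. \<eta> n \<in> {0..1}" "\<And>n. \<eta>' n \<in> {0..1}"
    "\<And>n. \<delta> n \<le> \<delta>0 \<and> \<tau> / 2 \<le> t n \<Longrightarrow> rice (\<delta> n) (t n) (\<eta> n) (\<eta>' n) \<le> q (\<delta> n) (t n) + (\<delta> n)^3"
    using lo by metis
  show ?thesis
  proof (rule tendsto_sandwich[where f="\<lambda>n. rice (\<delta> n) (t n) (\<eta> n) (\<eta>' n) / (\<delta> n)\<^sup>2 - \<delta> n" and h="\<lambda>n. rice (\<delta> n) (t n) (\<theta> n) (\<theta>' n) / (\<delta> n)\<^sup>2 + \<delta> n"])
    have d3: "\<delta> n ^ 3 / (\<delta> n)\<^sup>2 = \<delta> n" for n using \<delta>(2)[of n] by (simp add: power2_eq_square power3_eq_cube)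
    show "\<forall>\<^sub>F n in sequentially. rice (\<delta> n) (t n) (\<eta> n) (\<eta>' n) / (\<delta> n)\<^sup>2 - \<delta> n \<le> q (\<delta> n) (t n) / (\<delta> n)\<^sup>2"
      using ev
    proof eventually_elim
      case (elim n)
      show ?case using divide_right_mono[OF l(3)[OF elim], of "(\<delta> n)\<^sup>2"] d3[of n] by (simp add: add_divide_distrib)
    qed
    show "\<forall>\<^sub>F n in sequentially. q (\<delta> n) (t n) / (\<delta> n)\<^sup>2 \<le> rice (\<delta> n) (t n) (\<theta> n) (\<theta>' n) / (\<delta> n)\<^sup>2 + \<delta> n"
      using ev
    proof eventually_elim
      case (elim n)
      show ?case using divide_right_mono[OF u(3)[OF elim], of "(\<delta> n)\<^sup>2"] d3[of n] by (simp add: diff_divide_distrib)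
    qed
    show "(\<lambda>n. rice (\<delta> n) (t n) (\<eta> n) (\<eta>' n) / (\<delta> n)\<^sup>2 - \<delta> n) \<longlonglongrightarrow> Kac \<tau>"
      using tendsto_diff[OF lim[OF l(1,2)] \<delta>(1)] by simp
    show "(\<lambda>n. rice (\<delta> n) (t n) (\<theta> n) (\<theta>' n) / (\<delta> n)\<^sup>2 + \<delta> n) \<longlonglongrightarrow> Kac \<tau>"
      using tendsto_add[OF lim[OF u(1,2)] \<delta>(1)] by simp
  qed
qed

text \<open>By Tonelli the integral over \<open>t\<close> is taken first, for a fixed frequency,
  where the special form of \<open>mfun\<close> gives \<open>4 ln (1 + l^2)\<close>. This is at most
  \<open>8 ln (1 + \<bar>l\<bar>)\<close>, so the Geman condition gives finiteness.\<close>

lemma theta_over_t_integrable: "integrable lborel (\<lambda>t. indicat_real {0..1} t * (theta (2 * t) / t))"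
proof -
  have m2: "(\<lambda>t. theta (2 * t)) \<in> borel_measurable borel"
    unfolding theta_def by (rule R.borel_measurable_lebesgue_integral) (simp add: split_beta')
  have pos: "1 + l\<^sup>2 * t\<^sup>2 > 0" for l t :: real by (simp add: add_pos_nonneg)
  interpret pair_sigma_finite lborel \<rho> ..
  let ?g = "\<lambda>t l. ennreal (l\<^sup>2 * (8 * l\<^sup>2 * t / (1 + l\<^sup>2 * t\<^sup>2))) * indicator {0..1} t"
  have "(\<integral>\<^sup>+t. ennreal (indicat_real {0..1} t * (theta (2 * t) / t)) \<partial>lborel) = (\<integral>\<^sup>+t. \<integral>\<^sup>+l. ?g t l \<partial>\<rho> \<partial>lborel)"
  proof (intro nn_integral_cong)
    fix t :: real
    show "ennreal (indicat_real {0..1} t * (theta (2 * t) / t)) = (\<integral>\<^sup>+l. ?g t l \<partial>\<rho>)"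
    proof (cases "0 < t \<and> t \<le> 1")
      case True
      have e: "l\<^sup>2 * mfun (l * (2 * t)) / t = l\<^sup>2 * (8 * l\<^sup>2 * t / (1 + l\<^sup>2 * t\<^sup>2))" for l
      proof -
        have A: "8 * (4 * A) / (4 + 4 * A) = 8 * A / (1 + A)" if "A \<ge> 0" for A :: real
        proof -
          have "8 * (4 * A) / (4 + 4 * A) = (4 * (8 * A)) / (4 * (1 + A))" by (simp add: distrib_left)
          then show ?thesis by (simp only: mult_divide_mult_cancel_left_if) simp
        qed
        have "(l * (2 * t))\<^sup>2 = 4 * (l\<^sup>2 * t\<^sup>2)" by (simp add: power_mult_distrib)
        then have "mfun (l * (2 * t)) = 8 * (l\<^sup>2 * t\<^sup>2) / (1 + l\<^sup>2 * t\<^sup>2)" unfolding mfun_def using A[of "l\<^sup>2 * t\<^sup>2"] by simp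
        moreover have "8 * (l\<^sup>2 * t\<^sup>2) = 8 * l\<^sup>2 * t * t" by (simp add: power2_eq_square)
        ultimately have "mfun (l * (2 * t)) = 8 * l\<^sup>2 * t / (1 + l\<^sup>2 * t\<^sup>2) * t" by simp
        then show ?thesis using True by simp
      qed
      have i: "integrable \<rho> (\<lambda>l. l\<^sup>2 * mfun (l * (2 * t)) / t)" using theta_integrable[of "2 * t"] by simp
      have "theta (2 * t) / t = (LINT l|\<rho>. l\<^sup>2 * mfun (l * (2 * t)) / t)" by (simp add: theta_def)
      also have "ennreal \<dots> = (\<integral>\<^sup>+l. ennreal (l\<^sup>2 * mfun (l * (2 * t)) / t) \<partial>\<rho>)"
        using i True by (intro nn_integral_eq_integral[symmetric]) (auto intro!: mult_nonneg_nonneg divide_nonneg_nonneg mfun_nonneg)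
      finally show ?thesis using True by (simp add: e)
    qed (auto simp: indicator_def)
  qed
  also have "\<dots> = (\<integral>\<^sup>+l. \<integral>\<^sup>+t. ?g t l \<partial>lborel \<partial>\<rho>)"
    by (rule Fubini'[symmetric]) (simp add: split_beta')
  also have "\<dots> = (\<integral>\<^sup>+l. ennreal (l\<^sup>2 * (4 * ln (1 + l\<^sup>2))) \<partial>\<rho>)"
  proof (intro nn_integral_cong)
    fix l :: real
    have "(\<integral>\<^sup>+t. ennreal (8 * l\<^sup>2 * t / (1 + l\<^sup>2 * t\<^sup>2)) * indicator {0..1} t \<partial>lborel) = ennreal (4 * ln (1 + l\<^sup>2 * 1\<^sup>2) - 4 * ln (1 + l\<^sup>2 * 0\<^sup>2))"
    proof (rule nn_integral_FTC_Icc[where F="\<lambda>t. 4 * ln (1 + l\<^sup>2 * t\<^sup>2)"])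
      fix t :: real assume t: "t \<in> {0..1}"
      show "((\<lambda>t. 4 * ln (1 + l\<^sup>2 * t\<^sup>2)) has_real_derivative 8 * l\<^sup>2 * t / (1 + l\<^sup>2 * t\<^sup>2)) (at t)"
        using pos[of l t] by (auto intro!: derivative_eq_intros simp: power2_eq_square)
      show "0 \<le> 8 * l\<^sup>2 * t / (1 + l\<^sup>2 * t\<^sup>2)" using pos[of l t] t by simp
    qed auto
    then have "(\<integral>\<^sup>+t. ennreal (8 * l\<^sup>2 * t / (1 + l\<^sup>2 * t\<^sup>2)) * indicator {0..1} t \<partial>lborel) = ennreal (4 * ln (1 + l\<^sup>2))" by simp
    moreover have "(\<integral>\<^sup>+t. ?g t l \<partial>lborel) = (\<integral>\<^sup>+t. ennreal (l\<^sup>2) * (ennreal (8 * l\<^sup>2 * t / (1 + l\<^sup>2 * t\<^sup>2)) * indicator {0..1} t) \<partial>lborel)"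
      by (intro nn_integral_cong) (auto simp: indicator_def ennreal_mult[symmetric] less_imp_le[OF pos])
    ultimately show "(\<integral>\<^sup>+t. ?g t l \<partial>lborel) = ennreal (l\<^sup>2 * (4 * ln (1 + l\<^sup>2)))"
      by (simp add: nn_integral_cmult ennreal_mult)
  qed
  also have "\<dots> \<le> (\<integral>\<^sup>+l. ennreal (8 * (ln (1 + \<bar>l\<bar>) * l\<^sup>2)) \<partial>\<rho>)"
  proof (intro nn_integral_mono ennreal_leI)
    fix l :: real
    have "1 + l\<^sup>2 \<le> (1 + \<bar>l\<bar>)\<^sup>2" by (simp add: power2_eq_square algebra_simps)
    then have "ln (1 + l\<^sup>2) \<le> ln ((1 + \<bar>l\<bar>)\<^sup>2)" by (subst ln_le_cancel_iff) (auto simp: add_pos_nonneg)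
    also have "\<dots> = 2 * ln (1 + \<bar>l\<bar>)" by (subst ln_realpow) auto
    finally have "l\<^sup>2 * (4 * ln (1 + l\<^sup>2)) \<le> l\<^sup>2 * (4 * (2 * ln (1 + \<bar>l\<bar>)))" by (intro mult_left_mono) auto
    then show "l\<^sup>2 * (4 * ln (1 + l\<^sup>2)) \<le> 8 * (ln (1 + \<bar>l\<bar>) * l\<^sup>2)" by (simp add: mult_ac)
  qed
  also have "\<dots> < \<infinity>" using geman by (subst nn_integral_eq_integral) auto
  finally have fin: "(\<integral>\<^sup>+t. ennreal (indicat_real {0..1} t * (theta (2 * t) / t)) \<partial>lborel) < \<infinity>" .
  show ?thesis
  proof (rule integrableI_nonneg[OF _ _ fin])
    show "AE t in lborel. 0 \<le> indicat_real {0..1} t * (theta (2 * t) / t)"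
      by (intro AE_I2) (auto simp: indicator_def theta_nonneg)
  qed (use m2 in measurable)
qed

end

section \<open>Zeros and sign changes of continuous functions\<close>

definition grid :: "real \<Rightarrow> nat \<Rightarrow> nat \<Rightarrow> real" where
  "grid T n i = real i * (T / 2 ^ n)"

definition changes :: "(real \<Rightarrow> real) \<Rightarrow> real \<Rightarrow> real \<Rightarrow> nat \<Rightarrow> nat set" where
  "changes g u T n = {j. j < 2 ^ n \<and> (g (grid T n j) < u) \<noteq> (g (grid T n (Suc j)) < u)}"

definition cell :: "real \<Rightarrow> nat \<Rightarrow> real \<Rightarrow> nat" where
  "cell T n a = nat \<lfloor>a / (T / 2 ^ n)\<rfloor>"

lemma finite_changes[simp]: "finite (changes g u T n)"
  by (simp add: changes_def)

lemma grid_Suc: "grid T n (Suc j) = grid T n j + T / 2 ^ n"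
  by (simp add: grid_def distrib_right add_divide_distrib)

lemma grid_refine: "grid T (n + d) (j * 2 ^ d) = grid T n j"
  by (simp add: grid_def power_add)

lemma cell_bounds:
  assumes "T > 0" "0 \<le> a"
  shows "grid T n (cell T n a) \<le> a" "a < grid T n (Suc (cell T n a))"
proof -
  have d: "T / 2 ^ n > 0" using assms by simp
  have c: "real (cell T n a) = of_int \<lfloor>a / (T / 2 ^ n)\<rfloor>"
    using assms d by (simp add: cell_def)
  have "real (cell T n a) \<le> a / (T / 2 ^ n)" unfolding c by (rule of_int_floor_le)
  then show "grid T n (cell T n a) \<le> a" unfolding grid_def using d by (simp only: pos_le_divide_eq)
  have "a / (T / 2 ^ n) < real (cell T n a) + 1" unfolding c by linarith
  then show "a < grid T n (Suc (cell T n a))" unfolding grid_def of_nat_Suc using d by (simp only: pos_divide_less_eq add.commute)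
qed

lemma cell_less:
  assumes "T > 0" "0 \<le> a" "a < T"
  shows "cell T n a < 2 ^ n"
proof -
  have "real (cell T n a) * (T / 2 ^ n) < T" using cell_bounds(1)[OF assms(1,2), of n] assms(3) by (simp add: grid_def)
  then have "real (cell T n a) < 2 ^ n" using assms(1) by (simp add: field_simps)
  then show ?thesis by (metis of_nat_less_iff of_nat_numeral of_nat_power)
qed

lemma cell_unique:
  assumes "T > 0" "grid T n i \<le> a" "a < grid T n (Suc i)"
  shows "cell T n a = i"
proof -
  have d: "T / 2 ^ n > 0" using assms by simp
  have "real i \<le> a / (T / 2 ^ n)" "a / (T / 2 ^ n) < real i + 1"
    using assms(2,3) d unfolding grid_def of_nat_Suc by (simp_all only: pos_le_divide_eq pos_divide_less_eq add.commute)
  then have "\<lfloor>a / (T / 2 ^ n)\<rfloor> = int i" by (simp add: floor_eq_iff)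
  then show ?thesis by (simp add: cell_def)
qed

lemma mesh_small:
  assumes "T > 0" "e > (0::real)"
  obtains N where "\<And>n. n \<ge> N \<Longrightarrow> T / 2 ^ n < e"
proof -
  have "(\<lambda>n. T * (1 / 2) ^ n) \<longlonglongrightarrow> T * 0" by (intro tendsto_intros LIMSEQ_realpow_zero) auto
  then have "\<forall>\<^sub>F n in sequentially. T * (1 / 2) ^ n < e" using assms by (intro order_tendstoD) auto
  then obtain N where "\<And>n. n \<ge> N \<Longrightarrow> T * (1 / 2) ^ n < e" by (auto simp: eventually_sequentially)
  moreover have "T * (1 / 2) ^ n = T / 2 ^ n" for n by (simp add: power_one_over)
  ultimately show ?thesis using that[of N] by (simp only:)
qed

lemma cells_inj:
  assumes T: "T > 0" and A: "finite A" "A \<subseteq> {0..<T}"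
  obtains N where "\<And>n. n \<ge> N \<Longrightarrow> inj_on (cell T n) A"
proof -
  \<comment> \<open>The extra 1 keeps the set nonempty when \<open>A\<close> has at most one
    point.\<close>
  define D where "D = insert 1 ((\<lambda>(a, b). \<bar>a - b\<bar>) ` {(a, b) \<in> A \<times> A. a \<noteq> b})"
  have D: "finite D" "D \<noteq> {}" "\<And>x. x \<in> D \<Longrightarrow> x > 0"
  proof -
    have "finite {(a, b) \<in> A \<times> A. a \<noteq> b}" by (rule finite_subset[of _ "A \<times> A"]) (use A in auto)
    then show "finite D" unfolding D_def by (intro finite.insertI finite_imageI)
  qed (auto simp: D_def)
  then have "Min D > 0" by simp
  then obtain N where N: "\<And>n. n \<ge> N \<Longrightarrow> T / 2 ^ n < Min D" using mesh_small[OF T] by metis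
  show ?thesis
  proof (rule that, rule inj_onI, rule ccontr)
    fix n a b assume as: "n \<ge> N" "a \<in> A" "b \<in> A" "cell T n a = cell T n b" "a \<noteq> b"
    have ab: "0 \<le> a" "0 \<le> b" using as A by auto
    have "\<bar>a - b\<bar> < T / 2 ^ n"
      using cell_bounds[OF T ab(1), of n] cell_bounds[OF T ab(2), of n] unfolding as(4) grid_Suc by linarith
    moreover have "\<bar>a - b\<bar> \<in> D" using as by (force simp: D_def)
    ultimately show False using N[OF as(1)] Min_le[OF D(1)] by force
  qed
qed

text \<open>A block on which the sequence is not constant contains a jump, and jumps in different
  blocks are different.\<close>

lemma card_varying_blocks_le:
  fixes s :: "nat \<Rightarrow> bool"
  assumes "J \<subseteq> {..<2 ^ n}" and J: "\<And>j. j \<in> J \<Longrightarrow> \<exists>i. j * 2 ^ d \<le> i \<and> i \<le> Suc j * 2 ^ d \<and> s i \<noteq> s (j * 2 ^ d)"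
  shows "card J \<le> card {i. i < 2 ^ (n + d) \<and> s i \<noteq> s (Suc i)}"
proof -
  have "\<exists>k. j * 2 ^ d \<le> k \<and> k < Suc j * 2 ^ d \<and> s k \<noteq> s (Suc k)" if "j \<in> J" for j
  proof (rule ccontr)
    assume c: "\<not> ?thesis"
    have "s k = s (j * 2 ^ d)" if "j * 2 ^ d \<le> k" "k \<le> Suc j * 2 ^ d" for k
      using that
    proof (induction k rule: dec_induct)
      case (step k)
      then show ?case using c by auto
    qed simp
    then show False using J[OF that] by blast
  qed
  then obtain h where h: "\<And>j. j \<in> J \<Longrightarrow> j * 2 ^ d \<le> h j \<and> h j < Suc j * 2 ^ d \<and> s (h j) \<noteq> s (Suc (h j))" by metis
  have div: "h j div 2 ^ d = j" if "j \<in> J" for j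
    using h[OF that] by (intro div_nat_eqI) (auto simp: mult.commute)
  have "inj_on h J" by (rule inj_on_inverseI[where g="\<lambda>k. k div 2 ^ d"]) (use div in auto)
  moreover have "h ` J \<subseteq> {i. i < 2 ^ (n + d) \<and> s i \<noteq> s (Suc i)}"
  proof (rule image_subsetI)
    fix j assume j: "j \<in> J"
    then have "Suc j \<le> 2 ^ n" using assms(1) by auto
    then have "Suc j * 2 ^ d \<le> 2 ^ n * 2 ^ d" by (rule mult_right_mono) simp
    then show "h j \<in> {i. i < 2 ^ (n + d) \<and> s i \<noteq> s (Suc i)}" using h[OF j] by (auto simp: power_add)
  qed
  ultimately show ?thesis by (intro card_inj_on_le) auto
qed

text \<open>The second alternative is made for a cell whose endpoints agree but inside which a finer
  grid point lies on the other side of the level.\<close>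

lemma card_changes_refine:
  assumes "J \<subseteq> {..<2 ^ n}"
    and "\<And>j. j \<in> J \<Longrightarrow> j \<in> changes g u T n \<or>
      (\<exists>i. j * 2 ^ d \<le> i \<and> i \<le> Suc j * 2 ^ d \<and> (g (grid T (n + d) i) < u) \<noteq> (g (grid T n j) < u))"
  shows "card J \<le> card (changes g u T (n + d))"
  unfolding changes_def
proof (rule card_varying_blocks_le[OF assms(1)])
  fix j assume "j \<in> J"
  from assms(2)[OF this] show "\<exists>i. j * 2 ^ d \<le> i \<and> i \<le> Suc j * 2 ^ d \<and>
      (g (grid T (n + d) i) < u) \<noteq> (g (grid T (n + d) (j * 2 ^ d)) < u)"
  proof
    assume "j \<in> changes g u T n"
    then show ?thesis unfolding grid_refine by (intro exI[of _ "Suc j * 2 ^ d"]) (simp only: grid_refine, auto simp: changes_def)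
  qed (simp only: grid_refine)
qed

lemma card_changes_mono:
  assumes "n \<le> m" shows "card (changes g u T n) \<le> card (changes g u T m)"
proof -
  obtain d where m: "m = n + d" using assms le_Suc_ex by blast
  show ?thesis unfolding m by (rule card_changes_refine) (auto simp: changes_def)
qed

text \<open>The intermediate value theorem might return the right endpoint, which belongs to the
  next cell; nonvanishing grid values exclude this.\<close>

lemma changes_zero:
  assumes T: "T > 0" and g: "continuous_on UNIV g" and nz: "\<And>i. g (grid T n i) \<noteq> 0" and j: "j \<in> changes g 0 T n"
  obtains t where "t \<in> {0..T}" "g t = 0" "cell T n t = j"
proof -
  have lt: "grid T n j < grid T n (Suc j)" using T by (simp add: grid_Suc)
  have cont: "continuous_on {grid T n j..grid T n (Suc j)} g" using g continuous_on_subset by blast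
  have "\<exists>t\<ge>grid T n j. t \<le> grid T n (Suc j) \<and> g t = 0"
  proof (cases "g (grid T n j) < 0")
    case True
    then have "0 \<le> g (grid T n (Suc j))" using j by (auto simp: changes_def)
    then show ?thesis using IVT'[of g "grid T n j" 0 "grid T n (Suc j)"] True lt cont by auto
  next
    case False
    then have "g (grid T n (Suc j)) < 0" using j by (auto simp: changes_def)
    then show ?thesis using IVT2'[of g "grid T n (Suc j)" 0 "grid T n j"] False lt cont by auto
  qed
  then obtain t where t: "grid T n j \<le> t" "t \<le> grid T n (Suc j)" "g t = 0" by blast
  then have t2: "t < grid T n (Suc j)" using nz[of "Suc j"] by (cases "t = grid T n (Suc j)") auto
  have "Suc j \<le> 2 ^ n" using j by (auto simp: changes_def)
  then have "real (Suc j) \<le> 2 ^ n" by (metis of_nat_le_iff of_nat_numeral of_nat_power)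
  then have "grid T n (Suc j) \<le> 2 ^ n * (T / 2 ^ n)" unfolding grid_def using T by (intro mult_right_mono) auto
  then have "t \<le> T" using t by simp
  moreover have "0 \<le> t" using t T by (auto simp: grid_def intro: order_trans[rotated])
  ultimately show ?thesis using that[of t] t cell_unique[OF T t(1) t2] by auto
qed

text \<open>A zero without a sign change forces an additional sign change at all sufficiently small levels of one sign.\<close>

lemma zeros_dichotomy:
  assumes T: "T > 0" and g: "continuous_on UNIV g" and nz: "\<And>n i. g (grid T n i) \<noteq> 0"
    and st: "\<And>n. n \<ge> N \<Longrightarrow> card (changes g 0 T n) = m"
  shows "(finite {t \<in> {0..T}. g t = 0} \<and> card {t \<in> {0..T}. g t = 0} = m) \<or>
     (\<exists>\<mu>>0. \<forall>u. 0 < u \<and> u < \<mu> \<longrightarrow> (\<exists>n. Suc m \<le> card (changes g u T n))) \<or>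
     (\<exists>\<mu>>0. \<forall>u. 0 < u \<and> u < \<mu> \<longrightarrow> (\<exists>n. Suc m \<le> card (changes g (- u) T n)))"
proof (cases "finite {t \<in> {0..T}. g t = 0} \<and> card {t \<in> {0..T}. g t = 0} = m")
  case False
  let ?Z = "{t \<in> {0..T}. g t = 0}"
  have gT: "g T \<noteq> 0" using nz[of 0 1] by (simp add: grid_def)
  have "m \<le> card ?Z" if fin: "finite ?Z"
  proof -
    have "\<forall>j\<in>changes g 0 T N. \<exists>t. t \<in> ?Z \<and> cell T N t = j"
    proof
      fix j assume j: "j \<in> changes g 0 T N"
      obtain t where "t \<in> {0..T}" "g t = 0" "cell T N t = j" by (rule changes_zero[OF T g nz j])
      then show "\<exists>t. t \<in> ?Z \<and> cell T N t = j" by blast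
    qed
    then obtain h where h: "\<forall>j\<in>changes g 0 T N. h j \<in> ?Z \<and> cell T N (h j) = j" by (rule bchoice[elim_format]) blast
    have "inj_on h (changes g 0 T N)" by (rule inj_on_inverseI[where g="cell T N"]) (use h in auto)
    then have "card (changes g 0 T N) \<le> card ?Z" using h fin by (intro card_inj_on_le) auto
    then show ?thesis using st[of N] by simp
  qed
  then have "infinite ?Z \<or> Suc m \<le> card ?Z" using False by fastforce
  then have "\<exists>A. A \<subseteq> ?Z \<and> finite A \<and> card A = Suc m"
  proof
    assume "infinite ?Z"
    from infinite_arbitrarily_large[OF this, of "Suc m"] show ?thesis by blast
  next
    assume "Suc m \<le> card ?Z"
    from obtain_subset_with_card_n[OF this] show ?thesis by metis
  qed
  then obtain A where A: "A \<subseteq> ?Z" "finite A" "card A = Suc m" by blast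
  have A2: "A \<subseteq> {0..<T}" using A gT by (force simp: order_le_less)
  obtain N' where N': "\<And>n. n \<ge> N' \<Longrightarrow> inj_on (cell T n) A" using cells_inj[OF T A(2) A2] by metis
  define n where "n = max N N'"
  have inj: "inj_on (cell T n) A" and cm: "card (changes g 0 T n) = m" using N' st by (auto simp: n_def)
  \<comment> \<open>Pigeonhole: \<open>m + 1\<close> zeros lie in different cells but only
    \<open>m\<close> cells change sign, so some zero \<open>a\<close> sits in a cell without a
    change.\<close>
  have "\<not> cell T n ` A \<subseteq> changes g 0 T n"
    using card_mono[OF finite_changes, of "cell T n ` A" g 0 T n] card_image[OF inj] A(3) cm by auto
  then obtain a where a: "a \<in> A" "cell T n a \<notin> changes g 0 T n" by auto
  define j where "j = cell T n a"
  have a0: "0 \<le> a" "a < T" "g a = 0" using a A A2 by auto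
  have jn: "j < 2 ^ n" unfolding j_def by (rule cell_less[OF T a0(1,2)])
  have same: "(g (grid T n j) < 0) = (g (grid T n (Suc j)) < 0)" using a(2) jn by (auto simp: changes_def j_def)
  \<comment> \<open>Levels below the smallest modulus on the grid leave all sign changes of
    generation \<open>n\<close> in place.\<close>
  define \<mu> where "\<mu> = Min ((\<lambda>i. \<bar>g (grid T n i)\<bar>) ` {..2 ^ n})"
  have \<mu>: "\<mu> > 0" "\<And>i. i \<le> 2 ^ n \<Longrightarrow> \<mu> \<le> \<bar>g (grid T n i)\<bar>"
  proof -
    show "\<mu> > 0" unfolding \<mu>_def using nz by (subst Min_gr_iff) auto
    show "\<mu> \<le> \<bar>g (grid T n i)\<bar>" if "i \<le> 2 ^ n" for i unfolding \<mu>_def using that by (intro Min_le) auto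
  qed
  have sgn: "(g (grid T n i) < u) = (g (grid T n i) < 0)" if "i \<le> 2 ^ n" "\<bar>u\<bar> < \<mu>" for i u
    using \<mu>(2)[OF that(1)] that(2) by (auto simp: abs_if split: if_splits)
  have ch: "changes g u T n = changes g 0 T n" if "\<bar>u\<bar> < \<mu>" for u
    unfolding changes_def using sgn[OF _ that] by (auto simp: Suc_leI)
  \<comment> \<open>If \<open>u\<close> has the sign of \<open>g\<close> at the ends of the cell,
    the ends lie beyond the level \<open>u\<close>, while points near the zero do not. A finer grid
    meets such a point and gains a change.\<close>
  have key: "\<exists>k. Suc m \<le> card (changes g u T k)" if u: "\<bar>u\<bar> < \<mu>" "u \<noteq> 0" "(0 < u) = (\<not> g (grid T n j) < 0)" for u
  proof -
    have "isCont g a" using g continuous_on_eq_continuous_at[of UNIV g] by simp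
    then obtain e where e: "e > 0" "\<And>x. \<bar>x - a\<bar> < e \<Longrightarrow> \<bar>g x - g a\<bar> < \<bar>u\<bar>"
      using u(2) unfolding continuous_at_eps_delta dist_real_def by (metis zero_less_abs_iff)
    obtain d0 where d0: "\<And>k. k \<ge> d0 \<Longrightarrow> T / 2 ^ k < e" using mesh_small[OF T e(1)] by metis
    define d where "d = d0"
    define i where "i = cell T (n + d) a"
    have i: "grid T (n + d) i \<le> a" "a < grid T (n + d) (Suc i)" unfolding i_def using cell_bounds[OF T a0(1)] by auto
    have "\<bar>grid T (n + d) i - a\<bar> < T / 2 ^ (n + d)" using i unfolding grid_Suc by linarith
    then have "\<bar>grid T (n + d) i - a\<bar> < e" using d0[of "n + d"] by (simp add: d_def)
    then have gi: "\<bar>g (grid T (n + d) i)\<bar> < \<bar>u\<bar>" using e(2) a0 by simp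
    have mono: "grid T (n + d) x < grid T (n + d) y \<longleftrightarrow> x < y" for x y using T by (simp add: grid_def divide_less_cancel)
    have lo: "j * 2 ^ d \<le> i"
    proof -
      have "grid T (n + d) (j * 2 ^ d) < grid T (n + d) (Suc i)"
        unfolding grid_refine j_def using cell_bounds(1)[OF T a0(1), of n] i(2) by linarith
      then show ?thesis unfolding mono by simp
    qed
    have hi: "i \<le> Suc j * 2 ^ d"
    proof -
      have "grid T (n + d) i < grid T (n + d) (Suc j * 2 ^ d)"
        unfolding grid_refine j_def using cell_bounds(2)[OF T a0(1), of n] i(1) by linarith
      then show ?thesis unfolding mono by simp
    qed
    have neq: "(g (grid T (n + d) i) < u) \<noteq> (g (grid T n j) < u)"
      using gi u(3) sgn[of j u] jn u(1) by (auto simp: abs_if split: if_splits)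
    have "card (insert j (changes g u T n)) \<le> card (changes g u T (n + d))"
      by (rule card_changes_refine) (use jn lo hi neq in \<open>auto simp: changes_def\<close>)
    moreover have "j \<notin> changes g u T n" using a(2) ch[OF u(1)] by (simp add: j_def)
    ultimately have "Suc m \<le> card (changes g u T (n + d))" using ch[OF u(1)] cm by simp
    then show ?thesis by blast
  qed
  show ?thesis
  proof (cases "g (grid T n j) < 0")
    case True
    have "\<exists>k. Suc m \<le> card (changes g (- u) T k)" if "0 < u" "u < \<mu>" for u using key[of "- u"] that True by auto
    then show ?thesis using \<mu>(1) by blast
  next
    case False
    have "\<exists>k. Suc m \<le> card (changes g u T k)" if "0 < u" "u < \<mu>" for u using key[of u] that False by auto
    then show ?thesis using \<mu>(1) by blast
  qed
qed simp

section \<open>Measurability of the number of zeros, by counting cells that contain one\<close>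

definition zcells :: "(real \<Rightarrow> real) \<Rightarrow> real \<Rightarrow> nat \<Rightarrow> nat set" where
  "zcells g T n = {j. j < 2 ^ n \<and> (\<exists>t. grid T n j \<le> t \<and> t < grid T n (Suc j) \<and> g t = 0)}"

lemma zcells_eq:
  assumes T: "T > 0"
  shows "zcells g T n = cell T n ` {t \<in> {0..<T}. g t = 0}"
proof (intro equalityI subsetI)
  fix j assume "j \<in> zcells g T n"
  then obtain t where t: "j < 2 ^ n" "grid T n j \<le> t" "t < grid T n (Suc j)" "g t = 0" by (auto simp: zcells_def)
  have "real (Suc j) \<le> 2 ^ n" using t(1) by (metis Suc_leI of_nat_le_iff of_nat_numeral of_nat_power)
  then have "grid T n (Suc j) \<le> 2 ^ n * (T / 2 ^ n)" unfolding grid_def using T by (intro mult_right_mono) auto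
  then have "t < T" using t by simp
  moreover have "0 \<le> t" using t T by (auto simp: grid_def intro: order_trans[rotated])
  ultimately show "j \<in> cell T n ` {t \<in> {0..<T}. g t = 0}" using cell_unique[OF T t(2,3)] t(4) by (intro image_eqI[of _ _ t]) auto
next
  fix j assume "j \<in> cell T n ` {t \<in> {0..<T}. g t = 0}"
  then obtain t where t: "j = cell T n t" "0 \<le> t" "t < T" "g t = 0" by auto
  show "j \<in> zcells g T n"
    unfolding zcells_def t(1) using cell_less[OF T t(2,3), of n] cell_bounds[OF T t(2), of n] t(4) by blast
qed

text \<open>Any finite set of zeros is eventually separated by the cells. If there are infinitely
  many zeros the supremum is infinite, and \<open>enn2real\<close> sends it to 0, which agrees with
  \<open>card\<close> of an infinite set. The endpoint \<open>T\<close> is counted apart because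
  cells are half open.\<close>

lemma zero_count_SUP:
  assumes T: "T > 0"
  shows "real (card {t \<in> {0..T}. g t = 0}) = enn2real (SUP n. of_nat (card (zcells g T n) + (if g T = 0 then 1 else 0)))"
proof -
  let ?Z = "{t \<in> {0..<T}. g t = 0}"
  let ?b = "if g T = 0 then 1 else 0 :: nat"
  have Z: "{t \<in> {0..T}. g t = 0} = ?Z \<union> (if g T = 0 then {T} else {})" using T by (auto simp: less_le)
  have lb: "\<exists>n. card A \<le> card (zcells g T n)" if fin: "finite A" and sub: "A \<subseteq> ?Z" for A
  proof -
    have sub': "A \<subseteq> {0..<T}" using sub by auto
    obtain N where N: "inj_on (cell T N) A" using cells_inj[OF T fin sub'] by blast
    have "card A = card (cell T N ` A)" using N by (simp add: card_image)
    also have "\<dots> \<le> card (zcells g T N)" 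
    proof (rule card_mono)
      show "finite (zcells g T N)" by (simp add: zcells_def)
      show "cell T N ` A \<subseteq> zcells g T N" using sub unfolding zcells_eq[OF T] by (rule image_mono)
    qed
    finally show ?thesis by blast
  qed
  show ?thesis
  proof (cases "finite ?Z")
    case True
    have c: "card {t \<in> {0..T}. g t = 0} = card ?Z + ?b" unfolding Z using True by (subst card_Un_disjoint) auto
    obtain N where N: "card ?Z \<le> card (zcells g T N)" using lb[OF True] by auto
    have ub: "card (zcells g T n) \<le> card ?Z" for n unfolding zcells_eq[OF T] by (rule card_image_le[OF True])
    have "(SUP n. of_nat (card (zcells g T n) + ?b)) = (of_nat (card ?Z + ?b) :: ennreal)"
    proof (rule antisym)
      show "(SUP n. of_nat (card (zcells g T n) + ?b)) \<le> (of_nat (card ?Z + ?b) :: ennreal)"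
        using ub by (intro SUP_least) (auto simp del: of_nat_add)
      show "(of_nat (card ?Z + ?b) :: ennreal) \<le> (SUP n. of_nat (card (zcells g T n) + ?b))"
        using N by (intro SUP_upper2[of N]) (auto simp del: of_nat_add)
    qed
    then show ?thesis unfolding c by (simp only: enn2real_of_nat)
  next
    case False
    have "(of_nat k :: ennreal) \<le> (SUP n. of_nat (card (zcells g T n) + ?b))" for k
    proof -
      obtain A where A: "finite A" "card A = k" "A \<subseteq> ?Z" using infinite_arbitrarily_large[OF False] by blast
      obtain n where "k \<le> card (zcells g T n)" using lb[OF A(1,3)] unfolding A(2) by blast
      then show ?thesis by (intro SUP_upper2[of n]) (auto simp del: of_nat_add)
    qed
    then have "(SUP k. of_nat k) \<le> (SUP n. of_nat (card (zcells g T n) + ?b) :: ennreal)" by (intro SUP_least)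
    then have S: "(SUP n. of_nat (card (zcells g T n) + ?b)) = (top :: ennreal)"
      unfolding ennreal_SUP_of_nat_eq_top by (simp only: top_unique)
    have inf: "infinite {t \<in> {0..T}. g t = 0}" using False unfolding Z by simp
    show ?thesis unfolding S card.infinite[OF inf] by simp
  qed
qed

lemma ennreal_eq_of_le_nn_integral_le:
  fixes f g :: "'b \<Rightarrow> ennreal"
  assumes [measurable]: "f \<in> borel_measurable M" "g \<in> borel_measurable M"
    and le: "AE x in M. f x \<le> g x" and int: "(\<integral>\<^sup>+x. g x \<partial>M) \<le> (\<integral>\<^sup>+x. f x \<partial>M)" and fin: "(\<integral>\<^sup>+x. f x \<partial>M) < \<infinity>"
  shows "AE x in M. f x = g x"
proof -
  have "(\<integral>\<^sup>+x. g x - f x \<partial>M) = (\<integral>\<^sup>+x. g x \<partial>M) - (\<integral>\<^sup>+x. f x \<partial>M)"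
    by (rule nn_integral_diff) (use le fin in auto)
  also have "\<dots> = 0" using int fin by (simp add: diff_eq_0_iff_ennreal)
  finally have "AE x in M. g x - f x = 0" by (subst (asm) nn_integral_0_iff_AE) auto
  moreover have "AE x in M. f x \<noteq> \<infinity>" using fin by (intro nn_integral_PInf_AE) auto
  ultimately show ?thesis using le
  proof eventually_elim
    case (elim x)
    then have "g x \<le> f x" by (metis diff_eq_0_iff_ennreal infinity_ennreal_def less_top top.not_eq_extremum leD not_less)
    then show ?case using elim by simp
  qed
qed

section \<open>Sign changes of the process at small levels and their agreement with the
  zeros\<close>

context gaussian_zeros
begin

abbreviation path :: "'a \<Rightarrow> real \<Rightarrow> real" where "path \<omega> \<equiv> \<lambda>t. f t \<omega>"

definition sc :: "real \<Rightarrow> real \<Rightarrow> nat \<Rightarrow> 'a \<Rightarrow> nat" where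
  "sc u T n \<omega> = card (changes (path \<omega>) u T n)"

lemma sc_sum: "\<omega> \<in> space M \<Longrightarrow> real (sc u T n \<omega>) = (\<Sum>j<2 ^ n. indicat_real (chg u (grid T n j) (T / 2 ^ n)) \<omega>)"
proof -
  assume w: "\<omega> \<in> space M"
  have "changes (path \<omega>) u T n = {..<2 ^ n} \<inter> {j. \<omega> \<in> chg u (grid T n j) (T / 2 ^ n)}"
    using w by (auto simp: changes_def chg_def grid_Suc)
  then show ?thesis by (simp add: sc_def indicator_def of_bool_def sum.If_cases)
qed

lemma sc_measurable[measurable]: "(\<lambda>\<omega>. real (sc u T n \<omega>)) \<in> borel_measurable M"
  by (subst measurable_cong[OF sc_sum]) auto

lemma sc_le: "sc u T n \<omega> \<le> 2 ^ n"
  unfolding sc_def using card_mono[of "{..<2 ^ n}" "changes (path \<omega>) u T n"] by (auto simp: changes_def)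

lemma sc_mono: "n \<le> m \<Longrightarrow> sc u T n \<omega> \<le> sc u T m \<omega>"
  unfolding sc_def by (rule card_changes_mono)

lemma sc_integrable: "integrable M (\<lambda>\<omega>. real (sc u T n \<omega>))"
  by (rule bounded_integrable[where B="2 ^ n"]) (auto, metis of_nat_le_iff of_nat_numeral of_nat_power sc_le)

lemma expectation_sc: "expectation (\<lambda>\<omega>. real (sc u T n \<omega>)) = 2 ^ n * prob (chg u 0 (T / 2 ^ n))"
proof -
  have "expectation (\<lambda>\<omega>. real (sc u T n \<omega>)) = expectation (\<lambda>\<omega>. \<Sum>j<2 ^ n. indicat_real (chg u (grid T n j) (T / 2 ^ n)) \<omega>)"
    by (intro Bochner_Integration.integral_cong refl sc_sum)
  also have "\<dots> = (\<Sum>j<(2::nat) ^ n. prob (chg u (grid T n j) (T / 2 ^ n)))"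
  proof (subst Bochner_Integration.integral_sum)
    show "integrable M (indicat_real (chg u (grid T n j) (T / 2 ^ n)))" for j
      by (rule integrable_real_indicator[OF chg_sets]) (simp add: emeasure_eq_measure)
    show "(\<Sum>j<(2::nat) ^ n. expectation (indicat_real (chg u (grid T n j) (T / 2 ^ n)))) = (\<Sum>j<(2::nat) ^ n. prob (chg u (grid T n j) (T / 2 ^ n)))"
      by (intro sum.cong refl) (simp only: Bochner_Integration.integral_indicator sets.Int_space_eq2 chg_sets)
  qed
  also have "\<dots> = 2 ^ n * prob (chg u 0 (T / 2 ^ n))" using prob_chg_shift1[of u "grid T n j" "T / 2 ^ n" for j] by simp
  finally show ?thesis .
qed

text \<open>Refinement never loses sign changes, so the supremum is also the limit over the dyadic
  levels and monotone convergence gives its expectation.\<close>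

definition SC :: "real \<Rightarrow> real \<Rightarrow> 'a \<Rightarrow> ennreal" where
  "SC u T \<omega> = (SUP n. ennreal (real (sc u T n \<omega>)))"

lemma SC_measurable[measurable]: "SC u T \<in> borel_measurable M"
  unfolding SC_def[abs_def] by measurable

lemma nn_integral_SC: "(\<integral>\<^sup>+\<omega>. SC u T \<omega> \<partial>M) = (SUP n. ennreal (2 ^ n * prob (chg u 0 (T / 2 ^ n))))"
proof -
  have "(\<integral>\<^sup>+\<omega>. SC u T \<omega> \<partial>M) = (SUP n. \<integral>\<^sup>+\<omega>. ennreal (real (sc u T n \<omega>)) \<partial>M)"
    unfolding SC_def by (rule nn_integral_monotone_convergence_SUP) (auto simp: incseq_def le_fun_def intro!: ennreal_leI sc_mono)
  also have "\<dots> = (SUP n. ennreal (2 ^ n * prob (chg u 0 (T / 2 ^ n))))"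
    using expectation_sc sc_integrable by (subst nn_integral_eq_integral) auto
  finally show ?thesis .
qed

lemma incseq_prob_chg: "incseq (\<lambda>n. ennreal (2 ^ n * prob (chg u 0 (T / 2 ^ n))))"
  unfolding expectation_sc[symmetric] incseq_def
  by (intro allI impI ennreal_leI integral_mono sc_integrable) (simp add: sc_mono)

lemma filterlim_mesh:
  fixes T :: real
  assumes T: "T > 0"
  shows "filterlim (\<lambda>n. T / 2 ^ n) (at_right 0) sequentially"
proof -
  have "(\<lambda>n. T * (1 / 2 :: real) ^ n) \<longlonglongrightarrow> T * 0" by (intro tendsto_intros LIMSEQ_realpow_zero) auto
  moreover have "(\<lambda>n. T * (1 / 2 :: real) ^ n) = (\<lambda>n. T / 2 ^ n)" by (simp add: power_one_over)
  ultimately show ?thesis using T by (simp add: filterlim_at)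
qed

lemma nn_integral_SC_0:
  assumes T: "T > 0" shows "(\<integral>\<^sup>+\<omega>. SC 0 T \<omega> \<partial>M) = ennreal (\<sigma> * T / pi)"
proof -
  have "(\<lambda>n. T * (prob (chg 0 0 (T / 2 ^ n)) / (T / 2 ^ n))) \<longlonglongrightarrow> T * (\<sigma> / pi)"
    by (intro tendsto_intros filterlim_compose[OF chg_limit filterlim_mesh[OF T]])
  moreover have "T * (prob (chg 0 0 (T / 2 ^ n)) / (T / 2 ^ n)) = 2 ^ n * prob (chg 0 0 (T / 2 ^ n))" for n
    using T by (simp add: field_simps)
  ultimately have "(\<lambda>n. 2 ^ n * prob (chg 0 0 (T / 2 ^ n))) \<longlonglongrightarrow> \<sigma> * T / pi" by (simp add: mult.commute)
  then have "(\<lambda>n. ennreal (2 ^ n * prob (chg 0 0 (T / 2 ^ n)))) \<longlonglongrightarrow> ennreal (\<sigma> * T / pi)" by (rule tendsto_ennrealI)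
  then show ?thesis unfolding nn_integral_SC using LIMSEQ_SUP[OF incseq_prob_chg] LIMSEQ_unique by blast
qed

text \<open>The upper bound of \<open>prob_chg_bounds\<close> holds at all levels and is
  asymptotically attained at level 0.\<close>

lemma nn_integral_SC_le:
  assumes T: "T > 0" shows "(\<integral>\<^sup>+\<omega>. SC u T \<omega> \<partial>M) \<le> ennreal (\<sigma> * T / pi)"
proof -
  have "(\<lambda>n. T * (2 / pi) * (ratio (T / 2 ^ n) / (T / 2 ^ n))) \<longlonglongrightarrow> T * (2 / pi) * (\<sigma> / 2)"
    by (intro tendsto_intros filterlim_compose[OF ratio_limit filterlim_mesh[OF T]])
  then have "(\<lambda>n. ennreal (T * (2 / pi) * (ratio (T / 2 ^ n) / (T / 2 ^ n)))) \<longlonglongrightarrow> ennreal (T * (2 / pi) * (\<sigma> / 2))" by (rule tendsto_ennrealI)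
  moreover have "ennreal (2 ^ n * prob (chg u 0 (T / 2 ^ n))) \<le> ennreal (T * (2 / pi) * (ratio (T / 2 ^ n) / (T / 2 ^ n)))" for n
  proof (rule ennreal_leI)
    have "2 ^ n * prob (chg u 0 (T / 2 ^ n)) \<le> 2 ^ n * (2 / pi * ratio (T / 2 ^ n))"
      using T by (intro mult_left_mono prob_chg_bounds) auto
    then show "2 ^ n * prob (chg u 0 (T / 2 ^ n)) \<le> T * (2 / pi) * (ratio (T / 2 ^ n) / (T / 2 ^ n))" using T by (simp add: field_simps)
  qed
  ultimately have "(SUP n. ennreal (2 ^ n * prob (chg u 0 (T / 2 ^ n)))) \<le> ennreal (T * (2 / pi) * (\<sigma> / 2))"
    by (intro LIMSEQ_le[OF LIMSEQ_SUP[OF incseq_prob_chg]]) auto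
  also have "T * (2 / pi) * (\<sigma> / 2) = \<sigma> * T / pi" by simp
  finally show ?thesis unfolding nn_integral_SC .
qed

lemma AE_grid_ne: "AE \<omega> in M. \<forall>n i. f (grid T n i) \<omega> \<noteq> u"
  by (simp add: AE_all_countable f_ne)

text \<open>For a fixed grid a small change of level alters no sign, which gives one inequality
  pathwise. Fatou and \<open>nn_integral_SC_le\<close> give the reverse inequality for the
  expectations, and these are finite, so equality holds almost surely.\<close>

lemma AE_liminf_SC:
  assumes T: "T > 0" and U: "U \<longlonglongrightarrow> 0"
  shows "AE \<omega> in M. SC 0 T \<omega> = liminf (\<lambda>k. SC (U k) T \<omega>)"
proof (rule ennreal_eq_of_le_nn_integral_le)
  show "AE \<omega> in M. SC 0 T \<omega> \<le> liminf (\<lambda>k. SC (U k) T \<omega>)"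
    using AE_grid_ne[of T 0]
  proof eventually_elim
    case (elim \<omega>)
    show ?case unfolding SC_def[of 0]
    proof (rule SUP_least)
      fix n
      have "\<forall>\<^sub>F k in sequentially. \<forall>i\<in>{..2 ^ n}. (f (grid T n i) \<omega> < U k) = (f (grid T n i) \<omega> < 0)"
      proof (subst eventually_ball_finite_distrib, simp, intro ballI)
        fix i
        have "\<bar>f (grid T n i) \<omega>\<bar> > 0" using elim by simp
        then have "\<forall>\<^sub>F k in sequentially. \<bar>U k\<bar> < \<bar>f (grid T n i) \<omega>\<bar>" using tendsto_rabs[OF U] by (intro order_tendstoD) auto
        then show "\<forall>\<^sub>F k in sequentially. (f (grid T n i) \<omega> < U k) = (f (grid T n i) \<omega> < 0)"
          by eventually_elim (auto simp: abs_if split: if_splits)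
      qed
      then have "\<forall>\<^sub>F k in sequentially. sc (U k) T n \<omega> = sc 0 T n \<omega>"
      proof eventually_elim
        case (elim k)
        then have "changes (path \<omega>) (U k) T n = changes (path \<omega>) 0 T n" unfolding changes_def by (auto simp: Suc_leI)
        then show ?case by (simp add: sc_def)
      qed
      then have "\<forall>\<^sub>F k in sequentially. ennreal (real (sc 0 T n \<omega>)) \<le> SC (U k) T \<omega>"
        by eventually_elim (auto simp: SC_def intro!: SUP_upper2[of n])
      then show "ennreal (real (sc 0 T n \<omega>)) \<le> liminf (\<lambda>k. SC (U k) T \<omega>)" by (rule Liminf_bounded)
    qed
  qed
  have "(\<integral>\<^sup>+\<omega>. liminf (\<lambda>k. SC (U k) T \<omega>) \<partial>M) \<le> liminf (\<lambda>k. \<integral>\<^sup>+\<omega>. SC (U k) T \<omega> \<partial>M)"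
    by (rule nn_integral_liminf) auto
  also have "\<dots> \<le> liminf (\<lambda>k. ennreal (\<sigma> * T / pi))" by (intro Liminf_mono always_eventually allI nn_integral_SC_le T)
  also have "\<dots> = (\<integral>\<^sup>+\<omega>. SC 0 T \<omega> \<partial>M)" unfolding nn_integral_SC_0[OF T] by (simp add: Liminf_const)
  finally show "(\<integral>\<^sup>+\<omega>. liminf (\<lambda>k. SC (U k) T \<omega>) \<partial>M) \<le> (\<integral>\<^sup>+\<omega>. SC 0 T \<omega> \<partial>M)" .
  show "(\<integral>\<^sup>+\<omega>. SC 0 T \<omega> \<partial>M) < \<infinity>" by (simp add: nn_integral_SC_0[OF T])
qed auto

text \<open>If the count differed from \<open>m\<close>, all small levels of one sign would have at
  least \<open>m + 1\<close> changes, and so would the lower limit along \<open>1 / (k + 1)\<close>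
  or its negative. That contradicts \<open>AE_liminf_SC\<close>.\<close>

lemma AE_zero_count:
  assumes T: "T > 0"
  shows "AE \<omega> in M. \<exists>N. \<forall>n\<ge>N. sc 0 T n \<omega> = zero_count f T \<omega>"
proof -
  have l1: "(\<lambda>k. 1 / real (Suc k)) \<longlonglongrightarrow> 0" by (rule LIMSEQ_Suc[OF lim_1_over_n])
  have l2: "(\<lambda>k. - (1 / real (Suc k))) \<longlonglongrightarrow> 0" using tendsto_minus[OF l1] by simp
  have fin: "AE \<omega> in M. SC 0 T \<omega> \<noteq> \<infinity>" by (rule nn_integral_PInf_AE) (simp_all add: nn_integral_SC_0[OF T])
  show ?thesis
    using AE_space AE_grid_ne[of T 0] fin AE_liminf_SC[OF T l1] AE_liminf_SC[OF T l2]
  proof eventually_elim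
    case (elim \<omega>)
    have bd: "\<exists>B. \<forall>n. sc 0 T n \<omega> \<le> B"
    proof -
      obtain B where B: "SC 0 T \<omega> \<le> ennreal (real B)"
        using elim(3) by (metis ennreal_of_nat_eq_real_of_nat ennreal_Ex_less_of_nat infinity_ennreal_def less_imp_le less_top)
      have "sc 0 T n \<omega> \<le> B" for n
      proof -
        have "ennreal (real (sc 0 T n \<omega>)) \<le> ennreal (real B)" using B unfolding SC_def by (meson SUP_le_iff UNIV_I)
        then show ?thesis by simp
      qed
      then show ?thesis by blast
    qed
    define m where "m = Max (range (\<lambda>n. sc 0 T n \<omega>))"
    have fr: "finite (range (\<lambda>n. sc 0 T n \<omega>))" using bd by (auto simp: finite_nat_set_iff_bounded_le)
    have "m \<in> range (\<lambda>n. sc 0 T n \<omega>)" unfolding m_def by (rule Max_in[OF fr]) simp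
    then obtain N where N: "sc 0 T N \<omega> = m" by auto
    have le: "sc 0 T n \<omega> \<le> m" for n unfolding m_def by (rule Max_ge[OF fr]) simp
    have st: "sc 0 T n \<omega> = m" if "n \<ge> N" for n using le[of n] sc_mono[OF that, of 0 T \<omega>] N by simp
    have SCm: "SC 0 T \<omega> = ennreal (real m)"
      unfolding SC_def by (rule antisym) (auto intro!: SUP_least SUP_upper2[of N] simp: le N)
    have no: "\<not> (\<exists>\<mu>>0. \<forall>u. 0 < u \<and> u < \<mu> \<longrightarrow> (\<exists>n. Suc m \<le> sc (s * u) T n \<omega>))"
      if s: "SC 0 T \<omega> = liminf (\<lambda>k. SC (s * (1 / real (Suc k))) T \<omega>)" for s
    proof
      assume "\<exists>\<mu>>0. \<forall>u. 0 < u \<and> u < \<mu> \<longrightarrow> (\<exists>n. Suc m \<le> sc (s * u) T n \<omega>)"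
      then obtain \<mu> where \<mu>: "\<mu> > 0" "\<And>u. 0 < u \<Longrightarrow> u < \<mu> \<Longrightarrow> \<exists>n. Suc m \<le> sc (s * u) T n \<omega>" by blast
      have "\<forall>\<^sub>F k in sequentially. 1 / real (Suc k) < \<mu>" using order_tendstoD(2)[OF l1 \<mu>(1)] .
      then have "\<forall>\<^sub>F k in sequentially. ennreal (real (Suc m)) \<le> SC (s * (1 / real (Suc k))) T \<omega>"
      proof eventually_elim
        case (elim k)
        then obtain n where "Suc m \<le> sc (s * (1 / real (Suc k))) T n \<omega>" using \<mu>(2)[of "1 / real (Suc k)"] by auto
        then show ?case unfolding SC_def by (intro SUP_upper2[of n] ennreal_leI) simp_all
      qed
      then have "ennreal (real (Suc m)) \<le> liminf (\<lambda>k. SC (s * (1 / real (Suc k))) T \<omega>)" by (rule Liminf_bounded)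
      then have "ennreal (real (Suc m)) \<le> ennreal (real m)" unfolding s[symmetric] SCm .
      then show False by simp
    qed
    have "(finite {t \<in> {0..T}. f t \<omega> = 0} \<and> card {t \<in> {0..T}. f t \<omega> = 0} = m) \<or>
     (\<exists>\<mu>>0. \<forall>u. 0 < u \<and> u < \<mu> \<longrightarrow> (\<exists>n. Suc m \<le> card (changes (path \<omega>) u T n))) \<or>
     (\<exists>\<mu>>0. \<forall>u. 0 < u \<and> u < \<mu> \<longrightarrow> (\<exists>n. Suc m \<le> card (changes (path \<omega>) (- u) T n)))"
      by (rule zeros_dichotomy[OF T paths[OF elim(1)], where N=N]) (use elim(2) st in \<open>auto simp: sc_def\<close>)
    then have "card {t \<in> {0..T}. f t \<omega> = 0} = m"
      using no[of 1, unfolded mult_1_left sc_def, OF elim(4)] no[of "-1", unfolded mult_minus1 sc_def, OF elim(5)] by blast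
    then show ?case using st by (auto simp: zero_count_def)
  qed
qed

text \<open>By continuity and compactness a zero exists exactly when arbitrarily small values are
  taken at rational points, a countable condition.\<close>

lemma zero_in_Icc_sets:
  assumes "a < b" shows "{\<omega> \<in> space M. \<exists>t\<in>{a..b}. f t \<omega> = 0} \<in> events"
proof -
  have "(\<exists>t\<in>{a..b}. f t \<omega> = 0) \<longleftrightarrow> (\<forall>k::nat. \<exists>q::rat. of_rat q \<in> {a..b} \<and> \<bar>f (of_rat q) \<omega>\<bar> < 1 / real (Suc k))"
    if w: "\<omega> \<in> space M" for \<omega>
  proof
    assume "\<exists>t\<in>{a..b}. f t \<omega> = 0"
    then obtain t where t: "a \<le> t" "t \<le> b" "f t \<omega> = 0" by auto
    show "\<forall>k::nat. \<exists>q::rat. of_rat q \<in> {a..b} \<and> \<bar>f (of_rat q) \<omega>\<bar> < 1 / real (Suc k)"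
    proof
      fix k :: nat
      have "isCont (path \<omega>) t" using paths[OF w] continuous_on_eq_continuous_at[of UNIV "path \<omega>"] by simp
      then have C: "\<forall>e>0. \<exists>d>0. \<forall>x. \<bar>x - t\<bar> < d \<longrightarrow> \<bar>f x \<omega> - f t \<omega>\<bar> < e"
        unfolding continuous_at_eps_delta dist_real_def .
      have "\<exists>d>0. \<forall>x. \<bar>x - t\<bar> < d \<longrightarrow> \<bar>f x \<omega> - f t \<omega>\<bar> < 1 / real (Suc k)"
        by (rule C[rule_format]) simp
      then obtain e where e: "e > 0" "\<And>x. \<bar>x - t\<bar> < e \<Longrightarrow> \<bar>f x \<omega> - f t \<omega>\<bar> < 1 / real (Suc k)"
        by auto
      have "max a (t - e) < min b (t + e)" using t assms e(1) by auto
      then obtain q where q: "max a (t - e) < of_rat q" "of_rat q < min b (t + e)" using of_rat_dense by blast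
      have qt: "\<bar>of_rat q - t\<bar> < e" using q by (auto simp: abs_less_iff)
      show "\<exists>q::rat. of_rat q \<in> {a..b} \<and> \<bar>f (of_rat q) \<omega>\<bar> < 1 / real (Suc k)"
      proof (intro exI conjI)
        show "of_rat q \<in> {a..b}" using q by auto
        show "\<bar>f (of_rat q) \<omega>\<bar> < 1 / real (Suc k)" using e(2)[OF qt] by (simp only: t(3) diff_zero)
      qed
    qed
  next
    assume R: "\<forall>k::nat. \<exists>q::rat. of_rat q \<in> {a..b} \<and> \<bar>f (of_rat q) \<omega>\<bar> < 1 / real (Suc k)"
    have "continuous_on {a..b} (\<lambda>t. \<bar>f t \<omega>\<bar>)" by (rule continuous_on_rabs[OF continuous_on_subset[OF paths[OF w] subset_UNIV]])
    then obtain t where t: "t \<in> {a..b}" "\<And>s. s \<in> {a..b} \<Longrightarrow> \<bar>f t \<omega>\<bar> \<le> \<bar>f s \<omega>\<bar>"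
      using continuous_attains_inf[of "{a..b}" "\<lambda>t. \<bar>f t \<omega>\<bar>"] assms by auto
    have le: "\<bar>f t \<omega>\<bar> \<le> 1 / real (Suc k)" for k
    proof -
      obtain q :: rat where "of_rat q \<in> {a..b}" "\<bar>f (of_rat q) \<omega>\<bar> < 1 / real (Suc k)" using R by blast
      then show ?thesis using t(2)[of "of_rat q"] by linarith
    qed
    have "\<bar>f t \<omega>\<bar> \<le> 0" by (rule LIMSEQ_le[OF tendsto_const LIMSEQ_Suc[OF lim_1_over_n]]) (use le in blast)
    then show "\<exists>t\<in>{a..b}. f t \<omega> = 0" using t(1) by auto
  qed
  then have "{\<omega> \<in> space M. \<exists>t\<in>{a..b}. f t \<omega> = 0} = {\<omega> \<in> space M. \<forall>k::nat. \<exists>q::rat. of_rat q \<in> {a..b} \<and> \<bar>f (of_rat q) \<omega>\<bar> < 1 / real (Suc k)}" by auto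
  also have "\<dots> \<in> events" by measurable
  finally show ?thesis .
qed

lemma zero_in_Ico_sets:
  assumes "a < b" shows "{\<omega> \<in> space M. \<exists>t. a \<le> t \<and> t < b \<and> f t \<omega> = 0} \<in> events"
proof -
  \<comment> \<open>The offset 2 makes each approximating closed interval nondegenerate.\<close>
  have lt: "a < b - (b - a) / real (k + 2)" for k :: nat
  proof -
    have "(b - a) / real (k + 2) < (b - a) / 1" using assms by (intro divide_strict_left_mono) auto
    then show ?thesis by simp
  qed
  have "\<exists>k::nat. t \<le> b - (b - a) / real (k + 2)" if "t < b" for t
  proof -
    obtain k :: nat where "(b - a) / (b - t) < real k" using reals_Archimedean2 by blast
    then have "(b - a) / real (k + 2) \<le> b - t" using that assms by (simp add: field_simps)
    then show ?thesis by (intro exI[of _ k]) simp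
  qed
  moreover have "b - (b - a) / real (k + 2) < b" for k :: nat using assms by simp
  ultimately have "{\<omega> \<in> space M. \<exists>t. a \<le> t \<and> t < b \<and> f t \<omega> = 0} = (\<Union>k::nat. {\<omega> \<in> space M. \<exists>t\<in>{a..b - (b - a) / real (k + 2)}. f t \<omega> = 0})"
    by (fastforce intro: le_less_trans)
  also have "\<dots> \<in> events" using zero_in_Icc_sets[OF lt] by (intro sets.countable_UN) auto
  finally show ?thesis .
qed

lemma zero_count_measurable:
  assumes T: "T > 0" shows "(\<lambda>\<omega>. real (zero_count f T \<omega>)) \<in> borel_measurable M"
proof -
  have lt: "grid T n j < grid T n (Suc j)" for n j using T by (simp add: grid_Suc)
  define B where "B n j = {\<omega> \<in> space M. \<exists>t. grid T n j \<le> t \<and> t < grid T n (Suc j) \<and> f t \<omega> = 0}" for n j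
  have [measurable]: "B n j \<in> events" for n j unfolding B_def by (rule zero_in_Ico_sets[OF lt])
  have "(\<lambda>\<omega>. of_nat (card (zcells (path \<omega>) T n) + (if f T \<omega> = 0 then 1 else 0)) :: ennreal) \<in> borel_measurable M" for n
  proof (subst measurable_cong)
    fix \<omega> assume w: "\<omega> \<in> space M"
    have "zcells (path \<omega>) T n = {..<2 ^ n} \<inter> {j. \<omega> \<in> B n j}" using w by (auto simp: zcells_def B_def)
    then have "of_nat (card (zcells (path \<omega>) T n)) = (\<Sum>j<2 ^ n. indicator (B n j) \<omega> :: ennreal)"
      by (simp add: indicator_def of_bool_def sum.If_cases)
    then show "of_nat (card (zcells (path \<omega>) T n) + (if f T \<omega> = 0 then 1 else 0)) = (\<Sum>j<2 ^ n. indicator (B n j) \<omega>) + (if f T \<omega> = 0 then 1 else 0 :: ennreal)"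
      by simp
  qed measurable
  then have "(\<lambda>\<omega>. enn2real (SUP n. of_nat (card (zcells (path \<omega>) T n) + (if f T \<omega> = 0 then 1 else 0)))) \<in> borel_measurable M"
    by measurable
  then show ?thesis unfolding zero_count_def zero_count_SUP[OF T] .
qed

end

section \<open>The variance of the number of zeros\<close>

lemma sum_lags:
  fixes a :: "nat \<Rightarrow> real"
  shows "(\<Sum>j<N. \<Sum>k<N. a (if j \<le> k then k - j else j - k)) = real N * a 0 + 2 * (\<Sum>m\<in>{1..<N}. real (N - m) * a m)"
proof (induction N)
  case (Suc N)
  let ?d = "\<lambda>j k. a (if j \<le> k then k - j else j - k :: nat)"
  have rev: "(\<Sum>j<N. a (N - j)) = (\<Sum>m\<in>{1..N}. a m)"
    by (rule sum.reindex_bij_witness[of _ "\<lambda>m. N - m" "\<lambda>j. N - j"]) auto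
  have "(\<Sum>j<Suc N. \<Sum>k<Suc N. ?d j k) = (\<Sum>j<N. \<Sum>k<N. ?d j k) + (\<Sum>j<N. ?d j N) + (\<Sum>k<N. ?d N k) + a 0"
    by (simp add: sum.distrib)
  also have "(\<Sum>j<N. ?d j N) = (\<Sum>m\<in>{1..N}. a m)" unfolding rev[symmetric] by (intro sum.cong) auto
  also have "(\<Sum>k<N. ?d N k) = (\<Sum>m\<in>{1..N}. a m)" unfolding rev[symmetric] by (intro sum.cong) auto
  also have "(\<Sum>j<N. \<Sum>k<N. ?d j k) = real N * a 0 + 2 * (\<Sum>m\<in>{1..<N}. real (N - m) * a m)" by (rule Suc.IH)
  also have "(\<Sum>m\<in>{1..<N}. real (N - m) * a m) = (\<Sum>m\<in>{1..N}. real (N - m) * a m)"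
    by (rule sum.mono_neutral_left) auto
  finally have "(\<Sum>j<Suc N. \<Sum>k<Suc N. ?d j k) = real (Suc N) * a 0 + 2 * ((\<Sum>m\<in>{1..N}. real (N - m) * a m) + (\<Sum>m\<in>{1..N}. a m))"
    by (simp add: algebra_simps)
  also have "(\<Sum>m\<in>{1..N}. real (N - m) * a m) + (\<Sum>m\<in>{1..N}. a m) = (\<Sum>m\<in>{1..<Suc N}. real (Suc N - m) * a m)"
    unfolding sum.distrib[symmetric] atLeastLessThanSuc_atLeastAtMost
    by (intro sum.cong refl) (auto simp: Suc_diff_le algebra_simps)
  finally show ?case .
qed simp

context gaussian_zeros
begin

text \<open>The covariance of the sign change indicators of two cells that are \<open>m\<close>
  steps apart.\<close>

definition cc :: "real \<Rightarrow> nat \<Rightarrow> real" where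
  "cc \<delta> m = q \<delta> (real m * \<delta>) - (prob (chg 0 0 \<delta>))\<^sup>2"

lemma q_nonneg: "0 \<le> q \<delta> t" by (simp add: q_def)

lemma q_le_prob: "q \<delta> t \<le> prob (chg 0 0 \<delta>)"
  unfolding q_def by (rule finite_measure_mono) auto

lemma var_sc:
  assumes T: "T > 0"
  defines "\<delta> n \<equiv> T / 2 ^ n"
  shows "expectation (\<lambda>\<omega>. (real (sc 0 T n \<omega>))\<^sup>2) - (expectation (\<lambda>\<omega>. real (sc 0 T n \<omega>)))\<^sup>2
    = 2 ^ n * cc (\<delta> n) 0 + 2 * (\<Sum>m\<in>{1..<2 ^ n}. real (2 ^ n - m) * cc (\<delta> n) m)"
proof -
  let ?N = "2 ^ n :: nat"
  let ?A = "\<lambda>j. chg 0 (grid T n j) (\<delta> n)"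
  have P: "prob (?A j \<inter> ?A k) = q (\<delta> n) (real (if j \<le> k then k - j else j - k) * \<delta> n)" for j k
  proof -
    have *: "prob (?A j \<inter> ?A k) = q (\<delta> n) (real (k - j) * \<delta> n)" if "j \<le> k" for j k
    proof -
      have "grid T n k = grid T n j + real (k - j) * \<delta> n" using that by (simp add: grid_def \<delta>_def of_nat_diff left_diff_distrib diff_divide_distrib)
      then show ?thesis unfolding q_def using prob_chg_shift[of 0 "grid T n j" "\<delta> n" "real (k - j) * \<delta> n"] by simp
    qed
    show ?thesis using *[of j k] *[of k j] by (cases "j \<le> k") (auto simp: Int_commute)
  qed
  have I: "integrable M (indicat_real (?A j \<inter> ?A k))" for j k
    by (rule integrable_real_indicator) (auto simp: emeasure_eq_measure)
  have "expectation (\<lambda>\<omega>. (real (sc 0 T n \<omega>))\<^sup>2) = expectation (\<lambda>\<omega>. \<Sum>j<?N. \<Sum>k<?N. indicat_real (?A j \<inter> ?A k) \<omega>)"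
    by (intro Bochner_Integration.integral_cong refl)
       (simp add: sc_sum \<delta>_def power2_eq_square sum_product indicator_inter_arith)
  also have "\<dots> = (\<Sum>j<?N. \<Sum>k<?N. prob (?A j \<inter> ?A k))"
    using I by (simp add: Bochner_Integration.integral_sum sets.Int_space_eq2)
  finally have E2: "expectation (\<lambda>\<omega>. (real (sc 0 T n \<omega>))\<^sup>2) = (\<Sum>j<?N. \<Sum>k<?N. prob (?A j \<inter> ?A k))" .
  have E1: "(expectation (\<lambda>\<omega>. real (sc 0 T n \<omega>)))\<^sup>2 = (\<Sum>j<?N. \<Sum>k<?N. (prob (chg 0 0 (\<delta> n)))\<^sup>2)"
    unfolding expectation_sc \<delta>_def by (simp add: power_mult_distrib power2_eq_square)
  show ?thesis
    unfolding E1 E2 sum_subtractf[symmetric] P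
    using sum_lags[of "cc (\<delta> n)" ?N] by (simp add: cc_def)
qed

text \<open>Lag sums are rewritten as integrals of step functions in the lag, so that domination and
  dominated convergence can be applied to them.\<close>

lemma step_integral:
  assumes T: "T > 0" and S: "finite S"
  shows "integrable lborel (\<lambda>\<tau>. \<Sum>m\<in>S. indicat_real {grid T n m..<grid T n (Suc m)} \<tau> * a m)"
    "(LINT \<tau>|lborel. (\<Sum>m\<in>S. indicat_real {grid T n m..<grid T n (Suc m)} \<tau> * a m)) = (\<Sum>m\<in>S. a m * (T / 2 ^ n))"
proof -
  have i: "integrable lborel (\<lambda>\<tau>. indicat_real {grid T n m..<grid T n (Suc m)} \<tau> * a m)" for m
    by (intro integrable_mult_left integrable_real_indicator) (auto simp: grid_Suc T less_imp_le)
  show "integrable lborel (\<lambda>\<tau>. \<Sum>m\<in>S. indicat_real {grid T n m..<grid T n (Suc m)} \<tau> * a m)"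
    by (intro Bochner_Integration.integrable_sum i)
  have "(LINT \<tau>|lborel. (\<Sum>m\<in>S. indicat_real {grid T n m..<grid T n (Suc m)} \<tau> * a m)) = (\<Sum>m\<in>S. LINT \<tau>|lborel. indicat_real {grid T n m..<grid T n (Suc m)} \<tau> * a m)"
    by (rule Bochner_Integration.integral_sum[OF i])
  also have "\<dots> = (\<Sum>m\<in>S. a m * (T / 2 ^ n))"
    using T by (intro sum.cong refl) (simp add: grid_Suc)
  finally show "(LINT \<tau>|lborel. (\<Sum>m\<in>S. indicat_real {grid T n m..<grid T n (Suc m)} \<tau> * a m)) = (\<Sum>m\<in>S. a m * (T / 2 ^ n))" .
qed

lemma step_value:
  assumes T: "T > 0" and S: "finite S" and \<tau>: "\<tau> \<ge> 0"
  shows "(\<Sum>m\<in>S. indicat_real {grid T n m..<grid T n (Suc m)} \<tau> * a m) = (if cell T n \<tau> \<in> S then a (cell T n \<tau>) else 0)"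
proof -
  have "indicat_real {grid T n m..<grid T n (Suc m)} \<tau> * a m = (if m = cell T n \<tau> then a (cell T n \<tau>) else 0)" for m
  proof (cases "m = cell T n \<tau>")
    case True
    then show ?thesis using cell_bounds[OF T \<tau>, of n] by (simp add: indicator_def)
  next
    case False
    then have "\<tau> \<notin> {grid T n m..<grid T n (Suc m)}" using cell_unique[OF T, of n m \<tau>] by (metis atLeastLessThan_iff)
    then show ?thesis using False by (simp add: indicator_def)
  qed
  then show ?thesis using S by (simp add: sum.delta)
qed

text \<open>The constant does not depend on \<open>T\<close>; only the generation from which the
  bounds hold does. Lags 0 and 1 are left out of the sum because the estimate for short lags needs
  \<open>2 \<delta> \<le> t\<close>; the second bound is there to treat them.\<close>

lemma near_sum_bound:
  obtains C where "C \<ge> 0"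
    "\<And>T. T > 0 \<Longrightarrow> \<forall>\<^sub>F n in sequentially. (\<Sum>m\<in>{m\<in>{2..<2 ^ n}. grid T n m < t0}. \<bar>cc (T / 2 ^ n) m\<bar> / (T / 2 ^ n)\<^sup>2 * (T / 2 ^ n)) \<le> C"
    "\<And>T. T > 0 \<Longrightarrow> \<forall>\<^sub>F n in sequentially. prob (chg 0 0 (T / 2 ^ n)) \<le> C * (T / 2 ^ n)"
proof -
  obtain a where a: "a > 0" "\<And>\<delta> t. 0 < \<delta> \<Longrightarrow> 2 * \<delta> \<le> t \<Longrightarrow> t \<le> a \<Longrightarrow> q \<delta> t \<le> 64 / (pi * \<sigma>) * \<delta>\<^sup>2 * theta (2 * t) / t"
    using q_near by metis
  define b where "b = min a (1/2)"
  have b: "b > 0" "b \<le> a" "b \<le> 1/2" using a by (auto simp: b_def)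
  obtain C1 d1 where C1: "C1 \<ge> 0" "d1 > 0" "\<And>\<delta> t. 0 < \<delta> \<Longrightarrow> \<delta> \<le> d1 \<Longrightarrow> b \<le> t \<Longrightarrow> q \<delta> t \<le> C1 * \<delta>\<^sup>2"
    using q_far[OF b(1)] by metis
  \<comment> \<open>The limit is \<open>\<sigma> / pi\<close>, so \<open>\<sigma>\<close> is a
    strict upper bound.\<close>
  have "\<forall>\<^sub>F \<delta> in at_right 0. prob (chg 0 0 \<delta>) / \<delta> < \<sigma>" 
    using chg_limit by (rule order_tendstoD) (use sigma_pos pi_gt3 in \<open>simp add: divide_less_eq\<close>)
  then obtain d2 where d2: "d2 > 0" "\<And>\<delta>. 0 < \<delta> \<Longrightarrow> \<delta> < d2 \<Longrightarrow> prob (chg 0 0 \<delta>) / \<delta> < \<sigma>" by (auto simp: eventually_at_right_field)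
  define I0 where "I0 = (LINT t|lborel. indicat_real {0..1} t * (theta (2 * t) / t))"
  \<comment> \<open>A lag \<open>\<tau>\<close> in cell \<open>m \<ge> 2\<close> is at most 3/2
    times the left end of its cell, which lets the left end be replaced by \<open>\<tau>\<close> in
    the denominator.\<close>
  define C2 where "C2 = 64 / (pi * \<sigma>) * (3 / 2)"
  have C2: "C2 \<ge> 0" using sigma_pos by (simp add: C2_def)
  have I0: "I0 \<ge> 0" unfolding I0_def by (intro integral_nonneg_AE AE_I2) (auto simp: indicator_def theta_nonneg)
  \<comment> \<open>The last cell may protrude beyond \<open>t0\<close> by less than 1.\<close>
  define t1 where "t1 = max t0 0 + 1"
  have t1: "t1 > 0" by (simp add: t1_def)
  define C where "C = (C1 + \<sigma>\<^sup>2) * t1 + C2 * I0 + \<sigma>"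
  have C: "C \<ge> 0" "C \<ge> \<sigma>" using C1 C2 I0 sigma_pos t1 by (auto simp: C_def)
  show ?thesis
  proof (rule that[OF C(1)])
    fix T :: real assume T: "T > 0"
    obtain N where N: "\<And>n. n \<ge> N \<Longrightarrow> T / 2 ^ n < Min {d1, d2, 1/2}" using mesh_small[OF T, of "Min {d1, d2, 1/2}"] C1(2) d2(1) by auto
    have ev: "prob (chg 0 0 (T / 2 ^ n)) \<le> \<sigma> * (T / 2 ^ n)" if "n \<ge> N" for n
      using d2(2)[of "T / 2 ^ n"] N[OF that] T by (simp add: field_simps)
    show "\<forall>\<^sub>F n in sequentially. prob (chg 0 0 (T / 2 ^ n)) \<le> C * (T / 2 ^ n)"
      unfolding eventually_sequentially
      by (intro exI[of _ N] allI impI, rule order_trans[OF ev mult_right_mono[OF C(2)]]) (use T in auto)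
    show "\<forall>\<^sub>F n in sequentially. (\<Sum>m\<in>{m\<in>{2..<2 ^ n}. grid T n m < t0}. \<bar>cc (T / 2 ^ n) m\<bar> / (T / 2 ^ n)\<^sup>2 * (T / 2 ^ n)) \<le> C"
      unfolding eventually_sequentially
    proof (intro exI[of _ N] allI impI)
      fix n assume n: "n \<ge> N"
      define \<delta> where "\<delta> = T / 2 ^ n"
      have d: "\<delta> > 0" "\<delta> \<le> d1" "\<delta> \<le> 1/2" using T N[OF n] by (auto simp: \<delta>_def)
      define S where "S = {m\<in>{2..<2 ^ n}. grid T n m < t0}"
      have S: "finite S" by (simp add: S_def)
      have g: "grid T n m = real m * \<delta>" for m by (simp add: grid_def \<delta>_def)
      have c: "\<bar>cc \<delta> m\<bar> / \<delta>\<^sup>2 \<le> q \<delta> (real m * \<delta>) / \<delta>\<^sup>2 + \<sigma>\<^sup>2" for m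
      proof -
        have "(prob (chg 0 0 \<delta>))\<^sup>2 \<le> (\<sigma> * \<delta>)\<^sup>2" using ev[OF n] by (intro power_mono) (auto simp: \<delta>_def)
        then have "\<bar>cc \<delta> m\<bar> \<le> q \<delta> (real m * \<delta>) + \<sigma>\<^sup>2 * \<delta>\<^sup>2"
          unfolding cc_def power_mult_distrib using q_nonneg[of \<delta> "real m * \<delta>"] zero_le_power2[of "prob (chg 0 0 \<delta>)"] by linarith
        then have "\<bar>cc \<delta> m\<bar> / \<delta>\<^sup>2 \<le> (q \<delta> (real m * \<delta>) + \<sigma>\<^sup>2 * \<delta>\<^sup>2) / \<delta>\<^sup>2" by (intro divide_right_mono) auto
        then show ?thesis using d by (simp add: add_divide_distrib)
      qed
      let ?W = "\<lambda>\<tau>. (C1 + \<sigma>\<^sup>2) * indicat_real {0..t1} \<tau> + C2 * (indicat_real {0..1} \<tau> * (theta (2 * \<tau>) / \<tau>))"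
      have Wi1: "integrable lborel (\<lambda>\<tau>. (C1 + \<sigma>\<^sup>2) * indicat_real {0..t1} \<tau>)"
        by (intro integrable_mult_right integrable_real_indicator) (auto simp: less_top[symmetric] emeasure_lborel_Icc_eq)
      have Wi2: "integrable lborel (\<lambda>\<tau>. C2 * (indicat_real {0..1} \<tau> * (theta (2 * \<tau>) / \<tau>)))"
        by (intro integrable_mult_right theta_over_t_integrable)
      note Wi = Bochner_Integration.integrable_add[OF Wi1 Wi2]
      have W0: "0 \<le> ?W \<tau>" for \<tau> using C1 C2 by (auto simp: indicator_def theta_nonneg)
      have "(\<Sum>m\<in>S. \<bar>cc \<delta> m\<bar> / \<delta>\<^sup>2 * (T / 2 ^ n)) = (LINT \<tau>|lborel. (\<Sum>m\<in>S. indicat_real {grid T n m..<grid T n (Suc m)} \<tau> * (\<bar>cc \<delta> m\<bar> / \<delta>\<^sup>2)))"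
        by (rule step_integral(2)[OF T S, symmetric])
      also have "\<dots> \<le> (LINT \<tau>|lborel. ?W \<tau>)"
      proof (rule integral_mono[OF step_integral(1)[OF T S] Wi])
        fix \<tau> :: real
        show "(\<Sum>m\<in>S. indicat_real {grid T n m..<grid T n (Suc m)} \<tau> * (\<bar>cc \<delta> m\<bar> / \<delta>\<^sup>2)) \<le> ?W \<tau>"
        proof (cases "\<tau> \<ge> 0 \<and> cell T n \<tau> \<in> S")
          case False
          have "(\<Sum>m\<in>S. indicat_real {grid T n m..<grid T n (Suc m)} \<tau> * (\<bar>cc \<delta> m\<bar> / \<delta>\<^sup>2)) = 0"
          proof (cases "\<tau> \<ge> 0")
            case True
            then show ?thesis using False by (subst step_value[OF T S]) auto
          next
            case neg: False
            have "0 \<le> grid T n m" for m using T by (simp add: grid_def)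
            then show ?thesis using neg by (intro sum.neutral) (auto simp: indicator_def intro: order_trans)
          qed
          then show ?thesis using W0[of \<tau>] by simp
        next
          case True
          define m where "m = cell T n \<tau>"
          have m: "2 \<le> m" "real m * \<delta> < t0" using True by (auto simp: S_def m_def g)
          have mt: "real m * \<delta> \<le> \<tau>" "\<tau> < real m * \<delta> + \<delta>" using cell_bounds[OF T, of \<tau> n] True unfolding m_def[symmetric] grid_Suc g by (auto simp: \<delta>_def)
          have m2: "2 * \<delta> \<le> real m * \<delta>" using m(1) d by (intro mult_right_mono) auto
          have m3: "\<tau> * (2 / 3) \<le> real m * \<delta>" using mt m2 by linarith
          have tt: "\<tau> > 0" "\<tau> \<le> t1" using mt m m2 d unfolding t1_def by linarith+
          have "\<bar>cc \<delta> m\<bar> / \<delta>\<^sup>2 \<le> ?W \<tau>"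
          proof (cases "b \<le> real m * \<delta>")
            case True
            have "q \<delta> (real m * \<delta>) / \<delta>\<^sup>2 \<le> C1" using C1(3)[OF d(1,2) True] d(1) by (simp add: divide_le_eq)
            then have "\<bar>cc \<delta> m\<bar> / \<delta>\<^sup>2 \<le> (C1 + \<sigma>\<^sup>2) * 1" using c[of m] by simp
            also have "\<dots> \<le> ?W \<tau>" using tt C2 by (auto simp: indicator_def theta_nonneg)
            finally show ?thesis .
          next
            case False
            have "q \<delta> (real m * \<delta>) / \<delta>\<^sup>2 \<le> 64 / (pi * \<sigma>) * (theta (2 * (real m * \<delta>)) / (real m * \<delta>))"
              using a(2)[OF d(1) m2] False b d(1) by (simp add: divide_le_eq mult_ac)
            also have "\<dots> \<le> 64 / (pi * \<sigma>) * (theta (2 * \<tau>) / (\<tau> * (2 / 3)))"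
              using tt mt sigma_pos by (intro mult_left_mono frac_le theta_mono theta_nonneg m3) auto
            also have "64 / (pi * \<sigma>) * (theta (2 * \<tau>) / (\<tau> * (2 / 3))) = C2 * (theta (2 * \<tau>) / \<tau>)" by (simp add: C2_def)
            finally have "\<bar>cc \<delta> m\<bar> / \<delta>\<^sup>2 \<le> C2 * (theta (2 * \<tau>) / \<tau>) + \<sigma>\<^sup>2"
              using c[of m] by linarith
            moreover have "\<tau> \<le> 1" using mt False b d by linarith
            ultimately show ?thesis using tt C1(1) by (auto simp: indicator_def)
          qed
          moreover have "(\<Sum>m\<in>S. indicat_real {grid T n m..<grid T n (Suc m)} \<tau> * (\<bar>cc \<delta> m\<bar> / \<delta>\<^sup>2)) = \<bar>cc \<delta> m\<bar> / \<delta>\<^sup>2"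
            using True by (subst step_value[OF T S]) (auto simp: m_def)
          ultimately show ?thesis by simp
        qed
      qed
      also have "\<dots> = (C1 + \<sigma>\<^sup>2) * t1 + C2 * I0"
        unfolding Bochner_Integration.integral_add[OF Wi1 Wi2] integral_mult_right_zero I0_def using t1 by simp
      also have "\<dots> \<le> C" using sigma_pos by (simp add: C_def)
      finally show "(\<Sum>m\<in>{m\<in>{2..<2 ^ n}. grid T n m < t0}. \<bar>cc (T / 2 ^ n) m\<bar> / (T / 2 ^ n)\<^sup>2 * (T / 2 ^ n)) \<le> C"
        unfolding S_def \<delta>_def .
    qed
  qed
qed

text \<open>The weight \<open>T - \<tau>\<close> counts pairs of positions at lag
  \<open>\<tau>\<close>, and \<open>\<sigma>^2 / pi^2\<close> is the squared intensity of
  zeros.\<close>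

definition fargap :: "real \<Rightarrow> real \<Rightarrow> real \<Rightarrow> real" where
  "fargap t0 T \<tau> = indicat_real {t0<..<T} \<tau> * ((T - \<tau>) * (Kac \<tau> - \<sigma>\<^sup>2 / pi\<^sup>2))"

text \<open>Pointwise convergence is \<open>q_limit\<close> at the left end of the cell containing
  \<open>\<tau>\<close>; the bound \<open>q_far\<close> gives a constant majorant on the bounded
  range of lags.\<close>

lemma far_sum_limit:
  assumes t0: "t0 > 0" "t0 < T" and tame: "\<And>\<tau>. \<tau> \<ge> t0 \<Longrightarrow> tame \<tau>"
  shows "(\<lambda>n. \<Sum>m\<in>{m\<in>{2..<2 ^ n}. t0 \<le> grid T n m}. (T - grid T n m) * (cc (T / 2 ^ n) m / (T / 2 ^ n)\<^sup>2) * (T / 2 ^ n))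
     \<longlonglongrightarrow> (LINT \<tau>|lborel. fargap t0 T \<tau>)"
    and "integrable lborel (fargap t0 T)"
proof -
  have T: "T > 0" using t0 by simp
  define \<delta> where "\<delta> n = T / 2 ^ n" for n
  have d: "\<delta> n > 0" for n using T by (simp add: \<delta>_def)
  have d0: "\<delta> \<longlonglongrightarrow> 0" using filterlim_mesh[OF T] unfolding \<delta>_def[abs_def] by (rule filterlim_mono) (auto simp: at_within_le_nhds)
  define S where "S n = {m\<in>{2..<2 ^ n}. t0 \<le> grid T n m}" for n
  have S: "finite (S n)" for n by (simp add: S_def)
  define a where "a n m = (T - grid T n m) * (cc (\<delta> n) m / (\<delta> n)\<^sup>2)" for n m
  define F where "F n \<tau> = indicat_real {t0<..<T} \<tau> * (\<Sum>m\<in>S n. indicat_real {grid T n m..<grid T n (Suc m)} \<tau> * a n m)" for n \<tau>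
  have Fm[measurable]: "F n \<in> borel_measurable borel" for n unfolding F_def by measurable
  obtain C1 d1 where C1: "C1 \<ge> 0" "d1 > 0" "\<And>\<delta> t. 0 < \<delta> \<Longrightarrow> \<delta> \<le> d1 \<Longrightarrow> t0 \<le> t \<Longrightarrow> q \<delta> t \<le> C1 * \<delta>\<^sup>2"
    using q_far[OF t0(1)] by metis
  have pl: "(\<lambda>n. prob (chg 0 0 (\<delta> n)) / \<delta> n) \<longlonglongrightarrow> \<sigma> / pi"
    unfolding \<delta>_def by (rule filterlim_compose[OF chg_limit filterlim_mesh[OF T]])
  have pl2: "(\<lambda>n. (prob (chg 0 0 (\<delta> n)))\<^sup>2 / (\<delta> n)\<^sup>2) \<longlonglongrightarrow> \<sigma>\<^sup>2 / pi\<^sup>2"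
    using tendsto_power[OF pl, of 2] by (simp add: power_divide)
  have lim: "(\<lambda>n. F n \<tau>) \<longlonglongrightarrow> fargap t0 T \<tau>" for \<tau>
  proof (cases "t0 < \<tau> \<and> \<tau> < T")
    case True
    have \<tau>0: "\<tau> \<ge> 0" using True t0 by simp
    define t where "t n = grid T n (cell T n \<tau>)" for n
    have tb: "t n \<le> \<tau>" "\<tau> < t n + \<delta> n" for n using cell_bounds[OF T \<tau>0, of n] unfolding t_def \<delta>_def grid_Suc by auto
    have tl: "t \<longlonglongrightarrow> \<tau>"
    proof (rule tendsto_sandwich[where f="\<lambda>n. \<tau> - \<delta> n" and h="\<lambda>n. \<tau>"])
      show "(\<lambda>n. \<tau> - \<delta> n) \<longlonglongrightarrow> \<tau>" using tendsto_diff[OF tendsto_const d0, of \<tau>] by simp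
    qed (use tb in \<open>auto intro!: always_eventually less_imp_le simp: algebra_simps\<close>)
    have "(\<lambda>n. (T - t n) * (q (\<delta> n) (t n) / (\<delta> n)\<^sup>2 - (prob (chg 0 0 (\<delta> n)))\<^sup>2 / (\<delta> n)\<^sup>2)) \<longlonglongrightarrow> (T - \<tau>) * (Kac \<tau> - \<sigma>\<^sup>2 / pi\<^sup>2)"
      using True by (intro tendsto_intros tl pl2 q_limit tame d0 d) auto
    moreover have "\<forall>\<^sub>F n in sequentially. (T - t n) * (q (\<delta> n) (t n) / (\<delta> n)\<^sup>2 - (prob (chg 0 0 (\<delta> n)))\<^sup>2 / (\<delta> n)\<^sup>2) = F n \<tau>"
    proof -
      have "\<forall>\<^sub>F n in sequentially. t0 < t n" using True by (intro order_tendstoD(1)[OF tl]) auto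
      moreover have "\<forall>\<^sub>F n in sequentially. \<delta> n < t0 / 2" using t0 by (intro order_tendstoD(2)[OF d0]) auto
      ultimately show ?thesis
      proof eventually_elim
        case (elim n)
        have "real (cell T n \<tau>) * \<delta> n = t n" by (simp add: t_def grid_def \<delta>_def)
        moreover have "cell T n \<tau> \<ge> 2"
        proof (rule ccontr)
          assume "\<not> ?thesis"
          then have "real (cell T n \<tau>) * \<delta> n \<le> 1 * \<delta> n" using d[of n] by (intro mult_right_mono) auto
          then show False using elim t0 d[of n] calculation by simp
        qed
        moreover have "cell T n \<tau> \<in> S n" using calculation(2) elim cell_less[OF T \<tau>0] True by (auto simp: S_def t_def)
        ultimately show ?case unfolding F_def using True by (subst step_value[OF T S \<tau>0]) (auto simp: a_def cc_def t_def diff_divide_distrib)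
      qed
    qed
    ultimately show ?thesis using True unfolding fargap_def by (auto intro: Lim_transform_eventually)
  qed (auto simp: F_def fargap_def)
  have gm: "fargap t0 T \<in> borel_measurable borel" by (rule borel_measurable_LIMSEQ_real[where u=F, OF lim Fm])
  \<comment> \<open>The majorant holds only for a fine mesh, so the sequence is shifted by
    \<open>N0\<close> before dominated convergence is used.\<close>
  obtain N0 where N0: "\<And>n. n \<ge> N0 \<Longrightarrow> \<delta> n \<le> d1 \<and> (prob (chg 0 0 (\<delta> n)))\<^sup>2 / (\<delta> n)\<^sup>2 \<le> \<sigma>\<^sup>2 / pi\<^sup>2 + 1"
  proof -
    have "\<forall>\<^sub>F n in sequentially. \<delta> n < d1" by (rule order_tendstoD(2)[OF d0 C1(2)])
    moreover have "\<forall>\<^sub>F n in sequentially. (prob (chg 0 0 (\<delta> n)))\<^sup>2 / (\<delta> n)\<^sup>2 < \<sigma>\<^sup>2 / pi\<^sup>2 + 1" by (rule order_tendstoD(2)[OF pl2]) simp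
    ultimately have "\<forall>\<^sub>F n in sequentially. \<delta> n \<le> d1 \<and> (prob (chg 0 0 (\<delta> n)))\<^sup>2 / (\<delta> n)\<^sup>2 \<le> \<sigma>\<^sup>2 / pi\<^sup>2 + 1" by eventually_elim auto
    then show ?thesis using that by (auto simp: eventually_sequentially)
  qed
  define B where "B = T * (C1 + (\<sigma>\<^sup>2 / pi\<^sup>2 + 1))"
  have bnd: "\<bar>F (n + N0) \<tau>\<bar> \<le> indicat_real {t0<..<T} \<tau> * B" for n \<tau>
  proof (cases "t0 < \<tau> \<and> \<tau> < T")
    case True
    let ?n = "n + N0"
    have \<tau>0: "\<tau> \<ge> 0" using True t0 by simp
    show ?thesis
    proof (cases "cell T ?n \<tau> \<in> S ?n")
      case in_S: True
      define m where "m = cell T ?n \<tau>"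
      have gm: "real m * \<delta> ?n = grid T ?n m" by (simp add: grid_def \<delta>_def)
      have m: "t0 \<le> grid T ?n m" "grid T ?n m \<le> \<tau>" using in_S cell_bounds(1)[OF T \<tau>0, of ?n] by (auto simp: S_def m_def)
      have "q (\<delta> ?n) (grid T ?n m) / (\<delta> ?n)\<^sup>2 \<le> C1" using C1(3)[OF d _ m(1)] N0[of ?n] d[of ?n] by (simp add: divide_le_eq)
      moreover have "0 \<le> q (\<delta> ?n) (grid T ?n m) / (\<delta> ?n)\<^sup>2" by (simp add: q_nonneg)
      moreover have "0 \<le> (prob (chg 0 0 (\<delta> ?n)))\<^sup>2 / (\<delta> ?n)\<^sup>2" by simp
      ultimately have "\<bar>cc (\<delta> ?n) m / (\<delta> ?n)\<^sup>2\<bar> \<le> C1 + (\<sigma>\<^sup>2 / pi\<^sup>2 + 1)"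
        unfolding cc_def gm diff_divide_distrib using N0[of ?n] C1(1) by linarith
      moreover have "\<bar>T - grid T ?n m\<bar> \<le> T" using m t0 True by auto
      ultimately have "\<bar>a ?n m\<bar> \<le> B" unfolding a_def abs_mult B_def using T by (intro mult_mono) auto
      then show ?thesis using True in_S unfolding F_def by (subst step_value[OF T S \<tau>0]) (simp add: m_def)
    next
      case False
      then have "F ?n \<tau> = 0" unfolding F_def by (subst step_value[OF T S \<tau>0]) simp
      then show ?thesis using C1(1) T by (simp add: B_def)
    qed
  qed (auto simp: F_def)
  have wi: "integrable lborel (\<lambda>\<tau>. indicat_real {t0<..<T} \<tau> * B)" by (intro integrable_mult_left integrable_real_indicator) (use t0 in auto)
  have AEl: "AE \<tau> in lborel. (\<lambda>n. F (n + N0) \<tau>) \<longlonglongrightarrow> fargap t0 T \<tau>" using LIMSEQ_ignore_initial_segment[OF lim] by auto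
  have AEb: "AE \<tau> in lborel. norm (F (n + N0) \<tau>) \<le> indicat_real {t0<..<T} \<tau> * B" for n using bnd by auto
  show "integrable lborel (fargap t0 T)"
    by (rule integrable_dominated_convergence[OF _ _ wi AEl AEb]) (use gm in auto)
  have "(\<lambda>n. LINT \<tau>|lborel. F (n + N0) \<tau>) \<longlonglongrightarrow> (LINT \<tau>|lborel. fargap t0 T \<tau>)"
    by (rule integral_dominated_convergence[OF _ _ wi AEl AEb]) (use gm in auto)
  then have "(\<lambda>n. LINT \<tau>|lborel. F n \<tau>) \<longlonglongrightarrow> (LINT \<tau>|lborel. fargap t0 T \<tau>)" by (rule LIMSEQ_offset)
  moreover have "(LINT \<tau>|lborel. F n \<tau>) = (\<Sum>m\<in>S n. a n m * (T / 2 ^ n))" for n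
  proof -
    have "AE \<tau> in lborel. F n \<tau> = (\<Sum>m\<in>S n. indicat_real {grid T n m..<grid T n (Suc m)} \<tau> * a n m)"
      using AE_lborel_singleton[of t0]
    proof eventually_elim
      case (elim \<tau>)
      show ?case
      proof (cases "t0 < \<tau> \<and> \<tau> < T")
        case False
        have "indicat_real {grid T n m..<grid T n (Suc m)} \<tau> * a n m = 0" if "m \<in> S n" for m
        proof -
          have "Suc m \<le> 2 ^ n" using that by (auto simp: S_def)
          then have "real (Suc m) \<le> 2 ^ n" by (metis of_nat_le_iff of_nat_numeral of_nat_power)
          then have "grid T n (Suc m) \<le> 2 ^ n * (T / 2 ^ n)" unfolding grid_def using T by (intro mult_right_mono) auto
          then have "grid T n (Suc m) \<le> T" by simp
          moreover have "t0 \<le> grid T n m" using that by (simp add: S_def)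
          ultimately have "\<tau> \<notin> {grid T n m..<grid T n (Suc m)}" using False elim unfolding atLeastLessThan_iff by linarith
          then show ?thesis unfolding indicator_def by (simp only: of_bool_eq mult_zero_left)
        qed
        then have "(\<Sum>m\<in>S n. indicat_real {grid T n m..<grid T n (Suc m)} \<tau> * a n m) = 0" by (intro sum.neutral ballI)
        moreover have "F n \<tau> = 0" unfolding F_def indicator_def greaterThanLessThan_iff by (simp only: False of_bool_eq mult_zero_left)
        ultimately show ?thesis by simp
      next
        case True
        then have "indicat_real {t0<..<T} \<tau> = 1" by simp
        then show ?thesis unfolding F_def by (simp only: mult_1)
      qed
    qed
    then have "(LINT \<tau>|lborel. F n \<tau>) = (LINT \<tau>|lborel. (\<Sum>m\<in>S n. indicat_real {grid T n m..<grid T n (Suc m)} \<tau> * a n m))"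
      by (intro integral_cong_AE) auto
    then show ?thesis using step_integral(2)[OF T S] by simp
  qed
  ultimately show "(\<lambda>n. \<Sum>m\<in>{m\<in>{2..<2 ^ n}. t0 \<le> grid T n m}. (T - grid T n m) * (cc (T / 2 ^ n) m / (T / 2 ^ n)\<^sup>2) * (T / 2 ^ n))
     \<longlonglongrightarrow> (LINT \<tau>|lborel. fargap t0 T \<tau>)"
    by (simp add: S_def a_def \<delta>_def)
qed

text \<open>The variance on each grid is split into lag 0, lag 1, lags below \<open>t0\<close> and
  the rest. The first three are at most a constant times \<open>T\<close>; the last converges to the
  integral. The grid counts increase to the number of zeros, which carries the estimate to the
  limit.\<close>

lemma variance_zero_count:
  assumes t0: "t0 > 0" and tame: "\<And>\<tau>. \<tau> \<ge> t0 \<Longrightarrow> tame \<tau>"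
  obtains C where "C \<ge> 0" "\<And>T. T > t0 \<Longrightarrow> \<bar>variance (\<lambda>\<omega>. real (zero_count f T \<omega>)) - 2 * (LINT \<tau>|lborel. fargap t0 T \<tau>)\<bar> \<le> C * T"
proof (rule near_sum_bound[of t0])
  fix C assume C: "C \<ge> 0"
    "\<And>T. T > 0 \<Longrightarrow> \<forall>\<^sub>F n in sequentially. (\<Sum>m\<in>{m\<in>{2..<2 ^ n}. grid T n m < t0}. \<bar>cc (T / 2 ^ n) m\<bar> / (T / 2 ^ n)\<^sup>2 * (T / 2 ^ n)) \<le> C"
    "\<And>T. T > 0 \<Longrightarrow> \<forall>\<^sub>F n in sequentially. prob (chg 0 0 (T / 2 ^ n)) \<le> C * (T / 2 ^ n)"
  show ?thesis
  \<comment> \<open>Lag 0 counts once; lag 1 and the other short lags count twice each.\<close>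
  proof (rule that[of "5 * C"])
    show "5 * C \<ge> 0" using C by simp
    fix T assume tT: "T > t0"
    have T: "T > 0" using t0 tT by simp
    define \<delta> where "\<delta> n = T / 2 ^ n" for n
    have d: "\<delta> n > 0" for n using T by (simp add: \<delta>_def)
    define E1 where "E1 n = expectation (\<lambda>\<omega>. real (sc 0 T n \<omega>))" for n
    define E2 where "E2 n = expectation (\<lambda>\<omega>. (real (sc 0 T n \<omega>))\<^sup>2)" for n
    define FS where "FS n = (\<Sum>m\<in>{m\<in>{2..<2 ^ n}. t0 \<le> grid T n m}. (T - grid T n m) * (cc (T / 2 ^ n) m / (T / 2 ^ n)\<^sup>2) * (T / 2 ^ n))" for n
    have FS: "FS \<longlonglongrightarrow> (LINT \<tau>|lborel. fargap t0 T \<tau>)" unfolding FS_def by (rule far_sum_limit(1)[OF t0 tT tame])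
    have main: "\<forall>\<^sub>F n in sequentially. \<bar>(E2 n - (E1 n)\<^sup>2) - 2 * FS n\<bar> \<le> 5 * C * T"
      using C(2)[OF T] C(3)[OF T] eventually_ge_at_top[of 1]
    proof eventually_elim
      case (elim n)
      let ?N = "2 ^ n :: nat"
      let ?near = "{m\<in>{2..<?N}. grid T n m < t0}" and ?far = "{m\<in>{2..<?N}. t0 \<le> grid T n m}"
      let ?g = "\<lambda>m. real (?N - m) * cc (\<delta> n) m"
      let ?h = "\<lambda>m. (T - grid T n m) * (cc (\<delta> n) m / (\<delta> n)\<^sup>2) * \<delta> n"
      have p: "prob (chg 0 0 (\<delta> n)) \<le> C * \<delta> n" using elim(2) by (simp add: \<delta>_def)
      have gh: "?g m = ?h m" if "m < ?N" for m
      proof -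
        have "real (?N - m) = (T - grid T n m) / \<delta> n"
        proof -
          have "T = 2 ^ n * \<delta> n" by (simp add: \<delta>_def)
          moreover have "grid T n m = real m * \<delta> n" by (simp add: grid_def \<delta>_def)
          ultimately have "T - grid T n m = (2 ^ n - real m) * \<delta> n" by (simp add: left_diff_distrib)
          then show ?thesis using d[of n] that by (simp add: of_nat_diff)
        qed
        then show ?thesis using d[of n] by (simp add: power2_eq_square)
      qed
      have "?N \<ge> 2" using elim(3) by (cases n) auto
      then have "{1..<?N} = insert 1 {2..<?N}" by (intro set_eqI) (simp, linarith)
      then have "(\<Sum>m\<in>{1..<?N}. ?g m) = ?g 1 + (\<Sum>m\<in>{2..<?N}. ?g m)" by simp
      also have "(\<Sum>m\<in>{2..<?N}. ?g m) = (\<Sum>m\<in>{2..<?N}. ?h m)" by (intro sum.cong refl gh) simp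
      also have "\<dots> = (\<Sum>m\<in>?near. ?h m) + (\<Sum>m\<in>?far. ?h m)"
        by (subst sum.union_disjoint[symmetric]) (auto intro!: sum.cong)
      also have "(\<Sum>m\<in>?far. ?h m) = FS n" by (simp add: FS_def \<delta>_def)
      finally have s: "(\<Sum>m\<in>{1..<?N}. ?g m) = ?g 1 + (\<Sum>m\<in>?near. ?h m) + FS n" by simp
      have v: "E2 n - (E1 n)\<^sup>2 = 2 ^ n * cc (\<delta> n) 0 + 2 * (\<Sum>m\<in>{1..<?N}. ?g m)"
        unfolding E1_def E2_def \<delta>_def by (rule var_sc[OF T])
      have cp: "\<bar>cc (\<delta> n) m\<bar> \<le> prob (chg 0 0 (\<delta> n))" for m
      proof -
        have "(prob (chg 0 0 (\<delta> n)))\<^sup>2 \<le> prob (chg 0 0 (\<delta> n))" by (simp add: power2_eq_square mult_left_le)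
        then show ?thesis unfolding cc_def using q_nonneg[of "\<delta> n" "real m * \<delta> n"] q_le_prob[of "\<delta> n" "real m * \<delta> n"] zero_le_power2[of "prob (chg 0 0 (\<delta> n))"] by linarith
      qed
      have pT: "2 ^ n * prob (chg 0 0 (\<delta> n)) \<le> C * T" using mult_left_mono[OF p, of "2 ^ n"] by (simp add: \<delta>_def mult.left_commute)
      have b0: "\<bar>2 ^ n * cc (\<delta> n) 0\<bar> \<le> C * T"
      proof -
        have "\<bar>2 ^ n * cc (\<delta> n) 0\<bar> \<le> 2 ^ n * prob (chg 0 0 (\<delta> n))" by (simp add: abs_mult cp)
        then show ?thesis using pT by linarith
      qed
      have b1: "\<bar>?g 1\<bar> \<le> C * T"
      proof -
        have "\<bar>?g 1\<bar> \<le> 2 ^ n * prob (chg 0 0 (\<delta> n))" unfolding abs_mult using cp[of 1] by (intro mult_mono) (auto simp: of_nat_diff)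
        then show ?thesis using pT by linarith
      qed
      have b2: "\<bar>\<Sum>m\<in>?near. ?h m\<bar> \<le> C * T"
      proof -
        have "\<bar>\<Sum>m\<in>?near. ?h m\<bar> \<le> (\<Sum>m\<in>?near. T * (\<bar>cc (\<delta> n) m\<bar> / (\<delta> n)\<^sup>2 * \<delta> n))"
        proof (rule order_trans[OF sum_abs], rule sum_mono)
          fix m assume m: "m \<in> ?near"
          have "0 \<le> grid T n m" using T by (simp add: grid_def)
          then have "\<bar>T - grid T n m\<bar> \<le> T" using m tT by auto
          then have "\<bar>T - grid T n m\<bar> * (\<bar>cc (\<delta> n) m\<bar> / (\<delta> n)\<^sup>2 * \<delta> n) \<le> T * (\<bar>cc (\<delta> n) m\<bar> / (\<delta> n)\<^sup>2 * \<delta> n)"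
            using d[of n] by (intro mult_right_mono) auto
          then show "\<bar>?h m\<bar> \<le> T * (\<bar>cc (\<delta> n) m\<bar> / (\<delta> n)\<^sup>2 * \<delta> n)" using d[of n] by (simp add: abs_mult)
        qed
        also have "\<dots> = T * (\<Sum>m\<in>?near. \<bar>cc (\<delta> n) m\<bar> / (\<delta> n)\<^sup>2 * \<delta> n)" by (simp only: sum_distrib_left)
        also have "\<dots> \<le> T * C" using elim(1) T by (intro mult_left_mono) (auto simp: \<delta>_def)
        finally show ?thesis by (simp add: mult.commute)
      qed
      have "\<bar>x + 2 * (y + z + u) - 2 * u\<bar> \<le> 5 * c" if "\<bar>x\<bar> \<le> c" "\<bar>y\<bar> \<le> c" "\<bar>z\<bar> \<le> c" for x y z u c :: real
        using that by (auto simp: abs_le_iff)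
      from this[OF b0 b1 b2] show ?case unfolding v s mult.assoc[of 5] .
    qed
    have AEz: "AE \<omega> in M. (\<lambda>n. real (sc 0 T n \<omega>)) \<longlonglongrightarrow> real (zero_count f T \<omega>) \<and> (\<forall>n. sc 0 T n \<omega> \<le> zero_count f T \<omega>)"
      using AE_zero_count[OF T]
    proof eventually_elim
      case (elim \<omega>)
      then obtain N where N: "\<And>n. n \<ge> N \<Longrightarrow> sc 0 T n \<omega> = zero_count f T \<omega>" by blast
      have "sc 0 T n \<omega> \<le> zero_count f T \<omega>" for n using N[of "max n N"] sc_mono[of n "max n N" 0 T \<omega>] by simp
      moreover have "(\<lambda>n. real (sc 0 T n \<omega>)) \<longlonglongrightarrow> real (zero_count f T \<omega>)"
        by (rule tendsto_eventually) (use N in \<open>auto simp: eventually_sequentially\<close>)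
      ultimately show ?case by simp
    qed
    have zm[measurable]: "(\<lambda>\<omega>. real (zero_count f T \<omega>)) \<in> borel_measurable M" by (rule zero_count_measurable[OF T])
    have E1b: "\<forall>\<^sub>F n in sequentially. \<bar>E1 n\<bar> \<le> C * T"
      using C(3)[OF T]
    proof eventually_elim
      case (elim n)
      show ?case using elim by (simp add: E1_def expectation_sc abs_mult field_simps)
    qed
    have FSb: "\<forall>\<^sub>F n in sequentially. FS n \<le> (LINT \<tau>|lborel. fargap t0 T \<tau>) + 1"
      using order_tendstoD(2)[OF FS, of "(LINT \<tau>|lborel. fargap t0 T \<tau>) + 1"] by (auto elim: eventually_mono)
    define B where "B = 5 * C * T + 2 * ((LINT \<tau>|lborel. fargap t0 T \<tau>) + 1) + (C * T)\<^sup>2"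
    have E2b: "\<forall>\<^sub>F n in sequentially. E2 n \<le> B"
      using main E1b FSb
    proof eventually_elim
      case (elim n)
      have "(E1 n)\<^sup>2 \<le> (C * T)\<^sup>2" using elim(2) power_mono[of "\<bar>E1 n\<bar>" "C * T" 2] by simp
      moreover have "x \<le> c + 2 * z + p" if "y \<le> p" "\<bar>x - y - 2 * u\<bar> \<le> c" "u \<le> z" for x y z u c p :: real
        using that by linarith
      ultimately show ?case using elim(1,3) unfolding B_def by blast
    qed
    have i2: "integrable M (\<lambda>\<omega>. (real (sc 0 T n \<omega>))\<^sup>2)" for n
    proof (rule bounded_integrable[where B="(2 ^ n)\<^sup>2"])
      have "real (sc 0 T n \<omega>) \<le> 2 ^ n" for \<omega> using sc_le[of 0 T n \<omega>] by (metis of_nat_le_iff of_nat_numeral of_nat_power)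
      then show "\<bar>(real (sc 0 T n \<omega>))\<^sup>2\<bar> \<le> (2 ^ n)\<^sup>2" for \<omega> by (simp add: power_mono)
    qed simp
    \<comment> \<open>Fatou together with the bound on the grid variances gives a finite second
      moment; only then can the number of zeros serve as a majorant for its own
      approximations.\<close>
    have z2: "integrable M (\<lambda>\<omega>. (real (zero_count f T \<omega>))\<^sup>2)"
    proof (rule integrableI_nonneg)
      have "(\<integral>\<^sup>+\<omega>. ennreal ((real (zero_count f T \<omega>))\<^sup>2) \<partial>M) = (\<integral>\<^sup>+\<omega>. liminf (\<lambda>n. ennreal ((real (sc 0 T n \<omega>))\<^sup>2)) \<partial>M)"
      proof (rule nn_integral_cong_AE)
        show "AE \<omega> in M. ennreal ((real (zero_count f T \<omega>))\<^sup>2) = liminf (\<lambda>n. ennreal ((real (sc 0 T n \<omega>))\<^sup>2))"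
          using AEz
        proof eventually_elim
          case (elim \<omega>)
          then have "(\<lambda>n. ennreal ((real (sc 0 T n \<omega>))\<^sup>2)) \<longlonglongrightarrow> ennreal ((real (zero_count f T \<omega>))\<^sup>2)"
            by (intro tendsto_ennrealI tendsto_power) auto
          then show ?case by (intro lim_imp_Liminf[symmetric]) auto
        qed
      qed
      also have "\<dots> \<le> liminf (\<lambda>n. \<integral>\<^sup>+\<omega>. ennreal ((real (sc 0 T n \<omega>))\<^sup>2) \<partial>M)" by (rule nn_integral_liminf) auto
      also have "\<dots> = liminf (\<lambda>n. ennreal (E2 n))" unfolding E2_def using i2 by (subst nn_integral_eq_integral) auto
      also have "\<dots> \<le> ennreal B" using E2b by (intro Liminf_le) (auto elim!: eventually_mono intro!: ennreal_leI)
      finally show "(\<integral>\<^sup>+\<omega>. ennreal ((real (zero_count f T \<omega>))\<^sup>2) \<partial>M) < \<infinity>" by (simp add: le_less_trans)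
    qed auto
    have le2: "x \<le> 1 + x\<^sup>2" if "x \<ge> 0" for x :: real using sum_squares_bound[of x 1] that by simp
    have z1: "integrable M (\<lambda>\<omega>. real (zero_count f T \<omega>))"
      by (rule Bochner_Integration.integrable_bound[of M "\<lambda>\<omega>. 1 + (real (zero_count f T \<omega>))\<^sup>2"]) (use z2 le2 in auto)
    have L1: "E1 \<longlonglongrightarrow> expectation (\<lambda>\<omega>. real (zero_count f T \<omega>))"
      unfolding E1_def
    proof (rule integral_dominated_convergence[where w="\<lambda>\<omega>. real (zero_count f T \<omega>)"])
      show "AE \<omega> in M. (\<lambda>n. real (sc 0 T n \<omega>)) \<longlonglongrightarrow> real (zero_count f T \<omega>)"
        using AEz by eventually_elim simp
      show "AE \<omega> in M. norm (real (sc 0 T n \<omega>)) \<le> real (zero_count f T \<omega>)" for n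
        using AEz by eventually_elim simp
    qed (use z1 in auto)
    have L2: "E2 \<longlonglongrightarrow> expectation (\<lambda>\<omega>. (real (zero_count f T \<omega>))\<^sup>2)"
      unfolding E2_def
    proof (rule integral_dominated_convergence[where w="\<lambda>\<omega>. (real (zero_count f T \<omega>))\<^sup>2"])
      show "AE \<omega> in M. (\<lambda>n. (real (sc 0 T n \<omega>))\<^sup>2) \<longlonglongrightarrow> (real (zero_count f T \<omega>))\<^sup>2"
        using AEz by eventually_elim (intro tendsto_power, simp)
      show "AE \<omega> in M. norm ((real (sc 0 T n \<omega>))\<^sup>2) \<le> (real (zero_count f T \<omega>))\<^sup>2" for n
        using AEz by eventually_elim (simp add: power_mono)
    qed (use z2 in auto)
    have V: "variance (\<lambda>\<omega>. real (zero_count f T \<omega>)) = expectation (\<lambda>\<omega>. (real (zero_count f T \<omega>))\<^sup>2) - (expectation (\<lambda>\<omega>. real (zero_count f T \<omega>)))\<^sup>2"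
      by (rule variance_eq[OF z1 z2])
    have "(\<lambda>n. \<bar>(E2 n - (E1 n)\<^sup>2) - 2 * FS n\<bar>) \<longlonglongrightarrow> \<bar>variance (\<lambda>\<omega>. real (zero_count f T \<omega>)) - 2 * (LINT \<tau>|lborel. fargap t0 T \<tau>)\<bar>"
      unfolding V by (intro tendsto_intros L1 L2 FS)
    then show "\<bar>variance (\<lambda>\<omega>. real (zero_count f T \<omega>)) - 2 * (LINT \<tau>|lborel. fargap t0 T \<tau>)\<bar> \<le> 5 * C * T"
      by (rule tendsto_upperbound[OF _ main]) simp
  qed
qed

end

section \<open>Expansion of the two-point intensity\<close>

lemma DERIV_hfun:
  assumes "\<bar>x\<bar> < 1"
  shows "(hfun has_real_derivative arcsin x) (at x)"
proof -
  have s: "1 - x\<^sup>2 > 0" using assms by (simp add: abs_square_less_1)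
  have "((\<lambda>x. sqrt (1 - x\<^sup>2) + x * arcsin x) has_real_derivative arcsin x) (at x)"
    using assms s by (auto intro!: derivative_eq_intros simp: field_simps)
  then show ?thesis by (simp add: hfun_def[abs_def])
qed

lemma hfun_taylor:
  assumes a: "a < 1" and x: "\<bar>x\<bar> \<le> a" and u: "\<bar>u\<bar> \<le> a"
  obtains \<xi> where "\<bar>\<xi>\<bar> \<le> a" "hfun u - hfun x - arcsin x * (u - x) = (u - x)\<^sup>2 / (2 * sqrt (1 - \<xi>\<^sup>2))"
proof (cases "u = x")
  case True
  then show ?thesis using that[of x] x by simp
next
  case False
  define d where "d m = (if m = 0 then hfun else if m = 1 then arcsin else (\<lambda>t. inverse (sqrt (1 - t\<^sup>2))))" for m :: nat
  have "\<forall>m t. m < 2 \<and> - a \<le> t \<and> t \<le> a \<longrightarrow> (d m has_real_derivative d (Suc m) t) (at t)"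
  proof (intro allI impI)
    fix m t assume h: "m < (2::nat) \<and> - a \<le> t \<and> t \<le> a"
    then have t: "\<bar>t\<bar> < 1" using a by auto
    consider "m = 0" | "m = 1" using h by linarith
    then show "(d m has_real_derivative d (Suc m) t) (at t)"
    proof cases
      case 1
      then show ?thesis using DERIV_hfun[OF t] by (simp add: d_def)
    next
      case 2
      then show ?thesis using DERIV_arcsin[of t] t by (simp add: d_def abs_less_iff)
    qed
  qed
  then obtain \<xi> where \<xi>: "if u < x then u < \<xi> \<and> \<xi> < x else x < \<xi> \<and> \<xi> < u"
    "hfun u = (\<Sum>m<2. d m x / fact m * (u - x) ^ m) + d 2 \<xi> / fact 2 * (u - x) ^ 2"
    using Taylor[of 2 d hfun "- a" a x u] x u False by (auto simp: d_def abs_le_iff)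
  have two: "(\<Sum>m<2. g m) = g 0 + g 1" for g :: "nat \<Rightarrow> real" by (simp add: numeral_2_eq_2)
  have "hfun u = hfun x + arcsin x * (u - x) + inverse (sqrt (1 - \<xi>\<^sup>2)) / 2 * (u - x)\<^sup>2"
    using \<xi>(2) unfolding two by (simp add: d_def)
  also have "inverse (sqrt (1 - \<xi>\<^sup>2)) / 2 * (u - x)\<^sup>2 = (u - x)\<^sup>2 / (2 * sqrt (1 - \<xi>\<^sup>2))"
    by (simp only: divide_inverse inverse_mult_distrib mult_ac)
  finally have "hfun u - hfun x - arcsin x * (u - x) = (u - x)\<^sup>2 / (2 * sqrt (1 - \<xi>\<^sup>2))"
    by linarith
  moreover have "\<bar>\<xi>\<bar> \<le> a" using \<xi>(1) x u by (auto split: if_splits)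
  ultimately show ?thesis using that by blast
qed

text \<open>This is the coefficient of the quadratic term relative to its value at the origin. With
  \<open>u = \<epsilon>^2 \<le> 1/16\<close> the constant 20 is large enough for
  \<open>(1 + 20 u) (1 - 2 u) (1 - 4 u) \<ge> 1\<close>.\<close>

lemma expansion_factor:
  fixes x y \<xi> \<epsilon> :: real
  assumes e: "0 \<le> \<epsilon>" "\<epsilon> \<le> 1/4" and b: "\<bar>x\<bar> \<le> \<epsilon>" "\<bar>y\<bar> \<le> \<epsilon>" "\<bar>\<xi>\<bar> \<le> 2 * \<epsilon>"
  shows "\<bar>sqrt (1 - x\<^sup>2) / ((1 - x\<^sup>2 - y\<^sup>2) * sqrt (1 - \<xi>\<^sup>2)) - 1\<bar> \<le> 20 * \<epsilon>\<^sup>2"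
proof -
  have sq: "x\<^sup>2 \<le> \<epsilon>\<^sup>2" "y\<^sup>2 \<le> \<epsilon>\<^sup>2" "\<xi>\<^sup>2 \<le> (2 * \<epsilon>)\<^sup>2" "\<epsilon>\<^sup>2 \<le> (1/4)\<^sup>2"
    using b e abs_le_square_iff[of x \<epsilon>] abs_le_square_iff[of y \<epsilon>] abs_le_square_iff[of \<xi> "2 * \<epsilon>"] abs_le_square_iff[of \<epsilon> "1/4"] by auto
  define u where "u = \<epsilon>\<^sup>2"
  have u: "0 \<le> u" "u \<le> 1/16" "x\<^sup>2 \<le> u" "y\<^sup>2 \<le> u" "\<xi>\<^sup>2 \<le> 4 * u" using sq by (auto simp: u_def power2_eq_square)
  have root: "t \<le> sqrt t \<and> sqrt t \<le> 1" if "0 \<le> t" "t \<le> 1" for t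
    using that real_sqrt_le_mono[of t 1] mult_right_mono[of "sqrt t" 1 "sqrt t"] by simp
  define s where "s = sqrt (1 - x\<^sup>2)"
  define D where "D = (1 - x\<^sup>2 - y\<^sup>2) * sqrt (1 - \<xi>\<^sup>2)"
  have s: "1 - u \<le> s" "s \<le> 1" using root[of "1 - x\<^sup>2"] u zero_le_power2[of x] unfolding s_def by linarith+
  have q: "1 - 4 * u \<le> sqrt (1 - \<xi>\<^sup>2)" "sqrt (1 - \<xi>\<^sup>2) \<le> 1" using root[of "1 - \<xi>\<^sup>2"] u zero_le_power2[of \<xi>] by linarith+
  have p: "1 - 2 * u \<le> 1 - x\<^sup>2 - y\<^sup>2" "1 - x\<^sup>2 - y\<^sup>2 \<le> 1" using u by auto
  have D: "(1 - 2 * u) * (1 - 4 * u) \<le> D" "D \<le> 1 * 1" unfolding D_def using p q u by (intro mult_mono; simp)+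
  have uu: "u * u \<le> u * (1/16)" using u by (intro mult_left_mono) auto
  have "0 \<le> u * (u * u)" using u by simp
  moreover have "(1 + 20 * u) * ((1 - 2 * u) * (1 - 4 * u)) = 1 + 14 * u - 112 * (u * u) + 160 * (u * (u * u))"
    by (simp add: algebra_simps)
  ultimately have "1 \<le> (1 + 20 * u) * ((1 - 2 * u) * (1 - 4 * u))" using uu u by linarith
  also have "\<dots> \<le> (1 + 20 * u) * D" using D(1) u by (intro mult_left_mono) auto
  finally have up: "1 \<le> (1 + 20 * u) * D" .
  have Dp: "D > 0"
  proof (rule ccontr)
    assume "\<not> D > 0"
    then have "(1 + 20 * u) * D \<le> 0" using u by (intro mult_nonneg_nonpos) auto
    then show False using up by linarith
  qed
  have "s / D \<le> 1 + 20 * u" using s(2) up Dp by (simp add: divide_le_eq)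
  moreover have "1 - 20 * u \<le> s / D"
  proof -
    have "(1 - 20 * u) * D \<le> 1 - u"
    proof (cases "1 - 20 * u \<ge> 0")
      case True
      then have "(1 - 20 * u) * D \<le> (1 - 20 * u) * 1" using D(2) by (intro mult_left_mono) auto
      then show ?thesis using u by simp
    next
      case False
      then have "(1 - 20 * u) * D \<le> 0" using Dp by (intro mult_nonpos_nonneg) auto
      then show ?thesis using u by simp
    qed
    then show ?thesis using s(1) Dp by (simp add: le_divide_eq)
  qed
  ultimately show ?thesis unfolding s_def[symmetric] D_def[symmetric] u_def[symmetric] by linarith
qed

lemma DERIV_arcsin_over_sqrt:
  fixes x :: real
  assumes "\<bar>x\<bar> < 1"
  shows "((\<lambda>x. arcsin x / sqrt (1 - x\<^sup>2)) has_real_derivative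
    1 / (1 - x\<^sup>2) + x * arcsin x / ((1 - x\<^sup>2) * sqrt (1 - x\<^sup>2))) (at x)"
proof -
  have s: "1 - x\<^sup>2 > 0" using assms by (simp add: abs_square_less_1)
  define k where "k = sqrt (1 - x\<^sup>2)"
  have k: "k > 0" "1 - x\<^sup>2 = k * k" using s by (auto simp: k_def)
  have "((\<lambda>x. arcsin x / sqrt (1 - x\<^sup>2)) has_real_derivative
      (inverse k * k - arcsin x * (- (2 * x) * (inverse k / 2))) / (k * k)) (at x)"
    using assms s unfolding k_def by (auto intro!: derivative_eq_intros simp: abs_less_iff)
  also have "(inverse k * k - arcsin x * (- (2 * x) * (inverse k / 2))) / (k * k) = 1 / (k * k) + x * arcsin x / (k * k * k)"
    using k(1) by (simp add: field_simps)
  finally show ?thesis unfolding k(2)[symmetric] k_def[symmetric] .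
qed

context gaussian_zeros
begin

definition w :: "real \<Rightarrow> real" where "w t = r t + r2 t / \<sigma>\<^sup>2"

text \<open>The linear part of the two-point intensity is, up to the square of \<^term>\<open>w\<close>, the derivative of
  the following bounded function; it therefore contributes only \<open>O(T)\<close> to the variance.\<close>

definition G :: "real \<Rightarrow> real" where "G t = - (r1 t / \<sigma>) * (arcsin (r t) / sqrt (1 - (r t)\<^sup>2))"

definition G' :: "real \<Rightarrow> real" where
  "G' t = - (\<sigma> * ((r2 t / \<sigma>\<^sup>2) * (arcsin (r t) / sqrt (1 - (r t)\<^sup>2))
    + (r1 t / \<sigma>)\<^sup>2 * (1 / (1 - (r t)\<^sup>2) + r t * arcsin (r t) / ((1 - (r t)\<^sup>2) * sqrt (1 - (r t)\<^sup>2)))))"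

lemma G_has_derivative:
  assumes "t > 0" shows "(G has_real_derivative G' t) (at t)"
proof -
  have x: "\<bar>r t\<bar> < 1" by (rule abs_r_less_1[OF assms])
  let ?A = "\<lambda>x. arcsin x / sqrt (1 - x\<^sup>2)"
  let ?A' = "1 / (1 - (r t)\<^sup>2) + r t * arcsin (r t) / ((1 - (r t)\<^sup>2) * sqrt (1 - (r t)\<^sup>2))"
  have A: "((\<lambda>t. ?A (r t)) has_real_derivative ?A' * r1 t) (at t)"
    by (rule DERIV_chain2[OF DERIV_arcsin_over_sqrt[OF x] r_has_derivative])
  have y: "((\<lambda>t. - (r1 t / \<sigma>)) has_real_derivative - (r2 t / \<sigma>)) (at t)"
    by (intro DERIV_minus DERIV_cdivide r1_has_derivative)
  have D: "(G has_real_derivative - (r2 t / \<sigma>) * ?A (r t) + ?A' * r1 t * (- (r1 t / \<sigma>))) (at t)"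
    unfolding G_def[abs_def] by (rule DERIV_mult'[OF y A, THEN DERIV_cong]) (simp add: mult_ac)
  have e: "- (r2 t / \<sigma>) * a + b * r1 t * (- (r1 t / \<sigma>)) = - (\<sigma> * ((r2 t / \<sigma>\<^sup>2) * a + (r1 t / \<sigma>)\<^sup>2 * b))" for a b
    using sigma_pos by (simp add: field_simps power2_eq_square)
  show ?thesis unfolding G'_def e[symmetric] by (rule D)
qed

lemma isCont_r: "isCont r t" by (rule DERIV_isCont[OF r_has_derivative])
lemma isCont_r1: "isCont r1 t" by (rule DERIV_isCont[OF r1_has_derivative])

lemma isCont_w: "isCont w t"
  unfolding w_def[abs_def] using sigma_pos by (intro continuous_intros isCont_r isCont_r2) auto

lemma isCont_G:
  assumes "t > 0" shows "isCont G t" by (rule DERIV_isCont[OF G_has_derivative[OF assms]])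

lemma isCont_G':
  assumes "t > 0" shows "isCont G' t"
proof -
  have x: "\<bar>r t\<bar> < 1" by (rule abs_r_less_1[OF assms])
  then have p: "1 - (r t)\<^sup>2 > 0" by (simp add: abs_square_less_1)
  have a: "isCont (\<lambda>t. arcsin (r t)) t"
    by (rule isCont_o2[OF isCont_r isCont_arcsin]) (use x in auto)
  show ?thesis unfolding G'_def[abs_def]
    using p sigma_pos by (intro continuous_intros isCont_r isCont_r1 isCont_r2 a) auto
qed

lemma abs_G_le:
  assumes "tame t" shows "\<bar>G t\<bar> \<le> 1"
proof -
  have b: "\<bar>r t\<bar> \<le> 1/4" "\<bar>r1 t / \<sigma>\<bar> \<le> 1/4" using assms by (auto simp: tame_def)
  have "1/4 \<le> 1 - (r t)\<^sup>2" using tame_facts(1)[OF assms] by simp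
  then have s: "1/2 \<le> sqrt (1 - (r t)\<^sup>2)" using real_sqrt_le_mono[of "1/4" "1 - (r t)\<^sup>2"] by (simp add: real_sqrt_divide)
  have "- 1 \<le> r t" "r t \<le> 1" using b(1) by linarith+
  then have "\<bar>arcsin (r t)\<bar> \<le> 2" using arcsin_lbound[of "r t"] arcsin_ubound[of "r t"] pi_less_4 by linarith
  then have "\<bar>arcsin (r t) / sqrt (1 - (r t)\<^sup>2)\<bar> \<le> 2 / (1/2)" unfolding abs_divide using s by (intro frac_le) auto
  then have "\<bar>r1 t / \<sigma>\<bar> * \<bar>arcsin (r t) / sqrt (1 - (r t)\<^sup>2)\<bar> \<le> 1/4 * 4" using b by (intro mult_mono) auto
  then show ?thesis unfolding G_def abs_mult abs_minus by simp
qed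

text \<open>\<open>hfun\<close> is expanded at \<open>x = r t\<close>. The affine part of the
  expansion sums to \<open>1 + G' t / \<sigma>\<close> and the Lagrange remainder to
  \<open>(w t)^2 / 2\<close> times the factor of \<open>expansion_factor\<close>. The bound
  \<open>\<bar>\<mu>\<bar> \<le> 2 \<epsilon>\<close> keeps the intermediate point within reach of
  that lemma.\<close>

lemma Kac_expansion:
  assumes tame: "tame t" and e: "0 \<le> \<epsilon>" "\<epsilon> \<le> 1/4"
    and b: "\<bar>r t\<bar> \<le> \<epsilon>" "\<bar>r1 t / \<sigma>\<bar> \<le> \<epsilon>" "\<bar>r2 t / \<sigma>\<^sup>2\<bar> \<le> \<epsilon>"
  shows "\<bar>(Kac t - \<sigma>\<^sup>2 / pi\<^sup>2) - \<sigma>\<^sup>2 / pi\<^sup>2 * (w t)\<^sup>2 / 2 - \<sigma> / pi\<^sup>2 * G' t\<bar> \<le> 10 * \<epsilon>\<^sup>2 * (\<sigma>\<^sup>2 / pi\<^sup>2) * (w t)\<^sup>2"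
proof -
  define x y z where "x = r t" and "y = r1 t / \<sigma>" and "z = r2 t / \<sigma>\<^sup>2"
  note T = tame_facts[OF tame, folded x_def y_def z_def]
  define p D where "p = 1 - x\<^sup>2" and "D = p - y\<^sup>2"
  have pD: "p > 0" "D > 0" "7/8 \<le> D" "p \<le> 1" "y\<^sup>2 \<le> 1/16" using T by (auto simp: p_def D_def)
  define s where "s = sqrt p"
  have s: "s > 0" "p = s * s" using pD by (auto simp: s_def)
  define \<mu> where "\<mu> = - (z * p + x * y\<^sup>2) / D"
  have w: "w t = x + z" by (simp add: w_def x_def z_def)
  have "\<bar>z * p\<bar> \<le> \<epsilon> * 1" unfolding abs_mult using b pD by (intro mult_mono) (auto simp: z_def)
  moreover have "\<bar>x * y\<^sup>2\<bar> \<le> \<epsilon> * (1/16)" unfolding abs_mult using b pD by (intro mult_mono) (auto simp: x_def)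
  ultimately have "\<bar>z * p + x * y\<^sup>2\<bar> \<le> (2 * \<epsilon>) * (7/8)" using e by linarith
  also have "\<dots> \<le> (2 * \<epsilon>) * D" using pD e by (intro mult_left_mono) auto
  finally have mu: "\<bar>\<mu>\<bar> \<le> 2 * \<epsilon>" unfolding \<mu>_def abs_divide abs_minus using pD by (simp add: divide_le_eq)
  obtain \<xi> where \<xi>: "\<bar>\<xi>\<bar> \<le> 2 * \<epsilon>" "hfun \<mu> - hfun x - arcsin x * (\<mu> - x) = (\<mu> - x)\<^sup>2 / (2 * sqrt (1 - \<xi>\<^sup>2))"
    by (rule hfun_taylor[of "2 * \<epsilon>" x \<mu>]) (use e b mu in \<open>auto simp: x_def\<close>)
  define k where "k = sqrt (1 - \<xi>\<^sup>2)"
  define a where "a = arcsin x"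
  have hx: "hfun x = s + x * a" by (simp add: hfun_def s_def p_def a_def)
  \<comment> \<open>The identity that makes the remainder quadratic in \<open>w\<close>: the
    conditional correlation differs from \<open>r t\<close> by a multiple of
    \<open>w t\<close>.\<close>
  have mx: "\<mu> - x = - (w t * p / D)"
    unfolding \<mu>_def w using pD(2) by (simp add: field_simps) (simp add: D_def algebra_simps)
  have "D / (p * s) * (hfun \<mu> - hfun x - a * (\<mu> - x)) = D / (p * s) * ((w t * p / D)\<^sup>2 / (2 * k))"
    using \<xi>(2) by (simp add: a_def mx k_def)
  also have "\<dots> = (w t)\<^sup>2 / 2 * (s / (D * k))" using s pD by (simp add: power2_eq_square field_simps)
  finally have R: "D / (p * s) * (hfun \<mu> - hfun x - a * (\<mu> - x)) = (w t)\<^sup>2 / 2 * (s / (D * k))" .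
  \<comment> \<open>The derivative of \<open>hfun\<close> at \<open>x\<close> is
    \<open>arcsin x\<close>, so the affine part is explicit; apart from the constant 1 it is the
    expression in \<open>G'\<close>.\<close>
  have L: "D / (p * s) * (hfun x + a * (\<mu> - x)) = 1 - (z * (a / s) + y\<^sup>2 * (1 / p + x * a / (p * s)))"
  proof -
    have "D / (p * s) * (hfun x + a * (\<mu> - x)) = D / p + a * (D * \<mu>) / (p * s)"
      unfolding hx using s pD by (simp add: field_simps)
    also have "D * \<mu> = - (z * p + x * y\<^sup>2)" using pD by (simp add: \<mu>_def)
    also have "D / p + a * - (z * p + x * y\<^sup>2) / (p * s) = 1 - (z * (a / s) + y\<^sup>2 * (1 / p + x * a / (p * s)))"
      unfolding D_def using s(1) pD(1) by (simp add: field_simps)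
    finally show ?thesis .
  qed
  have G': "G' t = - (\<sigma> * (z * (a / s) + y\<^sup>2 * (1 / p + x * a / (p * s))))"
    unfolding G'_def x_def[symmetric] y_def[symmetric] z_def[symmetric] p_def[symmetric] s_def[symmetric] a_def[symmetric] ..
  have "Kac t = \<sigma>\<^sup>2 / pi\<^sup>2 * (D / (p * s) * hfun \<mu>)"
    using Kac_eq[OF tame] unfolding x_def[symmetric] y_def[symmetric] z_def[symmetric] p_def[symmetric] s_def[symmetric] D_def[symmetric] \<mu>_def[symmetric] .
  also have "D / (p * s) * hfun \<mu> = D / (p * s) * (hfun \<mu> - hfun x - a * (\<mu> - x)) + D / (p * s) * (hfun x + a * (\<mu> - x))"
    by (simp only: distrib_left[symmetric]) simp
  also have "\<dots> = (w t)\<^sup>2 / 2 * (s / (D * k)) + 1 + G' t / \<sigma>"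
    unfolding R L G' using sigma_pos by simp
  also have "\<sigma>\<^sup>2 / pi\<^sup>2 * ((w t)\<^sup>2 / 2 * (s / (D * k)) + 1 + G' t / \<sigma>)
      = \<sigma>\<^sup>2 / pi\<^sup>2 * ((w t)\<^sup>2 / 2 * (s / (D * k))) + \<sigma>\<^sup>2 / pi\<^sup>2 + \<sigma> / pi\<^sup>2 * G' t"
    unfolding distrib_left using sigma_pos by (simp add: power2_eq_square)
  finally have K: "Kac t = \<sigma>\<^sup>2 / pi\<^sup>2 * ((w t)\<^sup>2 / 2 * (s / (D * k))) + \<sigma>\<^sup>2 / pi\<^sup>2 + \<sigma> / pi\<^sup>2 * G' t" .
  have "X * (W / 2 * q) + X + Y - X - X * W / 2 - Y = X * W / 2 * (q - 1)" for X W q Y :: real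
    by (simp add: algebra_simps)
  then have eq: "(Kac t - \<sigma>\<^sup>2 / pi\<^sup>2) - \<sigma>\<^sup>2 / pi\<^sup>2 * (w t)\<^sup>2 / 2 - \<sigma> / pi\<^sup>2 * G' t = \<sigma>\<^sup>2 / pi\<^sup>2 * (w t)\<^sup>2 / 2 * (s / (D * k) - 1)"
    unfolding K .
  have "\<bar>s / (D * k) - 1\<bar> \<le> 20 * \<epsilon>\<^sup>2"
    unfolding s_def D_def k_def p_def by (rule expansion_factor[OF e _ _ \<xi>(1)]) (use b in \<open>auto simp: x_def y_def\<close>)
  then have "\<sigma>\<^sup>2 / pi\<^sup>2 * (w t)\<^sup>2 / 2 * \<bar>s / (D * k) - 1\<bar> \<le> \<sigma>\<^sup>2 / pi\<^sup>2 * (w t)\<^sup>2 / 2 * (20 * \<epsilon>\<^sup>2)"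
    by (intro mult_left_mono) auto
  then show ?thesis unfolding eq abs_mult by (simp add: mult_ac)
qed

section \<open>Growth of the variance\<close>

text \<open>For \<open>a = 0\<close> and positive \<open>T\<close> this is \<open>T\<close> times
  the integral in the denominator of the theorem.\<close>

definition J :: "real \<Rightarrow> real \<Rightarrow> real" where
  "J a T = (\<integral>t. (T - t) * (w t)\<^sup>2 * indicator {a..T} t \<partial>lborel)"

lemma borel_w[measurable]: "w \<in> borel_measurable borel"
  by (intro borel_measurable_continuous_onI continuous_at_imp_continuous_on ballI isCont_w)

lemma J_integrable: "integrable lborel (\<lambda>t. (T - t) * (w t)\<^sup>2 * indicator {a..T} t)"
  by (rule borel_integrable_atLeastAtMost) (intro continuous_intros isCont_w)

lemma w_even: "w (- t) = w t" by (simp add: w_def r_minus r2_minus)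

lemma w_sq_le: "(w t)\<^sup>2 \<le> 4"
proof -
  have "\<bar>r2 t / \<sigma>\<^sup>2\<bar> \<le> 1" using abs_r2_le[of t] sigma_pos by simp
  then have "\<bar>w t\<bar> \<le> 2" using abs_r_le[of t] unfolding w_def by linarith
  then show ?thesis using abs_le_square_iff[of "w t" 2] by simp
qed

lemma J_nonneg: "0 \<le> J a T"
  unfolding J_def by (intro integral_nonneg_AE AE_I2) (auto simp: indicator_def)

lemma J_le:
  assumes "0 < a" "a < T"
  shows "J a T \<le> J 0 T" "J 0 T \<le> J a T + 4 * a * T"
proof -
  show "J a T \<le> J 0 T" unfolding J_def
    by (rule integral_mono[OF J_integrable J_integrable]) (use assms in \<open>auto simp: indicator_def\<close>)
  have i: "integrable lborel (\<lambda>t. 4 * T * indicat_real {0..a} t)"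
    by (intro integrable_mult_right integrable_real_indicator) (auto simp: less_top[symmetric] emeasure_lborel_Icc_eq)
  have "J 0 T \<le> (\<integral>t. (T - t) * (w t)\<^sup>2 * indicator {a..T} t + 4 * T * indicat_real {0..a} t \<partial>lborel)"
    unfolding J_def
  proof (rule integral_mono[OF J_integrable Bochner_Integration.integrable_add[OF J_integrable i]])
    fix t :: real
    have "(T - t) * (w t)\<^sup>2 \<le> T * 4" if "0 \<le> t" "t \<le> T" using that w_sq_le[of t] by (intro mult_mono) auto
    then show "(T - t) * (w t)\<^sup>2 * indicator {0..T} t \<le> (T - t) * (w t)\<^sup>2 * indicator {a..T} t + 4 * T * indicat_real {0..a} t"
      using assms by (auto simp: indicator_def)
  qed
  also have "\<dots> = J a T + 4 * T * a"
    unfolding Bochner_Integration.integral_add[OF J_integrable i] J_def integral_mult_right_zero using assms by simp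
  finally show "J 0 T \<le> J a T + 4 * a * T" by (simp add: mult_ac)
qed

text \<open>\<open>Kac_expansion\<close> is integrated against \<open>T - t\<close>. The derivative
  term is integrated by parts: as \<open>G\<close> is bounded by 1, the boundary term and the
  integral of \<open>G\<close> are each at most \<open>T\<close>.\<close>

lemma fargap_estimate:
  assumes t0: "0 < t0" "t0 < T" and tame: "\<And>\<tau>. \<tau> \<ge> t0 \<Longrightarrow> tame \<tau>" and e: "0 \<le> \<epsilon>" "\<epsilon> \<le> 1/4"
    and b: "\<And>t. t \<ge> t0 \<Longrightarrow> \<bar>r t\<bar> \<le> \<epsilon> \<and> \<bar>r1 t / \<sigma>\<bar> \<le> \<epsilon> \<and> \<bar>r2 t / \<sigma>\<^sup>2\<bar> \<le> \<epsilon>"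
    and int: "integrable lborel (fargap t0 T)"
  shows "\<bar>2 * (LINT \<tau>|lborel. fargap t0 T \<tau>) - \<sigma>\<^sup>2 / pi\<^sup>2 * J t0 T\<bar> \<le> 20 * \<epsilon>\<^sup>2 * (\<sigma>\<^sup>2 / pi\<^sup>2) * J t0 T + 4 * (\<sigma> / pi\<^sup>2) * T"
proof -
  let ?I = "indicator {t0..T} :: real \<Rightarrow> real"
  have iG: "integrable lborel (\<lambda>t. G t * ?I t)"
    by (rule borel_integrable_atLeastAtMost) (use t0 isCont_G in auto)
  have iG': "integrable lborel (\<lambda>t. (T - t) * G' t * ?I t)"
    by (rule borel_integrable_atLeastAtMost) (use t0 isCont_G' in \<open>auto intro!: continuous_intros\<close>)
  have iFTC: "(\<integral>t. ((T - t) * G' t - G t) * ?I t \<partial>lborel) = (T - T) * G T - (T - t0) * G t0"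
  proof (rule integral_FTC_Icc_real)
    fix t assume t: "t0 \<le> t" "t \<le> T"
    then have "t > 0" using t0 by simp
    have "((\<lambda>t. (T - t) * G t) has_real_derivative (0 - 1) * G t + G' t * (T - t)) (at t)"
      by (intro DERIV_mult DERIV_diff DERIV_const DERIV_ident G_has_derivative \<open>t > 0\<close>)
    then show "((\<lambda>t. (T - t) * G t) has_real_derivative (T - t) * G' t - G t) (at t)" by (simp add: mult.commute)
    show "isCont (\<lambda>t. (T - t) * G' t - G t) t" by (intro continuous_intros isCont_G isCont_G' \<open>t > 0\<close>)
  qed (use t0 in simp)
  have "(\<integral>t. (T - t) * G' t * ?I t \<partial>lborel) = (\<integral>t. ((T - t) * G' t - G t) * ?I t + G t * ?I t \<partial>lborel)"
    by (simp add: left_diff_distrib)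
  also have "\<dots> = (\<integral>t. ((T - t) * G' t - G t) * ?I t \<partial>lborel) + (\<integral>t. G t * ?I t \<partial>lborel)"
    by (rule Bochner_Integration.integral_add) (use iG iG' in \<open>auto simp: left_diff_distrib\<close>)
  finally have GI: "(\<integral>t. (T - t) * G' t * ?I t \<partial>lborel) = (\<integral>t. G t * ?I t \<partial>lborel) - (T - t0) * G t0"
    unfolding iFTC by simp
  have iI: "integrable lborel ?I" by (rule integrable_real_indicator) (auto simp: less_top[symmetric] emeasure_lborel_Icc_eq)
  have "\<bar>\<integral>t. G t * ?I t \<partial>lborel\<bar> \<le> (\<integral>t. \<bar>G t * ?I t\<bar> \<partial>lborel)" by (rule integral_abs_bound)
  also have "\<dots> \<le> (\<integral>t. ?I t \<partial>lborel)"
    by (rule integral_mono[OF integrable_abs[OF iG] iI]) (use abs_G_le tame in \<open>auto simp: indicator_def\<close>)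
  also have "\<dots> = T - t0" using t0 by simp
  finally have G1: "\<bar>\<integral>t. G t * ?I t \<partial>lborel\<bar> \<le> T - t0" .
  have "\<bar>(T - t0) * G t0\<bar> \<le> (T - t0) * 1" unfolding abs_mult using t0 abs_G_le[OF tame[of t0]] by (intro mult_mono) auto
  then have "\<bar>a - (T - t0) * G t0\<bar> \<le> 2 * T" if "\<bar>a\<bar> \<le> T - t0" for a
    using that t0 abs_triangle_ineq4[of a "(T - t0) * G t0"] by simp
  from this[OF G1] have GT: "\<bar>\<integral>t. (T - t) * G' t * ?I t \<partial>lborel\<bar> \<le> 2 * T" unfolding GI .
  define g where "g t = fargap t0 T t - \<sigma>\<^sup>2 / pi\<^sup>2 / 2 * ((T - t) * (w t)\<^sup>2 * ?I t) - \<sigma> / pi\<^sup>2 * ((T - t) * G' t * ?I t)" for t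
  define c where "c = 10 * \<epsilon>\<^sup>2 * (\<sigma>\<^sup>2 / pi\<^sup>2)"
  have ig: "integrable lborel g" unfolding g_def
    by (intro Bochner_Integration.integrable_diff integrable_mult_right int J_integrable iG')
  have eg: "(LINT t|lborel. g t) = (LINT \<tau>|lborel. fargap t0 T \<tau>) - \<sigma>\<^sup>2 / pi\<^sup>2 / 2 * J t0 T - \<sigma> / pi\<^sup>2 * (\<integral>t. (T - t) * G' t * ?I t \<partial>lborel)"
    unfolding g_def J_def
    by (subst Bochner_Integration.integral_diff, intro Bochner_Integration.integrable_diff integrable_mult_right int J_integrable, intro integrable_mult_right iG',
        subst Bochner_Integration.integral_diff, rule int, intro integrable_mult_right J_integrable, unfold integral_mult_right_zero, rule refl)
  have "\<bar>LINT t|lborel. g t\<bar> \<le> (LINT t|lborel. \<bar>g t\<bar>)" by (rule integral_abs_bound)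
  also have "\<dots> \<le> (LINT t|lborel. c * ((T - t) * (w t)\<^sup>2 * ?I t))"
  proof (rule integral_mono_AE[OF integrable_abs[OF ig] integrable_mult_right[OF J_integrable]])
    show "AE t in lborel. \<bar>g t\<bar> \<le> c * ((T - t) * (w t)\<^sup>2 * ?I t)"
      using AE_lborel_singleton[of t0] AE_lborel_singleton[of T]
    proof eventually_elim
      case (elim t)
      show ?case
      proof (cases "t0 < t \<and> t < T")
        case True
        let ?e = "(Kac t - \<sigma>\<^sup>2 / pi\<^sup>2) - \<sigma>\<^sup>2 / pi\<^sup>2 * (w t)\<^sup>2 / 2 - \<sigma> / pi\<^sup>2 * G' t"
        have "fargap t0 T t = (T - t) * (Kac t - \<sigma>\<^sup>2 / pi\<^sup>2)" "?I t = 1" using True by (auto simp: fargap_def)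
        moreover have "(T - t) * (K - c) - c / 2 * ((T - t) * W * 1) - d * ((T - t) * h * 1) = (T - t) * ((K - c) - c * W / 2 - d * h)" for K c W d h
          by (simp add: field_simps)
        ultimately have ge: "g t = (T - t) * ?e" unfolding g_def by (simp only:)
        have "(T - t) * \<bar>?e\<bar> \<le> (T - t) * (c * (w t)\<^sup>2)" unfolding c_def
          using Kac_expansion[OF tame e, of t] b[of t] True by (intro mult_left_mono) auto
        then show ?thesis unfolding ge using True \<open>?I t = 1\<close> by (simp add: abs_mult mult_ac)
      next
        case False
        then have n: "t \<notin> {t0..T}" "t \<notin> {t0<..<T}" using elim by auto
        have "?I t = 0" "indicat_real {t0<..<T} t = 0" by (rule indicator_simps(2)[OF n(1)], rule indicator_simps(2)[OF n(2)])
        then show ?thesis unfolding g_def fargap_def by simp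
      qed
    qed
  qed
  also have "\<dots> = c * J t0 T" by (simp only: integral_mult_right_zero J_def)
  finally have gb: "\<bar>LINT t|lborel. g t\<bar> \<le> c * J t0 T" .
  have "\<bar>\<sigma> / pi\<^sup>2 * (\<integral>t. (T - t) * G' t * ?I t \<partial>lborel)\<bar> \<le> \<sigma> / pi\<^sup>2 * (2 * T)"
    unfolding abs_mult using GT sigma_pos by (intro mult_mono) auto
  then have "\<bar>(LINT \<tau>|lborel. fargap t0 T \<tau>) - \<sigma>\<^sup>2 / pi\<^sup>2 / 2 * J t0 T\<bar> \<le> c * J t0 T + \<sigma> / pi\<^sup>2 * (2 * T)"
    using gb unfolding eg by linarith
  then have "2 * \<bar>(LINT \<tau>|lborel. fargap t0 T \<tau>) - \<sigma>\<^sup>2 / pi\<^sup>2 / 2 * J t0 T\<bar> \<le> 2 * (c * J t0 T + \<sigma> / pi\<^sup>2 * (2 * T))"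
    by (rule mult_left_mono) simp
  moreover have "2 * \<bar>x - X / 2 * y\<bar> = \<bar>2 * x - X * y\<bar>" for x X y :: real
    using abs_mult[of 2 "x - X / 2 * y"] by (simp add: algebra_simps)
  moreover have "2 * (10 * u * X * y + v * (2 * T)) = 20 * u * X * y + 4 * v * T" for u X y v :: real by simp
  ultimately show ?thesis unfolding c_def by (simp only:)
qed

text \<open>By evenness of \<open>w\<close> the integrals of its square over \<open>{0..n}\<close>
  are unbounded. On a fixed such interval the weight \<open>T - t\<close> is at least
  \<open>T / 2\<close> once \<open>T \<ge> 2 n\<close>, so \<open>J\<close> outgrows any multiple of
  \<open>T\<close>.\<close>

lemma J_growth:
  assumes "\<not> integrable lborel (\<lambda>t. (w t)\<^sup>2)"
  shows "\<exists>a>0. \<forall>T\<ge>2 * a. J 0 T \<ge> K * T"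
proof -
  define I where "I n = (\<integral>t. (w t)\<^sup>2 * indicator {0..real n} t \<partial>lborel)" for n
  have ii: "integrable lborel (\<lambda>t. (w t)\<^sup>2 * indicator {0..real n} t)" for n
    by (rule borel_integrable_atLeastAtMost) (intro continuous_intros isCont_w)
  have "\<exists>n. I n > 2 * K"
  proof (rule ccontr)
    assume "\<not> ?thesis"
    then have bnd: "\<forall>n. I n \<le> 2 * K" by (auto simp: not_less)
    have "incseq I" unfolding I_def by (intro incseq_SucI integral_mono ii) (auto simp: indicator_def)
    then obtain L where L: "I \<longlonglongrightarrow> L" using incseq_convergent[of I "2 * K"] bnd by metis
    have g: "integrable lborel (\<lambda>t. (w t)\<^sup>2 * indicator {0..} t)"
    proof (rule integrable_monotone_convergence[OF ii _ _ L[unfolded I_def]])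
      show "AE t in lborel. mono (\<lambda>n. (w t)\<^sup>2 * indicator {0..real n} t)"
        by (intro AE_I2 monoI) (auto simp: indicator_def)
      show "AE t in lborel. (\<lambda>n. (w t)\<^sup>2 * indicator {0..real n} t) \<longlonglongrightarrow> (w t)\<^sup>2 * indicator {0..} t"
      proof (intro AE_I2 tendsto_eventually)
        fix t :: real
        obtain N where "t \<le> real N" using real_arch_simple by blast
        then show "\<forall>\<^sub>F n in sequentially. (w t)\<^sup>2 * indicator {0..real n} t = (w t)\<^sup>2 * indicator {0..} t"
          unfolding eventually_sequentially by (intro exI[of _ N]) (auto simp: indicator_def)
      qed
    qed measurable
    \<comment> \<open>Reflection supplies the negative half line.\<close>
    have g': "integrable lborel (\<lambda>t. (w (0 + (-1) * t))\<^sup>2 * indicator {0..} (0 + (-1) * t))"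
      by (rule lborel_integrable_real_affine[OF g]) simp
    have "integrable lborel (\<lambda>t. (w t)\<^sup>2)"
      by (rule Bochner_Integration.integrable_bound[OF Bochner_Integration.integrable_add[OF g g']])
         (auto simp: indicator_def w_even)
    then show False using assms by simp
  qed
  then obtain n where n: "I n > 2 * K" by blast
  show ?thesis
  proof (intro exI[of _ "real n + 1"] conjI allI impI)
    fix T assume T: "T \<ge> 2 * (real n + 1)"
    have "(T / 2) * I n = (\<integral>t. (T / 2) * ((w t)\<^sup>2 * indicator {0..real n} t) \<partial>lborel)"
      unfolding I_def by (simp only: integral_mult_right_zero)
    also have "\<dots> \<le> J 0 T" unfolding J_def
    proof (rule integral_mono[OF integrable_mult_right[OF ii] J_integrable])
      fix t :: real
      have "T / 2 * (w t)\<^sup>2 \<le> (T - t) * (w t)\<^sup>2" if "t \<le> real n" using that T by (intro mult_right_mono) auto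
      moreover have "0 \<le> (T - t) * (w t)\<^sup>2" if "t \<le> T" using that by simp
      ultimately show "T / 2 * ((w t)\<^sup>2 * indicator {0..real n} t) \<le> (T - t) * (w t)\<^sup>2 * indicator {0..T} t"
        using T by (simp add: indicator_def)
    qed
    finally have "T / 2 * I n \<le> J 0 T" .
    moreover have "T / 2 * (2 * K) \<le> T / 2 * I n" using n T by (intro mult_left_mono) auto
    ultimately show "J 0 T \<ge> K * T" by (simp add: mult_ac)
  qed simp
qed

text \<open>Two kinds of error are compared with the main term \<open>s * J 0 T\<close>: one
  proportional to it with a factor of order \<open>\<epsilon>^2\<close>, and one linear in
  \<open>T\<close>, which \<open>J_growth\<close> makes negligible. The cutoff \<open>t0\<close>
  depends on the required accuracy, but is fixed before \<open>T\<close> grows.\<close>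

theorem variance_ratio_tendsto:
  assumes nL2: "\<not> integrable lborel (\<lambda>t. (w t)\<^sup>2)"
    and small: "\<And>\<epsilon>. \<epsilon> > 0 \<Longrightarrow> \<exists>t0>0. \<forall>t\<ge>t0. \<bar>r t\<bar> \<le> \<epsilon> \<and> \<bar>r1 t / \<sigma>\<bar> \<le> \<epsilon> \<and> \<bar>r2 t / \<sigma>\<^sup>2\<bar> \<le> \<epsilon>"
  shows "((\<lambda>T. variance (\<lambda>\<omega>. real (zero_count f T \<omega>)) / (\<sigma>\<^sup>2 / pi\<^sup>2 * J 0 T)) \<longlongrightarrow> 1) at_top"
proof (rule tendstoI)
  fix e :: real assume e: "e > 0"
  \<comment> \<open>Then \<open>20 \<epsilon>^2 \<le> 20 e / 64\<close>, which is less than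
    \<open>e / 2\<close>.\<close>
  define \<epsilon> where "\<epsilon> = min (1/4) (sqrt e / 8)"
  have \<epsilon>: "\<epsilon> > 0" "\<epsilon> \<le> 1/4" using e by (auto simp: \<epsilon>_def)
  have "\<epsilon>\<^sup>2 \<le> (sqrt e / 8)\<^sup>2" using \<epsilon> by (intro power_mono) (auto simp: \<epsilon>_def)
  then have \<epsilon>2: "20 * \<epsilon>\<^sup>2 \<le> e / 2" using e by (simp add: power_divide)
  obtain t0 where t0: "t0 > 0" and b: "\<And>t. t \<ge> t0 \<Longrightarrow> \<bar>r t\<bar> \<le> \<epsilon> \<and> \<bar>r1 t / \<sigma>\<bar> \<le> \<epsilon> \<and> \<bar>r2 t / \<sigma>\<^sup>2\<bar> \<le> \<epsilon>"
    using small[OF \<epsilon>(1)] by blast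
  have tame: "tame \<tau>" if "\<tau> \<ge> t0" for \<tau> using b[OF that] \<epsilon> t0 that unfolding tame_def by linarith
  define V where "V T = variance (\<lambda>\<omega>. real (zero_count f T \<omega>))" for T
  define s where "s = \<sigma>\<^sup>2 / pi\<^sup>2"
  have s: "s > 0" using sigma_pos by (simp add: s_def)
  obtain C where C: "C \<ge> 0" "\<And>T. T > t0 \<Longrightarrow> \<bar>V T - 2 * (LINT \<tau>|lborel. fargap t0 T \<tau>)\<bar> \<le> C * T"
    using variance_zero_count[OF t0 tame] unfolding V_def by metis
  define C' where "C' = C + 4 * (\<sigma> / pi\<^sup>2) + s * (4 * t0)"
  have C': "C' \<ge> 0" using C(1) s t0 sigma_pos by (simp add: C'_def)
  have main: "\<bar>V T - s * J 0 T\<bar> \<le> C' * T + e / 2 * (s * J 0 T)" if T: "T > t0" for T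
  proof -
    have "\<bar>2 * (LINT \<tau>|lborel. fargap t0 T \<tau>) - s * J t0 T\<bar> \<le> 20 * \<epsilon>\<^sup>2 * s * J t0 T + 4 * (\<sigma> / pi\<^sup>2) * T"
      unfolding s_def by (rule fargap_estimate[OF t0 T tame _ \<epsilon>(2) b far_sum_limit(2)[OF t0 T tame]]) (use \<epsilon> in auto)
    moreover have "20 * \<epsilon>\<^sup>2 * s * J t0 T \<le> e / 2 * (s * J 0 T)"
      unfolding mult.assoc[of _ s] using \<epsilon>2 J_le(1)[OF t0 T] s e J_nonneg[of t0 T] by (intro mult_mono) auto
    moreover have "s * J t0 T \<le> s * J 0 T" using J_le(1)[OF t0 T] s by (intro mult_left_mono) auto
    moreover have "s * J 0 T \<le> s * J t0 T + s * (4 * t0) * T"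
      using mult_left_mono[OF J_le(2)[OF t0 T], of s] s by (simp add: distrib_left mult.assoc)
    ultimately show ?thesis using C(2)[OF T] unfolding C'_def distrib_right by linarith
  qed
  \<comment> \<open>The growth rate is chosen so that the linear error \<open>C' T\<close> falls
    strictly below half of the tolerance times \<open>s * J 0 T\<close>; the added 1 keeps the
    denominator positive when \<open>C'\<close> is 0.\<close>
  obtain a where a: "a > 0" "\<And>T. T \<ge> 2 * a \<Longrightarrow> J 0 T \<ge> ((2 * C' / e + 1) / s) * T"
    using J_growth[OF nL2, of "(2 * C' / e + 1) / s"] by blast
  show "\<forall>\<^sub>F T in at_top. dist (variance (\<lambda>\<omega>. real (zero_count f T \<omega>)) / (\<sigma>\<^sup>2 / pi\<^sup>2 * J 0 T)) 1 < e"
    using eventually_gt_at_top[of t0] eventually_ge_at_top[of "2 * a"]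
  proof eventually_elim
    case (elim T)
    have T: "T > 0" using elim t0 by simp
    define D where "D = s * J 0 T"
    have "s * (((2 * C' / e + 1) / s) * T) \<le> D" unfolding D_def using a(2)[OF elim(2)] s by (intro mult_left_mono) auto
    then have D: "(2 * C' / e + 1) * T \<le> D" using s by simp
    have "0 \<le> 2 * C' / e * T" using C' e T by simp
    then have Dp: "D > 0" using D T unfolding distrib_right by linarith
    have "2 * C' / e * T < D" using D T unfolding distrib_right by linarith
    then have "C' * T < e / 2 * D" using e by (simp add: field_simps)
    then have "\<bar>V T - D\<bar> < e * D" using main[OF elim(1)] unfolding D_def by linarith
    moreover have "V T / D - 1 = (V T - D) / D" using Dp by (simp add: field_simps)
    ultimately have "\<bar>V T / D - 1\<bar> < e" using Dp by (simp add: abs_divide divide_less_eq)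
    then show ?case unfolding V_def D_def s_def dist_real_def .
  qed
qed

end

theorem theorem1p6:
  fixes M :: "'a measure" and f :: "real \<Rightarrow> 'a \<Rightarrow> real"
    and r :: "real \<Rightarrow> real" and \<rho> :: "real measure" and \<sigma> :: real
    and \<phi> :: "real \<Rightarrow> real"
  assumes gauss: "centred_stationary_gaussian M f r"
    and r0: "r 0 = 1"
    and cont_r: "continuous_on UNIV r"
    and paths: "\<forall>\<omega>\<in>space M. continuous_on UNIV (\<lambda>t. f t \<omega>)"
    and spec: "spectral_measure \<rho> r"
    and geman: "integrable \<rho> (\<lambda>l. ln (1 + \<bar>l\<bar>) * l\<^sup>2)"
    and sigma_pos: "\<sigma> > 0"
    and sigma_def: "\<sigma>\<^sup>2 = (LINT l|\<rho>. l\<^sup>2)"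
    and not_L2: "\<not> integrable lborel (\<lambda>t. (r t + deriv (deriv r) t / \<sigma>\<^sup>2)\<^sup>2)"
    and phi_def: "\<And>t. \<phi> t = max (\<bar>r t\<bar> + \<bar>deriv r t\<bar> / \<sigma>)
                                (\<bar>deriv r t\<bar> / \<sigma> + \<bar>deriv (deriv r) t\<bar> / \<sigma>\<^sup>2)"
    and phi_lim: "(\<phi> \<longlongrightarrow> 0) at_infinity"
  shows "((\<lambda>T. prob_space.variance M (\<lambda>\<omega>. real (zero_count f T \<omega>)) /
              (\<sigma>\<^sup>2 / pi\<^sup>2 * T *
               (\<integral>t\<in>{0..T}. (1 - t / T) * (r t + deriv (deriv r) t / \<sigma>\<^sup>2)\<^sup>2 \<partial>lborel)))
          \<longlongrightarrow> 1) at_top"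
proof -
  have phi: "\<bar>r t\<bar> \<le> \<phi> t" "\<bar>deriv r t\<bar> / \<sigma> \<le> \<phi> t" "\<bar>deriv (deriv r) t\<bar> / \<sigma>\<^sup>2 \<le> \<phi> t" for t
  proof -
    have "0 \<le> \<bar>r t\<bar>" "0 \<le> \<bar>deriv r t\<bar> / \<sigma>" "0 \<le> \<bar>deriv (deriv r) t\<bar> / \<sigma>\<^sup>2" using sigma_pos by auto
    then show "\<bar>r t\<bar> \<le> \<phi> t" "\<bar>deriv r t\<bar> / \<sigma> \<le> \<phi> t" "\<bar>deriv (deriv r) t\<bar> / \<sigma>\<^sup>2 \<le> \<phi> t"
      unfolding phi_def by linarith+
  qed
  have r_lim: "(r \<longlongrightarrow> 0) at_infinity"
    by (rule Lim_null_comparison[OF _ phi_lim]) (use phi in auto)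
  interpret prob_space M using gauss by (simp add: centred_stationary_gaussian_def)
  interpret gaussian_zeros M f r \<rho> \<sigma>
    by unfold_locales (fact gauss r0 spec geman sigma_pos sigma_def r_lim | use paths in blast)+
  have small: "\<exists>t0>0. \<forall>t\<ge>t0. \<bar>r t\<bar> \<le> \<epsilon> \<and> \<bar>r1 t / \<sigma>\<bar> \<le> \<epsilon> \<and> \<bar>r2 t / \<sigma>\<^sup>2\<bar> \<le> \<epsilon>" if "\<epsilon> > 0" for \<epsilon>
  proof -
    have "\<forall>\<^sub>F t in at_infinity. \<phi> t < \<epsilon>" by (rule order_tendstoD(2)[OF phi_lim that])
    then obtain b where b: "\<And>t. b \<le> norm t \<Longrightarrow> \<phi> t < \<epsilon>" unfolding eventually_at_infinity by blast
    show ?thesis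
    proof (intro exI[of _ "max b 1"] conjI allI impI)
      fix t assume "max b 1 \<le> t"
      then have "\<phi> t < \<epsilon>" by (intro b) auto
      then show "\<bar>r t\<bar> \<le> \<epsilon>" "\<bar>r1 t / \<sigma>\<bar> \<le> \<epsilon>" "\<bar>r2 t / \<sigma>\<^sup>2\<bar> \<le> \<epsilon>"
        using phi[of t] sigma_pos unfolding deriv_deriv_r unfolding deriv_r by auto
    qed simp
  qed
  have w: "r t + deriv (deriv r) t / \<sigma>\<^sup>2 = w t" for t by (simp add: w_def deriv_deriv_r)
  have "\<not> integrable lborel (\<lambda>t. (w t)\<^sup>2)" using not_L2 unfolding w .
  from variance_ratio_tendsto[OF this small]
  have lim: "((\<lambda>T. variance (\<lambda>\<omega>. real (zero_count f T \<omega>)) / (\<sigma>\<^sup>2 / pi\<^sup>2 * J 0 T)) \<longlongrightarrow> 1) at_top" .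
  \<comment> \<open>The factor \<open>T\<close> turns \<open>1 - t / T\<close> into the weight
    \<open>T - t\<close>; this requires positive \<open>T\<close>, which holds eventually.\<close>
  have J: "T * (\<integral>t\<in>{0..T}. (1 - t / T) * (w t)\<^sup>2 \<partial>lborel) = J 0 T" if "T > 0" for T
    unfolding J_def set_lebesgue_integral_def integral_mult_right_zero[symmetric]
    using that by (intro Bochner_Integration.integral_cong refl) (simp add: field_simps)
  show ?thesis
    unfolding w by (rule Lim_transform_eventually[OF lim])
      (use eventually_gt_at_top[of 0] in \<open>eventually_elim, simp add: J mult.assoc\<close>)
qed

end
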